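(* Let $n\ge 3$ be an integer and $\lambda>0$ a real number. Let $f$ be a continuous function on $\mathbb{S}^{n-1}$ such that the function $$f^{\ast\ast}(x)=\frac{(f\circ\Lambda^{-1})(x)}{|x|^{n-2}(1+|x|^2)^{n-2}},\qquad x\in\mathbb{R}^{n-1}\setminus\{0\},$$ belongs to $L^1(\mathbb{R}^{n-1}\setminus\{0\})$, and let $$f^{\ast}(r\zeta)=\sum_{m=0}^{\infty}\sum_{l=1}^{d_m}f_{m,l}(r)Y_l^m(\zeta),\qquad \zeta\in\mathbb{S}^{n-2},$$ be the spherical harmonic expansion of $f^{\ast}=f\circ\Lambda^{-1}$ on $\mathbb{R}^{n-1}$. Then for each $m\ge 0$ and $1\le l\le d_m$ the term $f_{m,l}$ is recovered from the integrals $(Sf)(\mathrm{S}_{\psi,c})=\int_{\mathrm{S}_{\psi,c}}f\,d\mathrm{S}_{\psi,c}$, $\psi\in\mathbb{S}^{n-2}$, $c>0$, by $$f_{m,l}(r)=\frac{(1+r^2)^{n-2}}{2\pi i}\int_{\varrho-i\infty}^{\varrho+i\infty}r^{-s}\,\frac{\mathcal{M}(\mathcal{K}_{m,l})(s)}{\mathcal{M}(h_{m,\lambda})(1-s)}\,ds,$$ where $$\mathcal{K}_{m,l}(c)=\frac{1}{(2c\tanh\lambda)^{n-2}\,\omega_{n-3}}\int_{\mathbb{S}^{n-2}}(Sf)(\mathrm{S}_{\psi,c})\,\overline{Y_l^m(\psi)}\,d\psi,\qquad c>0,$$ and $\varrho$ is any number in the interval $(0,1)$.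
   Context: $\mathbb{S}^{k-1}$ is the unit sphere of $\mathbb{R}^{k}$ with its standard volume measure, and $\omega_{k-1}=2\pi^{k/2}/\Gamma(k/2)$ is its total volume (so $\omega_{n-3}$ is the volume of $\mathbb{S}^{n-3}$; $\omega_0=2$). Inverse stereographic projection: $\Lambda^{-1}:\mathbb{R}^{n-1}\to\mathbb{S}^{n-1}\setminus\{e_n\}$, $\Lambda^{-1}(y)=\left(\frac{2y_1}{1+|y|^2},\dots,\frac{2y_{n-1}}{1+|y|^2},\frac{-1+|y|^2}{1+|y|^2}\right)$. For $\psi\in\mathbb{S}^{n-2}\subset\mathbb{R}^{n-1}$ and $c>0$, $$\mathrm{S}_{\psi,c}=\{\Lambda^{-1}(c\psi+c(\tanh\lambda)\omega):\omega\in\mathbb{S}^{n-2}\},$$ an $(n-2)$-dimensional subsphere of $\mathbb{S}^{n-1}$, and $d\mathrm{S}_{\psi,c}$ is its standard $(n-2)$-dimensional volume measure. (These are the intersections of $\mathbb{S}^{n-1}$ with hyperplanes tangent to the spheroid $\Sigma_\lambda=\{x\in\mathbb{R}^n: x_n^2+(x_1^2+\dots+x_{n-1}^2)\cosh^2\lambda=1\}$.) For each $m\ge0$, $\{Y_l^m\}_{l=1}^{d_m}$ is an orthonormal basis, with respect to $\langle u,v\rangle=\int_{\mathbb{S}^{n-2}}u\overline{v}$, of the space of spherical harmonics of degree $m$ on $\mathbb{S}^{n-2}$, with $d_m$ its dimension; the coefficients are $f_{m,l}(r)=\int_{\mathbb{S}^{n-2}}f^{\ast}(r\zeta)\overline{Y_l^m(\zeta)}\,d\zeta$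 for $r>0$. Gegenbauer polynomials: for $\nu\geq 0$, $C_l^{\nu}$ is the polynomial of degree $l$ with positive leading coefficient determined by $$\int_{-1}^1C_l^{\nu}(t)C_k^{\nu}(t)(1-t^2)^{\nu-\frac12}dt=\begin{cases}0,& l\ne k,\\ \dfrac{2^{2\nu-1}\Gamma^2(\nu+\frac12)\,l!}{(l+\nu)\Gamma(l+2\nu)},& l=k,\end{cases}$$ (the value for $\nu=0$, $l=k=0$ being understood as the limit $\nu\to0$); equivalently they are normalized by $C_l^\nu(1)=1$, and $C_l^0(t)=\cos(l\arccos t)$. The function $h_{m,\lambda}:[0,\infty)\to\mathbb{R}$ is $$h_{m,\lambda}(x)=2^{4-n}(\tanh\lambda)^{3-n}\,x\,C_m^{\frac{n-3}{2}}\!\left(\tfrac{x^2+1-\tanh^2\lambda}{2x}\right)\Big((1+\tanh\lambda-x)(1+\tanh\lambda+x)(x-1+\tanh\lambda)(x+1-\tanh\lambda)\Big)^{\frac{n-4}{2}}$$ for $1-\tanh\lambda\le x\le1+\tanh\lambda$, and $h_{m,\lambda}(x)=0$ otherwise. The Mellin transform of a function $F$ on $[0,\infty)$ is $(\mathcal{M}F)(s)=\int_0^\infty y^{s-1}F(y)\,dy$. The integral $\frac{1}{2\pi i}\int_{\varrho-i\infty}^{\varrho+i\infty}r^{-s}(\cdot)(s)\,ds$ is the inverse Mellin transform, taken along the vertical line $\Re s=\varrho$.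
   Formalization: The integral over the line Re s = ϱ is taken as the Cesàro (C,1) limit of its symmetric truncations, since for merely continuous f the ordinary improper integral can diverge at single r; where it converges the two values agree. *)

theory Defs
  imports "HOL-Complex_Analysis.Complex_Analysis"
begin

(* Real d-space is real^'d and real (d+1)-space is (real^'d) \<times> real, the second factor being the
   last coordinate (so e_n = (0, 1)); the product norm is the Euclidean one. *)

section \<open>Volume measures on spheres\<close>

(* Cone construction: the surface measure of A is d times the Lebesgue measure of
   {r *\<^sub>R a | a \<in> A, 0 < r < 1}, where d is the dimension of the ambient space.  The space of this
   measure is the sphere, so integrands matter only there. *)
definition sphere_measure :: "'a::euclidean_space measure" where
  "sphere_measure = scale_measure (of_nat DIM('a))
     (distr (restrict_space lborel (ball 0 1 - {0})) (restrict_space borel (sphere 0 1)) sgn)"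

(* sphere_vol k is the volume of the unit sphere of dimension k. *)
definition sphere_vol :: "nat \<Rightarrow> real" where
  "sphere_vol k = 2 * pi powr (real (k + 1) / 2) / Gamma (real (k + 1) / 2)"

lemma space_sphere_measure [simp]: "space sphere_measure = sphere 0 1"
  by (simp add: sphere_measure_def space_scale_measure space_restrict_space)

lemma sets_sphere_measure [simp, measurable_cong]:
  "sets sphere_measure = sets (restrict_space borel (sphere 0 1))"
  by (simp add: sphere_measure_def)

lemma emeasure_sphere_measure:
  "emeasure (sphere_measure :: 'a::euclidean_space measure) (sphere 0 1)
     = ennreal (sphere_vol (DIM('a) - 1))"
proof -
  let ?B = "ball (0::'a) 1 - {0}"
  have meas: "(sgn :: 'a \<Rightarrow> 'a) \<in> restrict_space lborel ?B \<rightarrow>\<^sub>M restrict_space borel (sphere 0 1)"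
  proof (rule measurable_restrict_space2)
    show "sgn \<in> space (restrict_space lborel ?B) \<rightarrow> sphere (0::'a) 1"
      by (auto simp: space_restrict_space norm_sgn)
    show "(sgn :: 'a \<Rightarrow> 'a) \<in> borel_measurable (restrict_space lborel ?B)"
      by (rule measurable_restrict_space1) (simp add: sgn_div_norm[abs_def])
  qed
  have vimg: "sgn -` sphere (0::'a) 1 \<inter> space (restrict_space lborel ?B) = ?B"
    by (auto simp: space_restrict_space norm_sgn)
  have S: "sphere (0::'a) 1 \<in> sets (restrict_space borel (sphere 0 1))"
    by (subst sets_restrict_space_iff) auto
  have "emeasure (sphere_measure :: 'a measure) (sphere 0 1)
      = of_nat DIM('a) * emeasure (restrict_space lborel ?B) ?B"
    unfolding sphere_measure_def emeasure_scale_measure emeasure_distr[OF meas S] vimg ..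
  also have "emeasure (restrict_space lborel ?B) ?B = emeasure lborel ?B"
    by (rule emeasure_restrict_space) auto
  also have "\<dots> = emeasure lborel (ball (0::'a) 1)"
    by (rule emeasure_Diff_null_set) (auto simp: null_sets_def)
  also have "\<dots> = ennreal (unit_ball_vol DIM('a))"
    by (subst emeasure_ball) auto
  also have "of_nat DIM('a) * \<dots> = ennreal (real DIM('a) * unit_ball_vol DIM('a))"
    by (simp add: ennreal_mult ennreal_of_nat_eq_real_of_nat)
  also have "real DIM('a) * unit_ball_vol DIM('a) = sphere_vol (DIM('a) - 1)"
  proof -
    have "real DIM('a) / 2 > 0" by simp
    then have "real DIM('a) / 2 \<notin> \<int>\<^sub>\<le>\<^sub>0"
      using nonpos_Ints_nonpos by fastforce
    then have g: "Gamma (real DIM('a) / 2 + 1) = real DIM('a) / 2 * Gamma (real DIM('a) / 2)"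
      by (rule Gamma_plus1)
    have d: "real (DIM('a) - 1 + 1) = real DIM('a)"
      by (simp add: Suc_leI)
    show ?thesis
      unfolding sphere_vol_def unit_ball_vol_def d g by simp
  qed
  finally show ?thesis .
qed

(* Charts of a round sphere S: center p, radius R, and a linear isometry L from real^'d onto the
   linear hyperplane parallel to the hyperplane spanned by S. *)
definition subsphere_chart ::
    "((real^'d) \<times> real) set \<Rightarrow> (real^'d) \<times> real \<Rightarrow> real \<Rightarrow> (real^'d \<Rightarrow> (real^'d) \<times> real) \<Rightarrow> bool" where
  "subsphere_chart S p R L \<longleftrightarrow>
     0 < R \<and> linear L \<and> (\<forall>v. norm (L v) = norm v) \<and> S = (\<lambda>\<omega>. p + R *\<^sub>R L \<omega>) ` sphere 0 1"

(* The standard volume measure of a round sphere S of dimension CARD('d) - 1: the measure of the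
   unit sphere, moved to S by a similarity and scaled by the corresponding power of the radius.
   By rotation invariance of sphere_measure it does not depend on the chart. *)
definition subsphere_measure :: "((real^'d) \<times> real) set \<Rightarrow> ((real^'d) \<times> real) measure" where
  "subsphere_measure S = (SOME \<mu>. \<exists>p R L. subsphere_chart S p R L \<and>
     \<mu> = scale_measure (ennreal (R ^ (CARD('d) - 1)))
           (distr sphere_measure (restrict_space borel S) (\<lambda>\<omega>. p + R *\<^sub>R L \<omega>)))"

section \<open>The integral transform\<close>

definition inv_stereo :: "real^'d \<Rightarrow> (real^'d) \<times> real" where
  "inv_stereo y = ((2 / (1 + (norm y)\<^sup>2)) *\<^sub>R y, (-1 + (norm y)\<^sup>2) / (1 + (norm y)\<^sup>2))"

definition subsphere :: "real \<Rightarrow> real^'d \<Rightarrow> real \<Rightarrow> ((real^'d) \<times> real) set" where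
  "subsphere lam \<psi> c = (\<lambda>\<omega>. inv_stereo (c *\<^sub>R \<psi> + (c * tanh lam) *\<^sub>R \<omega>)) ` sphere 0 1"

definition S_transform :: "((real^'d) \<times> real \<Rightarrow> complex) \<Rightarrow> ((real^'d) \<times> real) set \<Rightarrow> complex" where
  "S_transform f S = (LINT x | subsphere_measure S. f x)"

section \<open>Spherical harmonics\<close>

definition laplacian :: "('a::euclidean_space \<Rightarrow> complex) \<Rightarrow> 'a \<Rightarrow> complex" where
  "laplacian p x = (\<Sum>b\<in>Basis. vector_derivative
     (\<lambda>t. vector_derivative (\<lambda>u. p (x + u *\<^sub>R b)) (at t)) (at 0))"

(* A spherical harmonic is a function on the unit sphere; its values elsewhere are irrelevant. *)
definition spherical_harmonic :: "nat \<Rightarrow> ('a::euclidean_space \<Rightarrow> complex) \<Rightarrow> bool" where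
  "spherical_harmonic m u \<longleftrightarrow> (\<exists>p. polynomial_function p \<and>
     (\<forall>t x. p (t *\<^sub>R x) = of_real (t ^ m) * p x) \<and>
     (\<forall>x. laplacian p x = 0) \<and>
     (\<forall>\<zeta>\<in>sphere 0 1. u \<zeta> = p \<zeta>))"

(* y 1, ..., y N is an orthonormal basis of the degree m spherical harmonics; in particular N is the
   dimension of that space. *)
definition harmonic_onb :: "nat \<Rightarrow> nat \<Rightarrow> (nat \<Rightarrow> 'a::euclidean_space \<Rightarrow> complex) \<Rightarrow> bool" where
  "harmonic_onb m N y \<longleftrightarrow>
     (\<forall>l\<in>{1..N}. spherical_harmonic m (y l)) \<and>
     (\<forall>l\<in>{1..N}. \<forall>k\<in>{1..N}.
        (LINT \<zeta> | sphere_measure. y l \<zeta> * cnj (y k \<zeta>)) = (if l = k then 1 else 0)) \<and>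
     (\<forall>u. spherical_harmonic m u \<longrightarrow>
        (\<exists>a. \<forall>\<zeta>\<in>sphere 0 1. u \<zeta> = (\<Sum>l=1..N. a l * y l \<zeta>)))"

definition harmonic_coeff ::
    "((real^'d) \<times> real \<Rightarrow> complex) \<Rightarrow> (real^'d \<Rightarrow> complex) \<Rightarrow> real \<Rightarrow> complex" where
  "harmonic_coeff f Y r = (LINT \<zeta> | sphere_measure. f (inv_stereo (r *\<^sub>R \<zeta>)) * cnj (Y \<zeta>))"

section \<open>Gegenbauer polynomials\<close>

(* At \<nu> = 0, l = 0 the quotient has the limit pi as \<nu> tends to 0. *)
definition gegenbauer_norm :: "real \<Rightarrow> nat \<Rightarrow> real" where
  "gegenbauer_norm \<nu> l = (if \<nu> = 0 \<and> l = 0 then pi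
     else 2 powr (2 * \<nu> - 1) * (Gamma (\<nu> + 1 / 2))\<^sup>2 * fact l
            / ((real l + \<nu>) * Gamma (real l + 2 * \<nu>)))"

definition gegenbauer :: "real \<Rightarrow> nat \<Rightarrow> real poly" where
  "gegenbauer \<nu> = (THE C.
     (\<forall>l. degree (C l) = l \<and> 0 < lead_coeff (C l)) \<and>
     (\<forall>l k. (LINT t:{-1..1}|lborel. poly (C l) t * poly (C k) t * (1 - t\<^sup>2) powr (\<nu> - 1 / 2))
              = (if l = k then gegenbauer_norm \<nu> l else 0)))"

section \<open>Mellin transforms\<close>

(* The real powers below take the value 0 at the two end points of the interval, a null set. *)
definition h_fun :: "nat \<Rightarrow> nat \<Rightarrow> real \<Rightarrow> real \<Rightarrow> real" where
  "h_fun n m lam x =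
     (if 1 - tanh lam \<le> x \<and> x \<le> 1 + tanh lam
      then 2 powi (4 - int n) * tanh lam powi (3 - int n) * x
        * poly (gegenbauer ((real n - 3) / 2) m) ((x\<^sup>2 + 1 - (tanh lam)\<^sup>2) / (2 * x))
        * ((1 + tanh lam - x) * (1 + tanh lam + x) * (x - 1 + tanh lam) * (x + 1 - tanh lam))
            powr ((real n - 4) / 2)
      else 0)"

definition K_fun ::
    "nat \<Rightarrow> real \<Rightarrow> ((real^'d) \<times> real \<Rightarrow> complex) \<Rightarrow> (real^'d \<Rightarrow> complex) \<Rightarrow> real \<Rightarrow> complex" where
  "K_fun n lam f Y c = 1 / of_real ((2 * c * tanh lam) ^ (n - 2) * sphere_vol (n - 3))
     * (LINT \<psi> | sphere_measure. S_transform f (subsphere lam \<psi> c) * cnj (Y \<psi>))"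

definition mellin_convergent :: "(real \<Rightarrow> complex) \<Rightarrow> complex \<Rightarrow> bool" where
  "mellin_convergent F s \<longleftrightarrow> set_integrable lborel {0<..} (\<lambda>y. of_real y powr (s - 1) * F y)"

definition mellin :: "(real \<Rightarrow> complex) \<Rightarrow> complex \<Rightarrow> complex" where
  "mellin F s = (LINT y:{0<..}|lborel. of_real y powr (s - 1) * F y)"

(* The integral of \<phi> along the vertical line Re s = \<rho>, which need not converge absolutely.
   For the inverse Mellin transform of the Mellin transform of a merely continuous function, even
   the symmetric improper integral may diverge at individual points (as Fourier integrals do), so
   the integral is taken in the standard (C,1) sense: it is the limit of the averages over
   0 < u < T of the integrals over the segments from \<rho> - iu to \<rho> + iu.  By
   vline_has_integral_improper this is the ordinary improper integral whenever the latter exists. *)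
definition vline_partial :: "real \<Rightarrow> (complex \<Rightarrow> complex) \<Rightarrow> real \<Rightarrow> complex" where
  "vline_partial \<rho> \<phi> u = contour_integral (linepath (Complex \<rho> (- u)) (Complex \<rho> u)) \<phi>"

definition vline_has_integral :: "real \<Rightarrow> (complex \<Rightarrow> complex) \<Rightarrow> complex \<Rightarrow> bool" where
  "vline_has_integral \<rho> \<phi> I \<longleftrightarrow>
     (\<forall>u>0. \<phi> contour_integrable_on linepath (Complex \<rho> (- u)) (Complex \<rho> u)) \<and>
     ((\<lambda>T. (1 / T) *\<^sub>R integral {0..T} (vline_partial \<rho> \<phi>)) \<longlongrightarrow> I) at_top"

definition vline_integral :: "real \<Rightarrow> (complex \<Rightarrow> complex) \<Rightarrow> complex" where
  "vline_integral \<rho> \<phi> = (THE I. vline_has_integral \<rho> \<phi> I)"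

lemma vline_has_integral_unique:
  "vline_has_integral \<rho> \<phi> I \<Longrightarrow> vline_has_integral \<rho> \<phi> J \<Longrightarrow> I = J"
  by (auto simp: vline_has_integral_def intro: tendsto_unique[OF trivial_limit_at_top_linorder])

lemma vline_integral_eq: "vline_has_integral \<rho> \<phi> I \<Longrightarrow> vline_integral \<rho> \<phi> = I"
  unfolding vline_integral_def using vline_has_integral_unique by blast

lemma vline_has_integral_improper:
  assumes int: "\<And>u. u > 0 \<Longrightarrow> \<phi> contour_integrable_on linepath (Complex \<rho> (- u)) (Complex \<rho> u)"
    and lim: "(vline_partial \<rho> \<phi> \<longlongrightarrow> I) at_top"
  shows "vline_has_integral \<rho> \<phi> I"
proof -
  let ?P = "vline_partial \<rho> \<phi>" and ?g = "\<lambda>\<tau>. \<phi> (Complex \<rho> \<tau>)"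
  have gint: "?g integrable_on {- u..u}" if "u > 0" for u
    using int[OF that] has_contour_integral_linepath_same_Re_iff[of "Complex \<rho> (- u)" \<rho> "Complex \<rho> u" "- u" u \<phi>] that
    by (auto simp: contour_integrable_on_def integrable_on_def)
  have P: "?P u = \<i> * (integral {-T..u} ?g - integral {-T..-u} ?g)" if "0 \<le> u" "u \<le> T" "0 < T" for u T
  proof (cases "u = 0")
    case True
    then show ?thesis by (simp add: vline_partial_def)
  next
    case False
    then have "u > 0" using that by simp
    have "integral {-T..-u} ?g + integral {-u..u} ?g = integral {-T..u} ?g"
      by (rule Henstock_Kurzweil_Integration.integral_combine)
         (use that in \<open>auto intro!: integrable_on_subinterval[OF gint[of T]]\<close>)
    then have "integral {-u..u} ?g = integral {-T..u} ?g - integral {-T..-u} ?g"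
      by (simp add: algebra_simps)
    then show ?thesis
      using contour_integral_linepath_same_Re[of "Complex \<rho> (- u)" \<rho> "Complex \<rho> u" "- u" u \<phi>] \<open>u > 0\<close>
      by (simp add: vline_partial_def)
  qed
  have Pint: "?P integrable_on {0..T}" if "T > 0" for T
  proof -
    have c: "continuous_on {-T..T} (\<lambda>x. integral {-T..x} ?g)"
      by (rule indefinite_integral_continuous_1[OF gint[OF that]])
    have "continuous_on {0..T} (\<lambda>u. \<i> * (integral {-T..u} ?g - integral {-T..-u} ?g))"
      by (intro continuous_intros continuous_on_compose2[OF c]) (use that in auto)
    then have "continuous_on {0..T} ?P"
      by (rule continuous_on_eq) (use P that in auto)
    then show ?thesis by (rule integrable_continuous_interval)
  qed
  have "((\<lambda>T. (1 / T) *\<^sub>R integral {0..T} ?P) \<longlongrightarrow> I) at_top"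
  proof (rule tendstoI)
    fix e :: real assume e: "e > 0"
    obtain A where A: "A > 0" "\<And>u. u \<ge> A \<Longrightarrow> norm (?P u - I) \<le> e / 2"
    proof -
      have "eventually (\<lambda>u. dist (?P u) I < e / 2) at_top"
        using lim e by (intro tendstoD) auto
      then obtain B where "\<And>u. u \<ge> B \<Longrightarrow> dist (?P u) I < e / 2"
        by (auto simp: eventually_at_top_linorder)
      then show ?thesis
        by (intro that[of "max B 1"]) (auto simp: dist_norm less_imp_le)
    qed
    define M where "M = norm (integral {0..A} (\<lambda>u. ?P u - I))"
    have "dist ((1 / T) *\<^sub>R integral {0..T} ?P) I < e" if T: "T > A" "T > 4 * M / e" for T
    proof -
      have T0: "T > 0" using A T by simp
      have D: "(\<lambda>u. ?P u - I) integrable_on {0..T}"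
        using Pint[OF T0] by (intro integrable_diff) auto
      have "integral {0..T} (\<lambda>u. ?P u - I) = integral {0..T} ?P - T *\<^sub>R I"
        using Pint[OF T0] T0 by (subst integral_diff) auto
      then have eq: "(1 / T) *\<^sub>R integral {0..T} ?P - I = (1 / T) *\<^sub>R integral {0..T} (\<lambda>u. ?P u - I)"
        using T0 by (simp add: scaleR_right_diff_distrib)
      have split: "integral {0..T} (\<lambda>u. ?P u - I)
          = integral {0..A} (\<lambda>u. ?P u - I) + integral {A..T} (\<lambda>u. ?P u - I)"
        using A T D by (subst Henstock_Kurzweil_Integration.integral_combine) auto
      have "norm (integral {A..T} (\<lambda>u. ?P u - I)) \<le> integral {A..T} (\<lambda>u. e / 2)"
        by (rule integral_norm_bound_integral)
           (use A T in \<open>auto intro!: integrable_on_subinterval[OF D]\<close>)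
      also have "\<dots> = (T - A) * (e / 2)" using T by simp
      also have "\<dots> \<le> T * (e / 2)" using A e by (intro mult_right_mono) auto
      finally have "norm (integral {0..T} (\<lambda>u. ?P u - I)) \<le> M + T * (e / 2)"
        unfolding split M_def using norm_triangle_ineq by (smt (verit, best))
      moreover have "M \<le> T * (e / 4)"
        using T e by (simp add: field_simps)
      ultimately have "norm (integral {0..T} (\<lambda>u. ?P u - I)) < T * e"
        using mult_pos_pos[OF T0 e] by linarith
      then show ?thesis
        unfolding dist_norm eq using T0 by (simp add: field_simps)
    qed
    then show "eventually (\<lambda>T. dist ((1 / T) *\<^sub>R integral {0..T} ?P) I < e) at_top"
      by (intro eventually_mono[OF eventually_conj[OF eventually_gt_at_top[of A]
            eventually_gt_at_top[of "4 * M / e"]]]) auto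
  qed
  then show ?thesis
    using int by (simp add: vline_has_integral_def)
qed

end

theory Submission
  imports Defs "HOL-Probability.Probability" "HOL-Real_Asymp.Real_Asymp"
begin

text \<open>In stereographic coordinates the subspheres become the spheres of center \<open>c \<psi>\<close> and radius
  \<open>c tanh \<lambda>\<close>.  The stereographic parametrization of such a subsphere differs from an affine chart by
  a conformal boost, and the Jacobian of the boost turns the volume element into the weight
  \<open>(1 + |y|\<^sup>2)\<^sup>2\<^sup>-\<^sup>n\<close>.  Pairing with a spherical harmonic, the Funk-Hecke formula collapses the double
  integral over \<open>\<psi>\<close> and \<open>\<omega>\<close> to a multiplicative convolution of \<open>h\<close> with \<open>f\<^sub>m\<^sub>,\<^sub>l(r) (1 + r\<^sup>2)\<^sup>2\<^sup>-\<^sup>n\<close>.  The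
  Mellin transform makes this a product, the transform of \<open>h\<close> is entire and not identically zero, so
  it has only countably many zeros, and Fejer summation inverts the transform at every point of
  continuity.\<close>

section \<open>Polar coordinates\<close>

text \<open>Two obstacles shape the proof. Surface integrals have to be computed from the cone
  definition of \<open>sphere_measure\<close> alone. One integration by parts formula carries this:
  it yields recursions for moments, these determine the integrals of polynomials, and uniform
  approximation passes on to continuous functions. Rotation invariance, slicing by hyperplanes, the
  boost Jacobian and Funk-Hecke all arise in this way. The second obstacle is the collapse of the
  double integral: \<psi> + t \<omega> runs over a sphere of fixed radius t about \<psi>, a singular
  measure to which Funk-Hecke for continuous profiles does not apply, and for n = 3 the kernel is
  unbounded at the ends of its support. Smearing t with a test function makes the profile
  continuous; continuity in t then removes the smearing. The exponent 2 - n comes from the conformal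
  factor of stereographic projection, raised to the dimension n - 2 of the subspheres. The same
  weight supplies the decay that makes the Mellin transform converge absolutely on the line of
  integration.\<close>

lemma measurable_sgn_restrict:
  "(sgn :: 'a::euclidean_space \<Rightarrow> 'a) \<in> restrict_space lborel (- {0}) \<rightarrow>\<^sub>M restrict_space borel (sphere 0 1)"
proof (rule measurable_restrict_space2)
  show "sgn \<in> space (restrict_space lborel (- {0})) \<rightarrow> sphere (0::'a) 1"
    by (auto simp: space_restrict_space norm_sgn)
  show "(sgn :: 'a \<Rightarrow> 'a) \<in> borel_measurable (restrict_space lborel (- {0}))"
    by (rule measurable_restrict_space1) (simp add: sgn_div_norm[abs_def])
qed

lemma finite_measure_sphere: "finite_measure (sphere_measure :: 'a::euclidean_space measure)"
  by (rule finite_measureI) (simp add: emeasure_sphere_measure)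

lemma emeasure_sphere_measure_cone:
  assumes B: "B \<in> sets (sphere_measure :: 'a::euclidean_space measure)"
  shows "emeasure sphere_measure B
    = ennreal (real DIM('a)) * emeasure lborel {x::'a. x \<noteq> 0 \<and> norm x < 1 \<and> sgn x \<in> B}"
proof -
  let ?B = "ball (0::'a) 1 - {0}"
  have meas: "(sgn :: 'a \<Rightarrow> 'a) \<in> restrict_space lborel ?B \<rightarrow>\<^sub>M restrict_space borel (sphere 0 1)"
  proof (rule measurable_restrict_space2)
    show "sgn \<in> space (restrict_space lborel ?B) \<rightarrow> sphere (0::'a) 1"
      by (auto simp: space_restrict_space norm_sgn)
    show "(sgn :: 'a \<Rightarrow> 'a) \<in> borel_measurable (restrict_space lborel ?B)"
      by (rule measurable_restrict_space1) (simp add: sgn_div_norm[abs_def])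
  qed
  have B': "B \<in> sets (restrict_space borel (sphere (0::'a) 1))"
    using B by simp
  have "sgn -` B \<inter> space (restrict_space lborel ?B) = {x::'a. x \<noteq> 0 \<and> norm x < 1 \<and> sgn x \<in> B}"
    by (auto simp: space_restrict_space)
  then show ?thesis
    unfolding sphere_measure_def emeasure_scale_measure emeasure_distr[OF meas B']
    by (subst emeasure_restrict_space) (auto simp: ennreal_of_nat_eq_real_of_nat)
qed

lemma cone_in_borel:
  assumes B: "B \<in> sets (sphere_measure :: 'a::euclidean_space measure)" and A: "A \<in> sets borel"
  shows "{x::'a. x \<noteq> 0 \<and> norm x \<in> A \<and> sgn x \<in> B} \<in> sets borel"
proof -
  have "B \<in> sets borel"
    using B by (auto simp: sets_restrict_space)
  then have [measurable]: "Measurable.pred borel (\<lambda>x. x \<in> B)" by simp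
  have [measurable]: "(sgn :: 'a \<Rightarrow> 'a) \<in> borel_measurable borel" by (simp add: sgn_div_norm[abs_def])
  have [measurable]: "Measurable.pred borel (\<lambda>x. x \<in> A)" using A by simp
  show ?thesis by measurable
qed

text \<open>Dilation by b maps the unit cone onto the cone of height b and multiplies Lebesgue
  measure by b to the power of the dimension; the factor \<open>DIM('a)\<close> in the definition of
  \<open>sphere_measure\<close> turns into the denominator.\<close>

lemma emeasure_cone_scale:
  assumes B: "B \<in> sets (sphere_measure :: 'a::euclidean_space measure)" and b: "b > 0"
  shows "emeasure lborel {x::'a. x \<noteq> 0 \<and> norm x < b \<and> sgn x \<in> B}
    = ennreal (b ^ DIM('a) / DIM('a)) * emeasure sphere_measure B"
proof -
  let ?S = "{x::'a. x \<noteq> 0 \<and> norm x < 1 \<and> sgn x \<in> B}"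
  let ?T = "{x::'a. x \<noteq> 0 \<and> norm x < b \<and> sgn x \<in> B}"
  have SS: "?S \<in> sets borel" and TT: "?T \<in> sets borel"
    using cone_in_borel[OF B, of "{..<1}"] cone_in_borel[OF B, of "{..<b}"] by auto
  have sc: "sgn (b *\<^sub>R x) = sgn x" for x :: 'a
    using b by (simp add: sgn_scaleR)
  have im: "(\<lambda>x. b *\<^sub>R x + 0) ` ?S = ?T"
  proof (intro equalityI subsetI)
    fix y assume "y \<in> ?T"
    moreover have "sgn ((1 / b) *\<^sub>R y) = sgn y" using b by (simp add: sgn_scaleR)
    ultimately show "y \<in> (\<lambda>x. b *\<^sub>R x + 0) ` ?S" using b
      by (intro image_eqI[where x="(1 / b) *\<^sub>R y"]) auto
  qed (use b sc in auto)
  have "emeasure lborel ?T = emeasure lebesgue ?T"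
    using TT by simp
  also have "\<dots> = \<bar>b\<bar> ^ DIM('a) * emeasure lebesgue ?S"
    using emeasure_lebesgue_affine[of b 0 ?S] unfolding im .
  also have "emeasure lebesgue ?S = emeasure lborel ?S"
    using SS by simp
  finally have 1: "emeasure lborel ?T = ennreal (b ^ DIM('a)) * emeasure lborel ?S" using b by simp
  show ?thesis
    unfolding 1 emeasure_sphere_measure_cone[OF B] mult.assoc[symmetric]
    using b by (subst ennreal_mult[symmetric]) auto
qed

definition radial_measure :: "nat \<Rightarrow> real measure" where
  "radial_measure d = density lborel (\<lambda>r. ennreal (indicator {0<..} r * r ^ (d - 1)))"

lemma sets_radial_measure [simp, measurable_cong]: "sets (radial_measure d) = sets borel"
  by (simp add: radial_measure_def)

lemma space_radial_measure [simp]: "space (radial_measure d) = UNIV"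
  by (simp add: radial_measure_def)

lemma emeasure_radial_measure_lessThan:
  assumes d: "d > 0"
  shows "emeasure (radial_measure d) {..<b} = ennreal (max 0 b ^ d / d)"
proof (cases "b > 0")
  case True
  have "emeasure (radial_measure d) {..<b}
      = (\<integral>\<^sup>+r. ennreal (indicator {0<..} r * r ^ (d - 1)) * indicator {..<b} r \<partial>lborel)"
    unfolding radial_measure_def by (rule emeasure_density) auto
  also have "\<dots> = (\<integral>\<^sup>+r. ennreal (r ^ (d - 1)) * indicator {0..b} r \<partial>lborel)"
  proof (rule nn_integral_cong_AE)
    have "AE r in lborel. r \<noteq> 0 \<and> r \<noteq> b"
      using AE_lborel_singleton[of 0] AE_lborel_singleton[of b] by auto
    then show "AE r in lborel. ennreal (indicator {0<..} r * r ^ (d - 1)) * indicator {..<b} r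
        = ennreal (r ^ (d - 1)) * indicator {0..b} r"
      by eventually_elim (auto split: split_indicator)
  qed
  also have "\<dots> = ennreal (b ^ d / d - 0 ^ d / d)"
  proof (rule nn_integral_FTC_Icc)
    show "((\<lambda>x. x ^ d / d) has_real_derivative x ^ (d - 1)) (at x)" for x
      using d by (auto intro!: derivative_eq_intros)
  qed (use True d in auto)
  finally show ?thesis using True d by (simp add: zero_power)
next
  case False
  have "emeasure (radial_measure d) {..<b}
      = (\<integral>\<^sup>+r. ennreal (indicator {0<..} r * r ^ (d - 1)) * indicator {..<b} r \<partial>lborel)"
    unfolding radial_measure_def by (rule emeasure_density) auto
  also have "\<dots> = (\<integral>\<^sup>+(r::real). 0 \<partial>lborel)"
    using False by (intro nn_integral_cong) (auto split: split_indicator)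
  finally show ?thesis using False d by (simp add: max_def)
qed

lemma sigma_finite_radial_measure:
  assumes "d > 0"
  shows "sigma_finite_measure (radial_measure d)"
proof -
  have "emeasure (radial_measure d) {..<real i} \<noteq> \<infinity>" for i
    using emeasure_radial_measure_lessThan[OF assms] by simp
  moreover have "(\<Union>i. {..<real i}) = UNIV"
    using reals_Archimedean2 by blast
  ultimately show ?thesis
    unfolding sigma_finite_measure_def
    by (intro exI[of _ "range (\<lambda>i. {..<real i})"]) auto
qed

text \<open>With B fixed, both sides are measures in A that agree on the half-lines below b, by the
  scaling of cones. Half-lines form an intersection-stable generator of the Borel sets, and those of
  an exhausting sequence have finite measure.\<close>

lemma emeasure_cone:
  assumes B: "B \<in> sets (sphere_measure :: 'a::euclidean_space measure)" and A: "A \<in> sets borel"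
  shows "emeasure lborel {x::'a. x \<noteq> 0 \<and> norm x \<in> A \<and> sgn x \<in> B}
    = emeasure (radial_measure DIM('a)) A * emeasure sphere_measure B"
proof -
  interpret finite_measure "sphere_measure :: 'a measure" by (rule finite_measure_sphere)
  let ?c = "emeasure sphere_measure B"
  let ?R = "restrict_space lborel {x::'a. x \<noteq> 0 \<and> sgn x \<in> B}"
  let ?M = "distr ?R borel (norm :: 'a \<Rightarrow> real)"
  let ?N = "scale_measure ?c (radial_measure DIM('a))"
  have C: "{x::'a. x \<noteq> 0 \<and> sgn x \<in> B} \<in> sets borel"
    using cone_in_borel[OF B, of UNIV] by simp
  have nm: "norm \<in> borel_measurable ?R"
    by (rule measurable_restrict_space1) simp
  have M: "emeasure ?M A = emeasure lborel {x::'a. x \<noteq> 0 \<and> norm x \<in> A \<and> sgn x \<in> B}"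
    if "A \<in> sets borel" for A
  proof -
    have "norm -` A \<inter> space ?R = {x::'a. x \<noteq> 0 \<and> norm x \<in> A \<and> sgn x \<in> B}"
      by (auto simp: space_restrict_space)
    then show ?thesis
      unfolding emeasure_distr[OF nm that] using C
      by (subst emeasure_restrict_space) auto
  qed
  have eq: "emeasure ?M {..<b} = emeasure ?N {..<b}" for b
  proof (cases "b > 0")
    case True
    then show ?thesis
      using emeasure_cone_scale[OF B True] M[of "{..<b}"]
      by (simp add: emeasure_radial_measure_lessThan mult.commute)
  next
    case False
    have "{x::'a. x \<noteq> 0 \<and> norm x \<in> {..<b} \<and> sgn x \<in> B} = {}"
      using False norm_ge_zero by (smt (verit) Collect_empty_eq lessThan_iff)
    moreover have "{..<b} \<in> sets borel" by simp
    ultimately have "emeasure ?M {..<b} = 0"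
      using M[of "{..<b}"] by (simp only: emeasure_empty)
    then show ?thesis
      using False by (simp add: emeasure_radial_measure_lessThan max_def zero_power)
  qed
  have "?M = ?N"
  proof (rule measure_eqI_generator_eq[where E="range lessThan" and \<Omega>=UNIV and A="\<lambda>i. {..<real i}"])
    show "Int_stable (range (lessThan :: real \<Rightarrow> _))"
    proof (rule Int_stableI, safe)
      fix a b :: real
      have "{..<a} \<inter> {..<b} = {..<min a b}" by auto
      then show "{..<a} \<inter> {..<b} \<in> range lessThan" by auto
    qed
    show "sets ?M = sigma_sets UNIV (range lessThan)" "sets ?N = sigma_sets UNIV (range lessThan)"
      by (simp_all add: borel_eq_lessThan eucl_lessThan)
    show "(\<Union>i. {..<real i}) = UNIV" using reals_Archimedean2 by blast
    show "emeasure ?M {..<real i} \<noteq> \<infinity>" for i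
      unfolding eq using emeasure_finite[of B]
      by (auto simp: emeasure_radial_measure_lessThan ennreal_mult_eq_top_iff)
  qed (use eq in auto)
  then show ?thesis
    using M[OF A] by (simp add: mult.commute)
qed

text \<open>A rectangle A x B pulls back under (norm, sgn) to a cone, whose Lebesgue measure is a
  product, and rectangles determine the product measure. The origin is removed because
  \<open>sgn\<close> leaves the sphere there.\<close>

lemma polar_pair_measure:
  "radial_measure DIM('a) \<Otimes>\<^sub>M (sphere_measure :: 'a::euclidean_space measure)
    = distr (restrict_space lborel (- {0})) (borel \<Otimes>\<^sub>M restrict_space borel (sphere 0 1))
        (\<lambda>x. (norm x, sgn x))"
proof (rule pair_measure_eqI)
  interpret finite_measure "sphere_measure :: 'a measure" by (rule finite_measure_sphere)
  show "sigma_finite_measure (sphere_measure :: 'a measure)" ..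
  show "sigma_finite_measure (radial_measure DIM('a))"
    by (rule sigma_finite_radial_measure) simp
  show "sets (radial_measure DIM('a) \<Otimes>\<^sub>M (sphere_measure :: 'a::euclidean_space measure))
      = sets (distr (restrict_space lborel (- {0})) (borel \<Otimes>\<^sub>M restrict_space borel (sphere (0::'a) 1))
        (\<lambda>x. (norm x, sgn x)))"
    by (simp cong: sets_pair_measure_cong)
  note [measurable] = measurable_sgn_restrict[where 'a='a]
  have nm [measurable]: "norm \<in> borel_measurable (restrict_space lborel (- {0::'a}))"
    by (rule measurable_restrict_space1) simp
  fix A B assume A: "A \<in> sets (radial_measure DIM('a))" and B: "B \<in> sets (sphere_measure :: 'a measure)"
  let ?D = "distr (restrict_space lborel (- {0::'a})) (borel \<Otimes>\<^sub>M restrict_space borel (sphere 0 1))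
        (\<lambda>x. (norm x, sgn x))"
  have A': "A \<in> sets borel" and B': "B \<in> sets (restrict_space borel (sphere (0::'a) 1))"
    using A B by auto
  have "emeasure ?D (A \<times> B) = emeasure (restrict_space lborel (- {0::'a}))
      ((\<lambda>x. (norm x, sgn x)) -` (A \<times> B) \<inter> space (restrict_space lborel (- {0::'a})))"
    using A' B' by (intro emeasure_distr) auto
  also have "(\<lambda>x. (norm x, sgn x)) -` (A \<times> B) \<inter> space (restrict_space lborel (- {0::'a}))
      = {x::'a. x \<noteq> 0 \<and> norm x \<in> A \<and> sgn x \<in> B}"
    by (auto simp: space_restrict_space)
  also have "emeasure (restrict_space lborel (- {0::'a})) \<dots>
      = emeasure lborel {x::'a. x \<noteq> 0 \<and> norm x \<in> A \<and> sgn x \<in> B}"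
    by (rule emeasure_restrict_space) auto
  also have "\<dots> = emeasure (radial_measure DIM('a)) A * emeasure sphere_measure B"
    by (rule emeasure_cone[OF B A'])
  finally show "emeasure (radial_measure DIM('a)) A * emeasure sphere_measure B = emeasure ?D (A \<times> B)"
    by simp
qed

lemma measurable_scaleR_sphere [measurable]:
  "(\<lambda>(r, \<omega>). r *\<^sub>R \<omega>) \<in> borel \<Otimes>\<^sub>M restrict_space borel (sphere (0::'a::euclidean_space) 1) \<rightarrow>\<^sub>M borel"
proof -
  have [measurable]: "(\<lambda>x. x) \<in> restrict_space borel (sphere (0::'a) 1) \<rightarrow>\<^sub>M borel"
    by (rule measurable_restrict_space1) simp
  have "(\<lambda>p. fst p *\<^sub>R (\<lambda>x. x) (snd p)) \<in> borel \<Otimes>\<^sub>M restrict_space borel (sphere (0::'a) 1) \<rightarrow>\<^sub>M borel"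
    by measurable
  then show ?thesis by (simp add: case_prod_beta')
qed

text \<open>Multiplying norm and direction again gives the identity away from the origin, so the
  push-forward is Lebesgue measure restricted to the complement of a null set.\<close>

lemma distr_polar:
  "distr (radial_measure DIM('a) \<Otimes>\<^sub>M (sphere_measure :: 'a::euclidean_space measure)) borel (\<lambda>(r, \<omega>). r *\<^sub>R \<omega>)
    = lborel"
proof (rule measure_eqI)
  note [measurable] = measurable_sgn_restrict[where 'a='a]
  have nm [measurable]: "norm \<in> borel_measurable (restrict_space lborel (- {0::'a}))"
    by (rule measurable_restrict_space1) simp
  have "distr (radial_measure DIM('a) \<Otimes>\<^sub>M (sphere_measure :: 'a::euclidean_space measure)) borel (\<lambda>(r, \<omega>). r *\<^sub>R \<omega>)
     = distr (restrict_space lborel (- {0::'a})) borel ((\<lambda>(r, \<omega>). r *\<^sub>R \<omega>) \<circ> (\<lambda>x. (norm x, sgn x)))"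
    unfolding polar_pair_measure by (rule distr_distr) measurable
  also have "(\<lambda>(r, \<omega>). r *\<^sub>R \<omega>) \<circ> (\<lambda>x. (norm x, sgn x)) = (\<lambda>x::'a. x)"
  proof
    show "((\<lambda>(r, \<omega>). r *\<^sub>R \<omega>) \<circ> (\<lambda>x. (norm x, sgn x))) x = x" for x :: 'a
      by (cases "x = 0") (auto simp: sgn_div_norm)
  qed
  finally have eq: "distr (radial_measure DIM('a) \<Otimes>\<^sub>M (sphere_measure :: 'a::euclidean_space measure)) borel (\<lambda>(r, \<omega>). r *\<^sub>R \<omega>)
     = distr (restrict_space lborel (- {0::'a})) borel (\<lambda>x. x)" .
  fix A assume "A \<in> sets (distr (radial_measure DIM('a) \<Otimes>\<^sub>M (sphere_measure :: 'a::euclidean_space measure)) borel (\<lambda>(r, \<omega>). r *\<^sub>R \<omega>))"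
  then have A: "A \<in> sets borel" by simp
  have id: "(\<lambda>x. x) \<in> restrict_space lborel (- {0::'a}) \<rightarrow>\<^sub>M borel"
    by (rule measurable_restrict_space1) simp
  have sp: "(\<lambda>x. x) -` A \<inter> space (restrict_space lborel (- {0::'a})) = A - {0}"
    by (auto simp: space_restrict_space)
  show "emeasure (distr (radial_measure DIM('a) \<Otimes>\<^sub>M (sphere_measure :: 'a::euclidean_space measure)) borel (\<lambda>(r, \<omega>). r *\<^sub>R \<omega>)) A
      = emeasure lborel A"
    unfolding eq emeasure_distr[OF id A] sp
    using A by (subst emeasure_restrict_space) (auto intro: emeasure_Diff_null_set simp: null_sets_def)
qed simp

lemma
  fixes f :: "'a::euclidean_space \<Rightarrow> 'b::{banach,second_countable_topology}"
  assumes f: "integrable lborel f"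
  shows integrable_polar: "integrable (radial_measure DIM('a) \<Otimes>\<^sub>M sphere_measure) (\<lambda>(r, \<omega>). f (r *\<^sub>R \<omega>))"
    and integral_polar_pair: "integral\<^sup>L lborel f
      = integral\<^sup>L (radial_measure DIM('a) \<Otimes>\<^sub>M sphere_measure) (\<lambda>(r, \<omega>). f (r *\<^sub>R \<omega>))"
proof -
  let ?P = "radial_measure DIM('a) \<Otimes>\<^sub>M (sphere_measure :: 'a measure)"
  have fm: "f \<in> borel_measurable borel" using f by auto
  have sm: "(\<lambda>(r, \<omega>::'a). r *\<^sub>R \<omega>) \<in> ?P \<rightarrow>\<^sub>M borel"
    by measurable
  have "integrable (distr ?P borel (\<lambda>(r, \<omega>). r *\<^sub>R \<omega>)) f" using f by (simp add: distr_polar)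
  then show "integrable ?P (\<lambda>(r, \<omega>). f (r *\<^sub>R \<omega>))"
    using integrable_distr_eq[OF sm fm] by (simp add: case_prod_beta')
  have "integral\<^sup>L (distr ?P borel (\<lambda>(r, \<omega>). r *\<^sub>R \<omega>)) f = integral\<^sup>L ?P (\<lambda>p. f ((\<lambda>(r, \<omega>). r *\<^sub>R \<omega>) p))"
    by (rule integral_distr[OF sm fm])
  then show "integral\<^sup>L lborel f = integral\<^sup>L ?P (\<lambda>(r, \<omega>). f (r *\<^sub>R \<omega>))"
    unfolding distr_polar by (simp add: case_prod_beta')
qed

lemma integral_radial_measure:
  fixes g :: "real \<Rightarrow> 'b::{banach,second_countable_topology}"
  assumes "g \<in> borel_measurable borel"
  shows "integral\<^sup>L (radial_measure d) g = (LINT r:{0<..}|lborel. r ^ (d - 1) *\<^sub>R g r)"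
  unfolding radial_measure_def set_lebesgue_integral_def
  using assms by (subst integral_density) (auto split: split_indicator)

lemma integral_polar:
  fixes f :: "'a::euclidean_space \<Rightarrow> 'b::{banach,second_countable_topology}"
  assumes f: "integrable lborel f"
  shows "integral\<^sup>L lborel f
    = (LINT r:{0<..}|lborel. r ^ (DIM('a) - 1) *\<^sub>R (LINT \<omega>|sphere_measure. f (r *\<^sub>R \<omega>)))"
proof -
  interpret S: finite_measure "sphere_measure :: 'a measure" by (rule finite_measure_sphere)
  interpret R: sigma_finite_measure "radial_measure DIM('a)" by (rule sigma_finite_radial_measure) simp
  interpret P: pair_sigma_finite "radial_measure DIM('a)" "sphere_measure :: 'a measure" ..
  note int = integrable_polar[OF f]
  have [measurable]: "f \<in> borel_measurable borel" using f by auto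
  have m: "(\<lambda>r. LINT \<omega>|(sphere_measure::'a measure). f (r *\<^sub>R \<omega>)) \<in> borel_measurable borel"
    using S.borel_measurable_lebesgue_integral[of "\<lambda>r \<omega>. f (r *\<^sub>R \<omega>)" borel]
    by measurable
  show ?thesis
    unfolding integral_polar_pair[OF f] P.integral_fst'[OF int, symmetric]
    by (subst integral_radial_measure[symmetric]) (use m in auto)
qed

section \<open>Directional derivatives of polynomials\<close>

text \<open>Shaped like the nested \<open>vector_derivative\<close> in \<open>laplacian\<close>, so
  that for polynomials the Laplacian is literally a sum of iterated directional derivatives.\<close>

definition dir_deriv :: "'a::euclidean_space \<Rightarrow> ('a \<Rightarrow> 'b::euclidean_space) \<Rightarrow> 'a \<Rightarrow> 'b" where
  "dir_deriv v p x = vector_derivative (\<lambda>t. p (x + t *\<^sub>R v)) (at 0)"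

lemma has_vector_derivative_line:
  assumes "(p has_derivative p') (at (x + s *\<^sub>R v))"
  shows "((\<lambda>t. p (x + t *\<^sub>R v)) has_vector_derivative p' v) (at s)"
proof -
  have "((\<lambda>t. p (x + t *\<^sub>R v)) has_derivative (\<lambda>t. p' (t *\<^sub>R v))) (at s)"
    by (rule has_derivative_compose[of "\<lambda>t. x + t *\<^sub>R v" "\<lambda>t. t *\<^sub>R v" s UNIV p p'])
       (use assms in \<open>auto intro!: derivative_eq_intros\<close>)
  moreover have "(\<lambda>t. p' (t *\<^sub>R v)) = (\<lambda>t. t *\<^sub>R p' v)"
    using has_derivative_bounded_linear[OF assms] by (simp add: linear_simps)
  ultimately show ?thesis by (simp add: has_vector_derivative_def)
qed

lemma dir_deriv_eq:
  assumes "(p has_derivative p') (at x)"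
  shows "dir_deriv v p x = p' v"
  unfolding dir_deriv_def
  using has_vector_derivative_line[of p p' x 0 v] assms by (auto intro: vector_derivative_at)

lemma polynomial_function_has_derivative:
  fixes p :: "'a::euclidean_space \<Rightarrow> 'b::euclidean_space"
  assumes "polynomial_function p"
  shows "(p has_derivative (\<lambda>v. dir_deriv v p x)) (at x)"
proof -
  have "(p has_derivative frechet_derivative p (at x)) (at x)"
    using differentiable_at_polynomial_function[OF assms] frechet_derivative_works by blast
  moreover from this have "frechet_derivative p (at x) = (\<lambda>v. dir_deriv v p x)"
    by (simp add: dir_deriv_eq)
  ultimately show ?thesis by simp
qed

lemma polynomial_function_line_derivative:
  fixes p :: "'a::euclidean_space \<Rightarrow> 'b::euclidean_space"
  assumes "polynomial_function p"
  shows "((\<lambda>t. p (x + t *\<^sub>R v)) has_vector_derivative dir_deriv v p (x + s *\<^sub>R v)) (at s)"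
  by (rule has_vector_derivative_line) (rule polynomial_function_has_derivative[OF assms])

lemma linear_dir_deriv:
  fixes p :: "'a::euclidean_space \<Rightarrow> 'b::euclidean_space"
  assumes "polynomial_function p"
  shows "linear (\<lambda>v. dir_deriv v p x)"
  using polynomial_function_has_derivative[OF assms] has_derivative_linear by blast

lemma dir_deriv_inner:
  fixes p :: "'a::euclidean_space \<Rightarrow> 'b::euclidean_space"
  assumes "polynomial_function p"
  shows "dir_deriv v (\<lambda>x. p x \<bullet> b) x = dir_deriv v p x \<bullet> b"
  by (rule dir_deriv_eq) (auto intro!: derivative_eq_intros polynomial_function_has_derivative[OF assms])

lemma dir_deriv_add:
  fixes p q :: "'a::euclidean_space \<Rightarrow> 'b::euclidean_space"
  assumes "polynomial_function p" "polynomial_function q"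
  shows "dir_deriv v (\<lambda>x. p x + q x) x = dir_deriv v p x + dir_deriv v q x"
  by (rule dir_deriv_eq) (auto intro!: derivative_eq_intros polynomial_function_has_derivative assms)

lemma dir_deriv_scaleR:
  fixes p :: "'a::euclidean_space \<Rightarrow> real" and q :: "'a::euclidean_space \<Rightarrow> 'b::euclidean_space"
  assumes "polynomial_function p" "polynomial_function q"
  shows "dir_deriv v (\<lambda>x. p x *\<^sub>R q x) x = dir_deriv v p x *\<^sub>R q x + p x *\<^sub>R dir_deriv v q x"
  by (rule dir_deriv_eq)
     (auto intro!: derivative_eq_intros polynomial_function_has_derivative assms simp: add.commute)

lemma dir_deriv_mult:
  fixes p q :: "'a::euclidean_space \<Rightarrow> real"
  assumes "polynomial_function p" "polynomial_function q"
  shows "dir_deriv v (\<lambda>x. p x * q x) x = dir_deriv v p x * q x + p x * dir_deriv v q x"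
  using dir_deriv_scaleR[OF assms] by simp

lemma dir_deriv_const: "dir_deriv v (\<lambda>x. c) x = 0"
  by (rule dir_deriv_eq[of "\<lambda>x. c" "\<lambda>x. 0", simplified]) 

lemma dir_deriv_linear:
  assumes "bounded_linear f"
  shows "dir_deriv v f x = f v"
  by (rule dir_deriv_eq) (rule bounded_linear_imp_has_derivative[OF assms])

lemma real_polynomial_function_dir_deriv:
  assumes "real_polynomial_function (p :: 'a::euclidean_space \<Rightarrow> real)"
  shows "real_polynomial_function (dir_deriv v p)"
  using assms
proof induction
  case (linear f)
  then have "dir_deriv v f = (\<lambda>x. f v)" by (simp add: dir_deriv_linear fun_eq_iff)
  then show ?case by auto
next
  case (const c)
  have "dir_deriv v (\<lambda>x::'a. c) = (\<lambda>x. 0)" by (simp add: dir_deriv_const fun_eq_iff)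
  then show ?case by auto
next
  case (add f g)
  then have "dir_deriv v (\<lambda>x. f x + g x) = (\<lambda>x. dir_deriv v f x + dir_deriv v g x)"
    by (simp add: dir_deriv_add real_polynomial_function_eq fun_eq_iff)
  then show ?case using add by auto
next
  case (mult f g)
  then have "dir_deriv v (\<lambda>x. f x * g x) = (\<lambda>x. dir_deriv v f x * g x + f x * dir_deriv v g x)"
    by (simp add: dir_deriv_mult real_polynomial_function_eq fun_eq_iff)
  then show ?case using mult by auto
qed

lemma polynomial_function_dir_deriv:
  fixes p :: "'a::euclidean_space \<Rightarrow> 'b::euclidean_space"
  assumes "polynomial_function p"
  shows "polynomial_function (dir_deriv v p)"
  using assms real_polynomial_function_dir_deriv
  unfolding polynomial_function_iff_Basis_inner[where 'a='a] dir_deriv_inner[OF assms, symmetric]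
  by blast

text \<open>Induction on the construction of the polynomial: linear forms and constants have
  vanishing second derivatives, and sums and products follow from the Leibniz rule.\<close>

lemma real_dir_deriv_commute:
  assumes "real_polynomial_function (p :: 'a::euclidean_space \<Rightarrow> real)"
  shows "dir_deriv u (dir_deriv v p) = dir_deriv v (dir_deriv u p)"
  using assms
proof induction
  case (linear f)
  then have "dir_deriv v f = (\<lambda>x. f v)" for v by (simp add: dir_deriv_linear fun_eq_iff)
  then show ?case by (simp add: dir_deriv_const fun_eq_iff)
next
  case (const c)
  have "dir_deriv v (\<lambda>x::'a. c) = (\<lambda>x. 0)" for v by (simp add: dir_deriv_const fun_eq_iff)
  then show ?case by (simp add: dir_deriv_const fun_eq_iff)
next
  case (add f g)
  have pf: "polynomial_function f" "polynomial_function g"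
    using add by (auto simp: real_polynomial_function_eq)
  have "dir_deriv v (\<lambda>x. f x + g x) = (\<lambda>x. dir_deriv v f x + dir_deriv v g x)" for v
    using pf by (simp add: dir_deriv_add fun_eq_iff)
  then show ?case
    using add by (simp add: dir_deriv_add polynomial_function_dir_deriv pf fun_eq_iff)
next
  case (mult f g)
  have pf: "polynomial_function f" "polynomial_function g"
    using mult by (auto simp: real_polynomial_function_eq)
  have pm: "polynomial_function (\<lambda>x. p x * q x)" if "polynomial_function p" "polynomial_function q"
    for p q :: "'a \<Rightarrow> real"
    using polynomial_function_mult[OF that] by simp
  have "dir_deriv v (\<lambda>x. f x * g x) = (\<lambda>x. dir_deriv v f x * g x + f x * dir_deriv v g x)" for v
    using pf by (simp add: dir_deriv_mult fun_eq_iff)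
  then show ?case
    using mult by (simp add: dir_deriv_mult dir_deriv_add pm polynomial_function_dir_deriv pf fun_eq_iff)
qed

lemma dir_deriv_commute:
  fixes p :: "'a::euclidean_space \<Rightarrow> 'b::euclidean_space"
  assumes p: "polynomial_function p"
  shows "dir_deriv u (dir_deriv v p) x = dir_deriv v (dir_deriv u p) x"
proof (rule euclidean_eqI)
  fix b :: 'b assume b: "b \<in> Basis"
  have "real_polynomial_function (\<lambda>x. p x \<bullet> b)"
    using p b polynomial_function_iff_Basis_inner by blast
  note c = fun_cong[OF real_dir_deriv_commute[OF this, of u v], of x]
  have "dir_deriv w (\<lambda>x. p x \<bullet> b) = (\<lambda>x. dir_deriv w p x \<bullet> b)" for w
    by (rule ext) (rule dir_deriv_inner[OF p])
  with c show "dir_deriv u (dir_deriv v p) x \<bullet> b = dir_deriv v (dir_deriv u p) x \<bullet> b"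
    by (simp add: dir_deriv_inner[OF polynomial_function_dir_deriv[OF p]])
qed

lemma laplacian_eq_dir_deriv:
  assumes p: "polynomial_function (p :: 'a::euclidean_space \<Rightarrow> complex)"
  shows "laplacian p x = (\<Sum>b\<in>Basis. dir_deriv b (dir_deriv b p) x)"
proof -
  have "vector_derivative (\<lambda>u. p (x + u *\<^sub>R b)) (at t) = dir_deriv b p (x + t *\<^sub>R b)" for b t
    by (rule vector_derivative_at) (rule polynomial_function_line_derivative[OF p])
  then show ?thesis by (simp add: laplacian_def dir_deriv_def)
qed

lemma continuous_on_polynomial_function:
  fixes p :: "'a::euclidean_space \<Rightarrow> 'b::euclidean_space"
  shows "polynomial_function p \<Longrightarrow> continuous_on S p"
  by (simp add: continuous_on_polymonial_function)

text \<open>The chain rule for the dilation by r lowers the degree to N - 1. The factor is written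
  \<open>r ^ N / r\<close>, which stays correct for N = 0, where the subtraction of naturals would
  not.\<close>

lemma dir_deriv_homogeneous:
  fixes q :: "'a::euclidean_space \<Rightarrow> 'b::euclidean_space"
  assumes q: "polynomial_function q" and hom: "\<And>t x. t > 0 \<Longrightarrow> q (t *\<^sub>R x) = (t ^ N) *\<^sub>R q x" and r: "r > 0"
  shows "dir_deriv v q (r *\<^sub>R x) = (r ^ N / r) *\<^sub>R dir_deriv v q x"
proof -
  have eq: "q (r *\<^sub>R x + t *\<^sub>R v) = (r ^ N) *\<^sub>R q (x + (t / r) *\<^sub>R v)" for t
    using hom[OF r, of "x + (t / r) *\<^sub>R v"] r by (simp add: scaleR_add_right)
  have 1: "((\<lambda>t. q (x + t *\<^sub>R v)) has_vector_derivative dir_deriv v q x) (at (0 / r))"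
    using polynomial_function_line_derivative[OF q, of x v 0] by simp
  have "((\<lambda>t. q (x + t *\<^sub>R v)) \<circ> (\<lambda>t. t / r) has_vector_derivative (1 / r) *\<^sub>R dir_deriv v q x) (at 0)"
    by (rule vector_diff_chain_at) (use r 1 in \<open>auto intro!: derivative_eq_intros
       simp: has_real_derivative_iff_has_vector_derivative[symmetric]\<close>)
  then have "((\<lambda>t. (r ^ N) *\<^sub>R q (x + (t / r) *\<^sub>R v)) has_vector_derivative (r ^ N) *\<^sub>R ((1 / r) *\<^sub>R dir_deriv v q x)) (at 0)"
    unfolding o_def by (rule bounded_linear.has_vector_derivative[OF bounded_linear_scaleR_right])
  then show ?thesis
    unfolding dir_deriv_def[of v q "r *\<^sub>R x"] eq by (subst vector_derivative_at) auto
qed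

text \<open>Differentiation at t = 0 of q((1 + t) x) = (1 + t)^N q(x), valid for |t| < 1, where the
  dilation factor is positive.\<close>

lemma euler_homogeneous:
  fixes q :: "'a::euclidean_space \<Rightarrow> 'b::euclidean_space"
  assumes q: "polynomial_function q" and hom: "\<And>t x. t > 0 \<Longrightarrow> q (t *\<^sub>R x) = (t ^ N) *\<^sub>R q x"
  shows "dir_deriv x q x = real N *\<^sub>R q x"
proof -
  have "((\<lambda>t. q (x + t *\<^sub>R x)) has_vector_derivative dir_deriv x q x) (at 0)"
    using polynomial_function_line_derivative[OF q, of x x 0] by simp
  moreover have "((\<lambda>t. q (x + t *\<^sub>R x)) has_vector_derivative real N *\<^sub>R q x) (at 0)"
  proof (rule has_vector_derivative_transform_within[where d=1 and f="\<lambda>t. ((1 + t) ^ N) *\<^sub>R q x"])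
    have "((\<lambda>t. (1 + t) ^ N) has_real_derivative real N) (at 0)"
      by (auto intro!: derivative_eq_intros)
    then show "((\<lambda>t. ((1 + t) ^ N) *\<^sub>R q x) has_vector_derivative real N *\<^sub>R q x) (at 0)"
      using has_vector_derivative_scaleR[of "\<lambda>t. (1 + t) ^ N" "real N" 0 UNIV "\<lambda>_. q x" 0]
      by simp
    show "((1 + t) ^ N) *\<^sub>R q x = q (x + t *\<^sub>R x)" if "dist t 0 < 1" for t
      using hom[of "1 + t" x] that by (simp add: algebra_simps dist_real_def)
  qed auto
  ultimately show ?thesis
    by (rule vector_derivative_unique_at)
qed

section \<open>Integrals of derivatives of compactly supported functions\<close>

text \<open>The difference quotients of g along v have integral zero by translation invariance and
  converge pointwise to G. They are dominated because g is Lipschitz along v, with a bound of |G| on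
  the unit ball as constant. No more than continuous differentiability along v enters, which a
  truncated and squared cutoff provides.\<close>

lemma integral_derivative_compact_support:
  fixes g G :: "'a::euclidean_space \<Rightarrow> 'b::euclidean_space"
  assumes cont: "continuous_on UNIV g" "continuous_on UNIV G"
    and deriv: "\<And>y. ((\<lambda>t. g (y + t *\<^sub>R v)) has_vector_derivative G y) (at 0)"
    and supp: "\<And>y. norm y > 1 \<Longrightarrow> g y = 0"
  shows "integral\<^sup>L lborel G = 0"
proof -
  have deriv': "((\<lambda>t. g (y + t *\<^sub>R v)) has_vector_derivative G (y + s *\<^sub>R v)) (at s)" for y s
  proof -
    have "((\<lambda>t. g ((y + s *\<^sub>R v) + t *\<^sub>R v)) \<circ> (\<lambda>t. t - s) has_vector_derivative 1 *\<^sub>R G (y + s *\<^sub>R v)) (at s)"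
      by (rule vector_diff_chain_at)
         (use deriv[of "y + s *\<^sub>R v"] in \<open>auto intro!: derivative_eq_intros
           simp: has_real_derivative_iff_has_vector_derivative[symmetric]\<close>)
    then show ?thesis by (simp add: o_def algebra_simps)
  qed
  have suppG: "G y = 0" if "norm y > 1" for y
  proof -
    have "open {y::'a. norm y > 1}" by (intro open_Collect_less continuous_intros)
    then have op: "open ((\<lambda>t. y + t *\<^sub>R v) -` {y. norm y > 1})"
      by (intro open_vimage continuous_intros) auto
    have "((\<lambda>t. g (y + t *\<^sub>R v)) has_vector_derivative 0) (at 0)"
      by (rule has_vector_derivative_transform_within_open[OF _ op, of "\<lambda>t. 0"]) (use that supp in auto)
    then show ?thesis using deriv[of y] vector_derivative_unique_at by blast
  qed
  have "compact (G ` cball 0 1)"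
    by (intro compact_continuous_image continuous_on_subset[OF cont(2)]) auto
  then obtain B where B: "B > 0" "\<And>y. y \<in> cball 0 1 \<Longrightarrow> norm (G y) \<le> B"
    using compact_imp_bounded bounded_pos by (metis imageI)
  have B': "norm (G y) \<le> B" for y
    using B suppG[of y] by (cases "norm y \<le> 1") auto
  have lip: "norm (g (y + t *\<^sub>R v) - g y) \<le> B * \<bar>t\<bar>" for y t
  proof -
    have "norm (g (y + t *\<^sub>R v) - g (y + 0 *\<^sub>R v)) \<le> B * norm (t - 0)"
    proof (rule differentiable_bound[where S=UNIV and f'="\<lambda>s t. t *\<^sub>R G (y + s *\<^sub>R v)"])
      show "((\<lambda>t. g (y + t *\<^sub>R v)) has_derivative (\<lambda>t. t *\<^sub>R G (y + s *\<^sub>R v))) (at s)" for s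
        using deriv'[of y s] by (simp add: has_vector_derivative_def)
      show "onorm (\<lambda>t. t *\<^sub>R G (y + s *\<^sub>R v)) \<le> B" for s
        using B' B(1) by (intro onorm_le) (simp add: mult.commute[of B] mult_left_mono)
    qed auto
    then show ?thesis by simp
  qed
  have gm: "g \<in> borel_measurable borel" using cont(1) by (rule borel_measurable_continuous_onI)
  have Gm: "G \<in> borel_measurable borel" using cont(2) by (rule borel_measurable_continuous_onI)
  have gint: "integrable lborel g"
  proof -
    have "set_integrable lborel (cball 0 1) g"
      unfolding set_integrable_def by (rule borel_integrable_compact) (auto intro: continuous_on_subset[OF cont(1)])
    moreover have "indicator (cball 0 1) y *\<^sub>R g y = g y" for y
      using supp[of y] by (auto split: split_indicator)
    ultimately show ?thesis by (simp add: set_integrable_def)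
  qed
  define e where "e = (\<lambda>n. 1 / real (Suc n))"
  have e0: "e \<longlonglongrightarrow> 0" unfolding e_def by (rule LIMSEQ_Suc[OF lim_1_over_n])
  have epos: "e n > 0" "e n \<le> 1" for n by (auto simp: e_def)
  let ?q = "\<lambda>n y. (1 / e n) *\<^sub>R (g (y + e n *\<^sub>R v) - g y)"
  have "(\<lambda>n. integral\<^sup>L lborel (?q n)) \<longlonglongrightarrow> integral\<^sup>L lborel G"
  \<comment> \<open>The increments \<open>e n\<close> are at most 1, so the shifted support stays in
    the ball of radius 1 + |v|.\<close>
  proof (rule integral_dominated_convergence[where w="\<lambda>y. B * indicator (cball 0 (1 + norm v)) y"])
    show "AE y in lborel. (\<lambda>n. ?q n y) \<longlonglongrightarrow> G y"
    proof (rule AE_I2)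
      fix y
      have "((\<lambda>t. (g (y + t *\<^sub>R v) - g y) /\<^sub>R t) \<longlongrightarrow> G y) (at 0)"
      proof (rule LIM_zero_cancel, rule Lim_null_comparison)
        have "((\<lambda>t. (g (y + t *\<^sub>R v) - g y - t *\<^sub>R G y) /\<^sub>R \<bar>t\<bar>) \<longlongrightarrow> 0) (at 0)"
          using deriv[of y] by (simp add: has_vector_derivative_def has_derivative_def)
        then show "((\<lambda>t. norm ((g (y + t *\<^sub>R v) - g y - t *\<^sub>R G y) /\<^sub>R \<bar>t\<bar>)) \<longlongrightarrow> 0) (at 0)"
          by (rule tendsto_norm_zero)
        have "norm ((g (y + t *\<^sub>R v) - g y) /\<^sub>R t - G y) = norm ((g (y + t *\<^sub>R v) - g y - t *\<^sub>R G y) /\<^sub>R \<bar>t\<bar>)"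
          if "t \<noteq> 0" for t
        proof -
          have "(g (y + t *\<^sub>R v) - g y) /\<^sub>R t - G y = (g (y + t *\<^sub>R v) - g y - t *\<^sub>R G y) /\<^sub>R t"
            using that by (simp add: scaleR_diff_right)
          then show ?thesis by simp
        qed
        then show "eventually (\<lambda>t. norm ((g (y + t *\<^sub>R v) - g y) /\<^sub>R t - G y)
            \<le> norm ((g (y + t *\<^sub>R v) - g y - t *\<^sub>R G y) /\<^sub>R \<bar>t\<bar>)) (at 0)"
          by (simp add: eventually_at_filter)
      qed
      then have "((\<lambda>n. (g (y + e n *\<^sub>R v) - g y) /\<^sub>R e n) \<longlonglongrightarrow> G y)"
        by (rule filterlim_compose) (use e0 epos in \<open>auto simp: filterlim_at intro!: always_eventually less_imp_neq[symmetric]\<close>)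
      then show "(\<lambda>n. ?q n y) \<longlonglongrightarrow> G y" by (simp add: divide_inverse)
    qed
    show "AE y in lborel. norm (?q n y) \<le> B * indicator (cball 0 (1 + norm v)) y" for n
    proof (rule AE_I2)
      fix y
      show "norm (?q n y) \<le> B * indicator (cball 0 (1 + norm v)) y"
      proof (cases "norm y \<le> 1 + norm v")
        case True
        have "norm (?q n y) \<le> (1 / e n) * (B * e n)"
          using lip[of y "e n"] epos[of n] by (simp add: divide_le_eq mult.commute)
        then show ?thesis using True epos(1)[of n] by auto
      next
        case False
        have "norm (e n *\<^sub>R v) \<le> norm v" using epos[of n] by (simp add: mult_left_le_one_le)
        then have "norm (y + e n *\<^sub>R v) > 1"
          using False norm_triangle_ineq4[of "y + e n *\<^sub>R v" "e n *\<^sub>R v"] by simp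
        then show ?thesis using False supp[of y] supp[of "y + e n *\<^sub>R v"] norm_ge_zero[of v] by simp
      qed
    qed
    show "integrable lborel (\<lambda>y. B * indicator (cball (0::'a) (1 + norm v)) y)"
      using emeasure_bounded_finite[of "cball (0::'a) (1 + norm v)"]
      by (intro integrable_mult_right integrable_real_indicator) auto
    show "?q n \<in> borel_measurable lborel" for n
      using gm by measurable
    show "G \<in> borel_measurable lborel" using Gm by simp
  qed
  moreover have "integral\<^sup>L lborel (?q n) = 0" for n
  proof -
    have sh: "integrable lborel (\<lambda>y. g (y + e n *\<^sub>R v))" "integral\<^sup>L lborel (\<lambda>y. g (y + e n *\<^sub>R v)) = integral\<^sup>L lborel g"
    proof -
      have "distr lborel borel (\<lambda>y. e n *\<^sub>R v + y) = lborel" by (rule lborel_distr_plus)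
      then have d: "distr lborel borel (\<lambda>y. y + e n *\<^sub>R v) = lborel"
        by (simp only: add.commute[of _ "e n *\<^sub>R v"])
      show "integrable lborel (\<lambda>y. g (y + e n *\<^sub>R v))"
        using integrable_distr[of "\<lambda>y. y + e n *\<^sub>R v" lborel borel g] gint d by simp
      show "integral\<^sup>L lborel (\<lambda>y. g (y + e n *\<^sub>R v)) = integral\<^sup>L lborel g"
        using integral_distr[of "\<lambda>y. y + e n *\<^sub>R v" lborel borel g] gm d by simp
    qed
    then show ?thesis using gint by simp
  qed
  ultimately show ?thesis
    by (simp only: LIMSEQ_const_iff)
qed

section \<open>Polynomial integrals over the sphere\<close>

lemma borel_measurable_sphere_continuous:
  assumes "continuous_on (sphere 0 1) (g :: 'a::euclidean_space \<Rightarrow> 'b::topological_space)"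
  shows "g \<in> borel_measurable sphere_measure"
  using borel_measurable_continuous_on_restrict[OF assms]
    measurable_cong_sets[of sphere_measure "restrict_space borel (sphere (0::'a) 1)" borel borel]
  by simp

lemma integrable_sphere_continuous:
  assumes "continuous_on (sphere 0 1) (g :: 'a::euclidean_space \<Rightarrow> 'b::euclidean_space)"
  shows "integrable sphere_measure g"
proof -
  interpret S: finite_measure "sphere_measure :: 'a measure" by (rule finite_measure_sphere)
  have "compact (g ` sphere 0 1)"
    by (intro compact_continuous_image assms) auto
  then have "bounded (g ` sphere 0 1)" by (rule compact_imp_bounded)
  then obtain B where "\<forall>y\<in>sphere 0 1. norm (g y) \<le> B"
    unfolding bounded_iff by blast
  then show ?thesis
    by (intro S.integrable_const_bound[where B=B] borel_measurable_sphere_continuous assms) auto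
qed

text \<open>The radial integrals of the two terms in the derivative of
  \<open>(1 - |y|\<^sup>2)\<^sub>+\<^sup>2 q(y)\<close>. Taken with the exponent N + DIM - 2, their
  comparison produces the factor N + DIM - 1 of the integration by parts formula.\<close>

lemma integral_poly_cutoff:
  fixes e :: nat
  shows "(LINT r:{0<..}|lborel. r ^ e * (max 0 (1 - r\<^sup>2))\<^sup>2)
      = 8 / ((real e + 1) * (real e + 3) * (real e + 5))"
    and "(LINT r:{0<..}|lborel. r ^ (e + 2) * max 0 (1 - r\<^sup>2)) = 2 / ((real e + 3) * (real e + 5))"
proof -
  have sq: "r\<^sup>2 \<le> 1 \<longleftrightarrow> r \<le> 1" if "0 < r" for r :: real
    using that by (simp add: abs_square_le_1)
  have P: "((\<lambda>r. r ^ Suc n / real (Suc n)) has_real_derivative x ^ n) (at x)" for n and x :: real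
    using DERIV_cdivide[OF DERIV_pow[of "Suc n" x UNIV], of "real (Suc n)"] by simp
  have "(LINT r:{0<..}|lborel. (r::real) ^ e * (max 0 (1 - r\<^sup>2))\<^sup>2)
      = (\<integral>r. (r ^ e * (1 - r\<^sup>2)\<^sup>2) * indicator {0..1} r \<partial>lborel)"
    unfolding set_lebesgue_integral_def
  proof (rule integral_cong_AE)
    have "AE r in lborel. r \<noteq> (0::real)" by (rule AE_lborel_singleton)
    then show "AE r::real in lborel. indicat_real {0<..} r *\<^sub>R (r ^ e * (max 0 (1 - r\<^sup>2))\<^sup>2)
        = (r ^ e * (1 - r\<^sup>2)\<^sup>2) * indicator {0..1} r"
      by (rule eventually_mono) (auto simp: max_def sq split: split_indicator)
  qed auto
  also have "\<dots> = (1 ^ Suc e / real (Suc e) - 2 * (1 ^ Suc (e+2) / real (Suc (e+2))) + 1 ^ Suc (e+4) / real (Suc (e+4)))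
      - (0 ^ Suc e / real (Suc e) - 2 * (0 ^ Suc (e+2) / real (Suc (e+2))) + 0 ^ Suc (e+4) / real (Suc (e+4)))"
  proof (rule integral_FTC_Icc_real)
    fix x :: real
    have "((\<lambda>r. r ^ Suc e / real (Suc e) - 2 * (r ^ Suc (e+2) / real (Suc (e+2))) + r ^ Suc (e+4) / real (Suc (e+4)))
        has_real_derivative x ^ e - 2 * x ^ (e + 2) + x ^ (e + 4)) (at x)"
      by (intro DERIV_add DERIV_diff DERIV_cmult P)
    also have "x ^ e - 2 * x ^ (e + 2) + x ^ (e + 4) = x ^ e * (1 - x\<^sup>2)\<^sup>2"
      by (simp add: power_add algebra_simps power2_eq_square power4_eq_xxxx)
    finally show "((\<lambda>r. r ^ Suc e / real (Suc e) - 2 * (r ^ Suc (e+2) / real (Suc (e+2))) + r ^ Suc (e+4) / real (Suc (e+4)))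
        has_real_derivative x ^ e * (1 - x\<^sup>2)\<^sup>2) (at x)" .
  qed auto
  also have "\<dots> = 8 / ((real e + 1) * (real e + 3) * (real e + 5))"
    by (simp add: divide_simps power_0_left) (simp add: algebra_simps)
  finally show "(LINT r:{0<..}|lborel. r ^ e * (max 0 (1 - r\<^sup>2))\<^sup>2)
      = 8 / ((real e + 1) * (real e + 3) * (real e + 5))" .
  have "(LINT r:{0<..}|lborel. (r::real) ^ (e + 2) * max 0 (1 - r\<^sup>2))
      = (\<integral>r. (r ^ (e + 2) * (1 - r\<^sup>2)) * indicator {0..1} r \<partial>lborel)"
    unfolding set_lebesgue_integral_def
  proof (rule integral_cong_AE)
    have "AE r in lborel. r \<noteq> (0::real)" by (rule AE_lborel_singleton)
    then show "AE r::real in lborel. indicat_real {0<..} r *\<^sub>R (r ^ (e + 2) * max 0 (1 - r\<^sup>2))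
        = (r ^ (e + 2) * (1 - r\<^sup>2)) * indicator {0..1} r"
      by (rule eventually_mono) (auto simp: max_def sq split: split_indicator)
  qed auto
  also have "\<dots> = (1 ^ Suc (e+2) / real (Suc (e+2)) - 1 ^ Suc (e+4) / real (Suc (e+4)))
      - (0 ^ Suc (e+2) / real (Suc (e+2)) - 0 ^ Suc (e+4) / real (Suc (e+4)))"
  proof (rule integral_FTC_Icc_real)
    fix x :: real
    have "((\<lambda>r. r ^ Suc (e+2) / real (Suc (e+2)) - r ^ Suc (e+4) / real (Suc (e+4)))
        has_real_derivative x ^ (e + 2) - x ^ (e + 4)) (at x)"
      by (intro DERIV_diff P)
    also have "x ^ (e + 2) - x ^ (e + 4) = x ^ (e + 2) * (1 - x\<^sup>2)"
      by (simp add: power_add algebra_simps power2_eq_square power4_eq_xxxx)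
    finally show "((\<lambda>r. r ^ Suc (e+2) / real (Suc (e+2)) - r ^ Suc (e+4) / real (Suc (e+4)))
        has_real_derivative x ^ (e + 2) * (1 - x\<^sup>2)) (at x)" .
  qed auto
  also have "\<dots> = 2 / ((real e + 3) * (real e + 5))"
    by (simp add: divide_simps power_0_left add.commute)
  finally show "(LINT r:{0<..}|lborel. r ^ (e + 2) * max 0 (1 - r\<^sup>2)) = 2 / ((real e + 3) * (real e + 5))" .
qed

lemma integrable_ball_supported:
  fixes g :: "'a::euclidean_space \<Rightarrow> 'b::euclidean_space"
  assumes cont: "continuous_on UNIV g" and supp: "\<And>y. norm y > 1 \<Longrightarrow> g y = 0"
  shows "integrable lborel g"
proof -
  have "set_integrable lborel (cball 0 1) g"
    unfolding set_integrable_def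
    by (rule borel_integrable_compact) (auto intro: continuous_on_subset[OF cont])
  moreover have "indicator (cball 0 1) y *\<^sub>R g y = g y" for y
    using supp[of y] by (auto split: split_indicator)
  ultimately show ?thesis by (simp add: set_integrable_def)
qed

text \<open>Integrating the derivative of \<open>(1 - |y|\<^sup>2)\<^sub>+\<^sup>2 q(y)\<close> over the space gives zero; in polar
  coordinates this is the integration by parts formula on the sphere.\<close>

proposition sphere_integration_by_parts:
  fixes q :: "'a::euclidean_space \<Rightarrow> 'b::euclidean_space"
  assumes dim: "DIM('a) \<ge> 2" and q: "polynomial_function q"
    and hom: "\<And>t x. t > 0 \<Longrightarrow> q (t *\<^sub>R x) = (t ^ N) *\<^sub>R q x"
  shows "real (N + DIM('a) - 1) *\<^sub>R (LINT \<psi>|sphere_measure. (v \<bullet> \<psi>) *\<^sub>R q \<psi>)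
    = (LINT \<psi>|sphere_measure. dir_deriv v q \<psi>)"
proof -
  let ?k = "\<lambda>y::'a. max 0 (1 - (norm y)\<^sup>2)"
  define g where "g = (\<lambda>y. (?k y)\<^sup>2 *\<^sub>R q y)"
  define G1 where "G1 = (\<lambda>y. (?k y)\<^sup>2 *\<^sub>R dir_deriv v q y)"
  define G2 where "G2 = (\<lambda>y. (4 * (v \<bullet> y) * ?k y) *\<^sub>R q y)"
  have dq: "polynomial_function (dir_deriv v q)" by (rule polynomial_function_dir_deriv[OF q])
  have k0: "?k y = 0" if "norm y > 1" for y :: 'a
  proof -
    have "(norm y)\<^sup>2 > 1" using that by (simp add: one_less_power)
    then show ?thesis by simp
  qed
  have cg: "continuous_on UNIV g" "continuous_on UNIV G1" "continuous_on UNIV G2"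
    unfolding g_def G1_def G2_def
    by (intro continuous_intros continuous_on_polynomial_function[OF q] continuous_on_polynomial_function[OF dq])+
  have i1: "integrable lborel G1" and i2: "integrable lborel G2"
    by (intro integrable_ball_supported cg; simp add: G1_def G2_def k0)+
  \<comment> \<open>Squaring removes the corner of the truncation at 0; the derivative there is read
    off from the difference quotient.\<close>
  have dmax: "((\<lambda>t. (max 0 t)\<^sup>2) has_real_derivative 2 * max 0 t) (at t)" for t :: real
  proof (cases t "0::real" rule: linorder_cases)
    case less
    have "((\<lambda>t. 0) has_real_derivative 2 * max 0 t) (at t)" using less by simp
    then show ?thesis
      by (rule has_field_derivative_transform_within_open[where S="{..<0}"]) (use less in auto)
  next
    case equal
    have "((\<lambda>h::real. (max 0 h)\<^sup>2 / h) \<longlongrightarrow> 0) (at 0)"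
    proof (rule Lim_null_comparison)
      show "eventually (\<lambda>h. norm ((max 0 h)\<^sup>2 / h) \<le> \<bar>h\<bar>) (at (0::real))"
        by (rule always_eventually) (auto simp: max_def power2_eq_square)
      show "((\<lambda>h::real. \<bar>h\<bar>) \<longlongrightarrow> 0) (at 0)" by (rule tendsto_eq_intros | simp)+
    qed
    then show ?thesis using equal by (simp add: DERIV_def)
  next
    case greater
    have "((\<lambda>t. t\<^sup>2) has_real_derivative 2 * max 0 t) (at t)"
      using greater by (auto intro!: derivative_eq_intros)
    then show ?thesis
      by (rule has_field_derivative_transform_within_open[where S="{0<..}"]) (use greater in auto)
  qed
  have "integral\<^sup>L lborel (\<lambda>y. G1 y - G2 y) = 0"
  proof (rule integral_derivative_compact_support[of g _ v])
    fix y
    have 1: "((\<lambda>t. 1 - (norm (y + t *\<^sub>R v))\<^sup>2) has_real_derivative - 2 * (v \<bullet> y)) (at 0)"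
      unfolding power2_norm_eq_inner
      by (auto intro!: derivative_eq_intros simp: inner_commute inner_add_left inner_add_right
            has_real_derivative_iff_has_vector_derivative has_vector_derivative_def)
    have 2: "((\<lambda>t. (?k (y + t *\<^sub>R v))\<^sup>2) has_real_derivative (2 * ?k y) * (- 2 * (v \<bullet> y))) (at 0)"
      using DERIV_chain2[of "\<lambda>t. (max 0 t)\<^sup>2" "2 * ?k y" "\<lambda>t. 1 - (norm (y + t *\<^sub>R v))\<^sup>2" 0, OF _ 1]
        dmax[of "1 - (norm y)\<^sup>2"] by simp
    have "((\<lambda>t. g (y + t *\<^sub>R v)) has_vector_derivative
        (?k (y + 0 *\<^sub>R v))\<^sup>2 *\<^sub>R dir_deriv v q (y + 0 *\<^sub>R v)
        + ((2 * ?k y) * (- 2 * (v \<bullet> y))) *\<^sub>R q (y + 0 *\<^sub>R v)) (at 0)"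
      unfolding g_def
      by (rule has_vector_derivative_scaleR[OF 2 polynomial_function_line_derivative[OF q]])
    then show "((\<lambda>t. g (y + t *\<^sub>R v)) has_vector_derivative G1 y - G2 y) (at 0)"
      by (simp add: G1_def G2_def algebra_simps)
    show "g y = 0" if "norm y > 1" using k0[OF that] by (simp add: g_def)
  qed (intro cg continuous_intros)+
  then have eq: "integral\<^sup>L lborel G1 = integral\<^sup>L lborel G2"
    using i1 i2 by simp
  \<comment> \<open>With DIM = e + 2 the radial exponent (DIM - 1) + N - 1 is the natural number N +
    e, also for N = 0.\<close>
  obtain e where e: "DIM('a) = e + 2" using dim nat_le_iff_add by (metis add.commute)
  have kk: "max 0 (1 - (norm r)\<^sup>2) = 0" if "norm r > 1" for r :: real
    using one_less_power[of "norm r" 2] that by simp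
  have k1: "integrable lborel (\<lambda>r::real. indicator {0<..} r *\<^sub>R (r ^ j * (max 0 (1 - r\<^sup>2))\<^sup>2))" for j
    by (rule integrable_mult_indicator, simp, rule integrable_ball_supported)
       (use kk in \<open>auto intro!: continuous_intros\<close>)
  have k2: "integrable lborel (\<lambda>r::real. indicator {0<..} r *\<^sub>R (r ^ j * max 0 (1 - r\<^sup>2)))" for j
    by (rule integrable_mult_indicator, simp, rule integrable_ball_supported)
       (use kk in \<open>auto intro!: continuous_intros\<close>)
  let ?I1 = "LINT \<psi>|sphere_measure. dir_deriv v q \<psi>" and ?I2 = "LINT \<psi>|sphere_measure. (v \<bullet> \<psi>) *\<^sub>R q \<psi>"
  have "integral\<^sup>L lborel G1
      = (LINT r:{0<..}|lborel. (r ^ (N + e) * (max 0 (1 - r\<^sup>2))\<^sup>2) *\<^sub>R ?I1)"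
    unfolding integral_polar[OF i1]
  proof (rule set_lebesgue_integral_cong)
    show "\<forall>r. r \<in> {0<..} \<longrightarrow> r ^ (DIM('a) - 1) *\<^sub>R (LINT \<omega>|sphere_measure. G1 (r *\<^sub>R \<omega>))
        = (r ^ (N + e) * (max 0 (1 - r\<^sup>2))\<^sup>2) *\<^sub>R ?I1"
    proof safe
      fix r :: real assume r: "r > 0"
      have "(LINT \<omega>|sphere_measure. G1 (r *\<^sub>R \<omega>))
          = (LINT \<omega>|sphere_measure. ((max 0 (1 - r\<^sup>2))\<^sup>2 * (r ^ N / r)) *\<^sub>R dir_deriv v q \<omega>)"
        by (rule Bochner_Integration.integral_cong)
           (use r in \<open>auto simp: G1_def dir_deriv_homogeneous[OF q hom]\<close>)
      also have "\<dots> = ((max 0 (1 - r\<^sup>2))\<^sup>2 * (r ^ N / r)) *\<^sub>R ?I1" by simp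
      finally show "r ^ (DIM('a) - 1) *\<^sub>R (LINT \<omega>|sphere_measure. G1 (r *\<^sub>R \<omega>))
        = (r ^ (N + e) * (max 0 (1 - r\<^sup>2))\<^sup>2) *\<^sub>R ?I1"
        using r by (simp add: e power_add field_simps)
    qed
  qed auto
  also have "\<dots> = (8 / ((real (N+e) + 1) * (real (N+e) + 3) * (real (N+e) + 5))) *\<^sub>R ?I1"
    unfolding integral_poly_cutoff(1)[symmetric] set_lebesgue_integral_def
    by (subst integral_scaleR_left[symmetric], rule k1) (simp only: scaleR_scaleR real_scaleR_def)
  finally have e1: "integral\<^sup>L lborel G1 = (8 / ((real (N+e) + 1) * (real (N+e) + 3) * (real (N+e) + 5))) *\<^sub>R ?I1" .
  have "integral\<^sup>L lborel G2
      = (LINT r:{0<..}|lborel. (r ^ (N + e + 2) * max 0 (1 - r\<^sup>2)) *\<^sub>R (4 *\<^sub>R ?I2))"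
    unfolding integral_polar[OF i2]
  proof (rule set_lebesgue_integral_cong)
    show "\<forall>r. r \<in> {0<..} \<longrightarrow> r ^ (DIM('a) - 1) *\<^sub>R (LINT \<omega>|sphere_measure. G2 (r *\<^sub>R \<omega>))
        = (r ^ (N + e + 2) * max 0 (1 - r\<^sup>2)) *\<^sub>R (4 *\<^sub>R ?I2)"
    proof safe
      fix r :: real assume r: "r > 0"
      have "(LINT \<omega>|sphere_measure. G2 (r *\<^sub>R \<omega>))
          = (LINT \<omega>|sphere_measure. (4 * r * max 0 (1 - r\<^sup>2) * r ^ N) *\<^sub>R ((v \<bullet> \<omega>) *\<^sub>R q \<omega>))"
        by (rule Bochner_Integration.integral_cong)
           (use r in \<open>auto simp: G2_def hom mult_ac\<close>)
      also have "\<dots> = (4 * r * max 0 (1 - r\<^sup>2) * r ^ N) *\<^sub>R ?I2" by (rule integral_scaleR_right)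
      finally show "r ^ (DIM('a) - 1) *\<^sub>R (LINT \<omega>|sphere_measure. G2 (r *\<^sub>R \<omega>))
        = (r ^ (N + e + 2) * max 0 (1 - r\<^sup>2)) *\<^sub>R (4 *\<^sub>R ?I2)"
        using r by (simp add: e power_add field_simps)
    qed
  qed auto
  also have "\<dots> = (2 / ((real (N+e) + 3) * (real (N+e) + 5))) *\<^sub>R (4 *\<^sub>R ?I2)"
    unfolding integral_poly_cutoff(2)[symmetric] set_lebesgue_integral_def
    by (subst integral_scaleR_left[symmetric], rule k2) (simp only: scaleR_scaleR real_scaleR_def mult.assoc)
  finally have e2: "integral\<^sup>L lborel G2 = (2 / ((real (N+e) + 3) * (real (N+e) + 5))) *\<^sub>R (4 *\<^sub>R ?I2)" .
  let ?c = "8 / ((real (N+e) + 1) * (real (N+e) + 3) * (real (N+e) + 5))"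
  \<comment> \<open>The two radial constants differ by the factor N + e + 1, that is N + DIM -
    1.\<close>
  have c: "2 / ((x + 3) * (x + 5)) * 4 = 8 / ((x + 1) * (x + 3) * (x + 5)) * (x + 1)" if "x \<ge> 0" for x :: real
  proof -
    have g: "8 / (A * B) * A = 8 / B" if "A \<noteq> 0" for A B :: real
      using that by simp
    show ?thesis
      unfolding mult.assoc[of "x + 1"] using that by (subst g) simp_all
  qed
  have "?c *\<^sub>R ?I1 = ?c *\<^sub>R ((real (N+e) + 1) *\<^sub>R ?I2)"
    using eq unfolding e1 e2 scaleR_scaleR by (subst c[symmetric]) simp_all
  moreover have "?c \<noteq> 0" by simp
  ultimately have "?I1 = (real (N+e) + 1) *\<^sub>R ?I2" by (rule scaleR_left_imp_eq[rotated])
  then show ?thesis by (simp add: e)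
qed

section \<open>Reduction to polynomials by uniform approximation\<close>

text \<open>Both sides depend continuously on g in the uniform norm on K, the constant being the sum
  of the L1 norms of f1 and f2, and Stone-Weierstrass supplies the polynomials. The two measure
  spaces are unrelated, so that an integral over the sphere can be compared with a weighted integral
  over an interval.\<close>

lemma integral_eq_of_polynomials:
  fixes g :: "'a::euclidean_space \<Rightarrow> real"
    and h1 :: "'c \<Rightarrow> 'a" and h2 :: "'d \<Rightarrow> 'a" and f1 :: "'c \<Rightarrow> 'b::euclidean_space" and f2 :: "'d \<Rightarrow> 'b"
  assumes K: "compact K"
    and h1: "h1 \<in> borel_measurable M1" "\<And>x. x \<in> space M1 \<Longrightarrow> h1 x \<in> K"
    and h2: "h2 \<in> borel_measurable M2" "\<And>x. x \<in> space M2 \<Longrightarrow> h2 x \<in> K"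
    and f1: "integrable M1 f1" and f2: "integrable M2 f2"
    and poly: "\<And>p. real_polynomial_function p \<Longrightarrow>
      (LINT x|M1. p (h1 x) *\<^sub>R f1 x) = (LINT x|M2. p (h2 x) *\<^sub>R f2 x)"
    and g: "continuous_on K g"
  shows "(LINT x|M1. g (h1 x) *\<^sub>R f1 x) = (LINT x|M2. g (h2 x) *\<^sub>R f2 x)"
proof -
  have int: "integrable M (\<lambda>x. g (h x) *\<^sub>R f x)"
    if "continuous_on K g" "h \<in> borel_measurable M" "\<And>x. x \<in> space M \<Longrightarrow> h x \<in> K" "integrable M f"
    for M :: "'z measure" and g h and f :: "'z \<Rightarrow> 'b"
  proof -
    have "bounded (g ` K)"
      by (intro compact_imp_bounded compact_continuous_image that K)
    then obtain B where B: "\<forall>y\<in>K. \<bar>g y\<bar> \<le> B" unfolding bounded_iff by auto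
    have "h \<in> M \<rightarrow>\<^sub>M restrict_space borel K"
      by (rule measurable_restrict_space2) (use that in auto)
    from measurable_compose[OF this borel_measurable_continuous_on_restrict[OF that(1)]]
    have m: "(\<lambda>x. g (h x)) \<in> borel_measurable M" .
    show ?thesis
    proof (rule Bochner_Integration.integrable_bound[where f="\<lambda>x. B *\<^sub>R f x"])
      show "AE x in M. norm (g (h x) *\<^sub>R f x) \<le> norm (B *\<^sub>R f x)"
        using B that(3) by (intro AE_I2) (force intro: mult_right_mono)
    qed (use m that in auto)
  qed
  define C where "C = (LINT x|M1. norm (f1 x)) + (LINT x|M2. norm (f2 x))"
  have C0: "C \<ge> 0" unfolding C_def by (intro add_nonneg_nonneg integral_nonneg_AE) auto
  let ?D = "norm ((LINT x|M1. g (h1 x) *\<^sub>R f1 x) - (LINT x|M2. g (h2 x) *\<^sub>R f2 x))"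
  have "?D \<le> e * C" if e: "e > 0" for e
  proof -
    obtain p where p: "real_polynomial_function p" "\<And>x. x \<in> K \<Longrightarrow> \<bar>g x - p x\<bar> < e"
      using Stone_Weierstrass_real_polynomial_function[OF K g e] by metis
    have cp: "continuous_on K p"
      using p(1) by (intro continuous_on_polymonial_function) (simp add: real_polynomial_function_eq)
    have near: "norm ((LINT x|M. g (h x) *\<^sub>R f x) - (LINT x|M. p (h x) *\<^sub>R f x)) \<le> e * (LINT x|M. norm (f x))"
      if h: "h \<in> borel_measurable M" "\<And>x. x \<in> space M \<Longrightarrow> h x \<in> K" and f: "integrable M f"
      for M :: "'z measure" and h and f :: "'z \<Rightarrow> 'b"
    proof -
      note i1 = int[OF g h f] and i2 = int[OF cp h f]
      have "norm ((LINT x|M. g (h x) *\<^sub>R f x) - (LINT x|M. p (h x) *\<^sub>R f x))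
          = norm (LINT x|M. g (h x) *\<^sub>R f x - p (h x) *\<^sub>R f x)"
        using i1 i2 by simp
      also have "\<dots> \<le> (LINT x|M. norm (g (h x) *\<^sub>R f x - p (h x) *\<^sub>R f x))"
        by (rule integral_norm_bound)
      also have "\<dots> \<le> (LINT x|M. e * norm (f x))"
      proof (rule integral_mono)
        show "integrable M (\<lambda>x. norm (g (h x) *\<^sub>R f x - p (h x) *\<^sub>R f x))" using i1 i2 by simp
        show "integrable M (\<lambda>x. e * norm (f x))" using f by auto
        fix x assume x: "x \<in> space M"
        have "norm (g (h x) *\<^sub>R f x - p (h x) *\<^sub>R f x) = \<bar>g (h x) - p (h x)\<bar> * norm (f x)"
          by (simp flip: scaleR_diff_left)
        also have "\<dots> \<le> e * norm (f x)"
          using p(2)[OF h(2)[OF x]] by (intro mult_right_mono) auto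
        finally show "norm (g (h x) *\<^sub>R f x - p (h x) *\<^sub>R f x) \<le> e * norm (f x)" .
      qed
      finally show ?thesis by simp
    qed
    have "?D \<le> norm ((LINT x|M1. g (h1 x) *\<^sub>R f1 x) - (LINT x|M1. p (h1 x) *\<^sub>R f1 x))
        + norm ((LINT x|M2. g (h2 x) *\<^sub>R f2 x) - (LINT x|M2. p (h2 x) *\<^sub>R f2 x))"
      unfolding poly[OF p(1)] by norm
    also have "\<dots> \<le> e * C"
      unfolding C_def distrib_left by (intro add_mono near h1 h2 f1 f2)
    finally show ?thesis .
  qed
  note D = this
  have "?D \<le> 0 + e" if "e > 0" for e
  proof -
    have "?D \<le> e / (C + 1) * C"
      by (rule D) (use C0 that in simp)
    also have "\<dots> \<le> e" using C0 that by (simp add: field_simps)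
    finally show ?thesis by simp
  qed
  then have "?D \<le> 0" by (rule field_le_epsilon)
  then show ?thesis by simp
qed

section \<open>Products of linear forms and rotation invariance\<close>

text \<open>Products of linear forms replace monomials: they span the polynomials without a choice
  of coordinates, and linear maps act on them by acting on the list of vectors.\<close>

definition lin_prod :: "'a::euclidean_space list \<Rightarrow> 'a \<Rightarrow> real" where
  "lin_prod vs x = prod_list (map (\<lambda>v. v \<bullet> x) vs)"

lemma lin_prod_simps [simp]:
  "lin_prod [] x = 1" "lin_prod (v # vs) x = (v \<bullet> x) * lin_prod vs x"
  "lin_prod (us @ vs) x = lin_prod us x * lin_prod vs x"
  by (auto simp: lin_prod_def)

lemma lin_prod_Nil_fun: "lin_prod [] = (\<lambda>x. 1)"
  by (simp add: fun_eq_iff)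

lemma lin_prod_Cons_fun: "lin_prod (v # vs) = (\<lambda>x. (v \<bullet> x) *\<^sub>R lin_prod vs x)"
  by (simp add: fun_eq_iff)

lemma polynomial_function_inner_left: "polynomial_function (\<lambda>x::'a::euclidean_space. v \<bullet> x)"
  by (rule polynomial_function_bounded_linear) (rule bounded_linear_inner_right)

lemma polynomial_function_lin_prod: "polynomial_function (lin_prod vs)"
proof (induction vs)
  case Nil
  show ?case unfolding lin_prod_Nil_fun by simp
next
  case (Cons v vs)
  show ?case unfolding lin_prod_Cons_fun
    by (intro polynomial_function_mult polynomial_function_inner_left Cons)
qed

lemma lin_prod_scaleR: "lin_prod vs (t *\<^sub>R x) = (t ^ length vs) *\<^sub>R lin_prod vs x"
  by (induction vs) auto

text \<open>The Leibniz rule recorded formally: each entry holds the coefficient v \<bullet> w of a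
  removed form and the list of the remaining ones. Coefficients are inner products, which makes the
  recursion for the integrals invariant under rotations.\<close>

fun lin_prod_deriv :: "'a::euclidean_space \<Rightarrow> 'a list \<Rightarrow> (real \<times> 'a list) list" where
  "lin_prod_deriv v [] = []"
| "lin_prod_deriv v (w # ws) = (v \<bullet> w, ws) # map (\<lambda>(c, us). (c, w # us)) (lin_prod_deriv v ws)"

lemma dir_deriv_lin_prod:
  "dir_deriv v (lin_prod vs) x = (\<Sum>(c, us)\<leftarrow>lin_prod_deriv v vs. c * lin_prod us x)"
proof (induction vs)
  case Nil
  show ?case unfolding lin_prod_Nil_fun by (simp add: dir_deriv_const)
next
  case (Cons w ws)
  have "dir_deriv v (\<lambda>x. w \<bullet> x) x = w \<bullet> v"
    by (rule dir_deriv_linear) (rule bounded_linear_inner_right)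
  then have "dir_deriv v (lin_prod (w # ws)) x = (w \<bullet> v) * lin_prod ws x + (w \<bullet> x) * dir_deriv v (lin_prod ws) x"
    unfolding lin_prod_Cons_fun
    by (subst dir_deriv_scaleR) (simp_all add: polynomial_function_inner_left polynomial_function_lin_prod)
  also have "(w \<bullet> x) * dir_deriv v (lin_prod ws) x
      = (\<Sum>(c, us)\<leftarrow>map (\<lambda>(c, us). (c, w # us)) (lin_prod_deriv v ws). c * lin_prod us x)"
    unfolding Cons by (simp add: o_def case_prod_beta' mult_ac flip: sum_list_const_mult)
  finally show ?case by (simp add: inner_commute)
qed

lemma length_lin_prod_deriv: "(c, us) \<in> set (lin_prod_deriv v vs) \<Longrightarrow> Suc (length us) = length vs"
  by (induction vs arbitrary: c us) auto

lemma continuous_on_lin_prod: "continuous_on S (lin_prod vs)"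
  by (rule continuous_on_polynomial_function) (rule polynomial_function_lin_prod)

text \<open>Integration by parts in the direction v, applied to the homogeneous polynomial
  \<open>lin_prod vs\<close>. The right-hand side has products with two factors fewer, so iteration
  determines the integrals of all products up to the total volume.\<close>

lemma integral_lin_prod_Cons:
  assumes dim: "DIM('a::euclidean_space) \<ge> 2"
  shows "real (length vs + DIM('a) - 1) * (LINT \<psi>|sphere_measure. lin_prod (v # vs) (\<psi> :: 'a))
    = (\<Sum>(c, us)\<leftarrow>lin_prod_deriv v vs. c * (LINT \<psi>|sphere_measure. lin_prod us \<psi>))"
proof -
  have I: "integrable sphere_measure (lin_prod us :: 'a \<Rightarrow> real)" for us
    by (rule integrable_sphere_continuous) (rule continuous_on_lin_prod)
  have "(LINT \<psi>|sphere_measure. (\<Sum>(c, us)\<leftarrow>L. c * lin_prod us (\<psi> :: 'a)))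
      = (\<Sum>(c, us)\<leftarrow>L. c * (LINT \<psi>|sphere_measure. lin_prod us \<psi>))
      \<and> integrable sphere_measure (\<lambda>\<psi>. (\<Sum>(c, us)\<leftarrow>L. c * lin_prod us (\<psi> :: 'a)))" for L
    by (induction L) (auto simp: I)
  then show ?thesis
    using sphere_integration_by_parts[OF dim polynomial_function_lin_prod lin_prod_scaleR, of vs v]
    by (simp add: dir_deriv_lin_prod)
qed

lemma lin_prod_deriv_orthogonal:
  assumes "orthogonal_transformation A"
  shows "lin_prod_deriv (A v) (map A vs) = map (\<lambda>(c, us). (c, map A us)) (lin_prod_deriv v vs)"
  using assms by (induction vs) (auto simp: orthogonal_transformation_def)

text \<open>Strong induction on the number of factors: the recursion has inner products as
  coefficients, and these are preserved by A.\<close>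

lemma integral_lin_prod_orthogonal:
  assumes dim: "DIM('a::euclidean_space) \<ge> 2" and A: "orthogonal_transformation (A :: 'a \<Rightarrow> 'a)"
  shows "(LINT \<psi>|sphere_measure. lin_prod (map A vs) \<psi>) = (LINT \<psi>|sphere_measure. lin_prod vs \<psi>)"
proof (induction "length vs" arbitrary: vs rule: less_induct)
  case less
  show ?case
  proof (cases vs)
    case (Cons v ws)
    let ?k = "real (length ws + DIM('a) - 1)"
    have "?k * (LINT \<psi>|sphere_measure. lin_prod (map A vs) \<psi>)
        = (\<Sum>(c, us)\<leftarrow>lin_prod_deriv v ws. c * (LINT \<psi>|sphere_measure. lin_prod (map A us) \<psi>))"
      using integral_lin_prod_Cons[OF dim, of "map A ws" "A v"] Cons
      by (simp add: lin_prod_deriv_orthogonal[OF A] o_def case_prod_beta')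
    also have "\<dots> = (\<Sum>(c, us)\<leftarrow>lin_prod_deriv v ws. c * (LINT \<psi>|sphere_measure. lin_prod us \<psi>))"
    proof (intro arg_cong[where f=sum_list] map_cong refl, clarify)
      fix c us assume "(c, us) \<in> set (lin_prod_deriv v ws)"
      then have "length us < length vs" using length_lin_prod_deriv Cons by fastforce
      from less[OF this] show "c * (LINT \<psi>|sphere_measure. lin_prod (map A us) \<psi>) = c * (LINT \<psi>|sphere_measure. lin_prod us \<psi>)"
        by simp
    qed
    also have "\<dots> = ?k * (LINT \<psi>|sphere_measure. lin_prod vs \<psi>)"
      using integral_lin_prod_Cons[OF dim, of ws v] Cons by simp
    finally show ?thesis using dim by simp
  qed simp
qed

text \<open>The set V of admissible vectors is a parameter because rotations are tested with all
  vectors, whereas boosts are tested with an axis and its orthogonal complement.\<close>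

inductive lin_prod_span :: "'a::euclidean_space set \<Rightarrow> ('a \<Rightarrow> real) \<Rightarrow> bool" for V where
  prod: "set vs \<subseteq> V \<Longrightarrow> lin_prod_span V (lin_prod vs)"
| add: "lin_prod_span V f \<Longrightarrow> lin_prod_span V g \<Longrightarrow> lin_prod_span V (\<lambda>x. f x + g x)"
| scale: "lin_prod_span V f \<Longrightarrow> lin_prod_span V (\<lambda>x. c * f x)"

lemma lin_prod_span_mult:
  assumes "lin_prod_span V f" "lin_prod_span V g"
  shows "lin_prod_span V (\<lambda>x. f x * g x)"
  using assms(1)
proof induction
  case (prod vs)
  show ?case using assms(2)
  proof induction
    case (prod us)
    have "lin_prod_span V (lin_prod (vs @ us))"
      using prod \<open>set vs \<subseteq> V\<close> by (intro lin_prod_span.prod) auto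
    moreover have "lin_prod (vs @ us) = (\<lambda>x. lin_prod vs x * lin_prod us x)" by (simp add: fun_eq_iff)
    ultimately show ?case by simp
  next
    case (add f g)
    from lin_prod_span.add[OF add.IH] show ?case by (simp add: distrib_left)
  next
    case (scale f c)
    from lin_prod_span.scale[OF scale.IH, of c] show ?case by (simp add: mult.left_commute)
  qed
next
  case (add f1 f2)
  from lin_prod_span.add[OF add.IH] show ?case by (simp add: distrib_right)
next
  case (scale f c)
  from lin_prod_span.scale[OF scale.IH, of c] show ?case by (simp add: mult.assoc)
qed

lemma real_polynomial_function_lin_prod_span:
  assumes "real_polynomial_function p" and V: "span V = (UNIV :: 'a::euclidean_space set)"
  shows "lin_prod_span V (p :: 'a \<Rightarrow> real)"
  using assms(1)
proof induction
  case (const c)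
  have "lin_prod_span V (\<lambda>x. c * lin_prod [] x)" by (intro lin_prod_span.intros) auto
  then show ?case by simp
next
  case (linear f)
  define a where "a = (\<Sum>b\<in>Basis. f b *\<^sub>R b)"
  have fa: "f x = a \<bullet> x" for x
  proof -
    have "f x = f (\<Sum>b\<in>Basis. (x \<bullet> b) *\<^sub>R b)" by (simp add: euclidean_representation)
    also have "\<dots> = (\<Sum>b\<in>Basis. (x \<bullet> b) * f b)"
      using bounded_linear.linear[OF linear.hyps] by (simp add: linear_sum linear_scale)
    also have "\<dots> = a \<bullet> x"
      unfolding a_def inner_sum_left by (simp add: inner_commute mult.commute)
    finally show ?thesis .
  qed
  have "a \<in> span V" using V by simp
  then have "lin_prod_span V (\<lambda>x. a \<bullet> x)"
  proof (induction rule: span_induct_alt)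
    case base
    have "lin_prod_span V (\<lambda>x. 0 * lin_prod [] x)" by (intro lin_prod_span.intros) auto
    then show ?case by simp
  next
    case (step c v y)
    have "lin_prod_span V (lin_prod [v])" using step by (intro lin_prod_span.prod) auto
    then have "lin_prod_span V (\<lambda>x. c * lin_prod [v] x + y \<bullet> x)"
      by (intro lin_prod_span.add lin_prod_span.scale step)
    then show ?case by (simp add: inner_add_left)
  qed
  then show ?case using fa by simp
qed (auto intro: lin_prod_span.add lin_prod_span_mult)

text \<open>Products of forms from a spanning set span the polynomials, and polynomials are
  uniformly dense on the sphere. Hence two weighted images of the surface measure coincide as soon
  as they integrate these products alike. The function g is treated one component at a time.\<close>

proposition sphere_integral_eqI:
  fixes h1 h2 :: "'a::euclidean_space \<Rightarrow> 'a" and w1 w2 :: "'a \<Rightarrow> real" and g :: "'a \<Rightarrow> 'b::euclidean_space"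
  assumes V: "span V = UNIV"
    and h1: "continuous_on (sphere 0 1) h1" "h1 \<in> sphere 0 1 \<rightarrow> sphere 0 1"
    and h2: "continuous_on (sphere 0 1) h2" "h2 \<in> sphere 0 1 \<rightarrow> sphere 0 1"
    and w1: "continuous_on (sphere 0 1) w1" and w2: "continuous_on (sphere 0 1) w2"
    and eq: "\<And>vs. set vs \<subseteq> V \<Longrightarrow>
      (LINT \<psi>|sphere_measure. w1 \<psi> * lin_prod vs (h1 \<psi>)) = (LINT \<psi>|sphere_measure. w2 \<psi> * lin_prod vs (h2 \<psi>))"
    and g: "continuous_on (sphere 0 1) g"
  shows "(LINT \<psi>|sphere_measure. w1 \<psi> *\<^sub>R g (h1 \<psi>)) = (LINT \<psi>|sphere_measure. w2 \<psi> *\<^sub>R g (h2 \<psi>))"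
proof (rule euclidean_eqI)
  have int: "integrable sphere_measure (\<lambda>\<psi>. w \<psi> *\<^sub>R g (h \<psi>))"
    if "continuous_on (sphere 0 1) w" "continuous_on (sphere 0 1) h" "h \<in> sphere 0 1 \<rightarrow> sphere 0 1"
      "continuous_on (sphere 0 1) g"
    for w :: "'a \<Rightarrow> real" and h :: "'a \<Rightarrow> 'a" and g :: "'a \<Rightarrow> 'z::euclidean_space"
    by (intro integrable_sphere_continuous continuous_intros continuous_on_compose2[OF that(4)] that)
       (use that(3) in auto)
  have poly: "(LINT \<psi>|sphere_measure. p (h1 \<psi>) *\<^sub>R w1 \<psi>) = (LINT \<psi>|sphere_measure. p (h2 \<psi>) *\<^sub>R w2 \<psi>)"
    if "real_polynomial_function p" for p
  proof -
    have "lin_prod_span V p" using that V by (rule real_polynomial_function_lin_prod_span)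
    then have "(LINT \<psi>|sphere_measure. w1 \<psi> *\<^sub>R p (h1 \<psi>)) = (LINT \<psi>|sphere_measure. w2 \<psi> *\<^sub>R p (h2 \<psi>))
        \<and> continuous_on (sphere 0 1) p"
    proof induction
      case (prod vs)
      then show ?case using eq[of vs] by (simp add: continuous_on_lin_prod)
    next
      case (add f1 f2)
      then show ?case
        using int[OF w1 h1, of f1] int[OF w1 h1, of f2] int[OF w2 h2, of f1] int[OF w2 h2, of f2]
        by (auto simp: distrib_left intro: continuous_on_add)
    next
      case (scale f c)
      then show ?case by (auto simp: mult.left_commute intro!: continuous_intros)
    qed
    then show ?thesis by (simp add: mult.commute)
  qed
  fix b :: 'b assume "b \<in> Basis"
  have ht: "h \<psi> \<in> sphere 0 1" if "h \<in> sphere 0 1 \<rightarrow> sphere 0 1" "\<psi> \<in> space sphere_measure" for \<psi> h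
    using that by auto
  have "(LINT \<psi>|sphere_measure. (g (h1 \<psi>) \<bullet> b) *\<^sub>R w1 \<psi>) = (LINT \<psi>|sphere_measure. (g (h2 \<psi>) \<bullet> b) *\<^sub>R w2 \<psi>)"
  proof (rule integral_eq_of_polynomials[where K="sphere 0 1" and g="\<lambda>x. g x \<bullet> b" and ?h1.0=h1 and ?h2.0=h2
        and ?f1.0=w1 and ?f2.0=w2])
    show "h1 \<in> borel_measurable sphere_measure" "h2 \<in> borel_measurable sphere_measure"
      by (intro borel_measurable_sphere_continuous h1 h2)+
    show "h1 \<psi> \<in> sphere 0 1" "h2 \<psi> \<in> sphere 0 1" if "\<psi> \<in> space sphere_measure" for \<psi>
      using that ht[OF h1(2)] ht[OF h2(2)] by blast+
    show "integrable sphere_measure w1" "integrable sphere_measure w2"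
      by (intro integrable_sphere_continuous w1 w2)+
    show "continuous_on (sphere 0 1) (\<lambda>x. g x \<bullet> b)" by (intro continuous_intros g)
  qed (use poly in simp_all)
  then show "(LINT \<psi>|sphere_measure. w1 \<psi> *\<^sub>R g (h1 \<psi>)) \<bullet> b = (LINT \<psi>|sphere_measure. w2 \<psi> *\<^sub>R g (h2 \<psi>)) \<bullet> b"
    using int[OF w1 h1 g] int[OF w2 h2 g]
    by (subst (1 2) integral_inner_left[symmetric]) (auto simp: mult.commute)
qed

text \<open>Every test vector has the form A u, and A u \<bullet> A \<psi> = u \<bullet> \<psi>, so
  composing with A amounts to replacing the list of vectors A u by the list of vectors u.\<close>

corollary sphere_integral_orthogonal:
  fixes A :: "'a::euclidean_space \<Rightarrow> 'a" and g :: "'a \<Rightarrow> 'b::euclidean_space"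
  assumes dim: "DIM('a) \<ge> 2" and A: "orthogonal_transformation A" and g: "continuous_on (sphere 0 1) g"
  shows "(LINT \<psi>|sphere_measure. g (A \<psi>)) = (LINT \<psi>|sphere_measure. g \<psi>)"
proof -
  have "(LINT \<psi>|sphere_measure. 1 *\<^sub>R g (A \<psi>)) = (LINT \<psi>|sphere_measure. 1 *\<^sub>R g \<psi>)"
  proof (rule sphere_integral_eqI[of UNIV])
    show "continuous_on (sphere 0 1) A"
      using A by (intro linear_continuous_on linear_conv_bounded_linear[THEN iffD1] orthogonal_transformation_linear)
    show "A \<in> sphere 0 1 \<rightarrow> sphere 0 1"
      using A by (auto simp: orthogonal_transformation_norm)
    fix vs :: "'a list"
    have "surj A" using A by (rule orthogonal_transformation_surj)
    then obtain us where us: "vs = map A us" by (metis ex_map_conv surj_def)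
    have "lin_prod (map A us) (A \<psi>) = lin_prod us \<psi>" for \<psi> us
      using A by (induction us) (auto simp: orthogonal_transformation_def)
    then show "(LINT \<psi>|sphere_measure. 1 * lin_prod vs (A \<psi>)) = (LINT \<psi>|sphere_measure. 1 * lin_prod vs \<psi>)"
      using integral_lin_prod_orthogonal[OF dim A, of us] us by simp
  qed (auto intro: g)
  then show ?thesis by simp
qed

section \<open>Substitution on the line and moments of the Gegenbauer weight\<close>

text \<open>The change of variables for Lebesgue integrable functions, brought back to
  \<open>lborel\<close>. Borel measurability of the transformed integrand is a separate premise
  because the completed measure provides only Lebesgue measurability.\<close>

lemma
  fixes f :: "real \<Rightarrow> 'b::euclidean_space" and g h :: "real \<Rightarrow> real"
  assumes S: "S \<in> sets borel" and T: "g ` S = T"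
    and deriv: "\<And>x. x \<in> S \<Longrightarrow> (g has_field_derivative h x) (at x within S)" and inj: "inj_on g S"
    and f: "set_integrable lborel T f"
    and m: "set_borel_measurable borel S (\<lambda>x. \<bar>h x\<bar> *\<^sub>R f (g x))"
  shows set_integrable_substitution: "set_integrable lborel S (\<lambda>x. \<bar>h x\<bar> *\<^sub>R f (g x))"
    and set_integral_substitution: "(LINT x:S|lborel. \<bar>h x\<bar> *\<^sub>R f (g x)) = (LINT y:T|lborel. f y)"
proof -
  have L: "S \<in> sets lebesgue" using S by simp
  have "f absolutely_integrable_on T"
    using f unfolding set_integrable_def by (rule integrable_completion[THEN iffD2, rotated]) (use f in \<open>auto simp: set_integrable_def\<close>)
  then have c: "(\<lambda>x. \<bar>h x\<bar> *\<^sub>R f (g x)) absolutely_integrable_on S"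
      "integral S (\<lambda>x. \<bar>h x\<bar> *\<^sub>R f (g x)) = integral T f"
    using has_absolute_integral_change_of_variables_real[OF L deriv inj, of f "integral T f"] T by auto
  show i: "set_integrable lborel S (\<lambda>x. \<bar>h x\<bar> *\<^sub>R f (g x))"
    using c(1) m unfolding set_integrable_def set_borel_measurable_def
    by (subst (asm) integrable_completion) auto
  show "(LINT x:S|lborel. \<bar>h x\<bar> *\<^sub>R f (g x)) = (LINT y:T|lborel. f y)"
    using set_borel_integral_eq_integral(2)[OF i] set_borel_integral_eq_integral(2)[OF f] c(2) by simp
qed

lemma set_integrable_of_nonneg:
  fixes f :: "real \<Rightarrow> real"
  assumes i: "f integrable_on S" and nn: "\<And>x. x \<in> S \<Longrightarrow> 0 \<le> f x" and m: "set_borel_measurable borel S f"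
  shows "set_integrable lborel S f"
proof -
  have "f absolutely_integrable_on S" using i nn by (rule nonnegative_absolutely_integrable_1)
  then show ?thesis using m unfolding set_integrable_def set_borel_measurable_def
    by (subst (asm) integrable_completion) auto
qed

text \<open>The extreme exponent -1/2 gives the derivative of arcsin, and larger exponents are
  dominated by it since 0 \<le> 1 - u^2 \<le> 1 on the interval. At the end points both
  \<open>powr\<close> and \<open>inverse\<close> yield 0.\<close>

lemma gegenbauer_weight_integrable:
  fixes a :: real
  assumes a: "a \<ge> - 1 / 2"
  shows "set_integrable lborel {-1..1} (\<lambda>u. (1 - u\<^sup>2) powr a)"
proof -
  have sq: "u\<^sup>2 < 1" if "-1 < u" "u < 1" for u :: real
    using that by (simp add: abs_square_less_1)
  have "((\<lambda>u. inverse (sqrt (1 - u\<^sup>2))) has_integral arcsin 1 - arcsin (-1)) {-1..1}"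
  proof (rule fundamental_theorem_of_calculus_interior)
    show "continuous_on {-1..1} arcsin" by (intro continuous_intros) auto
    show "(arcsin has_vector_derivative inverse (sqrt (1 - u\<^sup>2))) (at u)" if "u \<in> {-1<..<1}" for u
      using DERIV_arcsin[of u] that by (auto simp: has_real_derivative_iff_has_vector_derivative)
  qed auto
  then have "(\<lambda>u::real. inverse (sqrt (1 - u\<^sup>2))) integrable_on {-1..1}" by blast
  then have *: "set_integrable lborel {-1..1} (\<lambda>u::real. inverse (sqrt (1 - u\<^sup>2)))"
    by (rule set_integrable_of_nonneg)
       (auto simp: abs_square_le_1 set_borel_measurable_def)
  show ?thesis
  proof (rule set_integrable_bound[OF *])
    show "AE u in lborel. u \<in> {-1..1} \<longrightarrow> norm ((1 - u\<^sup>2) powr a) \<le> norm (inverse (sqrt (1 - u\<^sup>2)))"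
    proof (intro AE_I2 impI)
      fix u :: real assume "u \<in> {-1..1}"
      then have u: "0 \<le> 1 - u\<^sup>2" "1 - u\<^sup>2 \<le> 1" by (auto simp: abs_square_le_1)
      show "norm ((1 - u\<^sup>2) powr a) \<le> norm (inverse (sqrt (1 - u\<^sup>2)))"
      proof (cases "1 - u\<^sup>2 = 0")
        case False
        have "(1 - u\<^sup>2) powr a \<le> (1 - u\<^sup>2) powr (- 1 / 2)"
          using u False a by (intro powr_mono') auto
        also have "\<dots> = inverse (sqrt (1 - u\<^sup>2))"
          using u by (simp add: powr_minus powr_half_sqrt)
        finally show ?thesis using u by simp
      qed simp
    qed
  qed (auto simp: set_borel_measurable_def)
qed

lemma gegenbauer_weight_integrable_continuous:
  fixes \<phi> :: "real \<Rightarrow> 'b::euclidean_space"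
  assumes a: "a \<ge> - 1 / 2" and \<phi>: "continuous_on {-1..1} \<phi>"
  shows "set_integrable lborel {-1..1} (\<lambda>u. (1 - u\<^sup>2) powr a *\<^sub>R \<phi> u)"
proof -
  have "bounded (\<phi> ` {-1..1})"
    by (intro compact_imp_bounded compact_continuous_image \<phi>) auto
  then obtain B where B: "\<forall>u\<in>{-1..1}. norm (\<phi> u) \<le> B" unfolding bounded_iff by auto
  have "set_integrable lborel {-1..1} (\<lambda>u. (1 - u\<^sup>2) powr a * B)"
    using gegenbauer_weight_integrable[OF a] by (rule set_integrable_mult_left)
  then show ?thesis
  proof (rule set_integrable_bound)
    have "(\<lambda>u. indicator {-1..1} u *\<^sub>R \<phi> u) \<in> borel_measurable borel"
      using \<phi> by (intro borel_measurable_continuous_on_indicator) auto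
    then have "(\<lambda>u. (1 - u\<^sup>2) powr a *\<^sub>R (indicator {-1..1} u *\<^sub>R \<phi> u)) \<in> borel_measurable borel"
      by measurable
    then show "set_borel_measurable lborel {-1..1} (\<lambda>u. (1 - u\<^sup>2) powr a *\<^sub>R \<phi> u)"
      unfolding set_borel_measurable_def by (simp add: mult.commute)
    show "AE u in lborel. u \<in> {-1..1} \<longrightarrow> norm ((1 - u\<^sup>2) powr a *\<^sub>R \<phi> u) \<le> norm ((1 - u\<^sup>2) powr a * B)"
      using B by (intro AE_I2 impI) (force simp: abs_mult intro!: mult_left_mono)
  qed
qed

definition gegenbauer_moment :: "real \<Rightarrow> nat \<Rightarrow> real" where
  "gegenbauer_moment a j = (LINT u:{-1..1}|lborel. u ^ j * (1 - u\<^sup>2) powr a)"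

text \<open>Fundamental theorem for u^j (1 - u^2)^(a + 1), whose boundary values vanish as a + 1 >
  0. For j = 0 the truncated index j - 1 is harmless because its coefficient is 0.\<close>

lemma gegenbauer_moment_rec:
  assumes a: "a \<ge> - 1 / 2"
  shows "(real j + 2 * a + 2) * gegenbauer_moment a (Suc j) = real j * gegenbauer_moment a (j - 1)"
proof -
  have sq: "0 < 1 - u\<^sup>2" if "-1 < u" "u < 1" for u :: real
    using that by (simp add: abs_square_less_1)
  have i: "set_integrable lborel {-1..1} (\<lambda>u. u ^ j * (1 - u\<^sup>2) powr a)" for j
    using gegenbauer_weight_integrable_continuous[OF a, of "\<lambda>u. u ^ j"]
    by (simp add: mult.commute continuous_on_power continuous_on_id)
  let ?f = "\<lambda>u. real j * (u ^ (j - 1) * (1 - u\<^sup>2) powr a) - (real j + 2 * a + 2) * (u ^ Suc j * (1 - u\<^sup>2) powr a)"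
  let ?F = "\<lambda>u. u ^ j * (1 - u\<^sup>2) powr (a + 1)"
  have "(?f has_integral ?F 1 - ?F (-1)) {-1..1}"
  proof (rule fundamental_theorem_of_calculus_interior)
    show "continuous_on {-1..1} ?F"
      using a by (intro continuous_intros continuous_on_powr') (auto simp: abs_square_le_1)
    fix u :: real assume "u \<in> {-1<..<1}"
    then have u: "0 < 1 - u\<^sup>2" using sq by simp
    have d1: "((\<lambda>u. 1 - u\<^sup>2) has_real_derivative - 2 * u) (at u)"
      by (auto intro!: derivative_eq_intros)
    have d2: "((\<lambda>u. (1 - u\<^sup>2) powr (a + 1)) has_real_derivative (a + 1) * (1 - u\<^sup>2) powr a * (- 2 * u)) (at u)"
      using DERIV_chain2[OF has_real_derivative_powr[OF u, of "a + 1"] d1] by simp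
    have "(?F has_real_derivative real j * u ^ (j - 1) * (1 - u\<^sup>2) powr (a + 1)
        + u ^ j * ((a + 1) * (1 - u\<^sup>2) powr a * (- 2 * u))) (at u)"
      by (rule DERIV_mult'[OF DERIV_pow[of j u UNIV] d2, THEN DERIV_cong]) simp
    also have "(1 - u\<^sup>2) powr (a + 1) = (1 - u\<^sup>2) * (1 - u\<^sup>2) powr a"
      using u by (simp add: powr_add)
    also have "real j * u ^ (j - 1) * ((1 - u\<^sup>2) * (1 - u\<^sup>2) powr a)
        + u ^ j * ((a + 1) * (1 - u\<^sup>2) powr a * (- 2 * u)) = ?f u"
      by (cases j) (simp_all add: algebra_simps power2_eq_square)
    finally show "(?F has_vector_derivative ?f u) (at u)"
      by (simp add: has_real_derivative_iff_has_vector_derivative)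
  qed auto
  then have I0: "integral {-1..1} ?f = 0" by (auto dest: integral_unique)
  have si: "set_integrable lborel {-1..1} ?f"
    using i[of "j - 1"] i[of "Suc j"] by (intro set_integral_diff set_integrable_mult_right) auto
  have "(LINT u:{-1..1}|lborel. ?f u) = 0"
    using set_borel_integral_eq_integral(2)[OF si] I0 by simp
  then show ?thesis
    using i[of "j - 1"] i[of "Suc j"]
    by (subst (asm) set_integral_diff(2)) (auto simp: gegenbauer_moment_def set_integrable_mult_right)
qed

text \<open>The weight is even, and on the half interval the substitution t = u^2 gives the Beta
  integral with parameters 1/2 and a + 1.\<close>

lemma gegenbauer_moment_0:
  assumes a: "a \<ge> - 1 / 2"
  shows "gegenbauer_moment a 0 = sqrt pi * Gamma (a + 1) / Gamma (a + 3 / 2)"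
proof -
  have a1: "a + 1 > 0" using a by simp
  let ?f = "\<lambda>t::real. t powr (1 / 2 - 1) * (1 - t) powr (a + 1 - 1)"
  have fi: "set_integrable lborel {0..1} ?f" using a1 by (intro integrable_Beta) auto
  have B: "(LINT t:{0..1}|lborel. ?f t) = Beta (1 / 2) (a + 1)"
    using set_borel_integral_eq_integral(2)[OF fi] has_integral_Beta_real[of "1 / 2" "a + 1"] a1
    by (auto dest: integral_unique)
  have "(LINT u:{0..1}|lborel. \<bar>2 * u\<bar> *\<^sub>R ?f (u\<^sup>2)) = (LINT t:{0..1}|lborel. ?f t)"
  proof (rule set_integral_substitution)
    show "(\<lambda>u::real. u\<^sup>2) ` {0..1} = {0..1}"
    proof (intro equalityI subsetI)
      fix t :: real assume "t \<in> {0..1}"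
      then show "t \<in> (\<lambda>u. u\<^sup>2) ` {0..1}" by (intro image_eqI[of _ _ "sqrt t"]) auto
    qed (auto intro: power_le_one)
    show "((\<lambda>u. u\<^sup>2) has_real_derivative 2 * u) (at u within {0..1})" for u :: real
      by (auto intro!: derivative_eq_intros)
    show "inj_on (\<lambda>u::real. u\<^sup>2) {0..1}" by (auto simp: inj_on_def)
  qed (use fi in \<open>auto simp: set_borel_measurable_def\<close>)
  also have "(LINT u:{0..1}|lborel. \<bar>2 * u\<bar> *\<^sub>R ?f (u\<^sup>2)) = (LINT u:{0..1}|lborel. 2 * (1 - u\<^sup>2) powr a)"
  proof (rule set_lebesgue_integral_cong_AE)
    have "AE u in lborel. u \<noteq> (0::real)" by (rule AE_lborel_singleton)
    then show "AE u\<in>{0..1} in lborel. \<bar>2 * u\<bar> *\<^sub>R ?f (u\<^sup>2) = 2 * (1 - u\<^sup>2) powr a"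
    proof (rule eventually_mono, intro impI)
      fix u :: real assume u: "u \<noteq> 0" "u \<in> {0..1}"
      have "(u\<^sup>2) powr (1 / 2 - 1) = inverse u"
        using u by (simp add: powr_minus powr_half_sqrt)
      then show "\<bar>2 * u\<bar> *\<^sub>R ?f (u\<^sup>2) = 2 * (1 - u\<^sup>2) powr a" using u by simp
    qed
  qed auto
  finally have h: "2 * (LINT u:{0..1}|lborel. (1 - u\<^sup>2) powr a) = Beta (1 / 2) (a + 1)"
    unfolding B by simp
  note i = gegenbauer_weight_integrable[OF a]
  have i1: "(\<lambda>u. (1 - u\<^sup>2) powr a) integrable_on {-1..1}" using set_borel_integral_eq_integral(1)[OF i] .
  have "gegenbauer_moment a 0 = integral {-1..1} (\<lambda>u. (1 - u\<^sup>2) powr a)"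
    using set_borel_integral_eq_integral(2)[OF i] by (simp add: gegenbauer_moment_def)
  also have "\<dots> = integral {-1..0} (\<lambda>u. (1 - u\<^sup>2) powr a) + integral {0..1} (\<lambda>u. (1 - u\<^sup>2) powr a)"
    by (rule Henstock_Kurzweil_Integration.integral_combine[symmetric]) (use i1 in auto)
  also have "integral {-1..0} (\<lambda>u. (1 - u\<^sup>2) powr a) = integral {0..1} (\<lambda>u. (1 - u\<^sup>2) powr a)"
    using Henstock_Kurzweil_Integration.integral_reflect_real[of 1 0 "\<lambda>u. (1 - u\<^sup>2) powr a"] by simp
  also have "integral {0..1} (\<lambda>u. (1 - u\<^sup>2) powr a) = (LINT u:{0..1}|lborel. (1 - u\<^sup>2) powr a)"
    by (rule set_borel_integral_eq_integral(2)[symmetric]) (rule set_integrable_subset[OF i], auto)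
  finally have "gegenbauer_moment a 0 = Beta (1 / 2) (a + 1)" using h by simp
  then show ?thesis by (simp add: Beta_def Gamma_one_half_real add.commute add.left_commute)
qed

lemma gegenbauer_moment_0_pos:
  assumes "a \<ge> - 1 / 2"
  shows "gegenbauer_moment a 0 > 0"
  unfolding gegenbauer_moment_0[OF assms] using assms by (auto intro!: divide_pos_pos mult_pos_pos)

section \<open>Slicing the sphere by hyperplanes\<close>

text \<open>Integration by parts in the direction e differentiates just the power of e \<bullet>
  \<psi>, because Q does not vary along e. The resulting recursion in j is that of the weight with
  exponent a, so the two moment sequences are proportional; \<open>gegenbauer_moment a 0\<close> is
  kept as a factor instead of being divided by.\<close>

lemma slice_moments:
  fixes Q :: "'a::euclidean_space \<Rightarrow> real"
  assumes dim: "DIM('a) \<ge> 2" and e: "norm e = 1" and Q: "polynomial_function Q"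
    and hom: "\<And>t x. t > 0 \<Longrightarrow> Q (t *\<^sub>R x) = (t ^ k) *\<^sub>R Q x"
    and perp: "\<And>x. dir_deriv e Q x = 0"
    and a: "a = (real k + real DIM('a) - 3) / 2"
  shows "gegenbauer_moment a 0 * (LINT \<psi>|sphere_measure. (e \<bullet> \<psi>) ^ j * Q \<psi>)
    = (LINT \<psi>|sphere_measure. Q \<psi>) * gegenbauer_moment a j"
proof -
  define J where "J j = (LINT \<psi>|sphere_measure. (e \<bullet> \<psi>) ^ j * Q \<psi>)" for j
  have a2: "a \<ge> - 1 / 2" using dim unfolding a by simp
  have rec: "(real j + 2 * a + 2) * J (Suc j) = real j * J (j - 1)" for j
  proof -
    let ?q = "\<lambda>x. (e \<bullet> x) ^ j *\<^sub>R Q x"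
    have pj: "polynomial_function (\<lambda>x. (e \<bullet> x) ^ j)"
    proof (induction j)
      case (Suc j)
      from polynomial_function_mult[OF polynomial_function_inner_left this] show ?case by simp
    qed auto
    have dj: "dir_deriv e (\<lambda>x. (e \<bullet> x) ^ j) x = real j * (e \<bullet> x) ^ (j - 1)" for x
    proof -
      have "((\<lambda>x. (e \<bullet> x) ^ j) has_derivative (\<lambda>v. real j * (e \<bullet> x) ^ (j - 1) * (e \<bullet> v))) (at x)"
        by (auto intro!: derivative_eq_intros simp: mult_ac)
      from dir_deriv_eq[OF this, of e] show ?thesis using e by (simp add: dot_square_norm)
    qed
    have "real (j + k + DIM('a) - 1) *\<^sub>R (LINT \<psi>|sphere_measure. (e \<bullet> \<psi>) *\<^sub>R ?q \<psi>)
        = (LINT \<psi>|sphere_measure. dir_deriv e ?q \<psi>)"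
      by (rule sphere_integration_by_parts[OF dim polynomial_function_mult[OF pj Q]])
         (simp add: hom power_add power_mult_distrib)
    also have "(\<lambda>\<psi>. dir_deriv e ?q \<psi>) = (\<lambda>\<psi>. real j * ((e \<bullet> \<psi>) ^ (j - 1) * Q \<psi>))"
      by (rule ext, subst dir_deriv_scaleR[OF pj Q]) (simp add: dj perp)
    finally have "real (j + k + DIM('a) - 1) * J (Suc j) = real j * J (j - 1)"
      by (simp add: J_def mult.assoc)
    \<comment> \<open>Matching the factor of the integration by parts with that of
      \<open>gegenbauer_moment_rec\<close> is what determines a.\<close>
    moreover have "real j + 2 * a + 2 = real (j + k + DIM('a) - 1)"
      using dim by (simp add: a of_nat_diff field_simps)
    ultimately show ?thesis by simp
  qed
  have "gegenbauer_moment a 0 * J j = J 0 * gegenbauer_moment a j"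
  proof (induction j rule: less_induct)
    case (less j)
    show ?case
    proof (cases j)
      case (Suc i)
      have nz: "real i + 2 * a + 2 \<noteq> 0" using a2 by simp
      have "(real i + 2 * a + 2) * (gegenbauer_moment a 0 * J j) = real i * (gegenbauer_moment a 0 * J (i - 1))"
        using rec[of i] Suc by (metis mult.left_commute)
      also have "\<dots> = real i * (J 0 * gegenbauer_moment a (i - 1))"
        using less[of "i - 1"] Suc by (cases "i = 0") auto
      also have "\<dots> = (real i + 2 * a + 2) * (J 0 * gegenbauer_moment a j)"
        using gegenbauer_moment_rec[OF a2, of i] Suc by (metis mult.left_commute)
      finally show ?thesis using nz by simp
    qed simp
  qed
  then show ?thesis by (simp add: J_def)
qed

text \<open>On the slice at height u, a sphere of radius sqrt(1 - u^2), the homogeneous Q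
  contributes k/2 to the exponent of 1 - u^2, in addition to (DIM - 3)/2 from the slice measure. The
  proof does not parametrize slices: it compares moments and approximates \<phi> by
  polynomials.\<close>

proposition sphere_slicing:
  fixes Q :: "'a::euclidean_space \<Rightarrow> real" and \<phi> :: "real \<Rightarrow> real"
  assumes dim: "DIM('a) \<ge> 2" and e: "norm e = 1" and Q: "polynomial_function Q"
    and hom: "\<And>t x. t > 0 \<Longrightarrow> Q (t *\<^sub>R x) = (t ^ k) *\<^sub>R Q x"
    and perp: "\<And>x. dir_deriv e Q x = 0"
    and a: "a = (real k + real DIM('a) - 3) / 2"
    and \<phi>: "continuous_on {-1..1} \<phi>"
  shows "gegenbauer_moment a 0 * (LINT \<psi>|sphere_measure. \<phi> (e \<bullet> \<psi>) * Q \<psi>)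
    = (LINT \<psi>|sphere_measure. Q \<psi>) * (LINT u:{-1..1}|lborel. \<phi> u * (1 - u\<^sup>2) powr a)"
proof -
  \<comment> \<open>Clamping to [-1, 1]: the approximation lemma wants a map of the whole line into
    K, and the weight \<open>w\<close> vanishes wherever clamping changes anything.\<close>
  define h where "h u = max (-1) (min 1 u)" for u :: real
  define w where "w u = indicator {-1..1} u * (1 - u\<^sup>2) powr a" for u :: real
  have a2: "a \<ge> - 1 / 2" using dim unfolding a by simp
  have wi: "integrable lborel w"
    using gegenbauer_weight_integrable[OF a2] unfolding w_def set_integrable_def by simp
  let ?I = "LINT \<psi>|sphere_measure. Q \<psi>"
  have Qc: "continuous_on S Q" for S by (rule continuous_on_polynomial_function[OF Q])
  have eb: "e \<bullet> \<psi> \<in> {-1..1}" if "\<psi> \<in> space (sphere_measure :: 'a measure)" for \<psi>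
    using Cauchy_Schwarz_ineq2[of e \<psi>] that e by (auto simp: abs_le_iff)
  have hw: "g (h u) * (I * w u) = I * (indicator {-1..1} u *\<^sub>R (g u * (1 - u\<^sup>2) powr a))" for g :: "real \<Rightarrow> real" and u I
    by (auto simp: h_def w_def split: split_indicator)
  have R: "(LINT u|lborel. g (h u) *\<^sub>R (?I * w u)) = ?I * (LINT u:{-1..1}|lborel. g u * (1 - u\<^sup>2) powr a)" for g
    unfolding real_scaleR_def hw set_lebesgue_integral_def by simp
  have L: "(LINT \<psi>|sphere_measure. g (e \<bullet> \<psi>) *\<^sub>R (gegenbauer_moment a 0 * Q \<psi>))
      = gegenbauer_moment a 0 * (LINT \<psi>|sphere_measure. g (e \<bullet> \<psi>) * Q \<psi>)" for g
    by (simp add: mult.left_commute)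
  have "(LINT \<psi>|sphere_measure. \<phi> (e \<bullet> \<psi>) *\<^sub>R (gegenbauer_moment a 0 * Q \<psi>))
      = (LINT u|lborel. \<phi> (h u) *\<^sub>R (?I * w u))"
  proof (rule integral_eq_of_polynomials[where K="{-1..1}" and g=\<phi> and ?h2.0=h and ?h1.0="\<lambda>\<psi>. e \<bullet> \<psi>"])
    show "(\<lambda>\<psi>. e \<bullet> \<psi>) \<in> borel_measurable sphere_measure"
      by (intro borel_measurable_sphere_continuous continuous_intros)
    show "integrable sphere_measure (\<lambda>\<psi>. gegenbauer_moment a 0 * Q \<psi>)"
      by (intro integrable_sphere_continuous continuous_intros Qc)
    show "h \<in> borel_measurable lborel" unfolding h_def by measurable
    show "integrable lborel (\<lambda>u. ?I * w u)" using wi by simp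
    fix p :: "real \<Rightarrow> real" assume "real_polynomial_function p"
    then obtain c n where p: "p = (\<lambda>x. \<Sum>i\<le>n. c i * x ^ i)" using real_polynomial_function_imp_sum by blast
    have I1: "integrable sphere_measure (\<lambda>\<psi>. c i * ((e \<bullet> \<psi>) ^ i * Q \<psi>))" for i
      by (intro integrable_sphere_continuous continuous_intros Qc)
    have I2: "set_integrable lborel {-1..1} (\<lambda>u. c i * (u ^ i * (1 - u\<^sup>2) powr a))" for i
      using gegenbauer_weight_integrable_continuous[OF a2, of "\<lambda>u. c i * u ^ i"]
      by (simp add: mult_ac continuous_intros)
    have "gegenbauer_moment a 0 * (LINT \<psi>|sphere_measure. p (e \<bullet> \<psi>) * Q \<psi>)
        = (\<Sum>i\<le>n. c i * (gegenbauer_moment a 0 * (LINT \<psi>|sphere_measure. (e \<bullet> \<psi>) ^ i * Q \<psi>)))"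
    proof -
      have "(LINT \<psi>|sphere_measure. p (e \<bullet> \<psi>) * Q \<psi>)
          = (LINT \<psi>|sphere_measure. (\<Sum>i\<le>n. c i * ((e \<bullet> \<psi>) ^ i * Q \<psi>)))"
        by (simp add: p sum_distrib_right mult.assoc)
      also have "\<dots> = (\<Sum>i\<le>n. c i * (LINT \<psi>|sphere_measure. (e \<bullet> \<psi>) ^ i * Q \<psi>))"
        by (subst Bochner_Integration.integral_sum) (use I1 in simp_all)
      finally show ?thesis by (simp add: sum_distrib_left mult.left_commute)
    qed
    also have "\<dots> = (\<Sum>i\<le>n. c i * (?I * gegenbauer_moment a i))"
      by (simp only: slice_moments[OF dim e Q hom perp a])
    also have "\<dots> = ?I * (LINT u:{-1..1}|lborel. p u * (1 - u\<^sup>2) powr a)"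
    proof -
      have "(LINT u:{-1..1}|lborel. p u * (1 - u\<^sup>2) powr a)
          = (LINT u:{-1..1}|lborel. (\<Sum>i\<le>n. c i * (u ^ i * (1 - u\<^sup>2) powr a)))"
        by (simp add: p sum_distrib_right mult.assoc)
      also have "\<dots> = (\<Sum>i\<le>n. c i * gegenbauer_moment a i)"
        using I2 unfolding gegenbauer_moment_def set_lebesgue_integral_def set_integrable_def scaleR_sum_right
        by (subst Bochner_Integration.integral_sum) (simp_all add: mult.left_commute)
      finally show ?thesis by (simp add: sum_distrib_left mult.left_commute)
    qed
    finally show "(LINT \<psi>|sphere_measure. p (e \<bullet> \<psi>) *\<^sub>R (gegenbauer_moment a 0 * Q \<psi>))
      = (LINT u|lborel. p (h u) *\<^sub>R (?I * w u))" unfolding L R .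
  qed (use eb \<phi> in \<open>auto simp: h_def\<close>)
  then show ?thesis unfolding L R .
qed

section \<open>Conformal boosts and the transform in stereographic coordinates\<close>

text \<open>The action of the Lorentz boost with velocity direction \<open>e\<close> on the unit sphere, \<open>A\<close> and \<open>B\<close>
  being the hyperbolic cosine and sine of the rapidity.\<close>

definition sphere_boost :: "real \<Rightarrow> real \<Rightarrow> 'a::euclidean_space \<Rightarrow> 'a \<Rightarrow> 'a" where
  "sphere_boost A B e \<omega> = (1 / (A + B * (e \<bullet> \<omega>))) *\<^sub>R (\<omega> + ((A - 1) * (e \<bullet> \<omega>) + B) *\<^sub>R e)"

lemma boost_denominator_pos:
  fixes A B u :: real
  assumes AB: "A\<^sup>2 - B\<^sup>2 = 1" "A > 0" and u: "-1 \<le> u" "u \<le> 1"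
  shows "A + B * u > 0"
proof -
  have "\<bar>B\<bar>\<^sup>2 < A\<^sup>2" using AB by simp
  then have "\<bar>B\<bar> < A" by (rule power2_less_imp_less) (use AB in simp)
  moreover have "\<bar>B * u\<bar> \<le> \<bar>B\<bar>" unfolding abs_mult using u by (intro mult_left_le) auto
  ultimately show ?thesis by linarith
qed

lemma inner_unit_bounds:
  assumes "norm e = 1" "norm \<omega> = 1"
  shows "-1 \<le> e \<bullet> \<omega>" "e \<bullet> \<omega> \<le> 1"
  using Cauchy_Schwarz_ineq2[of e \<omega>] assms by (auto simp: abs_le_iff)

lemma inner_sphere_boost:
  assumes "norm e = 1"
  shows "e \<bullet> sphere_boost A B e \<omega> = (A * (e \<bullet> \<omega>) + B) / (A + B * (e \<bullet> \<omega>))"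
  using assms by (simp add: sphere_boost_def inner_add_right dot_square_norm algebra_simps add_divide_distrib[symmetric])

text \<open>The boost sends the null vector (1, \<omega>) to a null vector with time component A + B
  (e \<bullet> \<omega>). Its space component has the same length, so division by the time component
  lands on the unit sphere.\<close>

lemma norm_sphere_boost:
  assumes AB: "A\<^sup>2 - B\<^sup>2 = 1" "A > 0" and e: "norm e = 1" and w: "norm \<omega> = 1"
  shows "norm (sphere_boost A B e \<omega>) = 1"
proof -
  let ?u = "e \<bullet> \<omega>"
  have pos: "A + B * ?u > 0" using boost_denominator_pos AB inner_unit_bounds[OF e w] by blast
  have "(norm (\<omega> + ((A - 1) * ?u + B) *\<^sub>R e))\<^sup>2 = (A + B * ?u)\<^sup>2"
  proof -
    have "(norm (\<omega> + ((A - 1) * ?u + B) *\<^sub>R e))\<^sup>2 = 1 + 2 * ((A - 1) * ?u + B) * ?u + ((A - 1) * ?u + B)\<^sup>2"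
    proof -
      have "\<omega> \<bullet> \<omega> = 1" "e \<bullet> e = 1" using e w by (simp_all add: norm_eq_1)
      then have "(norm (\<omega> + s *\<^sub>R e))\<^sup>2 = 1 + 2 * s * ?u + s\<^sup>2" for s
        unfolding power2_norm_eq_inner inner_add_left inner_add_right inner_scaleR_left inner_scaleR_right
        by (simp add: inner_commute power2_eq_square algebra_simps)
      then show ?thesis .
    qed
    also have "\<dots> = (A + B * ?u)\<^sup>2 + (A\<^sup>2 - B\<^sup>2 - 1) * (?u\<^sup>2 - 1)"
      by (simp add: power2_eq_square algebra_simps)
    finally show ?thesis using AB by simp
  qed
  then have "norm (\<omega> + ((A - 1) * ?u + B) *\<^sub>R e) = A + B * ?u"
    using pos by (simp add: power2_eq_iff_nonneg)
  then show ?thesis using pos by (simp add: sphere_boost_def)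
qed

text \<open>The denominator of the second boost is the reciprocal of that of the first, and its
  shift along e undoes the first one; both follow from A^2 - B^2 = 1.\<close>

lemma sphere_boost_inverse:
  assumes AB: "A\<^sup>2 - B\<^sup>2 = 1" "A > 0" and e: "norm e = 1" and w: "norm \<omega> = 1"
  shows "sphere_boost A (- B) e (sphere_boost A B e \<omega>) = \<omega>"
proof -
  let ?u = "e \<bullet> \<omega>" and ?v = "e \<bullet> sphere_boost A B e \<omega>"
  have pos: "A + B * ?u > 0" using boost_denominator_pos AB inner_unit_bounds[OF e w] by blast
  have v: "?v = (A * ?u + B) / (A + B * ?u)" by (rule inner_sphere_boost[OF e])
  have "A - B * ?v = (A\<^sup>2 - B\<^sup>2) / (A + B * ?u)"
    unfolding v using pos by (simp add: field_simps power2_eq_square)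
  then have d: "A + - B * ?v = 1 / (A + B * ?u)" using AB by simp
  have k: "(A - 1) * ?v + - B = ((A - 1) * (A * ?u + B) - B * (A + B * ?u)) / (A + B * ?u)"
    unfolding v using pos by (simp add: field_simps)
  have "(A - 1) * (A * ?u + B) - B * (A + B * ?u) = (A\<^sup>2 - B\<^sup>2 - 1) * ?u - ((A - 1) * ?u + B)"
    by (simp add: power2_eq_square algebra_simps)
  then have k': "(A - 1) * ?v + - B = - ((A - 1) * ?u + B) / (A + B * ?u)"
    unfolding k using AB by simp
  have "sphere_boost A (- B) e (sphere_boost A B e \<omega>)
      = (A + B * ?u) *\<^sub>R (sphere_boost A B e \<omega> + (- ((A - 1) * ?u + B) / (A + B * ?u)) *\<^sub>R e)"
    unfolding sphere_boost_def[of A "- B" e "sphere_boost A B e \<omega>"] d k' by simp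
  also have "\<dots> = \<omega>"
  proof -
    have "D *\<^sub>R ((1 / D) *\<^sub>R (\<omega> + s *\<^sub>R e) + (- s / D) *\<^sub>R e) = \<omega>" if "D > 0" for D s
      using that by (simp add: scaleR_add_right)
    from this[OF pos] show ?thesis unfolding sphere_boost_def .
  qed
  finally show ?thesis .
qed

lemma sphere_boost_image:
  assumes AB: "A\<^sup>2 - B\<^sup>2 = 1" "A > 0" and e: "norm e = 1"
  shows "sphere_boost A B e ` sphere 0 1 = sphere 0 1"
proof (intro equalityI subsetI)
  fix \<omega> :: 'a assume "\<omega> \<in> sphere 0 1"
  then have w: "norm \<omega> = 1" by simp
  have "sphere_boost A B e (sphere_boost A (- B) e \<omega>) = \<omega>"
    using sphere_boost_inverse[of A "- B" e \<omega>] AB e w by simp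
  moreover have "norm (sphere_boost A (- B) e \<omega>) = 1"
    using norm_sphere_boost[of A "- B" e \<omega>] AB e w by simp
  ultimately show "\<omega> \<in> sphere_boost A B e ` sphere 0 1"
    by (metis image_eqI mem_sphere_0)
qed (use norm_sphere_boost[OF AB e] in auto)

lemma continuous_on_sphere_boost:
  assumes AB: "A\<^sup>2 - B\<^sup>2 = 1" "A > 0" and e: "norm e = 1"
  shows "continuous_on (sphere 0 1) (sphere_boost A B e)"
proof -
  have "A + B * (e \<bullet> \<omega>) \<noteq> 0" if "\<omega> \<in> sphere 0 1" for \<omega>
  proof -
    have "norm \<omega> = 1" using that by simp
    from boost_denominator_pos[OF AB inner_unit_bounds[OF e this]] show ?thesis by simp
  qed
  then show ?thesis
    unfolding sphere_boost_def[abs_def] by (intro continuous_intros) auto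
qed

lemma lin_prod_split:
  assumes "set vs \<subseteq> insert e {v. e \<bullet> v = 0}"
  shows "\<exists>j ws. (\<forall>v\<in>set ws. e \<bullet> v = 0) \<and> (\<forall>x. lin_prod vs x = (e \<bullet> x) ^ j * lin_prod ws x)"
  using assms
proof (induction vs)
  case Nil
  show ?case by (intro exI[of _ 0] exI[of _ "[]"]) simp
next
  case (Cons v vs)
  then obtain j ws where w: "\<forall>v\<in>set ws. e \<bullet> v = 0" "\<forall>x. lin_prod vs x = (e \<bullet> x) ^ j * lin_prod ws x"
    by auto
  show ?case
  proof (cases "v = e")
    case True
    with w show ?thesis by (intro exI[of _ "Suc j"] exI[of _ ws]) simp
  next
    case False
    with w Cons.prems show ?thesis by (intro exI[of _ j] exI[of _ "v # ws"]) simp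
  qed
qed

lemma dir_deriv_lin_prod_perp:
  assumes "\<forall>v\<in>set ws. e \<bullet> v = 0"
  shows "dir_deriv e (lin_prod ws) x = 0"
proof -
  have "c = 0" if "(c, us) \<in> set (lin_prod_deriv e ws)" for c us
    using that assms by (induction ws arbitrary: us) auto
  then have "(\<Sum>(c, us)\<leftarrow>lin_prod_deriv e ws. c * lin_prod us x) = (\<Sum>(c, us)\<leftarrow>lin_prod_deriv e ws. 0)"
    by (intro arg_cong[where f=sum_list] map_cong) auto
  then show ?thesis by (simp add: dir_deriv_lin_prod case_prod_beta')
qed

text \<open>Apart from the division by its denominator, the boost moves \<omega> along e only, which
  forms orthogonal to e do not see.\<close>

lemma lin_prod_boost_perp:
  assumes "\<forall>v\<in>set ws. e \<bullet> v = 0"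
  shows "lin_prod ws (sphere_boost A B e \<omega>) = (1 / (A + B * (e \<bullet> \<omega>))) ^ length ws * lin_prod ws \<omega>"
  using assms
  by (induction ws) (auto simp: sphere_boost_def inner_add_right inner_commute)

text \<open>The heights e \<bullet> \<omega> transform by the projective map g(u) = (A u + B) / (A +
  B u) of the interval, with derivative (A + B u)^(-2). Since 1 - g(u)^2 = (1 - u^2) / (A + B u)^2,
  derivative and weight together contribute the power 2 a + 2 of the denominator, which is
  m.\<close>

lemma boost_weight_integral:
  fixes A B a :: real
  assumes AB: "A\<^sup>2 - B\<^sup>2 = 1" "A > 0" and a: "a \<ge> - 1 / 2" and m: "real m = 2 * a + 2"
  shows "(LINT u:{-1..1}|lborel. ((1 / (A + B * u)) ^ m * ((A * u + B) / (A + B * u)) ^ j) * (1 - u\<^sup>2) powr a)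
    = (LINT u:{-1..1}|lborel. u ^ j * (1 - u\<^sup>2) powr a)"
proof -
  note pos = boost_denominator_pos[OF AB]
  let ?g = "\<lambda>B u. (A * u + B) / (A + B * u)"
  have gid: "?g (- B) (?g B u) = u" if AB: "A\<^sup>2 - B\<^sup>2 = 1" and u: "u \<in> {-1..1}" for B u
  proof -
    have p: "A + B * u > 0" using boost_denominator_pos[OF AB \<open>A > 0\<close>, of u] u by simp
    have 1: "A + - B * ?g B u = (A\<^sup>2 - B\<^sup>2) / (A + B * u)"
      using p by (simp add: field_simps power2_eq_square)
    have 2: "A * ?g B u + - B = (A\<^sup>2 - B\<^sup>2) * u / (A + B * u)"
      using p by (simp add: field_simps power2_eq_square)
    show ?thesis unfolding 1 2 using p AB by simp
  qed
  have gin: "?g B u \<in> {-1..1}" if AB: "A\<^sup>2 - B\<^sup>2 = 1" and u: "u \<in> {-1..1}" for B u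
  proof -
    have p: "A + B * u > 0" using boost_denominator_pos[OF AB \<open>A > 0\<close>, of u] u by simp
    have "\<bar>A * u + B\<bar> \<le> A + B * u"
    proof (rule power2_le_imp_le)
      have "(A + B * u)\<^sup>2 - \<bar>A * u + B\<bar>\<^sup>2 = (A\<^sup>2 - B\<^sup>2) * (1 - u\<^sup>2)"
        unfolding power2_abs by (simp add: power2_eq_square algebra_simps)
      also have "\<dots> \<ge> 0" using AB u by (simp add: abs_square_le_1 abs_le_iff)
      finally show "\<bar>A * u + B\<bar>\<^sup>2 \<le> (A + B * u)\<^sup>2" by simp
    qed (use p in simp)
    then show ?thesis using p by (simp add: divide_le_eq le_divide_eq abs_le_iff)
  qed
  let ?f = "\<lambda>v. v ^ j * (1 - v\<^sup>2) powr a"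
  have fi: "set_integrable lborel {-1..1} ?f"
    using gegenbauer_weight_integrable_continuous[OF a, of "\<lambda>u. u ^ j"]
    by (simp add: mult.commute continuous_on_power continuous_on_id)
  have "(LINT u:{-1..1}|lborel. \<bar>1 / (A + B * u)\<^sup>2\<bar> *\<^sub>R ?f (?g B u)) = (LINT v:{-1..1}|lborel. ?f v)"
  proof (rule set_integral_substitution)
    show "?g B ` {-1..1} = {-1..1}"
    proof (intro equalityI subsetI)
      fix v assume v: "v \<in> {-1..1::real}"
      have "?g B (?g (- B) v) = v" using gid[of "- B" v] AB v by simp
      moreover have "?g (- B) v \<in> {-1..1}" using gin[of "- B" v] AB v by simp
      ultimately show "v \<in> ?g B ` {-1..1}" by (rule image_eqI[OF sym])
    qed (use gin AB in auto)
    show "inj_on (?g B) {-1..1}" by (rule inj_on_inverseI[where g="?g (- B)"]) (use gid AB in auto)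
    show "(?g B has_real_derivative 1 / (A + B * u)\<^sup>2) (at u within {-1..1})" if "u \<in> {-1..1}" for u
    proof -
      have p: "A + B * u \<noteq> 0" using pos[of u] that by simp
      have n: "((\<lambda>u. A * u + B) has_real_derivative A) (at u within {-1..1})"
        and d: "((\<lambda>u. A + B * u) has_real_derivative B) (at u within {-1..1})"
        by (auto intro!: derivative_eq_intros)
      have "(?g B has_real_derivative (A * (A + B * u) - (A * u + B) * B) / ((A + B * u) * (A + B * u))) (at u within {-1..1})"
        by (rule DERIV_divide[OF n d p])
      moreover have "A * (A + B * u) - (A * u + B) * B = 1"
        using AB by (simp add: power2_eq_square algebra_simps)
      ultimately show ?thesis by (simp add: power2_eq_square)
    qed
  qed (use fi in \<open>auto simp: set_borel_measurable_def\<close>)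
  also have "(LINT u:{-1..1}|lborel. \<bar>1 / (A + B * u)\<^sup>2\<bar> *\<^sub>R ?f (?g B u))
      = (LINT u:{-1..1}|lborel. ((1 / (A + B * u)) ^ m * (?g B u) ^ j) * (1 - u\<^sup>2) powr a)"
  proof (rule set_lebesgue_integral_cong)
    show "\<forall>u. u \<in> {-1..1} \<longrightarrow> \<bar>1 / (A + B * u)\<^sup>2\<bar> *\<^sub>R ?f (?g B u)
        = ((1 / (A + B * u)) ^ m * (?g B u) ^ j) * (1 - u\<^sup>2) powr a"
    proof safe
      fix u :: real assume u: "u \<in> {-1..1}"
      define \<mu> where "\<mu> = 1 / (A + B * u)"
      have p: "A + B * u > 0" using pos[of u] u by simp
      have \<mu>: "\<mu> > 0" using p by (simp add: \<mu>_def)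
      have u2: "0 \<le> 1 - u\<^sup>2" using u by (simp add: abs_square_le_1 abs_le_iff)
      have "1 - (?g B u)\<^sup>2 = ((A + B * u)\<^sup>2 - (A * u + B)\<^sup>2) / (A + B * u)\<^sup>2"
        using p by (simp add: power_divide diff_divide_distrib)
      also have "(A + B * u)\<^sup>2 - (A * u + B)\<^sup>2 = (A\<^sup>2 - B\<^sup>2) * (1 - u\<^sup>2)"
        by (simp add: power2_eq_square algebra_simps)
      finally have g2: "1 - (?g B u)\<^sup>2 = \<mu>\<^sup>2 * (1 - u\<^sup>2)" using AB by (simp add: \<mu>_def power_divide)
      have "\<mu>\<^sup>2 * (\<mu>\<^sup>2) powr a = \<mu> powr (2 * a + 2)"
        using \<mu> by (simp add: powr_add powr_powr flip: powr_numeral)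
      also have "\<dots> = \<mu> ^ m" using \<mu> by (simp add: m[symmetric] powr_realpow)
      finally have mm: "\<mu>\<^sup>2 * (\<mu>\<^sup>2) powr a = \<mu> ^ m" .
      have "\<bar>1 / (A + B * u)\<^sup>2\<bar> *\<^sub>R ?f (?g B u) = \<mu>\<^sup>2 * ((?g B u) ^ j * ((\<mu>\<^sup>2) powr a * (1 - u\<^sup>2) powr a))"
        unfolding g2 powr_mult by (simp add: \<mu>_def power_divide)
      also have "\<dots> = (\<mu>\<^sup>2 * (\<mu>\<^sup>2) powr a) * (?g B u) ^ j * (1 - u\<^sup>2) powr a" by (simp add: mult_ac)
      finally show "\<bar>1 / (A + B * u)\<^sup>2\<bar> *\<^sub>R ?f (?g B u)
        = ((1 / (A + B * u)) ^ m * (?g B u) ^ j) * (1 - u\<^sup>2) powr a"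
        unfolding mm by (simp add: \<mu>_def mult.assoc)
    qed
  qed auto
  finally show ?thesis .
qed

text \<open>The weight to the power DIM - 1 is the Jacobian of the boost. It suffices to test
  products of forms that are e itself or orthogonal to e. For these both integrands are functions of
  the height times a product of k orthogonal forms, and slicing with a = (k + DIM - 3)/2 leaves the
  one-dimensional substitution, whose power is k + DIM - 1 = 2 a + 2.\<close>

proposition sphere_boost_integral:
  fixes g :: "'a::euclidean_space \<Rightarrow> 'b::euclidean_space"
  assumes dim: "DIM('a) \<ge> 2" and AB: "A\<^sup>2 - B\<^sup>2 = 1" "A > 0" and e: "norm e = 1"
    and g: "continuous_on (sphere 0 1) g"
  shows "(LINT \<omega>|sphere_measure. (1 / (A + B * (e \<bullet> \<omega>))) ^ (DIM('a) - 1) *\<^sub>R g (sphere_boost A B e \<omega>))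
    = (LINT \<omega>|sphere_measure. g \<omega>)"
proof -
  have nz: "A + B * (e \<bullet> \<omega>) \<noteq> 0" if "\<omega> \<in> sphere 0 1" for \<omega>
  proof -
    have "norm \<omega> = 1" using that by simp
    from boost_denominator_pos[OF AB inner_unit_bounds[OF e this]] show ?thesis by simp
  qed
  have "(LINT \<omega>|sphere_measure. (1 / (A + B * (e \<bullet> \<omega>))) ^ (DIM('a) - 1) *\<^sub>R g (sphere_boost A B e \<omega>))
      = (LINT \<omega>|sphere_measure. 1 *\<^sub>R g \<omega>)"
  proof (rule sphere_integral_eqI[where V="insert e {v. e \<bullet> v = 0}"])
    show "span (insert e {v. e \<bullet> v = 0}) = UNIV"
    proof -
      have "x \<in> span (insert e {v. e \<bullet> v = 0})" for x
      proof -
        have "e \<bullet> (x - (e \<bullet> x) *\<^sub>R e) = 0" using e by (simp add: inner_diff_right dot_square_norm)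
        then have "(e \<bullet> x) *\<^sub>R e + (x - (e \<bullet> x) *\<^sub>R e) \<in> span (insert e {v. e \<bullet> v = 0})"
          by (intro span_add span_scale span_base) auto
        then show ?thesis by simp
      qed
      then show ?thesis by blast
    qed
    show "continuous_on (sphere 0 1) (sphere_boost A B e)" by (rule continuous_on_sphere_boost[OF AB e])
    show "sphere_boost A B e \<in> sphere 0 1 \<rightarrow> sphere 0 1" using norm_sphere_boost[OF AB e] by auto
    show "continuous_on (sphere 0 1) (\<lambda>\<omega>. (1 / (A + B * (e \<bullet> \<omega>))) ^ (DIM('a) - 1))"
      by (intro continuous_intros) (use nz in auto)
    fix vs assume "set vs \<subseteq> insert e {v. e \<bullet> v = 0}"
    from lin_prod_split[OF this] obtain j ws where
      ws: "\<forall>v\<in>set ws. e \<bullet> v = 0" and vs: "\<And>x. lin_prod vs x = (e \<bullet> x) ^ j * lin_prod ws x" by blast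
    define k where "k = length ws"
    define a where "a = (real k + real DIM('a) - 3) / 2"
    have a2: "a \<ge> - 1 / 2" using dim unfolding a_def by simp
    let ?\<phi> = "\<lambda>u. (1 / (A + B * u)) ^ (k + DIM('a) - 1) * ((A * u + B) / (A + B * u)) ^ j"
    have sl: "gegenbauer_moment a 0 * (LINT \<psi>|sphere_measure. \<phi> (e \<bullet> \<psi>) * lin_prod ws \<psi>)
        = (LINT \<psi>|sphere_measure. lin_prod ws \<psi>) * (LINT u:{-1..1}|lborel. \<phi> u * (1 - u\<^sup>2) powr a)"
      if "continuous_on {-1..1} \<phi>" for \<phi>
      by (rule sphere_slicing[OF dim e polynomial_function_lin_prod _ _ a_def that])
         (auto simp: lin_prod_scaleR k_def dir_deriv_lin_prod_perp[OF ws])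
    have pos: "A + B * u \<noteq> 0" if "u \<in> {-1..1}" for u
      using boost_denominator_pos[OF AB, of u] that by simp
    have "gegenbauer_moment a 0 * (LINT \<omega>|sphere_measure. (1 / (A + B * (e \<bullet> \<omega>))) ^ (DIM('a) - 1) * lin_prod vs (sphere_boost A B e \<omega>))
        = gegenbauer_moment a 0 * (LINT \<omega>|sphere_measure. ?\<phi> (e \<bullet> \<omega>) * lin_prod ws \<omega>)"
    proof -
      have D: "k + DIM('a) - 1 = (DIM('a) - 1) + k" using dim by simp
      show ?thesis
        unfolding vs inner_sphere_boost[OF e] lin_prod_boost_perp[OF ws] k_def[symmetric] D power_add
        by (simp only: mult_ac)
    qed
    also have "\<dots> = (LINT \<psi>|sphere_measure. lin_prod ws \<psi>) * (LINT u:{-1..1}|lborel. ?\<phi> u * (1 - u\<^sup>2) powr a)"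
      by (rule sl) (intro continuous_intros, use pos in auto)
    also have "(LINT u:{-1..1}|lborel. ?\<phi> u * (1 - u\<^sup>2) powr a) = (LINT u:{-1..1}|lborel. u ^ j * (1 - u\<^sup>2) powr a)"
      by (rule boost_weight_integral[OF AB a2]) (use dim in \<open>simp add: a_def of_nat_diff field_simps\<close>)
    also have "(LINT \<psi>|sphere_measure. lin_prod ws \<psi>) * \<dots>
        = gegenbauer_moment a 0 * (LINT \<omega>|sphere_measure. 1 * lin_prod vs \<omega>)"
      by (subst sl[symmetric]) (auto simp: vs intro!: continuous_intros)
    finally show "(LINT \<omega>|sphere_measure. (1 / (A + B * (e \<bullet> \<omega>))) ^ (DIM('a) - 1) * lin_prod vs (sphere_boost A B e \<omega>))
        = (LINT \<omega>|sphere_measure. 1 * lin_prod vs \<omega>)"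
      using gegenbauer_moment_0_pos[OF a2] by simp
  qed (auto intro: g)
  then show ?thesis by simp
qed

section \<open>The transform evaluated in a chart\<close>

lemma scale_measure_eq_density: "scale_measure c M = density M (\<lambda>_. c)"
  by (rule measure_eqI) (auto simp: emeasure_density_const)

lemma integral_scale_measure:
  fixes f :: "'a \<Rightarrow> 'b::{banach,second_countable_topology}"
  assumes "c \<ge> 0" "f \<in> borel_measurable M"
  shows "integral\<^sup>L (scale_measure (ennreal c) M) f = c *\<^sub>R integral\<^sup>L M f"
  unfolding scale_measure_eq_density using assms by (subst integral_density) auto

text \<open>A diameter in one chart is a chord in the other, so R \<le> R', and equality follows by
  symmetry. The chord is then a diameter as well, and its midpoint is the common center. The
  differences to the center, scaled, sweep out the common range.\<close>

lemma subsphere_chart_unique: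
  fixes S :: "((real^'d) \<times> real) set"
  assumes c1: "subsphere_chart S p R L" and c2: "subsphere_chart S p' R' L'"
  shows "R = R'" "p = p'" "range L = range L'"
proof -
  have R: "R \<le> R' \<and> (R = R' \<longrightarrow> p = p')"
    if c1: "subsphere_chart S p R L" and c2: "subsphere_chart S p' R' L'" for p p' R R' L L'
  proof -
    note d1 = c1[unfolded subsphere_chart_def] and d2 = c2[unfolded subsphere_chart_def]
    obtain b :: "real^'d" where "b \<in> Basis" using nonempty_Basis by blast
    then have b: "norm b = 1" by simp
    have "p + R *\<^sub>R L b \<in> S" "p + R *\<^sub>R L (- b) \<in> S" using d1 b by auto
    then obtain x y where x: "norm x = 1" "p + R *\<^sub>R L b = p' + R' *\<^sub>R L' x"
      and y: "norm y = 1" "p + R *\<^sub>R L (- b) = p' + R' *\<^sub>R L' y"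
      using d2 by auto
    have lin: "linear L" "linear L'" using d1 d2 by auto
    have Lm: "L (- b) = - L b" using lin by (simp add: linear_neg)
    have sub: "(2 * R) *\<^sub>R L b = R' *\<^sub>R L' (x - y)"
    proof -
      have "(p + R *\<^sub>R L b) - (p + R *\<^sub>R L (- b)) = (p' + R' *\<^sub>R L' x) - (p' + R' *\<^sub>R L' y)"
        by (simp only: x(2) y(2))
      then have "R *\<^sub>R L b - R *\<^sub>R (- L b) = R' *\<^sub>R L' x - R' *\<^sub>R L' y"
        unfolding Lm add_diff_cancel_left .
      moreover have "R *\<^sub>R L b - R *\<^sub>R (- L b) = (2 * R) *\<^sub>R L b"
        by (simp flip: scaleR_2)
      ultimately show ?thesis by (simp add: linear_diff[OF lin(2)] scaleR_diff_right)
    qed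
    have "norm ((2 * R) *\<^sub>R L b) = norm (R' *\<^sub>R L' (x - y))" using sub by simp
    then have n: "2 * R = R' * norm (x - y)" using d1 d2 b by (simp add: abs_mult)
    have xy: "norm (x - y) \<le> 2" using norm_triangle_ineq4[of x y] x y by simp
    have le: "R \<le> R'" using n xy d2 mult_left_mono[OF xy, of R'] by linarith
    have "p = p'" if "R = R'"
    proof -
      have "norm (x - y) = 2" using n that d1 by simp
      then have "norm (x + - y) = norm x + norm (- y)" using x y by simp
      then have "x = - y" using norm_triangle_eq[of x "- y"] x y by simp
      then have "L' x + L' y = 0" using lin(2) by (simp add: linear_neg)
      have "2 *\<^sub>R p = (p + R *\<^sub>R L b) + (p + R *\<^sub>R L (- b))" by (simp add: Lm scaleR_2)
      also have "\<dots> = 2 *\<^sub>R p' + R' *\<^sub>R (L' x + L' y)" unfolding x(2) y(2) by (simp add: scaleR_2 scaleR_add_right)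
      also have "\<dots> = 2 *\<^sub>R p'" using \<open>L' x + L' y = 0\<close> by simp
      finally show ?thesis by simp
    qed
    with le show ?thesis by blast
  qed
  show RR: "R = R'" using R[OF c1 c2] R[OF c2 c1] by simp
  show pp: "p = p'" using R[OF c1 c2] RR by simp
  have rng: "range L \<subseteq> range L'" if c1: "subsphere_chart S p R L" and c2: "subsphere_chart S p R L'" for L L'
  proof (rule image_subsetI)
    note d1 = c1[unfolded subsphere_chart_def] and d2 = c2[unfolded subsphere_chart_def]
    fix v
    show "L v \<in> range L'"
    proof (cases "v = 0")
      case True
      then have "L v = L' 0" using d1 d2 by (simp add: linear_0)
      then show ?thesis by simp
    next
      case False
      then have "p + R *\<^sub>R L (sgn v) \<in> S" using d1 by (auto simp: norm_sgn)
      then obtain x where "p + R *\<^sub>R L (sgn v) = p + R *\<^sub>R L' x" using d2 by auto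
      then have "L (sgn v) = L' x" using d1 by simp
      then have "norm v *\<^sub>R L (sgn v) = L' (norm v *\<^sub>R x)" using d2 by (simp add: linear_scale)
      moreover have "norm v *\<^sub>R L (sgn v) = L v"
      proof -
        have "norm v *\<^sub>R L (sgn v) = L (norm v *\<^sub>R sgn v)" using d1 by (simp add: linear_scale)
        then show ?thesis using False by (simp add: sgn_div_norm)
      qed
      ultimately show ?thesis by (metis rangeI)
    qed
  qed
  show "range L = range L'" using rng[OF c1, of L'] rng[of L', OF _ c1] c2 RR pp by blast
qed

text \<open>Two charts of one sphere differ by the orthogonal map A of the parameter space with L A
  = L', so rotation invariance applies.\<close>

lemma subsphere_chart_integral_unique:
  fixes S :: "((real^'d) \<times> real) set" and f :: "(real^'d) \<times> real \<Rightarrow> complex"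
  assumes dim: "CARD('d) \<ge> 2" and c1: "subsphere_chart S p R L" and c2: "subsphere_chart S p' R' L'"
    and f: "continuous_on S f"
  shows "(LINT \<omega>|sphere_measure. f (p' + R' *\<^sub>R L' \<omega>)) = (LINT \<omega>|sphere_measure. f (p + R *\<^sub>R L \<omega>))"
proof -
  note d1 = c1[unfolded subsphere_chart_def] and d2 = c2[unfolded subsphere_chart_def]
  note u = subsphere_chart_unique[OF c1 c2]
  have "\<forall>v. \<exists>w. L w = L' v" using u(3) by (metis rangeE rangeI)
  then obtain A where A: "\<And>v. L (A v) = L' v" by metis
  have inj: "x = y" if "L x = L y" for x y
  proof -
    have "L (x - y) = 0" using that d1 by (simp add: linear_diff)
    then have "norm (x - y) = 0" using d1 by (metis norm_zero)
    then show ?thesis by simp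
  qed
  have "linear A"
  proof (rule linearI)
    show "A (x + y) = A x + A y" for x y by (rule inj) (use d1 d2 in \<open>simp add: A linear_add\<close>)
    show "A (c *\<^sub>R x) = c *\<^sub>R A x" for c x by (rule inj) (use d1 d2 in \<open>simp add: A linear_scale\<close>)
  qed
  moreover have "norm (A v) = norm v" for v using d1 d2 A by metis
  ultimately have "orthogonal_transformation A" by (simp add: orthogonal_transformation)
  moreover have "continuous_on (sphere 0 1) (\<lambda>\<omega>. f (p + R *\<^sub>R L \<omega>))"
  proof (rule continuous_on_compose2[OF f])
    show "continuous_on (sphere 0 1) (\<lambda>\<omega>. p + R *\<^sub>R L \<omega>)"
      using d1 by (intro continuous_intros linear_continuous_on linear_conv_bounded_linear[THEN iffD1]) auto
  qed (use d1 in auto)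
  ultimately have "(LINT \<omega>|sphere_measure. f (p + R *\<^sub>R L (A \<omega>))) = (LINT \<omega>|sphere_measure. f (p + R *\<^sub>R L \<omega>))"
    using dim by (intro sphere_integral_orthogonal[of A "\<lambda>\<omega>. f (p + R *\<^sub>R L \<omega>)"]) auto
  then show ?thesis using u A by simp
qed

text \<open>\<open>subsphere_measure\<close> is given by an unspecified chart. All charts yield the
  same integrals of continuous functions, so the transform may be evaluated in the chart at
  hand.\<close>

lemma S_transform_chart:
  fixes S :: "((real^'d) \<times> real) set" and f :: "(real^'d) \<times> real \<Rightarrow> complex"
  assumes dim: "CARD('d) \<ge> 2" and c: "subsphere_chart S p R L" and f: "continuous_on S f"
  shows "S_transform f S = (R ^ (CARD('d) - 1)) *\<^sub>R (LINT \<omega>|sphere_measure. f (p + R *\<^sub>R L \<omega>))"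
proof -
  have "\<exists>p R L. subsphere_chart S p R L \<and>
     subsphere_measure S = scale_measure (ennreal (R ^ (CARD('d) - 1)))
           (distr sphere_measure (restrict_space borel S) (\<lambda>\<omega>. p + R *\<^sub>R L \<omega>))"
    unfolding subsphere_measure_def by (rule someI_ex) (use c in blast)
  then obtain p' R' L' where c': "subsphere_chart S p' R' L'"
    and M: "subsphere_measure S = scale_measure (ennreal (R' ^ (CARD('d) - 1)))
           (distr sphere_measure (restrict_space borel S) (\<lambda>\<omega>. p' + R' *\<^sub>R L' \<omega>))" by blast
  note d = c'[unfolded subsphere_chart_def]
  have cont: "continuous_on (sphere 0 1) (\<lambda>\<omega>. p' + R' *\<^sub>R L' \<omega>)"
    using d by (intro continuous_intros linear_continuous_on linear_conv_bounded_linear[THEN iffD1]) auto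
  have m: "(\<lambda>\<omega>. p' + R' *\<^sub>R L' \<omega>) \<in> sphere_measure \<rightarrow>\<^sub>M restrict_space borel S"
    by (rule measurable_restrict_space2) (use d cont in \<open>auto intro: borel_measurable_sphere_continuous\<close>)
  have fm: "f \<in> borel_measurable (restrict_space borel S)"
    by (rule borel_measurable_continuous_on_restrict[OF f])
  have "S_transform f S = (R' ^ (CARD('d) - 1)) *\<^sub>R (LINT \<omega>|sphere_measure. f (p' + R' *\<^sub>R L' \<omega>))"
    unfolding S_transform_def M integral_distr[OF m fm, symmetric]
    by (rule integral_scale_measure) (use d fm in simp_all)
  then show ?thesis
    using subsphere_chart_integral_unique[OF dim c c' f] subsphere_chart_unique(1)[OF c c'] by simp
qed

section \<open>Stereographic parametrization of the subspheres\<close>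

lemma inv_stereo_in_sphere: "inv_stereo y \<in> sphere 0 1"
proof -
  have pos: "1 + (norm y)\<^sup>2 > 0" by (smt (verit) zero_le_power2)
  have "(norm (inv_stereo y))\<^sup>2 = (2 / (1 + (norm y)\<^sup>2))\<^sup>2 * (norm y)\<^sup>2 + ((-1 + (norm y)\<^sup>2) / (1 + (norm y)\<^sup>2))\<^sup>2"
    by (simp add: inv_stereo_def norm_Pair power_mult_distrib power_divide)
  also have "\<dots> = (4 * (norm y)\<^sup>2 + (-1 + (norm y)\<^sup>2)\<^sup>2) / (1 + (norm y)\<^sup>2)\<^sup>2"
    by (simp add: power_divide add_divide_distrib)
  also have "4 * (norm y)\<^sup>2 + (-1 + (norm y)\<^sup>2)\<^sup>2 = (1 + (norm y)\<^sup>2)\<^sup>2"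
    by (simp add: power2_eq_square algebra_simps)
  finally have "(norm (inv_stereo y))\<^sup>2 = 1" using pos by simp
  then have "norm (inv_stereo y) = 1" by (simp add: power2_eq_1_iff) (use norm_ge_zero[of "inv_stereo y"] in linarith)?
  then show ?thesis by simp
qed

lemma one_plus_square_pos: "1 + (norm y)\<^sup>2 > 0"
  by (rule add_pos_nonneg) auto

lemma continuous_on_inv_stereo: "continuous_on S inv_stereo"
proof -
  have "1 + (norm y)\<^sup>2 \<noteq> 0" for y :: "real^'d" using one_plus_square_pos[of y] by simp
  then show ?thesis unfolding inv_stereo_def[abs_def] by (intro continuous_intros) auto
qed

text \<open>On the sphere y = c \<psi> + c t \<omega> the conformal denominator 1 + |y|^2 equals
  \<alpha> + \<beta> (\<psi> \<bullet> \<omega>), and after division by \<delta> it is the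
  denominator A + B (\<psi> \<bullet> \<omega>) of a boost along \<psi>. The stereographic
  parametrization is this boost followed by an affine chart of radius R = 2 c t / \<delta>. With D =
  CARD('d), the Jacobian of the boost times R^(D - 1) is the quotient of (2 c t)^(D - 1) by (1 +
  |y|^2)^(D - 1).\<close>

proposition S_transform_subsphere:
  fixes f :: "(real^'d) \<times> real \<Rightarrow> complex" and \<psi> :: "real^'d"
  assumes dim: "CARD('d) \<ge> 2" and t: "0 < t" "t = tanh lam" and c: "c > 0" and \<psi>: "norm \<psi> = 1"
    and f: "continuous_on (sphere 0 1) f"
  shows "S_transform f (subsphere lam \<psi> c) = of_real ((2 * c * t) ^ (CARD('d) - 1)) *
    (LINT \<omega>|sphere_measure. f (inv_stereo (c *\<^sub>R \<psi> + (c * t) *\<^sub>R \<omega>)) /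
      of_real ((1 + (norm (c *\<^sub>R \<psi> + (c * t) *\<^sub>R \<omega>))\<^sup>2) ^ (CARD('d) - 1)))"
proof -
  \<comment> \<open>The extreme values of 1 + |y|^2 on this sphere are \<alpha> - \<beta> and
    \<alpha> + \<beta>. Both are positive, and dividing by \<delta>, the root of their product,
    normalizes the pair to A^2 - B^2 = 1.\<close>
  define \<alpha> \<beta> where "\<alpha> = 1 + c\<^sup>2 * (1 + t\<^sup>2)" and "\<beta> = 2 * c\<^sup>2 * t"
  have "\<alpha> - \<beta> = 1 + c\<^sup>2 * (1 - t)\<^sup>2" by (simp add: \<alpha>_def \<beta>_def power2_eq_square algebra_simps)
  then have "\<alpha> - \<beta> > 0" by (simp add: add_pos_nonneg)
  moreover have b0: "\<beta> > 0" using c t by (simp add: \<beta>_def)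
  ultimately have ab: "(\<alpha> - \<beta>) * (\<alpha> + \<beta>) > 0" by (intro mult_pos_pos) auto
  define \<delta> where "\<delta> = sqrt ((\<alpha> - \<beta>) * (\<alpha> + \<beta>))"
  have d0: "\<delta> > 0" using ab by (simp add: \<delta>_def)
  have d2: "\<delta>\<^sup>2 = \<alpha>\<^sup>2 - \<beta>\<^sup>2" using ab by (simp add: \<delta>_def power2_eq_square algebra_simps)
  define A B where "A = \<alpha> / \<delta>" and "B = \<beta> / \<delta>"
  have AB: "A\<^sup>2 - B\<^sup>2 = 1" "A > 0"
  proof -
    have "A\<^sup>2 - B\<^sup>2 = (\<alpha>\<^sup>2 - \<beta>\<^sup>2) / \<delta>\<^sup>2" by (simp add: A_def B_def power_divide diff_divide_distrib)
    also have "\<dots> = \<delta>\<^sup>2 / \<delta>\<^sup>2" by (simp only: d2)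
    finally show "A\<^sup>2 - B\<^sup>2 = 1" using d0 by simp
    have "\<alpha> > 0" by (simp add: \<alpha>_def add_pos_nonneg)
    then show "A > 0" using d0 by (simp add: A_def)
  qed
  define y where "y \<omega> = c *\<^sub>R \<psi> + (c * t) *\<^sub>R \<omega>" for \<omega>
  define N where "N \<omega> = 1 + (norm (y \<omega>))\<^sup>2" for \<omega>
  have N: "N \<omega> = \<delta> * (A + B * (\<psi> \<bullet> \<omega>))" if "norm \<omega> = 1" for \<omega>
  proof -
    have "\<psi> \<bullet> \<psi> = 1" "\<omega> \<bullet> \<omega> = 1" using \<psi> that by (simp_all add: norm_eq_1)
    then have "N \<omega> = \<alpha> + \<beta> * (\<psi> \<bullet> \<omega>)"
      unfolding N_def y_def \<alpha>_def \<beta>_def power2_norm_eq_inner inner_add_left inner_add_right inner_scaleR_left inner_scaleR_right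
      by (simp add: inner_commute power2_eq_square algebra_simps)
    then show ?thesis using d0 by (simp add: A_def B_def distrib_left)
  qed
  define R where "R = 2 * c * t / \<delta>"
  have R0: "R > 0" using c t d0 by (simp add: R_def)
  \<comment> \<open>L sends w orthogonal to \<psi> to (w, 0), and \<psi> to ((1 + k1) \<psi>, k2).
    These two numbers and the center p result from comparing coefficients in \<open>key\<close>: the
    multiples of the boosted height and the constant terms.\<close>
  define k1 k2 where "k1 = A - 1 - B / t" and "k2 = B / (c * t)"
  define L where "L w = (w + (k1 * (\<psi> \<bullet> w)) *\<^sub>R \<psi>, k2 * (\<psi> \<bullet> w))" for w :: "real^'d"
  define p where "p = (((2 * c * A - 2 * c * t * B) / \<delta>) *\<^sub>R \<psi>, 1 - 2 * A / \<delta>)"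
  have k: "(1 + k1)\<^sup>2 + k2\<^sup>2 = 1"
  proof -
    have "c\<^sup>2 * t\<^sup>2 * ((A - B / t)\<^sup>2 + (B / (c * t))\<^sup>2) = c\<^sup>2 * (A * t - B)\<^sup>2 + B\<^sup>2"
      using c t by (simp add: field_simps power2_eq_square)
    also have "\<dots> = (c\<^sup>2 * (\<alpha> * t - \<beta>)\<^sup>2 + \<beta>\<^sup>2) / \<delta>\<^sup>2"
      using d0 by (simp add: A_def B_def field_simps power2_eq_square)
    also have "c\<^sup>2 * (\<alpha> * t - \<beta>)\<^sup>2 + \<beta>\<^sup>2 = c\<^sup>2 * t\<^sup>2 * (\<alpha>\<^sup>2 - \<beta>\<^sup>2)"
      by (simp add: \<alpha>_def \<beta>_def power2_eq_square algebra_simps)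
    also have "\<dots> / \<delta>\<^sup>2 = c\<^sup>2 * t\<^sup>2 * 1" unfolding d2[symmetric] using d0 by simp
    finally have "(A - B / t)\<^sup>2 + (B / (c * t))\<^sup>2 = 1" using c t by (simp only: mult_cancel_left) auto
    then show ?thesis by (simp add: k1_def k2_def)
  qed
  have \<psi>\<psi>: "\<psi> \<bullet> \<psi> = 1" using \<psi> by (simp add: norm_eq_1)
  have linL: "linear L"
    by (rule linearI) (auto simp: L_def inner_add_right algebra_simps)
  have normL: "norm (L w) = norm w" for w
  proof -
    have "(norm (L w))\<^sup>2 = (w + (k1 * (\<psi> \<bullet> w)) *\<^sub>R \<psi>) \<bullet> (w + (k1 * (\<psi> \<bullet> w)) *\<^sub>R \<psi>) + (k2 * (\<psi> \<bullet> w))\<^sup>2"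
      by (simp add: L_def norm_Pair power2_norm_eq_inner)
    also have "\<dots> = w \<bullet> w + ((1 + k1)\<^sup>2 + k2\<^sup>2 - 1) * (\<psi> \<bullet> w)\<^sup>2"
      unfolding inner_add_left inner_add_right inner_scaleR_left inner_scaleR_right \<psi>\<psi>
      by (simp add: inner_commute power2_eq_square algebra_simps)
    finally show ?thesis using k by (simp add: norm_eq_sqrt_inner real_sqrt_unique)
  qed
  have key: "inv_stereo (y \<omega>) = p + R *\<^sub>R L (sphere_boost A B \<psi> \<omega>)" if w: "norm \<omega> = 1" for \<omega>
  proof -
    let ?u = "\<psi> \<bullet> \<omega>"
    define D where "D = A + B * ?u"
    have D0: "D > 0" unfolding D_def using boost_denominator_pos[OF AB inner_unit_bounds[OF \<psi> w]] .
    have v: "\<psi> \<bullet> sphere_boost A B \<psi> \<omega> = (A * ?u + B) / D" unfolding D_def by (rule inner_sphere_boost[OF \<psi>])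
    have bst: "sphere_boost A B \<psi> \<omega> = (1 / D) *\<^sub>R (\<omega> + ((A - 1) * ?u + B) *\<^sub>R \<psi>)"
      by (simp add: sphere_boost_def D_def)
    have NN: "N \<omega> = \<delta> * D" unfolding D_def by (rule N[OF w])
    \<comment> \<open>The relation that turns the fraction 1 / D into an affine function of the
      boosted height (A u + B) / D.\<close>
    have A2: "A * D - B * (A * ?u + B) = 1"
      using AB(1) by (simp add: D_def power2_eq_square algebra_simps)
    have "inv_stereo (y \<omega>) = ((2 / (\<delta> * D)) *\<^sub>R y \<omega>, (\<delta> * D - 2) / (\<delta> * D))"
      by (simp add: inv_stereo_def NN[symmetric] N_def)
    moreover have "(\<delta> * D - 2) / (\<delta> * D) = 1 - 2 * A / \<delta> + R * (k2 * ((A * ?u + B) / D))"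
    proof -
      have "1 - 2 * A / \<delta> + R * (k2 * ((A * ?u + B) / D)) = 1 - 2 * (A * D - B * (A * ?u + B)) / (\<delta> * D)"
        using c t d0 D0 by (simp add: R_def k2_def field_simps)
      then show ?thesis unfolding A2 using d0 D0 by (simp add: field_simps)
    qed
    moreover have "(2 / (\<delta> * D)) *\<^sub>R y \<omega> = ((2 * c * A - 2 * c * t * B) / \<delta>) *\<^sub>R \<psi>
        + R *\<^sub>R (sphere_boost A B \<psi> \<omega> + (k1 * ((A * ?u + B) / D)) *\<^sub>R \<psi>)"
    proof -
      have "((2 * c * A - 2 * c * t * B) / \<delta>) *\<^sub>R \<psi>
          + R *\<^sub>R (sphere_boost A B \<psi> \<omega> + (k1 * ((A * ?u + B) / D)) *\<^sub>R \<psi>)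
        = (R / D) *\<^sub>R \<omega> + ((2 * c * A - 2 * c * t * B) / \<delta> + R * (((A - 1) * ?u + B) / D) + R * (k1 * ((A * ?u + B) / D))) *\<^sub>R \<psi>"
      proof -
        have "a *\<^sub>R \<psi> + R *\<^sub>R ((1 / D) *\<^sub>R (\<omega> + s *\<^sub>R \<psi>) + k *\<^sub>R \<psi>) = (R / D) *\<^sub>R \<omega> + (a + R * (s / D) + R * k) *\<^sub>R \<psi>"
          for a s k by (simp add: scaleR_add_right scaleR_add_left)
        then show ?thesis unfolding bst .
      qed
      also have "(2 * c * A - 2 * c * t * B) / \<delta> + R * (((A - 1) * ?u + B) / D) + R * (k1 * ((A * ?u + B) / D))
        = (2 * c / (\<delta> * D)) * ((A - t * B) * D + t * ((A - 1) * ?u + B) + (t * (A - 1) - B) * (A * ?u + B))"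
        using c t d0 D0 by (simp add: R_def k1_def field_simps)
      also have "(A - t * B) * D + t * ((A - 1) * ?u + B) + (t * (A - 1) - B) * (A * ?u + B)
        = (A * D - B * (A * ?u + B)) + t * ?u * (A\<^sup>2 - B\<^sup>2 - 1)"
        by (simp add: D_def power2_eq_square algebra_simps)
      also have "\<dots> = 1" using A2 AB(1) by simp
      finally show ?thesis by (simp add: y_def R_def scaleR_add_right mult_ac)
    qed
    ultimately show ?thesis by (simp add: p_def L_def v)
  qed
  have S: "subsphere lam \<psi> c = (\<lambda>\<omega>. p + R *\<^sub>R L \<omega>) ` sphere 0 1"
  proof -
    have "subsphere lam \<psi> c = (\<lambda>\<omega>. inv_stereo (y \<omega>)) ` sphere 0 1"
      unfolding subsphere_def y_def t(2) ..
    also have "\<dots> = (\<lambda>\<omega>. p + R *\<^sub>R L \<omega>) ` (sphere_boost A B \<psi> ` sphere 0 1)"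
      unfolding image_image using key by (intro image_cong) auto
    finally show ?thesis unfolding sphere_boost_image[OF AB \<psi>] .
  qed
  then have chart: "subsphere_chart (subsphere lam \<psi> c) p R L"
    unfolding subsphere_chart_def using R0 linL normL by blast
  have sub: "subsphere lam \<psi> c \<subseteq> sphere 0 1"
    unfolding subsphere_def using inv_stereo_in_sphere by blast
  have fS: "continuous_on (subsphere lam \<psi> c) f" by (rule continuous_on_subset[OF f sub])
  let ?g = "\<lambda>\<omega>. f (p + R *\<^sub>R L \<omega>)"
  have gc: "continuous_on (sphere 0 1) ?g"
  proof (rule continuous_on_compose2[OF f])
    show "continuous_on (sphere 0 1) (\<lambda>\<omega>. p + R *\<^sub>R L \<omega>)"
      using linL by (intro continuous_intros linear_continuous_on linear_conv_bounded_linear[THEN iffD1]) auto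
    show "(\<lambda>\<omega>. p + R *\<^sub>R L \<omega>) ` sphere 0 1 \<subseteq> sphere 0 1" using S sub by simp
  qed
  have "S_transform f (subsphere lam \<psi> c) = (R ^ (CARD('d) - 1)) *\<^sub>R (LINT \<omega>|sphere_measure. ?g \<omega>)"
    by (rule S_transform_chart[OF dim chart fS])
  also have "(LINT \<omega>|sphere_measure. ?g \<omega>)
      = (LINT \<omega>|sphere_measure. (1 / (A + B * (\<psi> \<bullet> \<omega>))) ^ (DIM(real^'d) - 1) *\<^sub>R ?g (sphere_boost A B \<psi> \<omega>))"
    by (rule sphere_boost_integral[OF _ AB \<psi> gc, symmetric]) (use dim in simp)
  also have "(R ^ (CARD('d) - 1)) *\<^sub>R \<dots>
      = (LINT \<omega>|sphere_measure. of_real ((2 * c * t) ^ (CARD('d) - 1)) * (f (inv_stereo (y \<omega>)) / of_real (N \<omega> ^ (CARD('d) - 1))))"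
    unfolding integral_scaleR_right[symmetric]
  proof (rule Bochner_Integration.integral_cong)
    fix \<omega> :: "real^'d" assume "\<omega> \<in> space sphere_measure"
    then have w: "norm \<omega> = 1" by simp
    have "R * (1 / (A + B * (\<psi> \<bullet> \<omega>))) = 2 * c * t / N \<omega>"
      using d0 unfolding N[OF w] R_def by simp
    then have "R ^ (CARD('d) - 1) * (1 / (A + B * (\<psi> \<bullet> \<omega>))) ^ (CARD('d) - 1) = (2 * c * t) ^ (CARD('d) - 1) / N \<omega> ^ (CARD('d) - 1)"
      by (simp only: power_mult_distrib[symmetric] power_divide[symmetric])
    then show "R ^ (CARD('d) - 1) *\<^sub>R (1 / (A + B * (\<psi> \<bullet> \<omega>))) ^ (DIM(real^'d) - 1) *\<^sub>R ?g (sphere_boost A B \<psi> \<omega>)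
      = of_real ((2 * c * t) ^ (CARD('d) - 1)) * (f (inv_stereo (y \<omega>)) / of_real (N \<omega> ^ (CARD('d) - 1)))"
      unfolding key[OF w, symmetric] scaleR_scaleR by (simp add: scaleR_conv_of_real)
  qed simp
  finally show ?thesis unfolding N_def y_def by (simp only: integral_mult_right_zero)
qed

section \<open>Gegenbauer polynomials normalized at 1\<close>

text \<open>The three-term recurrence of the Gegenbauer polynomials divided by their value at 1. In
  this normalization \<nu> = 0 requires no limit: the coefficients become 2 and 1, and the
  recurrence is that of the Chebyshev polynomials.\<close>

fun gegen :: "real \<Rightarrow> nat \<Rightarrow> real poly" where
  "gegen \<nu> 0 = 1"
| "gegen \<nu> (Suc 0) = [:0, 1:]"
| "gegen \<nu> (Suc (Suc m)) = smult (2 * (real m + 1 + \<nu>) / (real m + 1 + 2 * \<nu>)) ([:0, 1:] * gegen \<nu> (Suc m))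
     - smult ((real m + 1) / (real m + 1 + 2 * \<nu>)) (gegen \<nu> m)"

definition gegen_moment :: "real \<Rightarrow> nat \<Rightarrow> nat \<Rightarrow> real" where
  "gegen_moment \<nu> m k = (LINT u:{-1..1}|lborel. u ^ k * poly (gegen \<nu> m) u * (1 - u\<^sup>2) powr (\<nu> - 1 / 2))"

text \<open>The closed form of the moments; with \<open>k = m + 2 j\<close> it reads
  \<open>\<surd>\<pi> \<Gamma>(\<nu> + 1/2) k! / (2\<^sup>k j! \<Gamma>(\<nu> + 1 + m + j))\<close>.\<close>

definition gegen_moment_value :: "real \<Rightarrow> nat \<Rightarrow> nat \<Rightarrow> real" where
  "gegen_moment_value \<nu> m k = (if k < m \<or> odd (k + m) then 0 else
     sqrt pi * Gamma (\<nu> + 1 / 2) * fact k / (2 ^ k * fact ((k - m) div 2) * Gamma (\<nu> + 1 + real ((k + m) div 2))))"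

lemma gegen_moment_value_eq:
  "gegen_moment_value \<nu> m (m + 2 * j) = sqrt pi * Gamma (\<nu> + 1 / 2) * fact (m + 2 * j)
     / (2 ^ (m + 2 * j) * fact j * Gamma (\<nu> + 1 + real (m + j)))"
proof -
  have "(m + 2 * j + m) div 2 = m + j" by simp
  then show ?thesis by (simp add: gegen_moment_value_def)
qed

lemma poly_weight_integrable:
  fixes p :: "real poly"
  assumes "\<nu> \<ge> 0"
  shows "set_integrable lborel {-1..1} (\<lambda>u. poly p u * (1 - u\<^sup>2) powr (\<nu> - 1 / 2))"
  using gegenbauer_weight_integrable_continuous[of "\<nu> - 1 / 2" "poly p"] assms
  by (simp add: mult.commute continuous_on_poly)

lemma poly_weight_integrable_power:
  fixes p :: "real poly"
  assumes "\<nu> \<ge> 0"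
  shows "set_integrable lborel {-1..1} (\<lambda>u. u ^ k * poly p u * (1 - u\<^sup>2) powr (\<nu> - 1 / 2))"
  using poly_weight_integrable[OF assms, of "monom 1 k * p"] by (simp add: poly_monom)

lemma Gamma_step: "(x::real) > 0 \<Longrightarrow> Gamma (x + 1) = x * Gamma x"
  by (rule Gamma_plus1) (auto elim: nonpos_Ints_cases)

lemma gegen_moment_0:
  assumes \<nu>: "\<nu> \<ge> 0"
  shows "gegen_moment \<nu> 0 k = gegen_moment_value \<nu> 0 k"
proof (induction k rule: less_induct)
  case (less k)
  have M: "gegen_moment \<nu> 0 k = gegenbauer_moment (\<nu> - 1 / 2) k" for k
    by (simp add: gegen_moment_def gegenbauer_moment_def)
  have a: "\<nu> - 1 / 2 \<ge> - 1 / 2" using \<nu> by simp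
  consider "k = 0" | "k = 1" | i where "k = i + 2"
    by (metis One_nat_def add_2_eq_Suc' not0_implies_Suc)
  then show ?case
  proof cases
    case 1
    then show ?thesis
      using gegenbauer_moment_0[OF a] by (simp add: M gegen_moment_value_def add.commute)
  next
    case 2
    then show ?thesis
      using gegenbauer_moment_rec[OF a, of 0] \<nu> by (simp add: M gegen_moment_value_def)
  next
    case 3
    have p: "real (Suc i) + 2 * (\<nu> - 1 / 2) + 2 > 0" using \<nu> by simp
    have "(real (Suc i) + 2 * (\<nu> - 1 / 2) + 2) * gegen_moment \<nu> 0 (i + 2) = real (Suc i) * gegen_moment_value \<nu> 0 i"
      using gegenbauer_moment_rec[OF a, of "Suc i"] less[of i] 3 by (simp add: M)
    also have "\<dots> = (real (Suc i) + 2 * (\<nu> - 1 / 2) + 2) * gegen_moment_value \<nu> 0 (i + 2)"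
    proof (cases "even i")
      case True
      then obtain j where i: "i = 2 * j" by blast
      have g: "Gamma (\<nu> + 1 + real (Suc j)) = (\<nu> + 1 + real j) * Gamma (\<nu> + 1 + real j)"
        using Gamma_step[of "\<nu> + 1 + real j"] \<nu> by (simp add: add_ac)
      have gp: "Gamma (\<nu> + 1 + real j) > 0" using \<nu> by simp
      have v1: "gegen_moment_value \<nu> 0 i = sqrt pi * Gamma (\<nu> + 1 / 2) * fact i / (2 ^ i * fact j * Gamma (\<nu> + 1 + real j))"
        using gegen_moment_value_eq[of \<nu> 0 j] i by simp
      have v2: "gegen_moment_value \<nu> 0 (i + 2) = sqrt pi * Gamma (\<nu> + 1 / 2) * ((real i + 2) * ((real i + 1) * fact i))
          / (4 * 2 ^ i * ((real j + 1) * fact j) * ((\<nu> + 1 + real j) * Gamma (\<nu> + 1 + real j)))"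
        using gegen_moment_value_eq[of \<nu> 0 "Suc j"] i g by (simp add: algebra_simps)
      show ?thesis
        unfolding v1 v2 using gp \<nu> i by (simp add: divide_simps) (simp add: algebra_simps)?
    next
      case False
      then show ?thesis by (simp add: gegen_moment_value_def)
    qed
    finally show ?thesis using p 3 by simp
  qed
qed

text \<open>Multiplying the three-term recurrence by u^k expresses the moment (m, k) through (m - 1,
  k + 1) and (m - 2, k), and the closed form obeys the same relation. The zeros for k < m are the
  orthogonality to lower powers; among them only k = m - 2 involves two non-zero terms that
  cancel.\<close>

lemma gegen_moment_eq:
  assumes \<nu>: "\<nu> \<ge> 0"
  shows "gegen_moment \<nu> m k = gegen_moment_value \<nu> m k"
proof (induction m arbitrary: k rule: less_induct)
  case (less m)
  let ?G = "sqrt pi * Gamma (\<nu> + 1 / 2)"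
  consider "m = 0" | "m = 1" | i where "m = Suc (Suc i)" by (metis One_nat_def not0_implies_Suc)
  then show ?case
  proof cases
    case 1
    then show ?thesis using gegen_moment_0[OF \<nu>] by simp
  next
    case 2
    have "gegen_moment \<nu> 1 k = gegen_moment \<nu> 0 (Suc k)"
      by (simp add: gegen_moment_def mult.commute)
    also have "\<dots> = gegen_moment_value \<nu> 0 (Suc k)" using gegen_moment_0[OF \<nu>] .
    also have "\<dots> = gegen_moment_value \<nu> 1 k"
    proof (cases "odd k")
      case True
      then obtain j where k: "k = Suc (2 * j)" by (auto elim: oddE)
      have v1: "gegen_moment_value \<nu> 1 k = ?G * fact k / (2 ^ k * fact j * Gamma (\<nu> + 1 + real (Suc j)))"
        using gegen_moment_value_eq[of \<nu> 1 j] k by simp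
      have v0: "gegen_moment_value \<nu> 0 (Suc k) = ?G * ((real k + 1) * fact k) / (2 * 2 ^ k * ((real j + 1) * fact j) * Gamma (\<nu> + 1 + real (Suc j)))"
        using gegen_moment_value_eq[of \<nu> 0 "Suc j"] k by (simp add: algebra_simps)
      have k1: "real k + 1 = 2 * (real j + 1)" using k by simp
      have gen: "G * ((2 * J) * f) / (2 * P * (J * q) * h) = G * f / (P * q * h)" if "J > 0" for G J f P q h :: real
        using that by simp
      show ?thesis unfolding v1 v0 k1 by (rule gen) simp
    qed (simp add: gegen_moment_value_def)
    finally show ?thesis using 2 by simp
  next
    case 3
    let ?a = "2 * (real i + 1 + \<nu>) / (real i + 1 + 2 * \<nu>)" and ?b = "(real i + 1) / (real i + 1 + 2 * \<nu>)"
    have "gegen_moment \<nu> m k = (LINT u:{-1..1}|lborel. ?a * (u ^ Suc k * poly (gegen \<nu> (Suc i)) u * (1 - u\<^sup>2) powr (\<nu> - 1 / 2))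
        - ?b * (u ^ k * poly (gegen \<nu> i) u * (1 - u\<^sup>2) powr (\<nu> - 1 / 2)))"
      unfolding gegen_moment_def 3 by (rule arg_cong[where f="set_lebesgue_integral _ _"]) (simp add: fun_eq_iff algebra_simps)
    also have "\<dots> = ?a * gegen_moment \<nu> (Suc i) (Suc k) - ?b * gegen_moment \<nu> i k"
      unfolding gegen_moment_def
    proof -
      note i = poly_weight_integrable_power[OF \<nu>]
      show "(LINT u:{-1..1}|lborel. a * (u ^ Suc k * poly (gegen \<nu> (Suc i)) u * (1 - u\<^sup>2) powr (\<nu> - 1 / 2))
          - b * (u ^ k * poly (gegen \<nu> i) u * (1 - u\<^sup>2) powr (\<nu> - 1 / 2)))
        = a * (LINT u:{-1..1}|lborel. u ^ Suc k * poly (gegen \<nu> (Suc i)) u * (1 - u\<^sup>2) powr (\<nu> - 1 / 2))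
          - b * (LINT u:{-1..1}|lborel. u ^ k * poly (gegen \<nu> i) u * (1 - u\<^sup>2) powr (\<nu> - 1 / 2))" for a b
      proof -
        have j: "set_integrable lborel {-1..1} (\<lambda>u. c * (u ^ k * poly p u * (1 - u\<^sup>2) powr (\<nu> - 1 / 2)))" for c k p
          by (rule set_integrable_mult_right) (rule i)
        show ?thesis by (simp only: set_integral_diff(2)[OF j j] set_integral_mult_right)
      qed
    qed
    also have "\<dots> = ?a * gegen_moment_value \<nu> (Suc i) (Suc k) - ?b * gegen_moment_value \<nu> i k"
      using less[of "Suc i"] less[of i] 3 by simp
    also have "\<dots> = gegen_moment_value \<nu> m k"
    proof -
      have nz: "real i + 1 + 2 * \<nu> > 0" using \<nu> by simp
      consider "odd (k + m)" | "even (k + m)" "k < i" | "even (k + m)" "k = i" | "even (k + m)" "k = i + 1" |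
        j where "k = m + 2 * j"
      proof -
        assume *: "odd (k + m) \<Longrightarrow> thesis" "even (k + m) \<Longrightarrow> k < i \<Longrightarrow> thesis"
          "even (k + m) \<Longrightarrow> k = i \<Longrightarrow> thesis" "even (k + m) \<Longrightarrow> k = i + 1 \<Longrightarrow> thesis" "\<And>j. k = m + 2 * j \<Longrightarrow> thesis"
        show thesis
        proof (cases "odd (k + m) \<or> k < i \<or> k = i \<or> k = i + 1")
          case False
          then have "even (k - m)" "m \<le> k" using 3 by auto
          then obtain j where "k - m = 2 * j" by blast
          then show ?thesis using \<open>m \<le> k\<close> *(5)[of j] by simp
        qed (use * in blast)
      qed
      then show ?thesis
      proof cases
        case 1
        then show ?thesis using 3 by (simp add: gegen_moment_value_def)
      next
        case 2
        then show ?thesis using 3 by (simp add: gegen_moment_value_def)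
      next
        case c3: 3
        have g: "Gamma (\<nu> + 1 + real (Suc i)) = (\<nu> + 1 + real i) * Gamma (\<nu> + 1 + real i)"
          using Gamma_step[of "\<nu> + 1 + real i"] \<nu> by (simp add: add_ac)
        have gp: "Gamma (\<nu> + 1 + real i) > 0" using \<nu> by simp
        have v1: "gegen_moment_value \<nu> (Suc i) (Suc k) = ?G * ((real i + 1) * fact i) / (2 * 2 ^ i * ((\<nu> + 1 + real i) * Gamma (\<nu> + 1 + real i)))"
          using gegen_moment_value_eq[of \<nu> "Suc i" 0] c3 g by (simp add: algebra_simps)
        have v0: "gegen_moment_value \<nu> i k = ?G * fact i / (2 ^ i * Gamma (\<nu> + 1 + real i))"
          using gegen_moment_value_eq[of \<nu> i 0] c3 by simp
        have "?a * gegen_moment_value \<nu> (Suc i) (Suc k) = ?b * gegen_moment_value \<nu> i k"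
        proof -
          have "\<nu> + 1 + real i > 0" using \<nu> by simp
          moreover have "real i + 1 + \<nu> = \<nu> + 1 + real i" by simp
          ultimately show ?thesis unfolding v1 v0 using gp nz by (simp add: divide_simps)
        qed
        then show ?thesis using 3 c3 by (simp add: gegen_moment_value_def)
      next
        case 4
        then show ?thesis using 3 by simp
      next
        case (5 j)
        define g where "g = Gamma (\<nu> + 1 + (real i + real j + 1))"
        define x where "x = \<nu> + 1 + (real i + real j + 1)"
        have x0: "x > 0" using \<nu> by (simp add: x_def)
        have gp: "g > 0" using x0 by (simp add: g_def x_def)
        have gs: "Gamma (\<nu> + 1 + (real i + real j + 2)) = x * g"
          using Gamma_step[of x] x0 by (simp add: g_def x_def add_ac)
        have v: "gegen_moment_value \<nu> m k = ?G * fact k / (2 ^ k * fact j * (x * g))"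
          using gegen_moment_value_eq[of \<nu> m j] 5 3 gs by (simp add: add_ac)
        have v1: "gegen_moment_value \<nu> (Suc i) (Suc k) = ?G * ((real k + 1) * fact k) / (2 * 2 ^ k * ((real j + 1) * fact j) * (x * g))"
          using gegen_moment_value_eq[of \<nu> "Suc i" "Suc j"] 5 3 gs by (simp add: add_ac)
        have v0: "gegen_moment_value \<nu> i k = ?G * fact k / (2 ^ k * ((real j + 1) * fact j) * g)"
          using gegen_moment_value_eq[of \<nu> i "Suc j"] 5 3 by (simp add: g_def add_ac)
        define F where "F = ?G * fact k / (2 ^ k * fact j * g)"
        have v': "gegen_moment_value \<nu> m k = F / x" unfolding v F_def by simp
        have v1': "gegen_moment_value \<nu> (Suc i) (Suc k) = F * (real k + 1) / (2 * (real j + 1) * x)"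
        proof -
          have gen: "G * (K * f) / (2 * P * (J * q) * (x * g)) = G * f / (P * q * g) * K / (2 * J * x)"
            for G K f P J q :: real by (simp add: mult_ac)
          show ?thesis unfolding v1 F_def by (rule gen)
        qed
        have v0': "gegen_moment_value \<nu> i k = F / (real j + 1)" unfolding v0 F_def by simp
        have k: "real k = real i + 2 + 2 * real j" using 5 3 by simp
        have j0: "real j + 1 > 0" by simp
        \<comment> \<open>The polynomial identity that remains once the factorials and Gamma values
          are collected in F.\<close>
        have alg: "2 * (real i + 1 + \<nu>) * (real k + 1) - 2 * (real i + 1) * x = 2 * (real i + 1 + 2 * \<nu>) * (real j + 1)"
          unfolding k x_def by (simp add: algebra_simps)
        have "?a * (F * (real k + 1) / (2 * (real j + 1) * x)) - ?b * (F / (real j + 1))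
            = F * (2 * (real i + 1 + \<nu>) * (real k + 1) - 2 * (real i + 1) * x) / (2 * (real i + 1 + 2 * \<nu>) * (real j + 1) * x)"
        proof -
          have gen: "2 * A / D * (F * K / (2 * J * x)) - E / D * (F / J) = F * (2 * A * K - 2 * E * x) / (2 * D * J * x)"
            if "D > 0" "J > 0" for A D K J E :: real
            using that x0 by (simp add: field_simps)
          show ?thesis by (rule gen[OF nz j0])
        qed
        also have "\<dots> = F / x" unfolding alg using nz j0 by simp
        finally show ?thesis unfolding v' v1' v0' .
      qed
    qed
    finally show ?thesis .
  qed
qed

section \<open>Orthogonality and uniqueness of the Gegenbauer family\<close>

lemma degree_lead_recurrence:
  fixes p q :: "real poly"
  assumes "degree p = M" "lead_coeff p > 0" "degree q \<le> M" "c > 0"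
  shows "degree (smult c ([:0, 1:] * p) - smult b q) = Suc M"
    and "lead_coeff (smult c ([:0, 1:] * p) - smult b q) = c * lead_coeff p"
proof -
  let ?P = "smult c ([:0, 1:] * p) - smult b q"
  have "coeff q (Suc M) = 0" using assms by (intro coeff_eq_0) simp
  then have co: "coeff ?P (Suc M) = c * lead_coeff p"
    using assms by simp
  have "degree ?P \<le> Suc M"
    by (rule degree_diff_le) (use assms in \<open>auto intro!: degree_pCons_le order_trans[OF degree_smult_le]
      order_trans[OF degree_pCons_le]\<close>)
  moreover have "Suc M \<le> degree ?P"
  proof (rule le_degree)
    show "coeff ?P (Suc M) \<noteq> 0" unfolding co using assms by simp
  qed
  ultimately show d: "degree ?P = Suc M" by simp
  show "lead_coeff ?P = c * lead_coeff p" unfolding d by (rule co)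
qed

lemma
  assumes \<nu>: "\<nu> \<ge> 0"
  shows degree_gegen: "degree (gegen \<nu> m) = m" and lead_coeff_gegen_pos: "lead_coeff (gegen \<nu> m) > 0"
proof -
  have "degree (gegen \<nu> m) = m \<and> lead_coeff (gegen \<nu> m) > 0
      \<and> degree (gegen \<nu> (Suc m)) = Suc m \<and> lead_coeff (gegen \<nu> (Suc m)) > 0" for m
  proof (induction m)
    case (Suc m)
    have c: "2 * (real m + 1 + \<nu>) / (real m + 1 + 2 * \<nu>) > 0" using \<nu> by (intro divide_pos_pos) auto
    have d: "degree (gegen \<nu> (Suc m)) = Suc m" "lead_coeff (gegen \<nu> (Suc m)) > 0" "degree (gegen \<nu> m) \<le> Suc m"
      using Suc by auto
    have "degree (gegen \<nu> (Suc (Suc m))) = Suc (Suc m)"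
      unfolding gegen.simps(3) by (rule degree_lead_recurrence(1)[OF d c])
    moreover have "lead_coeff (gegen \<nu> (Suc (Suc m))) > 0"
      unfolding gegen.simps(3) degree_lead_recurrence(2)[OF d c] using c d(2) by (rule mult_pos_pos)
    ultimately show ?case using d by simp
  qed auto
  then show "degree (gegen \<nu> m) = m" "lead_coeff (gegen \<nu> m) > 0" by blast+
qed

lemma lead_coeff_gegen_Suc_Suc:
  assumes \<nu>: "\<nu> \<ge> 0"
  shows "lead_coeff (gegen \<nu> (Suc (Suc m))) = 2 * (real m + 1 + \<nu>) / (real m + 1 + 2 * \<nu>) * lead_coeff (gegen \<nu> (Suc m))"
proof -
  have "2 * (real m + 1 + \<nu>) / (real m + 1 + 2 * \<nu>) > 0" using \<nu> by (intro divide_pos_pos) auto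
  then show ?thesis
    unfolding gegen.simps(3)
    by (intro degree_lead_recurrence(2)[where M="Suc m"] lead_coeff_gegen_pos[OF \<nu>])
       (simp_all add: degree_gegen[OF \<nu>])
qed

definition gegen_inner :: "real \<Rightarrow> real poly \<Rightarrow> real poly \<Rightarrow> real" where
  "gegen_inner \<nu> p q = (LINT u:{-1..1}|lborel. poly p u * poly q u * (1 - u\<^sup>2) powr (\<nu> - 1 / 2))"

lemma gegen_inner_commute: "gegen_inner \<nu> p q = gegen_inner \<nu> q p"
  by (simp add: gegen_inner_def mult.commute[of "poly p _"])

lemma gegen_inner_sum:
  assumes \<nu>: "\<nu> \<ge> 0"
  shows "gegen_inner \<nu> (\<Sum>i\<in>I. smult (c i) (p i)) q = (\<Sum>i\<in>I. c i * gegen_inner \<nu> (p i) q)"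
proof (cases "finite I")
  case True
  have i: "integrable lborel (\<lambda>u. indicator {-1..1} u *\<^sub>R (poly p u * poly q u * (1 - u\<^sup>2) powr (\<nu> - 1 / 2)))" for p
    using poly_weight_integrable[OF \<nu>, of "p * q"] by (simp add: set_integrable_def)
  have "gegen_inner \<nu> (\<Sum>i\<in>I. smult (c i) (p i)) q
      = (LINT u|lborel. (\<Sum>i\<in>I. c i * (indicator {-1..1} u *\<^sub>R (poly (p i) u * poly q u * (1 - u\<^sup>2) powr (\<nu> - 1 / 2)))))"
    unfolding gegen_inner_def set_lebesgue_integral_def
    by (rule Bochner_Integration.integral_cong) (auto simp: poly_sum sum_distrib_right sum_distrib_left mult_ac)
  also have "\<dots> = (\<Sum>i\<in>I. c i * gegen_inner \<nu> (p i) q)"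
    unfolding gegen_inner_def set_lebesgue_integral_def
    by (subst Bochner_Integration.integral_sum) (use i in simp_all)
  finally show ?thesis .
qed (simp add: gegen_inner_def set_lebesgue_integral_def)

lemma gegen_inner_diff_smult:
  assumes \<nu>: "\<nu> \<ge> 0"
  shows "gegen_inner \<nu> (p - smult c r) q = gegen_inner \<nu> p q - c * gegen_inner \<nu> r q"
proof -
  have "gegen_inner \<nu> (\<Sum>i\<in>{False, True}. smult (if i then - c else 1) (if i then r else p)) q
      = (\<Sum>i\<in>{False, True}. (if i then - c else 1) * gegen_inner \<nu> (if i then r else p) q)"
    by (rule gegen_inner_sum[OF \<nu>])
  then show ?thesis by simp
qed

lemma gegen_inner_smult:
  assumes \<nu>: "\<nu> \<ge> 0"
  shows "gegen_inner \<nu> (smult c p) q = c * gegen_inner \<nu> p q"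
  using gegen_inner_sum[OF \<nu>, of "\<lambda>_. c" "\<lambda>_. p" "{()}"] by simp

text \<open>All moments of order below l vanish, so the coefficient of degree l alone
  contributes.\<close>

lemma gegen_inner_gegen:
  assumes \<nu>: "\<nu> \<ge> 0" and p: "degree p \<le> l"
  shows "gegen_inner \<nu> p (gegen \<nu> l) = coeff p l * gegen_moment_value \<nu> l l"
proof -
  have m: "gegen_inner \<nu> (monom 1 i) q = (LINT u:{-1..1}|lborel. u ^ i * poly q u * (1 - u\<^sup>2) powr (\<nu> - 1 / 2))" for i q
    by (simp add: gegen_inner_def poly_monom)
  have "p = (\<Sum>i\<le>l. smult (coeff p i) (monom 1 i))"
    using poly_as_sum_of_monoms'[OF p] by (simp add: smult_monom)
  then have "gegen_inner \<nu> p (gegen \<nu> l) = (\<Sum>i\<le>l. coeff p i * gegen_inner \<nu> (monom 1 i) (gegen \<nu> l))"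
    using gegen_inner_sum[OF \<nu>] by metis
  also have "\<dots> = (\<Sum>i\<le>l. coeff p i * gegen_moment_value \<nu> l i)"
    using gegen_moment_eq[OF \<nu>] by (simp add: m gegen_moment_def)
  also have "\<dots> = (\<Sum>i\<in>{l}. coeff p i * gegen_moment_value \<nu> l i)"
    by (rule sum.mono_neutral_right) (auto simp: gegen_moment_value_def)
  finally show ?thesis by simp
qed

lemma Gamma_legendre_duplication_real:
  assumes x: "(x::real) > 0"
  shows "Gamma x * Gamma (x + 1 / 2) = 2 powr (1 - 2 * x) * sqrt pi * Gamma (2 * x)"
proof -
  have nn: "complex_of_real y \<notin> \<int>\<^sub>\<le>\<^sub>0" if "y > 0" for y
    using that by (auto elim!: nonpos_Ints_cases simp: complex_eq_iff)
  have "complex_of_real (Gamma x * Gamma (x + 1 / 2)) = Gamma (complex_of_real x) * Gamma (complex_of_real x + 1 / 2)"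
    using Gamma_complex_of_real[of x] Gamma_complex_of_real[of "x + 1 / 2"] by simp
  also have "\<dots> = exp ((1 - 2 * complex_of_real x) * complex_of_real (ln 2)) * complex_of_real (sqrt pi) * Gamma (2 * complex_of_real x)"
    using nn[of x] nn[of "x + 1 / 2"] x by (intro Gamma_legendre_duplication) auto
  also have "\<dots> = complex_of_real (2 powr (1 - 2 * x) * sqrt pi * Gamma (2 * x))"
    using Gamma_complex_of_real[of "2 * x"] by (simp add: powr_def exp_of_real flip: of_real_mult)
       (simp add: exp_of_real[symmetric])?
  finally show ?thesis by (simp only: of_real_eq_iff)
qed

text \<open>The left-hand side is the squared norm, by the preceding reduction to the top
  coefficient. The recurrence of the leading coefficients starts at degree 2, so degrees 0 and 1 are
  computed directly; there the power of 2 and the squared Gamma value come from Legendre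
  duplication. The case \<nu> = l = 0 is the separate clause of
  \<open>gegenbauer_norm\<close>.\<close>

lemma gegenbauer_norm_eq:
  assumes \<nu>: "\<nu> \<ge> 0"
  shows "lead_coeff (gegen \<nu> l) * gegen_moment_value \<nu> l l = gegenbauer_norm \<nu> l"
proof -
  let ?g = "Gamma (\<nu> + 1 / 2)"
  have gp: "Gamma (\<nu> + 1) > 0" "?g > 0" "Gamma (2 * \<nu> + 1) > 0" using \<nu> by auto
  have dup: "?g * Gamma (\<nu> + 1) = 2 powr (- 2 * \<nu>) * sqrt pi * Gamma (2 * \<nu> + 1)"
    using Gamma_legendre_duplication_real[of "\<nu> + 1 / 2"] \<nu> by (simp add: algebra_simps)
  have val: "gegen_moment_value \<nu> l l = sqrt pi * ?g * fact l / (2 ^ l * Gamma (\<nu> + 1 + real l))" for l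
    using gegen_moment_value_eq[of \<nu> l 0] by simp
  have p1: "2 powr (- 2 * \<nu>) * 2 powr (2 * \<nu>) = (1::real)" by (simp flip: powr_add)
  have base: "sqrt pi * ?g / Gamma (\<nu> + 1) = 2 powr (2 * \<nu>) * ?g\<^sup>2 / Gamma (2 * \<nu> + 1)"
  proof -
    have "sqrt pi * Gamma (2 * \<nu> + 1) = (2 powr (- 2 * \<nu>) * 2 powr (2 * \<nu>)) * (sqrt pi * Gamma (2 * \<nu> + 1))" unfolding p1 by simp
    also have "\<dots> = 2 powr (2 * \<nu>) * (?g * Gamma (\<nu> + 1))" unfolding dup by (simp add: mult_ac)
    finally have e: "sqrt pi * Gamma (2 * \<nu> + 1) = 2 powr (2 * \<nu>) * (?g * Gamma (\<nu> + 1))" .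
    have "sqrt pi * ?g * Gamma (2 * \<nu> + 1) = 2 powr (2 * \<nu>) * ?g\<^sup>2 * Gamma (\<nu> + 1)"
      using arg_cong[OF e, of "\<lambda>x. x * ?g"] by (simp add: power2_eq_square mult_ac)
    then show ?thesis using gp by (simp add: frac_eq_eq)
  qed
  have half: "2 powr (2 * \<nu> - 1) = 2 powr (2 * \<nu>) / (2::real)"
    by (simp add: powr_diff)
  show ?thesis
  proof (cases "l = 0")
    case True
    show ?thesis
    proof (cases "\<nu> = 0")
      case True
      then show ?thesis using \<open>l = 0\<close> val[of 0] by (simp add: gegenbauer_norm_def Gamma_one_half_real)
    next
      case False
      then have g2: "Gamma (2 * \<nu> + 1) = 2 * \<nu> * Gamma (2 * \<nu>)" using Gamma_step[of "2 * \<nu>"] \<nu> by simp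
      show ?thesis using \<open>l = 0\<close> False base unfolding g2 by (simp add: val gegenbauer_norm_def half)
    qed
  next
    case False
    then obtain k where l: "l = Suc k" by (cases l) auto
    have "lead_coeff (gegen \<nu> (Suc k)) * gegen_moment_value \<nu> (Suc k) (Suc k) = gegenbauer_norm \<nu> (Suc k)"
    proof (induction k)
      case 0
      have g1: "Gamma (\<nu> + 1 + 1) = (\<nu> + 1) * Gamma (\<nu> + 1)" using Gamma_step[of "\<nu> + 1"] \<nu> by simp
      have "sqrt pi * ?g / (2 * ((\<nu> + 1) * Gamma (\<nu> + 1))) = (sqrt pi * ?g / Gamma (\<nu> + 1)) / (2 * (\<nu> + 1))" by simp
      also have "\<dots> = 2 powr (2 * \<nu> - 1) * ?g\<^sup>2 / ((1 + \<nu>) * Gamma (1 + 2 * \<nu>))"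
        unfolding base half by (simp add: add.commute mult_ac)
      finally show ?case using g1 by (simp add: val gegenbauer_norm_def)
    next
      case (Suc k)
      define x where "x = real k + 1"
      have x: "x > 0" by (simp add: x_def)
      have g1: "Gamma (\<nu> + 1 + real (Suc (Suc k))) = (\<nu> + 1 + x) * Gamma (\<nu> + 1 + real (Suc k))"
        using Gamma_step[of "\<nu> + 1 + x"] \<nu> x by (simp add: x_def add_ac)
      have g2: "Gamma (real (Suc (Suc k)) + 2 * \<nu>) = (x + 2 * \<nu>) * Gamma (real (Suc k) + 2 * \<nu>)"
        using Gamma_step[of "x + 2 * \<nu>"] \<nu> x by (simp add: x_def add_ac)
      have "lead_coeff (gegen \<nu> (Suc (Suc k))) * gegen_moment_value \<nu> (Suc (Suc k)) (Suc (Suc k))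
          = (2 * (x + \<nu>) / (x + 2 * \<nu>)) * ((x + 1) / (2 * (\<nu> + 1 + x)))
            * (lead_coeff (gegen \<nu> (Suc k)) * gegen_moment_value \<nu> (Suc k) (Suc k))"
      proof -
        have gen: "(2 * a / b * L) * (G * (c * f) / (2 * P * (d * H))) = (2 * a / b) * (c / (2 * d)) * (L * (G * f / (P * H)))"
          for a b c d f G H L P :: real by (simp add: mult_ac)
        have f: "fact (Suc (Suc k)) = (x + 1) * fact (Suc k)" by (simp add: x_def algebra_simps)
        have p: "(2::real) ^ Suc (Suc k) = 2 * 2 ^ Suc k" by simp
        show ?thesis
          unfolding lead_coeff_gegen_Suc_Suc[OF \<nu>] val g1 f p x_def[symmetric] by (rule gen)
      qed
      also have "\<dots> = (2 * (x + \<nu>) / (x + 2 * \<nu>)) * ((x + 1) / (2 * (\<nu> + 1 + x))) * gegenbauer_norm \<nu> (Suc k)"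
        unfolding Suc ..
      also have "\<dots> = gegenbauer_norm \<nu> (Suc (Suc k))"
      proof -
        define G where "G = Gamma (real (Suc k) + 2 * \<nu>)"
        define P where "P = 2 powr (2 * \<nu> - 1) * ?g\<^sup>2 * fact (Suc k)"
        have n1: "gegenbauer_norm \<nu> (Suc k) = P / ((x + \<nu>) * G)"
          by (simp add: gegenbauer_norm_def P_def G_def x_def add_ac)
        have n2: "gegenbauer_norm \<nu> (Suc (Suc k)) = P * (x + 1) / ((x + 1 + \<nu>) * ((x + 2 * \<nu>) * G))"
          unfolding gegenbauer_norm_def g2 by (simp add: P_def G_def x_def algebra_simps)
        have gen: "(2 * a / b) * (c / (2 * d)) * (P / (a * G)) = P * c / (d * (b * G))" if "a \<noteq> 0" for a b c d :: real
          using that by (simp add: mult_ac)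
        have e: "\<nu> + 1 + x = x + 1 + \<nu>" by simp
        have "x + \<nu> \<noteq> 0" using x \<nu> by simp
        then show ?thesis unfolding n1 n2 e by (rule gen)
      qed
      finally show ?case .
    qed
    then show ?thesis using l by simp
  qed
qed

lemma gegen_orthogonal:
  assumes \<nu>: "\<nu> \<ge> 0"
  shows "gegen_inner \<nu> (gegen \<nu> l) (gegen \<nu> k) = (if l = k then gegenbauer_norm \<nu> l else 0)"
proof -
  have "gegen_inner \<nu> (gegen \<nu> l) (gegen \<nu> k) = (if l = k then gegenbauer_norm \<nu> l else 0)" if "l \<le> k" for l k
    using gegen_inner_gegen[OF \<nu>, of "gegen \<nu> l" k] degree_gegen[OF \<nu>, of l] gegenbauer_norm_eq[OF \<nu>, of l] that
    by (auto simp: coeff_eq_0)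
  then show ?thesis using gegen_inner_commute by (metis nat_le_linear)
qed

lemma gegenbauer_norm_pos:
  assumes \<nu>: "\<nu> \<ge> 0"
  shows "gegenbauer_norm \<nu> l > 0"
proof -
  have "gegen_moment_value \<nu> l l > 0"
    using gegen_moment_value_eq[of \<nu> l 0] \<nu> by (auto intro!: divide_pos_pos mult_pos_pos)
  then show ?thesis using lead_coeff_gegen_pos[OF \<nu>, of l] gegenbauer_norm_eq[OF \<nu>, of l] by (metis mult_pos_pos)
qed

lemma gegen_expansion:
  assumes \<nu>: "\<nu> \<ge> 0"
  shows "degree p < n \<or> p = 0 \<Longrightarrow> \<exists>c. p = (\<Sum>k<n. smult (c k) (gegen \<nu> k))"
proof (induction n arbitrary: p)
  case (Suc n)
  define c where "c = coeff p n / lead_coeff (gegen \<nu> n)"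
  let ?q = "p - smult c (gegen \<nu> n)"
  have "coeff ?q i = 0" if "i \<ge> n" for i
  proof (cases "i = n")
    case True
    then show ?thesis using lead_coeff_gegen_pos[OF \<nu>, of n] by (simp add: c_def degree_gegen[OF \<nu>])
  next
    case False
    then have "i > n" using that by simp
    moreover have "coeff p i = 0" using Suc.prems \<open>i > n\<close> by (auto intro: coeff_eq_0)
    ultimately show ?thesis by (simp add: coeff_eq_0 degree_gegen[OF \<nu>])
  qed
  then have "degree ?q < n \<or> ?q = 0"
    by (metis leI leading_coeff_0_iff)
  from Suc.IH[OF this] obtain d where d: "?q = (\<Sum>k<n. smult (d k) (gegen \<nu> k))" by blast
  have "p = (\<Sum>k<Suc n. smult ((d(n := c)) k) (gegen \<nu> k))"
    using d by (simp add: diff_eq_eq)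
  then show ?case by blast
qed auto

text \<open>Uniqueness behind the \<open>THE\<close>: if the families agree below degree l,
  subtracting a suitable multiple of \<open>gegen \<nu> l\<close> from \<open>C l\<close> leaves a
  polynomial of lower degree that is orthogonal to all lower members, hence 0. The norm fixes the
  multiple up to sign, and the positive leading coefficients fix the sign.\<close>

proposition gegenbauer_eq_gegen:
  assumes \<nu>: "\<nu> \<ge> 0"
  shows "gegenbauer \<nu> = gegen \<nu>"
  unfolding gegenbauer_def
proof (rule the_equality)
  show "(\<forall>l. degree (gegen \<nu> l) = l \<and> 0 < lead_coeff (gegen \<nu> l)) \<and>
     (\<forall>l k. (LINT t:{-1..1}|lborel. poly (gegen \<nu> l) t * poly (gegen \<nu> k) t * (1 - t\<^sup>2) powr (\<nu> - 1 / 2))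
              = (if l = k then gegenbauer_norm \<nu> l else 0))"
    using degree_gegen[OF \<nu>] lead_coeff_gegen_pos[OF \<nu>] gegen_orthogonal[OF \<nu>]
    by (simp add: gegen_inner_def)
next
  fix C assume "(\<forall>l. degree (C l) = l \<and> 0 < lead_coeff (C l)) \<and>
     (\<forall>l k. (LINT t:{-1..1}|lborel. poly (C l) t * poly (C k) t * (1 - t\<^sup>2) powr (\<nu> - 1 / 2))
              = (if l = k then gegenbauer_norm \<nu> l else 0))"
  then have deg: "\<And>l. degree (C l) = l" and lead: "\<And>l. 0 < lead_coeff (C l)"
    and orth: "\<And>l k. gegen_inner \<nu> (C l) (C k) = (if l = k then gegenbauer_norm \<nu> l else 0)"
    unfolding gegen_inner_def by blast+
  have "C l = gegen \<nu> l" for l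
  proof (induction l rule: less_induct)
    case (less l)
    define c where "c = lead_coeff (C l) / lead_coeff (gegen \<nu> l)"
    have c0: "c > 0" using lead lead_coeff_gegen_pos[OF \<nu>] by (simp add: c_def)
    let ?q = "C l - smult c (gegen \<nu> l)"
    have "coeff ?q i = 0" if "i \<ge> l" for i
    proof (cases "i = l")
      case True
      then show ?thesis using lead_coeff_gegen_pos[OF \<nu>, of l] by (simp add: c_def degree_gegen[OF \<nu>] deg)
    qed (use that in \<open>simp add: coeff_eq_0 degree_gegen[OF \<nu>] deg\<close>)
    then have "degree ?q < l \<or> ?q = 0" by (metis leI leading_coeff_0_iff)
    from gegen_expansion[OF \<nu> this] obtain d where d: "?q = (\<Sum>k<l. smult (d k) (gegen \<nu> k))" by blast
    have "d k = 0" if k: "k < l" for k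
    proof -
      have "gegen_inner \<nu> ?q (gegen \<nu> k) = 0"
        using orth[of l k] less[OF k] k gegen_orthogonal[OF \<nu>, of l k] by (simp add: gegen_inner_diff_smult[OF \<nu>])
      moreover have "gegen_inner \<nu> ?q (gegen \<nu> k) = (\<Sum>i<l. d i * gegen_inner \<nu> (gegen \<nu> i) (gegen \<nu> k))"
        unfolding d by (rule gegen_inner_sum[OF \<nu>])
      moreover have "\<dots> = (\<Sum>i\<in>{k}. d i * gegen_inner \<nu> (gegen \<nu> i) (gegen \<nu> k))"
        by (rule sum.mono_neutral_right) (use k in \<open>auto simp: gegen_orthogonal[OF \<nu>]\<close>)
      ultimately show ?thesis using gegenbauer_norm_pos[OF \<nu>, of k] by (simp add: gegen_orthogonal[OF \<nu>])
    qed
    then have "?q = 0" unfolding d by simp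
    then have Cl: "C l = smult c (gegen \<nu> l)" by simp
    have "gegenbauer_norm \<nu> l = c * (c * gegenbauer_norm \<nu> l)"
      using orth[of l l] gegen_orthogonal[OF \<nu>, of l l] unfolding Cl
      by (simp add: gegen_inner_smult[OF \<nu>] gegen_inner_commute[of \<nu> "gegen \<nu> l" "smult c (gegen \<nu> l)"])
    then have "c * c = 1" using gegenbauer_norm_pos[OF \<nu>, of l] by (metis mult.assoc mult_cancel_right1 less_irrefl)
    then have "c = 1" using c0 by (simp add: square_eq_1_iff)
    then show ?case using Cl by simp
  qed
  then show "C = gegen \<nu>" by (simp add: fun_eq_iff)
qed

text \<open>This is the recursion that integration by parts on the sphere will produce: two steps
  down in k, or one step down in both k and m. The indices are truncated only for k = 1 or m = 0,
  and then their coefficients are 0.\<close>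

lemma gegen_moment_value_rec:
  assumes \<nu>: "\<nu> \<ge> 0" and k: "k > 0"
  shows "(real k + real m + 2 * \<nu>) * gegen_moment_value \<nu> m k
    = real (k - 1) * gegen_moment_value \<nu> m (k - 2) + real m * gegen_moment_value \<nu> (m - 1) (k - 1)"
proof -
  consider "odd (k + m)" | "even (k + m)" "k < m" | j where "k = m + 2 * j"
  proof -
    assume *: "odd (k + m) \<Longrightarrow> thesis" "even (k + m) \<Longrightarrow> k < m \<Longrightarrow> thesis" "\<And>j. k = m + 2 * j \<Longrightarrow> thesis"
    show thesis
    proof (cases "odd (k + m) \<or> k < m")
      case False
      then have "even (k - m)" "m \<le> k" by auto
      then obtain j where "k - m = 2 * j" by blast
      then show ?thesis using \<open>m \<le> k\<close> *(3)[of j] by simp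
    qed (use * in blast)
  qed
  then show ?thesis
  proof cases
    case 1
    have "real (k - 1) * gegen_moment_value \<nu> m (k - 2) = 0"
      using 1 k by (cases "k = 1") (auto simp: gegen_moment_value_def)
    moreover have "real m * gegen_moment_value \<nu> (m - 1) (k - 1) = 0"
      using 1 k by (cases "m = 0") (auto simp: gegen_moment_value_def)
    moreover have "gegen_moment_value \<nu> m k = 0" using 1 by (simp add: gegen_moment_value_def)
    ultimately show ?thesis by (simp only: mult_zero_right add_0)
  next
    case 2
    then have "k - 2 < m" "k - 1 < m - 1" using k by auto
    with 2 have "gegen_moment_value \<nu> m k = 0" "gegen_moment_value \<nu> m (k - 2) = 0" "gegen_moment_value \<nu> (m - 1) (k - 1) = 0"
      by (simp_all add: gegen_moment_value_def)
    then show ?thesis by (simp only: mult_zero_right add_0)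
  next
    case (3 j)
    define K where "K = sqrt pi * Gamma (\<nu> + 1 / 2)"
    define x where "x = \<nu> + real m + real j"
    have x0: "x > 0" using k 3 \<nu> by (cases "m = 0") (auto simp: x_def)
    define H where "H = Gamma x"
    have G: "Gamma (\<nu> + 1 + real (m + j)) = x * H"
      using Gamma_step[OF x0] by (simp add: H_def x_def add_ac)
    define F where "F = K * fact (k - 1) / (2 ^ (k - 1) * fact j * H)"
    have fk: "fact k = real k * fact (k - 1)" using k by (simp add: fact_reduce)
    have pk: "(2::real) ^ k = 2 * 2 ^ (k - 1)" using k by (cases k) auto
    have 0: "gegen_moment_value \<nu> m k = F * real k / (2 * x)"
    proof -
      have gen: "K * (a * f) / (2 * p * q * (x * H)) = K * f / (p * q * H) * a / (2 * x)" for a f p q :: real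
        by (simp add: mult_ac)
      show ?thesis
        using gegen_moment_value_eq[of \<nu> m j] unfolding 3[symmetric] G fk pk K_def[symmetric] F_def gen .
    qed
    have 1: "real (k - 1) * gegen_moment_value \<nu> m (k - 2) = F * (2 * real j)"
    proof (cases j)
      case 0
      then show ?thesis using 3 k by (cases "k = 1") (auto simp: gegen_moment_value_def)
    next
      case (Suc i)
      have k2: "k - 2 = m + 2 * i" using 3 Suc by simp
      have f1: "fact (k - 1) = real (k - 1) * fact (k - 2)"
        using 3 Suc by (simp add: fact_reduce numeral_2_eq_2)
      have p1: "(2::real) ^ (k - 1) = 2 * 2 ^ (k - 2)"
        using 3 Suc by simp
      have g: "\<nu> + 1 + real (m + i) = x" using Suc by (simp add: x_def)
      have fj: "fact j = (real j) * fact i" using Suc by simp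
      have j0: "real j > 0" using Suc by simp
      have gen: "a * (K * f / (p * q * H)) = K * (a * f) / (2 * p * (b * q) * H) * (2 * b)" if "b > 0" for a b f p q :: real
        using that by (simp add: mult_ac)
      show ?thesis
        using gegen_moment_value_eq[of \<nu> m i] unfolding k2[symmetric] g H_def[symmetric] K_def[symmetric] F_def f1 p1 fj
        by (simp only: gen[OF j0])
    qed
    have 2: "real m * gegen_moment_value \<nu> (m - 1) (k - 1) = F * real m"
    proof (cases m)
      case (Suc i)
      have k2: "k - 1 = (m - 1) + 2 * j" using 3 Suc by simp
      have g: "\<nu> + 1 + real (m - 1 + j) = x" using Suc by (simp add: x_def)
      show ?thesis
        using gegen_moment_value_eq[of \<nu> "m - 1" j] unfolding k2[symmetric] g H_def[symmetric] K_def[symmetric] F_def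
        by simp
    qed simp
    have e: "real k + real m + 2 * \<nu> = 2 * x" and k': "real k = 2 * real j + real m" using 3 by (simp_all add: x_def)
    have "2 * x * (F * real k / (2 * x)) = F * real k" using x0 by simp
    then show ?thesis unfolding 0 1 2 e by (simp add: k' distrib_left)
  qed
qed

section \<open>The Funk-Hecke formula\<close>

lemma polynomial_function_inner_power: "polynomial_function (\<lambda>y::'a::euclidean_space. (x \<bullet> y) ^ k)"
proof (induction k)
  case (Suc k)
  from polynomial_function_mult[OF polynomial_function_inner_left this] show ?case by simp
qed auto

lemma dir_deriv_inner_power:
  "dir_deriv v (\<lambda>y::'a::euclidean_space. (x \<bullet> y) ^ k) y = real k * (x \<bullet> y) ^ (k - 1) * (x \<bullet> v)"
proof -
  have "((\<lambda>y. (x \<bullet> y) ^ k) has_derivative (\<lambda>v. real k * (x \<bullet> y) ^ (k - 1) * (x \<bullet> v))) (at y)"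
    by (auto intro!: derivative_eq_intros simp: mult_ac)
  from dir_deriv_eq[OF this] show ?thesis .
qed

text \<open>The polynomial witness in \<open>spherical_harmonic\<close>, restated with
  \<open>dir_deriv\<close> so that derivatives can be iterated. Homogeneity is demanded for all real
  t, which includes the parity of p.\<close>

definition harmonic_polynomial :: "nat \<Rightarrow> ('a::euclidean_space \<Rightarrow> complex) \<Rightarrow> bool" where
  "harmonic_polynomial m p \<longleftrightarrow> polynomial_function p \<and> (\<forall>t x. p (t *\<^sub>R x) = (t ^ m) *\<^sub>R p x) \<and>
    (\<forall>x. (\<Sum>b\<in>Basis. dir_deriv b (dir_deriv b p) x) = 0)"

text \<open>The Laplacian commutes with the derivative along v. The chain rule gives homogeneity of
  the derivative for t > 0; negative t follow from the parity of p, and t = 0 from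
  continuity.\<close>

lemma harmonic_polynomial_dir_deriv:
  assumes p: "harmonic_polynomial (Suc m) p"
  shows "harmonic_polynomial m (dir_deriv v p)"
proof -
  have pf: "polynomial_function p" and hom: "\<And>t x. p (t *\<^sub>R x) = (t ^ Suc m) *\<^sub>R p x"
    and lap: "\<And>x. (\<Sum>b\<in>Basis. dir_deriv b (dir_deriv b p) x) = 0"
    using p by (auto simp: harmonic_polynomial_def)
  have dpf: "polynomial_function (dir_deriv v p)" for v by (rule polynomial_function_dir_deriv[OF pf])
  have pos: "dir_deriv v p (t *\<^sub>R x) = (t ^ m) *\<^sub>R dir_deriv v p x" if "t > 0" for t x
    using dir_deriv_homogeneous[OF pf hom that, of v x] that by simp
  have neg: "dir_deriv v p (- x) = ((-1) ^ m) *\<^sub>R dir_deriv v p x" for x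
  proof -
    have e: "p (- x + t *\<^sub>R v) = ((-1) ^ Suc m) *\<^sub>R p (x + (- t) *\<^sub>R v)" for t
      using hom[of "-1" "x + (- t) *\<^sub>R v"] by simp
    have "((\<lambda>t. p (x + t *\<^sub>R v)) has_vector_derivative dir_deriv v p x) (at (- 0))"
      using polynomial_function_line_derivative[OF pf, of x v 0] by simp
    then have "((\<lambda>t. p (x + t *\<^sub>R v)) \<circ> (\<lambda>t. - t) has_vector_derivative (-1) *\<^sub>R dir_deriv v p x) (at 0)"
      by (intro vector_diff_chain_at)
         (auto intro!: derivative_eq_intros simp: has_real_derivative_iff_has_vector_derivative[symmetric])
    then have "((\<lambda>t. ((-1) ^ Suc m) *\<^sub>R p (x + (- t) *\<^sub>R v)) has_vector_derivative ((-1) ^ Suc m) *\<^sub>R ((-1) *\<^sub>R dir_deriv v p x)) (at 0)"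
      unfolding o_def by (rule bounded_linear.has_vector_derivative[OF bounded_linear_scaleR_right])
    then have "((\<lambda>t. p (- x + t *\<^sub>R v)) has_vector_derivative ((-1) ^ m) *\<^sub>R dir_deriv v p x) (at 0)"
      by (simp only: e) simp
    then show ?thesis
      unfolding dir_deriv_def[of v p "- x"] by (rule vector_derivative_at)
  qed
  have "dir_deriv v p (t *\<^sub>R x) = (t ^ m) *\<^sub>R dir_deriv v p x" for t x
  proof (cases t "0::real" rule: linorder_cases)
    case greater
    then show ?thesis by (rule pos)
  next
    case less
    have "dir_deriv v p (t *\<^sub>R x) = dir_deriv v p (- ((- t) *\<^sub>R x))" by simp
    also have "\<dots> = ((-1) ^ m) *\<^sub>R ((- t) ^ m) *\<^sub>R dir_deriv v p x"
      using neg[of "(- t) *\<^sub>R x"] pos[of "- t" x] less by simp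
    also have "\<dots> = (t ^ m) *\<^sub>R dir_deriv v p x" by (simp flip: power_mult_distrib)
    finally show ?thesis .
  next
    case equal
    have c: "isCont (dir_deriv v p) 0" for x
      using continuous_on_polynomial_function[OF dpf, of UNIV] by (simp add: continuous_on_eq_continuous_at)
    have t1: "((\<lambda>s::real. dir_deriv v p (s *\<^sub>R x)) \<longlongrightarrow> dir_deriv v p 0) (at_right 0)"
      by (rule isCont_tendsto_compose[OF c]) (auto intro!: tendsto_eq_intros)
    have t2: "((\<lambda>s::real. (s ^ m) *\<^sub>R dir_deriv v p x) \<longlongrightarrow> (0 ^ m) *\<^sub>R dir_deriv v p x) (at_right 0)"
      by (intro tendsto_intros)
    have "eventually (\<lambda>s::real. (s ^ m) *\<^sub>R dir_deriv v p x = dir_deriv v p (s *\<^sub>R x)) (at_right 0)"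
      using eventually_at_right_less[of "0::real"] by eventually_elim (simp add: pos)
    from tendsto_unique[OF _ t1 Lim_transform_eventually[OF t2 this]]
    show ?thesis using equal by simp
  qed
  moreover have "(\<Sum>b\<in>Basis. dir_deriv b (dir_deriv b (dir_deriv v p)) x) = 0" for x
  proof -
    have "dir_deriv b (dir_deriv v p) = dir_deriv v (dir_deriv b p)" for b
      by (rule ext) (rule dir_deriv_commute[OF pf])
    then have "(\<Sum>b\<in>Basis. dir_deriv b (dir_deriv b (dir_deriv v p)) x) = (\<Sum>b\<in>Basis. dir_deriv v (dir_deriv b (dir_deriv b p)) x)"
      by (simp add: dir_deriv_commute[OF dpf])
    also have "\<dots> = dir_deriv v (\<lambda>x. \<Sum>b\<in>Basis. dir_deriv b (dir_deriv b p) x) x"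
      by (rule dir_deriv_eq[symmetric])
         (auto intro!: has_derivative_sum polynomial_function_has_derivative polynomial_function_dir_deriv pf)
    also have "\<dots> = 0" by (simp add: lap dir_deriv_const)
    finally show ?thesis .
  qed
  ultimately show ?thesis using dpf by (simp add: harmonic_polynomial_def)
qed

text \<open>Euler's identity writes (m + 1) p as the sum of the coordinates times the partial
  derivatives; integration by parts absorbs each coordinate and leaves a multiple of the integral of
  the Laplacian.\<close>

lemma harmonic_polynomial_integral_zero:
  fixes p :: "'a::euclidean_space \<Rightarrow> complex"
  assumes dim: "DIM('a) \<ge> 2" and p: "harmonic_polynomial (Suc m) p"
  shows "(LINT \<psi>|sphere_measure. p \<psi>) = 0"
proof -
  have pf: "polynomial_function p" and hom: "\<And>t x. p (t *\<^sub>R x) = (t ^ Suc m) *\<^sub>R p x"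
    and lap: "\<And>x. (\<Sum>b\<in>Basis. dir_deriv b (dir_deriv b p) x) = 0"
    using p by (auto simp: harmonic_polynomial_def)
  have dpf: "polynomial_function (dir_deriv v p)" for v by (rule polynomial_function_dir_deriv[OF pf])
  have ddpf: "polynomial_function (dir_deriv v (dir_deriv v p))" for v by (rule polynomial_function_dir_deriv[OF dpf])
  have euler: "(\<Sum>b\<in>Basis. (b \<bullet> \<psi>) *\<^sub>R dir_deriv b p \<psi>) = real (Suc m) *\<^sub>R p \<psi>" for \<psi>
  proof -
    have "(\<Sum>b\<in>Basis. (b \<bullet> \<psi>) *\<^sub>R dir_deriv b p \<psi>) = dir_deriv (\<Sum>b\<in>Basis. (\<psi> \<bullet> b) *\<^sub>R b) p \<psi>"
      using linear_sum[OF linear_dir_deriv[OF pf, of \<psi>], of "\<lambda>b. (\<psi> \<bullet> b) *\<^sub>R b" Basis]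
        linear_scale[OF linear_dir_deriv[OF pf, of \<psi>]]
      by (simp add: inner_commute)
    also have "\<dots> = real (Suc m) *\<^sub>R p \<psi>"
      unfolding euclidean_representation by (rule euler_homogeneous[OF pf hom])
    finally show ?thesis .
  qed
  have i1: "integrable sphere_measure (\<lambda>\<psi>::'a. (b \<bullet> \<psi>) *\<^sub>R dir_deriv b p \<psi>)" for b
    by (intro integrable_sphere_continuous continuous_intros continuous_on_polynomial_function[OF dpf])
  have i2: "integrable sphere_measure (\<lambda>\<psi>::'a. dir_deriv b (dir_deriv b p) \<psi>)" for b
    by (intro integrable_sphere_continuous continuous_on_polynomial_function[OF ddpf])
  let ?c = "real (m + DIM('a) - 1)"
  have "?c *\<^sub>R (real (Suc m) *\<^sub>R (LINT \<psi>|sphere_measure. p \<psi>))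
      = ?c *\<^sub>R (LINT \<psi>|sphere_measure. (\<Sum>b\<in>Basis. (b \<bullet> \<psi>) *\<^sub>R dir_deriv b p \<psi>))"
    unfolding euler integral_scaleR_right ..
  also have "\<dots> = (\<Sum>b\<in>Basis. ?c *\<^sub>R (LINT \<psi>|sphere_measure. (b \<bullet> \<psi>) *\<^sub>R dir_deriv b p \<psi>))"
    by (subst Bochner_Integration.integral_sum) (use i1 in \<open>simp_all add: scaleR_sum_right\<close>)
  also have "\<dots> = (\<Sum>b\<in>Basis. (LINT \<psi>|sphere_measure. dir_deriv b (dir_deriv b p) \<psi>))"
  proof (rule sum.cong[OF refl])
    fix b :: 'a
    have "harmonic_polynomial m (dir_deriv b p)" by (rule harmonic_polynomial_dir_deriv[OF p])
    then have "\<And>t x. dir_deriv b p (t *\<^sub>R x) = (t ^ m) *\<^sub>R dir_deriv b p x"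
      by (auto simp: harmonic_polynomial_def)
    then show "?c *\<^sub>R (LINT \<psi>|sphere_measure. (b \<bullet> \<psi>) *\<^sub>R dir_deriv b p \<psi>)
        = (LINT \<psi>|sphere_measure. dir_deriv b (dir_deriv b p) \<psi>)"
      by (intro sphere_integration_by_parts[OF dim dpf])
  qed
  also have "\<dots> = (LINT \<psi>|sphere_measure. (\<Sum>b\<in>Basis. dir_deriv b (dir_deriv b p) (\<psi>::'a)))"
    by (subst Bochner_Integration.integral_sum) (use i2 in simp_all)
  also have "\<dots> = 0" by (simp add: lap)
  finally show ?thesis using dim by auto
qed

text \<open>The instance m = k = 0 of Funk-Hecke, which anchors the induction below: the volume of
  the sphere is that of its equator times the integral of the weight. With the closed forms it is a
  cancellation of Gamma values.\<close>

lemma sphere_vol_gegen_moment: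
  assumes dim: "DIM('a::euclidean_space) \<ge> 2"
  shows "measure (sphere_measure :: 'a measure) (sphere 0 1)
    = sphere_vol (DIM('a) - 2) * gegen_moment_value ((real DIM('a) - 2) / 2) 0 0"
proof -
  let ?d = "real DIM('a)"
  have nn: "sphere_vol k \<ge> 0" for k by (auto simp: sphere_vol_def intro!: divide_nonneg_nonneg Gamma_real_nonneg)
  have 1: "real (DIM('a) - 2 + 1) / 2 = (?d - 1) / 2" using dim by (simp add: of_nat_diff)
  have 2: "real (DIM('a) - 1 + 1) / 2 = ?d / 2" using dim by simp
  have g: "Gamma ((?d - 1) / 2) > 0" using dim by simp
  have "sphere_vol (DIM('a) - 2) * gegen_moment_value ((?d - 2) / 2) 0 0
      = 2 * pi powr ((?d - 1) / 2) / Gamma ((?d - 1) / 2) * (sqrt pi * Gamma ((?d - 1) / 2) / Gamma (?d / 2))"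
    unfolding sphere_vol_def 1 gegen_moment_value_def by (simp add: diff_divide_distrib)
  also have "\<dots> = 2 * (pi powr ((?d - 1) / 2) * pi powr (1 / 2)) / Gamma (?d / 2)"
    using g by (simp add: powr_half_sqrt)
  also have "pi powr ((?d - 1) / 2) * pi powr (1 / 2) = pi powr (?d / 2)"
    by (simp add: powr_add[symmetric] diff_divide_distrib)
  also have "2 * pi powr (?d / 2) / Gamma (?d / 2) = sphere_vol (DIM('a) - 1)"
    unfolding sphere_vol_def 2 ..
  finally show ?thesis by (simp add: measure_def emeasure_sphere_measure nn)
qed

text \<open>Integration by parts in the direction x lowers k. The derivative falls either on the
  power of x \<bullet> \<psi> or on p; in the second case the derivative of p along x is harmonic of
  degree m - 1 and, by Euler, takes the value m p(x) at x. The outcome is the recursion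
  \<open>gegen_moment_value_rec\<close>.\<close>

lemma funk_hecke_power:
  fixes p :: "'a::euclidean_space \<Rightarrow> complex"
  assumes dim: "DIM('a) \<ge> 2" and x: "norm x = 1" and p: "harmonic_polynomial m p"
  shows "(LINT \<psi>|sphere_measure. ((x \<bullet> \<psi>) ^ k) *\<^sub>R p \<psi>)
    = (sphere_vol (DIM('a) - 2) * gegen_moment_value ((real DIM('a) - 2) / 2) m k) *\<^sub>R p x"
  using p
proof (induction k arbitrary: m p rule: less_induct)
  case (less k)
  let ?V = "gegen_moment_value ((real DIM('a) - 2) / 2)" and ?s = "sphere_vol (DIM('a) - 2)"
  have \<nu>: "(real DIM('a) - 2) / 2 \<ge> 0" using dim by simp
  have pf: "polynomial_function p" and hom: "\<And>t x. p (t *\<^sub>R x) = (t ^ m) *\<^sub>R p x"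
    using less.prems by (auto simp: harmonic_polynomial_def)
  have const: "p y = p 0" if "m = 0" for y using hom[of 0 y] that by simp
  show ?case
  proof (cases "k = 0")
    case True
    show ?thesis
    proof (cases m)
      case 0
      have "(LINT \<psi>|sphere_measure. p \<psi>) = (LINT (\<psi>::'a)|sphere_measure. p 0)"
        by (rule Bochner_Integration.integral_cong) (use const[OF 0] in auto)
      then show ?thesis
        using True 0 sphere_vol_gegen_moment[OF dim] const[OF 0, of x] by simp
    next
      case (Suc m')
      then show ?thesis
        using True harmonic_polynomial_integral_zero[OF dim, of m' p] less.prems by (simp add: gegen_moment_value_def)
    qed
  next
    case False
    let ?q = "\<lambda>y. ((x \<bullet> y) ^ (k - 1)) *\<^sub>R p y"
    have dpf: "polynomial_function (dir_deriv x p)" by (rule polynomial_function_dir_deriv[OF pf])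
    have i1: "integrable sphere_measure (\<lambda>\<psi>::'a. (x \<bullet> \<psi>) ^ j *\<^sub>R p \<psi>)" for j
      by (intro integrable_sphere_continuous continuous_intros continuous_on_polynomial_function[OF pf])
    have i2: "integrable sphere_measure (\<lambda>\<psi>::'a. (x \<bullet> \<psi>) ^ j *\<^sub>R dir_deriv x p \<psi>)" for j
      by (intro integrable_sphere_continuous continuous_intros continuous_on_polynomial_function[OF dpf])
    have dq: "dir_deriv x ?q \<psi> = real (k - 1) *\<^sub>R ((x \<bullet> \<psi>) ^ (k - 2) *\<^sub>R p \<psi>) + (x \<bullet> \<psi>) ^ (k - 1) *\<^sub>R dir_deriv x p \<psi>" for \<psi>
      using x by (subst dir_deriv_scaleR[OF polynomial_function_inner_power pf])
        (simp add: dir_deriv_inner_power dot_square_norm numeral_2_eq_2)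
    have "real (k - 1 + m + DIM('a) - 1) *\<^sub>R (LINT \<psi>|sphere_measure. (x \<bullet> \<psi>) *\<^sub>R ?q \<psi>) = (LINT \<psi>|sphere_measure. dir_deriv x ?q \<psi>)"
      by (rule sphere_integration_by_parts[OF dim polynomial_function_mult[OF polynomial_function_inner_power pf]])
         (simp add: hom power_add power_mult_distrib mult_ac)
    also have "\<dots> = real (k - 1) *\<^sub>R (LINT \<psi>|sphere_measure. (x \<bullet> \<psi>) ^ (k - 2) *\<^sub>R p \<psi>)
        + (LINT \<psi>|sphere_measure. (x \<bullet> \<psi>) ^ (k - 1) *\<^sub>R dir_deriv x p \<psi>)"
      unfolding dq
      by (simp only: Bochner_Integration.integral_add[OF integrable_scaleR_right[OF i1] i2] integral_scaleR_right)
    also have "real (k - 1) *\<^sub>R (LINT \<psi>|sphere_measure. (x \<bullet> \<psi>) ^ (k - 2) *\<^sub>R p \<psi>)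
        = (real (k - 1) * (?s * ?V m (k - 2))) *\<^sub>R p x"
      using less.IH[of "k - 2" m p] less.prems False by (cases "k = 1") auto
    also have "(LINT \<psi>|sphere_measure. (x \<bullet> \<psi>) ^ (k - 1) *\<^sub>R dir_deriv x p \<psi>)
        = (real m * (?s * ?V (m - 1) (k - 1))) *\<^sub>R p x"
    proof (cases m)
      case 0
      have "dir_deriv x p = (\<lambda>y. 0)"
      proof
        fix y
        have "p = (\<lambda>_. p 0)" using const[OF 0] by auto
        then show "dir_deriv x p y = 0" by (metis dir_deriv_const)
      qed
      then show ?thesis using 0 by simp
    next
      case (Suc m')
      have "harmonic_polynomial m' (dir_deriv x p)" using less.prems Suc by (intro harmonic_polynomial_dir_deriv) simp
      from less.IH[OF _ this, of "k - 1"] have "(LINT \<psi>|sphere_measure. (x \<bullet> \<psi>) ^ (k - 1) *\<^sub>R dir_deriv x p \<psi>)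
          = (?s * ?V m' (k - 1)) *\<^sub>R dir_deriv x p x" using False by simp
      also have "dir_deriv x p x = real m *\<^sub>R p x" by (rule euler_homogeneous[OF pf hom])
      finally show ?thesis using Suc by (simp add: mult_ac)
    qed
    finally have "real (k - 1 + m + DIM('a) - 1) *\<^sub>R (LINT \<psi>|sphere_measure. (x \<bullet> \<psi>) *\<^sub>R ?q \<psi>)
        = (?s * (real (k - 1) * ?V m (k - 2) + real m * ?V (m - 1) (k - 1))) *\<^sub>R p x"
      by (simp add: algebra_simps)
    also have "real (k - 1) * ?V m (k - 2) + real m * ?V (m - 1) (k - 1)
        = real (k - 1 + m + DIM('a) - 1) * ?V m k"
    proof -
      have "real (k - 1 + m + DIM('a) - 1) = real k + real m + 2 * ((real DIM('a) - 2) / 2)"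
        using False dim by (simp add: of_nat_diff)
      then show ?thesis using gegen_moment_value_rec[OF \<nu>, of k m] False by simp
    qed
    finally have "real (k - 1 + m + DIM('a) - 1) *\<^sub>R (LINT \<psi>|sphere_measure. (x \<bullet> \<psi>) *\<^sub>R ?q \<psi>)
        = real (k - 1 + m + DIM('a) - 1) *\<^sub>R ((?s * ?V m k) *\<^sub>R p x)"
      by (simp add: mult.left_commute)
    moreover have "real (k - 1 + m + DIM('a) - 1) \<noteq> 0" using dim by simp
    ultimately have "(LINT \<psi>|sphere_measure. (x \<bullet> \<psi>) *\<^sub>R ?q \<psi>) = (?s * ?V m k) *\<^sub>R p x"
      by (rule scaleR_left_imp_eq[rotated])
    moreover have "(x \<bullet> \<psi>) *\<^sub>R ?q \<psi> = ((x \<bullet> \<psi>) ^ k) *\<^sub>R p \<psi>" for \<psi>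
      using False by (cases k) auto
    ultimately show ?thesis by (simp only:)
  qed
qed

text \<open>Powers of x \<bullet> \<psi> give the moments of \<open>gegen \<nu> m\<close>, and
  uniform approximation extends this to continuous profiles. The index \<nu> = (D - 2)/2, with D the
  dimension, makes the Gegenbauer weight equal to the slice measure (1 - u^2)^((D - 3)/2)
  du.\<close>

proposition funk_hecke:
  fixes p :: "'a::euclidean_space \<Rightarrow> complex" and \<phi> :: "real \<Rightarrow> real"
  assumes dim: "DIM('a) \<ge> 2" and x: "norm x = 1" and p: "harmonic_polynomial m p"
    and \<phi>: "continuous_on {-1..1} \<phi>" and \<nu>_def: "\<nu> = (real DIM('a) - 2) / 2"
  shows "(LINT \<psi>|sphere_measure. \<phi> (x \<bullet> \<psi>) *\<^sub>R p \<psi>)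
    = (sphere_vol (DIM('a) - 2) * (LINT u:{-1..1}|lborel. \<phi> u * poly (gegen \<nu> m) u * (1 - u\<^sup>2) powr (\<nu> - 1 / 2))) *\<^sub>R p x"
proof -
  let ?s = "sphere_vol (DIM('a) - 2)"
  have \<nu>: "\<nu> \<ge> 0" using dim unfolding \<nu>_def by simp
  define h where "h u = max (-1) (min 1 u)" for u :: real
  define w where "w u = indicator {-1..1} u * (poly (gegen \<nu> m) u * (1 - u\<^sup>2) powr (\<nu> - 1 / 2))" for u :: real
  have wi: "integrable lborel w"
    using poly_weight_integrable[OF \<nu>, of "gegen \<nu> m"] unfolding w_def set_integrable_def by simp
  have pf: "polynomial_function p" using p by (simp add: harmonic_polynomial_def)
  have eb: "x \<bullet> \<psi> \<in> {-1..1}" if "\<psi> \<in> space (sphere_measure :: 'a measure)" for \<psi>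
    using inner_unit_bounds[OF x] that by auto
  have hw: "g (h u) *\<^sub>R ((?s * w u) *\<^sub>R p x) = (indicator {-1..1} u *\<^sub>R (g u * poly (gegen \<nu> m) u * (1 - u\<^sup>2) powr (\<nu> - 1 / 2))) *\<^sub>R (?s *\<^sub>R p x)"
    for g :: "real \<Rightarrow> real" and u
    by (auto simp: h_def w_def split: split_indicator)
  have R: "(LINT u|lborel. g (h u) *\<^sub>R ((?s * w u) *\<^sub>R p x))
      = (?s * (LINT u:{-1..1}|lborel. g u * poly (gegen \<nu> m) u * (1 - u\<^sup>2) powr (\<nu> - 1 / 2))) *\<^sub>R p x"
    if "continuous_on {-1..1} g" for g
  proof -
    have "set_integrable lborel {-1..1} (\<lambda>u. g u * poly (gegen \<nu> m) u * (1 - u\<^sup>2) powr (\<nu> - 1 / 2))"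
      using gegenbauer_weight_integrable_continuous[of "\<nu> - 1 / 2" "\<lambda>u. g u * poly (gegen \<nu> m) u"] \<nu> that
      by (simp add: mult.commute continuous_on_mult continuous_on_poly)
    then show ?thesis
      unfolding hw set_lebesgue_integral_def set_integrable_def
      by (subst integral_scaleR_left) (simp_all add: mult.commute)
  qed
  have "(LINT \<psi>|sphere_measure. \<phi> (x \<bullet> \<psi>) *\<^sub>R p \<psi>) = (LINT u|lborel. \<phi> (h u) *\<^sub>R ((?s * w u) *\<^sub>R p x))"
  proof (rule integral_eq_of_polynomials[where K="{-1..1}" and g=\<phi> and ?h2.0=h and ?h1.0="\<lambda>\<psi>. x \<bullet> \<psi>"])
    show "(\<lambda>\<psi>. x \<bullet> \<psi>) \<in> borel_measurable sphere_measure"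
      by (intro borel_measurable_sphere_continuous continuous_intros)
    show "integrable sphere_measure p"
      by (intro integrable_sphere_continuous continuous_on_polynomial_function[OF pf])
    show "h \<in> borel_measurable lborel" unfolding h_def by measurable
    show "integrable lborel (\<lambda>u. (?s * w u) *\<^sub>R p x)" using wi by simp
    fix q :: "real \<Rightarrow> real" assume "real_polynomial_function q"
    then obtain c n where q: "q = (\<lambda>x. \<Sum>i\<le>n. c i * x ^ i)" using real_polynomial_function_imp_sum by blast
    have qc: "continuous_on {-1..1} q" unfolding q by (intro continuous_intros)
    have I1: "integrable sphere_measure (\<lambda>\<psi>::'a. c i *\<^sub>R ((x \<bullet> \<psi>) ^ i *\<^sub>R p \<psi>))" for i
      by (intro integrable_sphere_continuous continuous_intros continuous_on_polynomial_function[OF pf])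
    have I2: "integrable lborel (\<lambda>u. indicator {-1..1} u *\<^sub>R (c i * (u ^ i * poly (gegen \<nu> m) u * (1 - u\<^sup>2) powr (\<nu> - 1 / 2))))" for i
      using set_integrable_mult_right[of "c i", OF poly_weight_integrable_power[OF \<nu>, of i "gegen \<nu> m"]]
      by (simp add: set_integrable_def)
    have "(LINT \<psi>|sphere_measure. q (x \<bullet> \<psi>) *\<^sub>R p \<psi>) = (LINT \<psi>|sphere_measure. (\<Sum>i\<le>n. c i *\<^sub>R ((x \<bullet> \<psi>) ^ i *\<^sub>R p \<psi>)))"
      by (simp add: q scaleR_sum_left)
    also have "\<dots> = (\<Sum>i\<le>n. c i *\<^sub>R (LINT \<psi>|sphere_measure. (x \<bullet> \<psi>) ^ i *\<^sub>R p \<psi>))"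
      by (simp only: Bochner_Integration.integral_sum[OF I1] integral_scaleR_right)
    also have "\<dots> = (\<Sum>i\<le>n. c i *\<^sub>R ((?s * gegen_moment \<nu> m i) *\<^sub>R p x))"
      by (simp only: funk_hecke_power[OF dim x p] gegen_moment_eq[OF \<nu>] flip: \<nu>_def)
    also have "\<dots> = (?s * (\<Sum>i\<le>n. c i * gegen_moment \<nu> m i)) *\<^sub>R p x"
      by (simp add: scaleR_sum_left sum_distrib_left mult.left_commute)
    also have "(\<Sum>i\<le>n. c i * gegen_moment \<nu> m i) = (LINT u:{-1..1}|lborel. q u * poly (gegen \<nu> m) u * (1 - u\<^sup>2) powr (\<nu> - 1 / 2))"
    proof -
      have "(LINT u:{-1..1}|lborel. q u * poly (gegen \<nu> m) u * (1 - u\<^sup>2) powr (\<nu> - 1 / 2))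
          = (LINT u|lborel. (\<Sum>i\<le>n. indicator {-1..1} u *\<^sub>R (c i * (u ^ i * poly (gegen \<nu> m) u * (1 - u\<^sup>2) powr (\<nu> - 1 / 2)))))"
        unfolding set_lebesgue_integral_def
        by (rule Bochner_Integration.integral_cong) (simp_all add: q sum_distrib_right sum_distrib_left mult.assoc)
      also have "\<dots> = (\<Sum>i\<le>n. c i * gegen_moment \<nu> m i)"
        unfolding gegen_moment_def set_lebesgue_integral_def
        by (subst Bochner_Integration.integral_sum) (use I2 in \<open>simp_all add: mult.left_commute\<close>)
      finally show ?thesis ..
    qed
    finally show "(LINT \<psi>|sphere_measure. q (x \<bullet> \<psi>) *\<^sub>R p \<psi>) = (LINT u|lborel. q (h u) *\<^sub>R ((?s * w u) *\<^sub>R p x))"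
      unfolding R[OF qc] .
  qed (use eb \<phi> in \<open>auto simp: h_def\<close>)
  then show ?thesis unfolding R[OF \<phi>] .
qed

lemma borel_measurable_poly [measurable]:
  fixes p :: "real poly"
  assumes "f \<in> borel_measurable M"
  shows "(\<lambda>x. poly p (f x)) \<in> borel_measurable M"
  using measurable_compose[OF assms borel_measurable_continuous_onI[of "poly p"]]
  by (simp add: continuous_on_poly)

section \<open>The kernel as a density of spherical averages\<close>

lemma measurable_ident_sphere:
  "(\<lambda>x. x) \<in> (sphere_measure :: 'a::euclidean_space measure) \<rightarrow>\<^sub>M borel"
  by (rule borel_measurable_sphere_continuous) (rule continuous_on_id)

text \<open>Continuity and compact support in z give joint integrability, so the two integrals may
  be exchanged before z is written in polar coordinates.\<close>

lemma sphere_lborel_polar: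
  fixes F :: "'a::euclidean_space \<Rightarrow> 'a \<Rightarrow> complex"
  assumes F: "continuous_on UNIV (\<lambda>(\<psi>, z). F \<psi> z)"
    and supp: "\<And>\<psi> z. norm \<psi> = 1 \<Longrightarrow> norm z > \<beta> \<Longrightarrow> F \<psi> z = 0"
  shows "(LINT \<psi>|sphere_measure. LINT z|lborel. F \<psi> z)
    = (LINT r:{0<..}|lborel. r ^ (DIM('a) - 1) *\<^sub>R (LINT \<zeta>|sphere_measure. LINT \<psi>|sphere_measure. F \<psi> (r *\<^sub>R \<zeta>)))"
proof -
  interpret S: finite_measure "sphere_measure :: 'a measure" by (rule finite_measure_sphere)
  interpret P: pair_sigma_finite "sphere_measure :: 'a measure" "lborel :: 'a measure" ..
  have Fm: "(\<lambda>(\<psi>, z). F \<psi> z) \<in> borel_measurable (borel \<Otimes>\<^sub>M borel)"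
    unfolding borel_prod using F by (rule borel_measurable_continuous_onI)
  have m: "(\<lambda>(\<psi>, z). F \<psi> z) \<in> borel_measurable (sphere_measure \<Otimes>\<^sub>M lborel)"
  proof -
    have "fst \<in> (sphere_measure :: 'a measure) \<Otimes>\<^sub>M (lborel :: 'a measure) \<rightarrow>\<^sub>M borel"
      using measurable_compose[OF measurable_fst[of "sphere_measure :: 'a measure" "lborel :: 'a measure"] measurable_ident_sphere] .
    moreover have "snd \<in> (sphere_measure :: 'a measure) \<Otimes>\<^sub>M (lborel :: 'a measure) \<rightarrow>\<^sub>M borel"
      using measurable_snd[of "sphere_measure :: 'a measure" "lborel :: 'a measure"] by simp
    ultimately have "(\<lambda>q. (fst q, snd q)) \<in> (sphere_measure :: 'a measure) \<Otimes>\<^sub>M (lborel :: 'a measure) \<rightarrow>\<^sub>M borel \<Otimes>\<^sub>M borel"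
      by (rule measurable_Pair)
    from measurable_compose[OF this Fm] show ?thesis by (simp add: case_prod_beta')
  qed
  have "compact ((\<lambda>(\<psi>, z). F \<psi> z) ` (sphere 0 1 \<times> cball 0 \<beta>))"
    by (intro compact_continuous_image continuous_on_subset[OF F] compact_Times) auto
  then have "bounded ((\<lambda>(\<psi>, z). F \<psi> z) ` (sphere 0 1 \<times> cball 0 \<beta>))" by (rule compact_imp_bounded)
  then obtain B where B: "\<And>\<psi> z. norm \<psi> = 1 \<Longrightarrow> norm z \<le> \<beta> \<Longrightarrow> norm (F \<psi> z) \<le> B"
    unfolding bounded_iff by fastforce
  have int: "integrable (sphere_measure \<Otimes>\<^sub>M lborel) (\<lambda>(\<psi>, z). F \<psi> z)"
  proof (rule integrableI_bounded_set[where A="sphere 0 1 \<times> cball 0 \<beta>" and B=B])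
    have S: "sphere 0 1 \<in> sets (sphere_measure :: 'a measure)"
      using sets.top[of "sphere_measure :: 'a measure"] by simp
    then show "sphere 0 1 \<times> cball 0 \<beta> \<in> sets ((sphere_measure :: 'a measure) \<Otimes>\<^sub>M (lborel :: 'a measure))" by auto
    have "emeasure ((sphere_measure :: 'a measure) \<Otimes>\<^sub>M (lborel :: 'a measure)) (sphere 0 1 \<times> cball 0 \<beta>)
        = emeasure (sphere_measure :: 'a measure) (sphere 0 1) * emeasure lborel (cball (0::'a) \<beta>)"
      using S by (intro lborel.emeasure_pair_measure_Times) auto
    also have "\<dots> < \<infinity>"
      using emeasure_bounded_finite[of "cball (0::'a) \<beta>"]
      by (simp add: ennreal_mult_less_top emeasure_sphere_measure)
    finally show "emeasure ((sphere_measure :: 'a measure) \<Otimes>\<^sub>M (lborel :: 'a measure)) (sphere 0 1 \<times> cball 0 \<beta>) < \<infinity>" .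
    show "AE q in sphere_measure \<Otimes>\<^sub>M lborel. q \<in> sphere 0 1 \<times> cball 0 \<beta> \<longrightarrow> norm (case q of (\<psi>, z) \<Rightarrow> F \<psi> z) \<le> B"
      using B by (intro AE_I2) auto
    show "AE q in sphere_measure \<Otimes>\<^sub>M lborel. q \<notin> sphere 0 1 \<times> cball 0 \<beta> \<longrightarrow> (case q of (\<psi>, z) \<Rightarrow> F \<psi> z) = 0"
      by (intro AE_I2) (clarsimp simp: space_pair_measure, meson supp not_le)
  qed (rule m)
  have "(LINT \<psi>|sphere_measure. LINT z|lborel. F \<psi> z) = (LINT z|lborel. LINT \<psi>|sphere_measure. F \<psi> z)"
    using P.Fubini_integral[OF int] by simp
  also have "integrable lborel (\<lambda>z. LINT \<psi>|sphere_measure. F \<psi> z)" by (rule P.integrable_snd[OF int])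
  then have "(LINT z|lborel. LINT \<psi>|sphere_measure. F \<psi> z)
      = (LINT r:{0<..}|lborel. r ^ (DIM('a) - 1) *\<^sub>R (LINT \<zeta>|sphere_measure. LINT \<psi>|sphere_measure. F \<psi> (r *\<^sub>R \<zeta>)))"
    by (rule integral_polar)
  finally show ?thesis .
qed

lemma continuous_parametric_sphere_integral:
  fixes f :: "'c::metric_space \<Rightarrow> 'a::euclidean_space \<Rightarrow> 'b::euclidean_space"
  assumes T: "compact T" and f: "continuous_on (T \<times> sphere 0 1) (\<lambda>(t, \<omega>). f t \<omega>)"
  shows "continuous_on T (\<lambda>t. LINT \<omega>|sphere_measure. f t \<omega>)"
proof -
  interpret S: finite_measure "sphere_measure :: 'a measure" by (rule finite_measure_sphere)
  have "compact ((\<lambda>(t, \<omega>). f t \<omega>) ` (T \<times> sphere 0 1))"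
    by (intro compact_continuous_image f compact_Times T) auto
  then have "bounded ((\<lambda>(t, \<omega>). f t \<omega>) ` (T \<times> sphere 0 1))" by (rule compact_imp_bounded)
  then obtain B where B: "\<And>t \<omega>. t \<in> T \<Longrightarrow> norm \<omega> = 1 \<Longrightarrow> norm (f t \<omega>) \<le> B"
    unfolding bounded_iff by fastforce
  have c: "continuous_on (sphere 0 1) (f t)" if "t \<in> T" for t
  proof -
    have "continuous_on (sphere 0 1) (\<lambda>\<omega>. (t, \<omega>))" by (intro continuous_intros)
    from continuous_on_compose2[OF f this] that show ?thesis by auto
  qed
  show ?thesis
    unfolding continuous_on_sequentially
  proof (intro allI ballI impI, elim conjE)
    fix x a assume a: "a \<in> T" and x: "\<forall>n. x n \<in> T" "x \<longlonglongrightarrow> a"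
    have "(\<lambda>n. LINT \<omega>|sphere_measure. f (x n) \<omega>) \<longlonglongrightarrow> (LINT \<omega>|sphere_measure. f a \<omega>)"
    proof (rule integral_dominated_convergence[where w="\<lambda>_. B"])
      show "f a \<in> borel_measurable sphere_measure" "f (x n) \<in> borel_measurable sphere_measure" for n
        using a x(1) by (auto intro!: borel_measurable_sphere_continuous c)
      show "AE \<omega> in sphere_measure. (\<lambda>n. f (x n) \<omega>) \<longlonglongrightarrow> f a \<omega>"
      proof (rule AE_I2)
        fix \<omega> :: 'a assume "\<omega> \<in> space sphere_measure"
        then have w: "\<omega> \<in> sphere 0 1" by simp
        have "(\<lambda>n. (x n, \<omega>)) \<longlonglongrightarrow> (a, \<omega>)" using x by (intro tendsto_intros)
        then show "(\<lambda>n. f (x n) \<omega>) \<longlonglongrightarrow> f a \<omega>"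
          using f[unfolded continuous_on_sequentially, rule_format, of "(a, \<omega>)" "\<lambda>n. (x n, \<omega>)"] a x w
          by (auto simp: o_def)
      qed
      show "AE \<omega> in sphere_measure. norm (f (x n) \<omega>) \<le> B" for n
        using B x(1) by (intro AE_I2) auto
    qed (auto intro: S.integrable_const)
    then show "((\<lambda>t. LINT \<omega>|sphere_measure. f t \<omega>) \<circ> x) \<longlonglongrightarrow> (LINT \<omega>|sphere_measure. f a \<omega>)"
      by (simp add: o_def)
  qed
qed

text \<open>For \<open>D = n - 1\<close> this is the kernel \<open>h\<^sub>m\<^sub>,\<^sub>\<lambda>\<close> with \<open>t = tanh \<lambda>\<close>.\<close>

definition sphere_kernel :: "nat \<Rightarrow> nat \<Rightarrow> real \<Rightarrow> real \<Rightarrow> real" where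
  "sphere_kernel D m t r = (if 1 - t \<le> r \<and> r \<le> 1 + t then
     2 powi (3 - int D) * t powi (2 - int D) * r * poly (gegen ((real D - 2) / 2) m) ((r\<^sup>2 + 1 - t\<^sup>2) / (2 * r))
      * ((1 + t - r) * (1 + t + r) * (r - 1 + t) * (r + 1 - t)) powr ((real D - 3) / 2) else 0)"

section \<open>The kernel as a density in r and in t\<close>

text \<open>By Heron the product is 16 times the squared area of the triangle with sides 1, t and r.
  The two expansions express it through the cosine of the angle between the sides 1 and t, and
  between 1 and r.\<close>

lemma triangle_product:
  fixes r t :: real
  shows "(1 + t - r) * (1 + t + r) * (r - 1 + t) * (r + 1 - t) = 4 * t\<^sup>2 - (r\<^sup>2 - 1 - t\<^sup>2)\<^sup>2"
    and "(1 + t - r) * (1 + t + r) * (r - 1 + t) * (r + 1 - t) = 4 * r\<^sup>2 - (r\<^sup>2 + 1 - t\<^sup>2)\<^sup>2"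
  by (simp_all add: power2_eq_square algebra_simps)

lemma one_minus_square_quotient: "w \<noteq> 0 \<Longrightarrow> 1 - (u / w)\<^sup>2 = (w\<^sup>2 - u\<^sup>2) / w\<^sup>2" for u w :: real
  by (simp add: power_divide diff_divide_distrib)

lemma powr_half_powi:
  fixes x :: real
  assumes "x > 0"
  shows "(x\<^sup>2) powr ((real D - 3) / 2) = x powi (int D - 3)"
proof -
  have "(x\<^sup>2) powr e = x powr (2 * e)" for e
    using assms by (simp add: powr_powr flip: powr_numeral)
  moreover have "2 * ((real D - 3) / 2) = real D - 3" by simp
  ultimately have "(x\<^sup>2) powr ((real D - 3) / 2) = x powr (real D - 3)"
    by metis
  also have "\<dots> = x powr real_of_int (int D - 3)" by simp
  also have "\<dots> = x powi (int D - 3)" by (rule powr_real_of_int') (use assms in auto)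
  finally show ?thesis .
qed

lemma powr_quotient_powi:
  fixes w q :: real
  assumes w: "w > 0"
  shows "(q / w\<^sup>2) powr ((real D - 3) / 2) = q powr ((real D - 3) / 2) * w powi (3 - int D)"
proof -
  have i: "w powi (3 - int D) = inverse (w powi (int D - 3))"
    using power_int_minus[of w "int D - 3"] by simp
  show ?thesis unfolding powr_divide powr_half_powi[OF w] i by (rule divide_inverse)
qed

text \<open>Law of cosines: for u = \<psi> \<bullet> \<omega> the length r = |\<psi> + t \<omega>|
  is sqrt(1 + t^2 + 2 t u), and (1 + t u) / r is the cosine of the angle between \<psi> and \<psi> +
  t \<omega>. In the variable u the kernel becomes the Gegenbauer weight on the fixed interval
  [-1, 1], from which integrability and later continuity in t are read off.\<close>

lemma
  fixes g :: "real \<Rightarrow> complex"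
  assumes D: "D \<ge> 2" and t: "0 < t" "t < 1" and g: "continuous_on {1 - t..1 + t} g"
    and \<nu>_def: "\<nu> = (real D - 2) / 2"
  shows sphere_kernel_integrable: "integrable lborel (\<lambda>r. sphere_kernel D m t r *\<^sub>R g r)"
    and sphere_kernel_integral: "(LINT r|lborel. sphere_kernel D m t r *\<^sub>R g r)
      = (LINT u:{-1..1}|lborel. (1 - u\<^sup>2) powr (\<nu> - 1 / 2) *\<^sub>R
          (poly (gegen \<nu> m) ((1 + t * u) / sqrt (1 + t\<^sup>2 + 2 * t * u)) *\<^sub>R g (sqrt (1 + t\<^sup>2 + 2 * t * u))))"
proof -
  let ?S = "{1 - t..1 + t}"
  let ?x = "\<lambda>u. sqrt (1 + t\<^sup>2 + 2 * t * u)"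
  let ?f = "\<lambda>u. (1 - u\<^sup>2) powr (\<nu> - 1 / 2) *\<^sub>R (poly (gegen \<nu> m) ((1 + t * u) / ?x u) *\<^sub>R g (?x u))"
  let ?g = "\<lambda>r. (r\<^sup>2 - 1 - t\<^sup>2) / (2 * t)"
  have \<nu>: "\<nu> \<ge> 0" using D by (simp add: \<nu>_def)
  have x1: "1 - t \<le> ?x u \<and> ?x u \<le> 1 + t" if "u \<in> {-1..1}" for u
  proof -
    have "(1 - t)\<^sup>2 \<le> 1 + t\<^sup>2 + 2 * t * u" "1 + t\<^sup>2 + 2 * t * u \<le> (1 + t)\<^sup>2"
      using that t mult_left_mono[of "-1" u t] mult_left_mono[of u 1 t] by (auto simp: power2_eq_square algebra_simps)
    then show ?thesis
      using real_sqrt_le_mono[of "(1 - t)\<^sup>2" "1 + t\<^sup>2 + 2 * t * u"] real_sqrt_le_mono[of "1 + t\<^sup>2 + 2 * t * u" "(1 + t)\<^sup>2"] t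
      by simp
  qed
  have cx: "continuous_on {-1..1} ?x" by (intro continuous_intros)
  have cg: "continuous_on {-1..1} (\<lambda>u. poly (gegen \<nu> m) ((1 + t * u) / ?x u) *\<^sub>R g (?x u))"
    by (intro continuous_intros continuous_on_compose2[OF g cx] continuous_on_poly)
       (use x1 t in \<open>fastforce+\<close>)
  have fi: "set_integrable lborel {-1..1} ?f"
    by (rule gegenbauer_weight_integrable_continuous[OF _ cg]) (use \<nu> in simp)
  have gin: "?g r \<in> {-1..1}" if "r \<in> ?S" for r
  proof -
    have "(1 - t)\<^sup>2 \<le> r\<^sup>2" "r\<^sup>2 \<le> (1 + t)\<^sup>2" using that t by (auto intro!: power_mono)
    then show ?thesis using t by (simp add: divide_le_eq le_divide_eq power2_eq_square algebra_simps)
  qed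
  have xg: "?x (?g r) = r" if "r \<in> ?S" for r
  proof -
    have "1 + t\<^sup>2 + 2 * t * ?g r = r\<^sup>2" using t by simp
    then show ?thesis using that t by simp
  qed
  have gx: "?g (?x u) = u" if "u \<in> {-1..1}" for u
  proof -
    have "0 \<le> ?x u" using x1[OF that] t by linarith
    then have "0 \<le> 1 + t\<^sup>2 + 2 * t * u" by simp
    then show ?thesis using t by simp
  qed
  have img: "?g ` ?S = {-1..1}"
  proof (intro equalityI subsetI)
    fix u :: real assume u: "u \<in> {-1..1}"
    show "u \<in> ?g ` ?S" by (rule image_eqI[where x="?x u"]) (use gx[OF u] x1[OF u] in auto)
  qed (use gin in auto)
  have der: "(?g has_real_derivative r / t) (at r within ?S)" for r
    using t by (auto intro!: derivative_eq_intros)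
  have inj: "inj_on ?g ?S" by (rule inj_on_inverseI[where g="?x"]) (rule xg)
  have eq: "\<bar>r / t\<bar> *\<^sub>R ?f (?g r) = sphere_kernel D m t r *\<^sub>R g r" if r: "r \<in> ?S" for r
  proof -
    let ?Q = "(1 + t - r) * (1 + t + r) * (r - 1 + t) * (r + 1 - t)"
    have r0: "r > 0" using r t by simp
    have "1 - (?g r)\<^sup>2 = ((2 * t)\<^sup>2 - (r\<^sup>2 - 1 - t\<^sup>2)\<^sup>2) / (2 * t)\<^sup>2"
      by (rule one_minus_square_quotient) (use t in simp)
    also have "(2 * t)\<^sup>2 - (r\<^sup>2 - 1 - t\<^sup>2)\<^sup>2 = ?Q" unfolding triangle_product(1) by (simp add: power2_eq_square)
    finally have 1: "1 - (?g r)\<^sup>2 = ?Q / (2 * t)\<^sup>2" .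
    have Q0: "?Q \<ge> 0" using r t by (intro mult_nonneg_nonneg) auto
    have ex: "\<nu> - 1 / 2 = (real D - 3) / 2" by (simp add: \<nu>_def field_simps)
    have 2: "(1 - (?g r)\<^sup>2) powr (\<nu> - 1 / 2) = ?Q powr ((real D - 3) / 2) * (2 * t) powi (3 - int D)"
      unfolding 1 ex by (rule powr_quotient_powi) (use t in simp)
    have 3: "(1 + t * ?g r) / ?x (?g r) = (r\<^sup>2 + 1 - t\<^sup>2) / (2 * r)"
      unfolding xg[OF r] using t r0 by (simp add: field_simps)
    have 4: "(r / t) * (2 * t) powi (3 - int D) = 2 powi (3 - int D) * t powi (2 - int D) * r"
    proof -
      have "t powi (3 - int D) = t powi (2 - int D) * t"
        using t power_int_add[of t "2 - int D" 1] by simp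
      then show ?thesis using t by (simp add: power_int_mult_distrib)
    qed
    have "\<bar>r / t\<bar> *\<^sub>R ?f (?g r) = ((r / t) * (2 * t) powi (3 - int D) * poly (gegen \<nu> m) ((r\<^sup>2 + 1 - t\<^sup>2) / (2 * r))
        * ?Q powr ((real D - 3) / 2)) *\<^sub>R g r"
      unfolding 2 unfolding 3 unfolding xg[OF r] using r0 t by (simp add: mult_ac)
    also have "\<dots> = sphere_kernel D m t r *\<^sub>R g r"
      unfolding 4 using r by (simp add: sphere_kernel_def \<nu>_def)
    finally show ?thesis .
  qed
  have meas: "set_borel_measurable borel ?S (\<lambda>r. \<bar>r / t\<bar> *\<^sub>R ?f (?g r))"
  proof -
    have "(\<lambda>r. indicator ?S r *\<^sub>R g r) \<in> borel_measurable borel"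
      using g by (intro borel_measurable_continuous_on_indicator) auto
    then have M: "(\<lambda>r. sphere_kernel D m t r *\<^sub>R (indicator ?S r *\<^sub>R g r)) \<in> borel_measurable borel"
      unfolding sphere_kernel_def[abs_def] by measurable
    have e: "indicator ?S r *\<^sub>R (\<bar>r / t\<bar> *\<^sub>R ?f (?g r)) = sphere_kernel D m t r *\<^sub>R (indicator ?S r *\<^sub>R g r)" for r
    proof (cases "r \<in> ?S")
      case True
      then show ?thesis using eq[OF True] by (simp only: indicator_simps scaleR_one)
    next
      case False
      then show ?thesis by (simp only: indicator_simps scaleR_zero_left scaleR_zero_right not_False_eq_True)
    qed
    show ?thesis unfolding set_borel_measurable_def e by (rule M)
  qed
  have ind: "indicator ?S r *\<^sub>R (\<bar>r / t\<bar> *\<^sub>R ?f (?g r)) = sphere_kernel D m t r *\<^sub>R g r" for r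
  proof (cases "r \<in> ?S")
    case True
    then show ?thesis using eq[OF True] by (simp only: indicator_simps scaleR_one)
  next
    case False
    then have "sphere_kernel D m t r = 0" unfolding sphere_kernel_def by (intro if_not_P) auto
    then show ?thesis using False by (simp only: indicator_simps scaleR_zero_left not_False_eq_True)
  qed
  have "set_integrable lborel ?S (\<lambda>r. \<bar>r / t\<bar> *\<^sub>R ?f (?g r))"
    by (rule set_integrable_substitution[OF _ img der inj fi meas]) auto
  then show "integrable lborel (\<lambda>r. sphere_kernel D m t r *\<^sub>R g r)"
    unfolding set_integrable_def ind .
  have "(LINT r:?S|lborel. \<bar>r / t\<bar> *\<^sub>R ?f (?g r)) = (LINT u:{-1..1}|lborel. ?f u)"
    by (rule set_integral_substitution[OF _ img der inj fi meas]) auto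
  then show "(LINT r|lborel. sphere_kernel D m t r *\<^sub>R g r) = (LINT u:{-1..1}|lborel. ?f u)"
    unfolding set_lebesgue_integral_def ind .
qed

text \<open>The same triangle with r fixed: u = \<zeta> \<bullet> \<psi> and t = |r \<zeta> -
  \<psi>|. The factors \<open>r ^ (D - 1)\<close> and \<open>t ^ (D - 1)\<close> are the polar
  densities of z and of z - \<psi>; with them this substitution leads to the same kernel as the one
  for fixed t.\<close>

lemma sphere_kernel_substitution:
  fixes \<phi> :: "real \<Rightarrow> real"
  assumes D: "D \<ge> 2" and r: "r > 0" and \<phi>: "continuous_on UNIV \<phi>"
    and supp: "\<And>t. t \<notin> {a..b} \<Longrightarrow> \<phi> t = 0" and ab: "0 < a" "b < 1"
    and \<nu>_def: "\<nu> = (real D - 2) / 2"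
  shows "integrable lborel (\<lambda>t. \<phi> t * t ^ (D - 1) * sphere_kernel D m t r)"
    and "r ^ (D - 1) * (LINT u:{-1..1}|lborel. \<phi> (sqrt (r\<^sup>2 + 1 - 2 * r * u)) * poly (gegen \<nu> m) u * (1 - u\<^sup>2) powr (\<nu> - 1 / 2))
      = (LINT t|lborel. \<phi> t * t ^ (D - 1) * sphere_kernel D m t r)"
proof -
  let ?S = "{\<bar>r - 1\<bar>..r + 1}"
  let ?x = "\<lambda>u. sqrt (r\<^sup>2 + 1 - 2 * r * u)"
  let ?f = "\<lambda>u. \<phi> (?x u) * poly (gegen \<nu> m) u * (1 - u\<^sup>2) powr (\<nu> - 1 / 2)"
  let ?g = "\<lambda>t. (r\<^sup>2 + 1 - t\<^sup>2) / (2 * r)"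
  have \<nu>: "\<nu> \<ge> 0" using D by (simp add: \<nu>_def)
  have x0: "(r - 1)\<^sup>2 \<le> r\<^sup>2 + 1 - 2 * r * u" "r\<^sup>2 + 1 - 2 * r * u \<le> (r + 1)\<^sup>2" if "u \<in> {-1..1}" for u
    using that r mult_left_mono[of "-1" u r] mult_left_mono[of u 1 r] by (auto simp: power2_eq_square algebra_simps)
  have x1: "\<bar>r - 1\<bar> \<le> ?x u \<and> ?x u \<le> r + 1" if "u \<in> {-1..1}" for u
    using real_sqrt_le_mono[OF x0(1)[OF that]] real_sqrt_le_mono[OF x0(2)[OF that]] r by simp
  have cf: "continuous_on {-1..1} (\<lambda>u. \<phi> (?x u) * poly (gegen \<nu> m) u)"
    by (intro continuous_intros continuous_on_compose2[OF \<phi>]) auto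
  have fi: "set_integrable lborel {-1..1} ?f"
    using gegenbauer_weight_integrable_continuous[OF _ cf, of "\<nu> - 1 / 2"] \<nu> by (simp add: mult.commute)
  have gin: "?g t \<in> {-1..1}" if "t \<in> ?S" for t
  proof -
    have "\<bar>r - 1\<bar>\<^sup>2 \<le> t\<^sup>2" by (rule power_mono) (use that in auto)
    moreover have "0 \<le> t" using that by (auto intro: order_trans[OF abs_ge_zero])
    then have "t\<^sup>2 \<le> (r + 1)\<^sup>2" by (intro power_mono) (use that in auto)
    ultimately have "(r - 1)\<^sup>2 \<le> t\<^sup>2" "t\<^sup>2 \<le> (r + 1)\<^sup>2" by simp_all
    then show ?thesis using r by (simp add: divide_le_eq le_divide_eq power2_eq_square algebra_simps)
  qed
  have xg: "?x (?g t) = t" if "t \<in> ?S" for t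
  proof -
    have "r\<^sup>2 + 1 - 2 * r * ?g t = t\<^sup>2" using r by simp
    moreover have "0 \<le> t" using that by (auto intro: order_trans[OF abs_ge_zero])
    ultimately show ?thesis by (simp only: real_sqrt_abs abs_of_nonneg)
  qed
  have gx: "?g (?x u) = u" if "u \<in> {-1..1}" for u
  proof -
    have "0 \<le> r\<^sup>2 + 1 - 2 * r * u" using x0(1)[OF that] order_trans[OF zero_le_power2] by blast
    then show ?thesis using r by simp
  qed
  have img: "?g ` ?S = {-1..1}"
  proof (intro equalityI subsetI)
    fix u :: real assume u: "u \<in> {-1..1}"
    show "u \<in> ?g ` ?S" by (rule image_eqI[where x="?x u"]) (use gx[OF u] x1[OF u] in auto)
  qed (use gin in auto)
  have der: "(?g has_real_derivative - (t / r)) (at t within ?S)" for t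
    using r by (auto intro!: derivative_eq_intros)
  have inj: "inj_on ?g ?S" by (rule inj_on_inverseI[where g="?x"]) (rule xg)
  have ind: "r ^ (D - 1) * (indicator ?S t *\<^sub>R (\<bar>- (t / r)\<bar> *\<^sub>R ?f (?g t))) = \<phi> t * t ^ (D - 1) * sphere_kernel D m t r" for t
  proof (cases "t \<in> {a..b}")
    case False
    have "indicator ?S t *\<^sub>R (\<bar>- (t / r)\<bar> *\<^sub>R ?f (?g t)) = 0"
      using supp[OF False] xg[of t] by (cases "t \<in> ?S") auto
    then show ?thesis using supp[OF False] by simp
  next
    case True
    then have t: "0 < t" "t < 1" using ab by auto
    have iff: "t \<in> ?S \<longleftrightarrow> 1 - t \<le> r \<and> r \<le> 1 + t" using t by auto
    show ?thesis
    proof (cases "t \<in> ?S")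
      case False
      have "indicator ?S t = (0::real)" using False by (rule indicator_simps(2))
      moreover have "sphere_kernel D m t r = 0"
        unfolding sphere_kernel_def using False iff by (intro if_not_P) blast
      ultimately show ?thesis by (simp only: scaleR_zero_left mult_zero_right)
    next
      case tS: True
      let ?Q = "(1 + t - r) * (1 + t + r) * (r - 1 + t) * (r + 1 - t)"
      have "1 - (?g t)\<^sup>2 = ((2 * r)\<^sup>2 - (r\<^sup>2 + 1 - t\<^sup>2)\<^sup>2) / (2 * r)\<^sup>2"
        by (rule one_minus_square_quotient) (use r in simp)
      also have "(2 * r)\<^sup>2 - (r\<^sup>2 + 1 - t\<^sup>2)\<^sup>2 = ?Q" unfolding triangle_product(2) by (simp add: power2_eq_square)
      finally have 1: "1 - (?g t)\<^sup>2 = ?Q / (2 * r)\<^sup>2" .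
      have Q0: "?Q \<ge> 0" using tS iff t r by (intro mult_nonneg_nonneg) auto
      have ex: "\<nu> - 1 / 2 = (real D - 3) / 2" by (simp add: \<nu>_def field_simps)
      have 2: "(1 - (?g t)\<^sup>2) powr (\<nu> - 1 / 2) = ?Q powr ((real D - 3) / 2) * (2 * r) powi (3 - int D)"
      unfolding 1 ex by (rule powr_quotient_powi) (use r in simp)
      have rD: "r ^ (D - 1) = r powi (int D - 1)" using D by (simp add: power_int_def nat_diff_distrib')
      have tD: "t ^ (D - 1) = t powi (int D - 1)" using D by (simp add: power_int_def nat_diff_distrib')
      have "r powi (int D - 1) * r powi (3 - int D) = r\<^sup>2"
        using r by (simp flip: power_int_add)
      then have 3: "r ^ (D - 1) * (t / r) * (2 * r) powi (3 - int D) = 2 powi (3 - int D) * t * r"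
        unfolding rD power_int_mult_distrib using r by (simp add: field_simps power2_eq_square)
      have "t powi (int D - 1) * t powi (2 - int D) = t"
        using t by (simp flip: power_int_add)
      then have 4: "t ^ (D - 1) * (2 powi (3 - int D) * t powi (2 - int D) * r) = 2 powi (3 - int D) * t * r"
        unfolding tD by (simp add: mult_ac)
      have "r ^ (D - 1) * (indicator ?S t *\<^sub>R (\<bar>- (t / r)\<bar> *\<^sub>R ?f (?g t)))
          = (r ^ (D - 1) * (t / r) * (2 * r) powi (3 - int D)) * (\<phi> t * poly (gegen \<nu> m) (?g t) * ?Q powr ((real D - 3) / 2))"
        unfolding 2 xg[OF tS] using tS r t by (simp add: mult_ac)
      also have "\<dots> = \<phi> t * t ^ (D - 1) * sphere_kernel D m t r"
        unfolding 3 4[symmetric] using tS iff by (simp add: sphere_kernel_def \<nu>_def mult_ac)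
      finally show ?thesis .
    qed
  qed
  have \<phi>m [measurable]: "\<phi> \<in> borel_measurable borel" using \<phi> by (rule borel_measurable_continuous_onI)
  have meas: "set_borel_measurable borel ?S (\<lambda>t. \<bar>- (t / r)\<bar> *\<^sub>R ?f (?g t))"
    unfolding set_borel_measurable_def by measurable
  have "set_integrable lborel ?S (\<lambda>t. \<bar>- (t / r)\<bar> *\<^sub>R ?f (?g t))"
    by (rule set_integrable_substitution[OF _ img der inj fi meas]) auto
  then have "integrable lborel (\<lambda>t. r ^ (D - 1) * (indicator ?S t *\<^sub>R (\<bar>- (t / r)\<bar> *\<^sub>R ?f (?g t))))"
    unfolding set_integrable_def by (rule integrable_mult_right)
  then show "integrable lborel (\<lambda>t. \<phi> t * t ^ (D - 1) * sphere_kernel D m t r)" unfolding ind .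
  have "(LINT t:?S|lborel. \<bar>- (t / r)\<bar> *\<^sub>R ?f (?g t)) = (LINT u:{-1..1}|lborel. ?f u)"
    by (rule set_integral_substitution[OF _ img der inj fi meas]) auto
  then show "r ^ (D - 1) * (LINT u:{-1..1}|lborel. ?f u) = (LINT t|lborel. \<phi> t * t ^ (D - 1) * sphere_kernel D m t r)"
    unfolding ind[symmetric] integral_mult_right_zero by (simp only: set_lebesgue_integral_def)
qed

section \<open>Test functions, continuity in the parameter and Fubini\<close>

text \<open>Let L be the real or the imaginary part and g a bump that is positive at t. Testing with
  g L(f) makes the integral of g L(f)^2 vanish, and a continuous non-negative function with integral
  0 is 0.\<close>

lemma continuous_vanishing_test_functions:
  fixes f :: "real \<Rightarrow> complex"
  assumes f: "continuous_on {0<..<1} f"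
    and test: "\<And>\<phi> a b. continuous_on UNIV \<phi> \<Longrightarrow> (\<And>t. t \<notin> {a..b} \<Longrightarrow> \<phi> t = 0) \<Longrightarrow> 0 < a \<Longrightarrow> b < 1 \<Longrightarrow>
      (LINT t|lborel. \<phi> t *\<^sub>R f t) = 0"
    and t: "0 < t" "t < 1"
  shows "f t = 0"
proof -
  define a b where "a = t / 2" and "b = (1 + t) / 2"
  have ab: "0 < a" "a < t" "t < b" "b < 1" using t by (auto simp: a_def b_def)
  define g where "g s = max 0 (s - a) * max 0 (b - s)" for s
  have g0: "g s = 0" if "s \<notin> {a..b}" for s using that by (auto simp: g_def)
  have cf: "continuous_on {a..b} f" by (rule continuous_on_subset[OF f]) (use ab in auto)
  have gc: "continuous_on A g" for A unfolding g_def by (intro continuous_intros)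
  have zero: "L (f t) = 0" if L: "bounded_linear L" for L :: "complex \<Rightarrow> real"
  proof -
    have cLf: "continuous_on {a..b} (\<lambda>s. L (f s))"
      by (rule bounded_linear.continuous_on[OF L cf])
    \<comment> \<open>The clamped argument extends L(f) continuously from [a, b] to the whole line,
      and g cuts it off.\<close>
    define \<phi> where "\<phi> s = g s * L (f (max a (min b s)))" for s
    have c\<phi>: "continuous_on UNIV \<phi>"
      unfolding \<phi>_def by (intro continuous_intros gc continuous_on_compose2[OF cLf]) (use ab in auto)
    have \<phi>0: "\<phi> s = 0" if "s \<notin> {a..b}" for s using g0[OF that] by (simp add: \<phi>_def)
    have \<phi>f: "\<phi> s *\<^sub>R f s = indicator {a..b} s *\<^sub>R (\<phi> s *\<^sub>R f s)" for s
      using \<phi>0[of s] by (auto split: split_indicator)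
    have I: "set_integrable lborel {a..b} (\<lambda>s. \<phi> s *\<^sub>R f s)"
      unfolding set_integrable_def
      by (rule borel_integrable_compact) (auto intro!: continuous_intros cf continuous_on_subset[OF c\<phi>])
    have "(LINT s|lborel. \<phi> s *\<^sub>R f s) = 0" by (rule test[OF c\<phi> \<phi>0 ab(1,4)])
    then have "(LINT s:{a..b}|lborel. \<phi> s *\<^sub>R f s) = 0"
      unfolding set_lebesgue_integral_def \<phi>f[symmetric] .
    then have "L (LINT s:{a..b}|lborel. \<phi> s *\<^sub>R f s) = 0" using linear_0[OF bounded_linear.linear[OF L]] by simp
    then have z: "(LINT s:{a..b}|lborel. L (\<phi> s *\<^sub>R f s)) = 0"
      using integral_bounded_linear[OF L, of lborel "\<lambda>s. indicator {a..b} s *\<^sub>R (\<phi> s *\<^sub>R f s)"] I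
      by (simp add: set_lebesgue_integral_def set_integrable_def linear_scale[OF bounded_linear.linear[OF L]] mult.assoc)
    have Lp: "L (\<phi> s *\<^sub>R f s) = g s * (L (f s))\<^sup>2" if "s \<in> {a..b}" for s
    proof -
      have "max a (min b s) = s" using that by simp
      then show ?thesis
        by (simp add: \<phi>_def linear_scale[OF bounded_linear.linear[OF L]] power2_eq_square)
    qed
    have cG: "continuous_on {a..b} (\<lambda>s. g s * (L (f s))\<^sup>2)"
      by (intro continuous_intros gc cLf)
    have "(LINT s:{a..b}|lborel. g s * (L (f s))\<^sup>2) = 0"
      using z set_lebesgue_integral_cong[of "{a..b}" lborel "\<lambda>s. L (\<phi> s *\<^sub>R f s)" "\<lambda>s. g s * (L (f s))\<^sup>2"] Lp by simp
    moreover have "set_integrable lborel {a..b} (\<lambda>s. g s * (L (f s))\<^sup>2)"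
      unfolding set_integrable_def by (rule borel_integrable_compact) (auto intro!: cG)
    ultimately have "((\<lambda>s. g s * (L (f s))\<^sup>2) has_integral 0) (cbox a b)"
      using set_borel_integral_eq_integral[of "{a..b}" "\<lambda>s. g s * (L (f s))\<^sup>2"]
      by (simp add: has_integral_iff)
    then have "g t * (L (f t))\<^sup>2 = 0"
      by (rule has_integral_0_cbox_imp_0[rotated 2])
         (use cG ab in \<open>auto simp: g_def\<close>)
    moreover have "g t > 0" using ab by (simp add: g_def)
    ultimately show ?thesis by simp
  qed
  show ?thesis
    using zero[OF bounded_linear_Re] zero[OF bounded_linear_Im] by (simp add: complex_eq_iff)
qed

text \<open>H is bounded on the compact product, so the weight times this bound dominates, even
  where the weight is unbounded near the end points.\<close>

lemma continuous_parametric_weighted_integral: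
  fixes H :: "'c::metric_space \<Rightarrow> real \<Rightarrow> 'b::euclidean_space"
  assumes T: "compact T" and H: "continuous_on (T \<times> {-1..1}) (\<lambda>(t, u). H t u)" and a: "a \<ge> - 1 / 2"
  shows "continuous_on T (\<lambda>t. LINT u:{-1..1}|lborel. (1 - u\<^sup>2) powr a *\<^sub>R H t u)"
proof -
  have "compact ((\<lambda>(t, u). H t u) ` (T \<times> {-1..1}))"
    by (intro compact_continuous_image H compact_Times T) auto
  then have "bounded ((\<lambda>(t, u). H t u) ` (T \<times> {-1..1}))" by (rule compact_imp_bounded)
  then obtain B where B: "\<And>t u. t \<in> T \<Longrightarrow> u \<in> {-1..1} \<Longrightarrow> norm (H t u) \<le> B"
    unfolding bounded_iff by fastforce
  have c: "continuous_on {-1..1} (H t)" if "t \<in> T" for t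
  proof -
    have "continuous_on {-1..1} (\<lambda>u::real. (t, u))" by (intro continuous_intros)
    from continuous_on_compose2[OF H this] that show ?thesis by auto
  qed
  have i: "integrable lborel (\<lambda>u. indicator {-1..1} u *\<^sub>R ((1 - u\<^sup>2) powr a *\<^sub>R H t u))" if "t \<in> T" for t
    using gegenbauer_weight_integrable_continuous[OF a c[OF that]] by (simp only: set_integrable_def)
  have wi: "integrable lborel (\<lambda>u. indicator {-1..1} u *\<^sub>R ((1 - u\<^sup>2) powr a * B))"
    using set_integrable_mult_left[OF gegenbauer_weight_integrable[OF a], of B] by (simp only: set_integrable_def)
  show ?thesis
    unfolding continuous_on_sequentially
  proof (intro allI ballI impI, elim conjE)
    fix x s assume s: "s \<in> T" and x: "\<forall>n. x n \<in> T" "x \<longlonglongrightarrow> s"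
    have "(\<lambda>n. LINT u|lborel. indicator {-1..1} u *\<^sub>R ((1 - u\<^sup>2) powr a *\<^sub>R H (x n) u))
        \<longlonglongrightarrow> (LINT u|lborel. indicator {-1..1} u *\<^sub>R ((1 - u\<^sup>2) powr a *\<^sub>R H s u))"
    proof (rule integral_dominated_convergence[OF _ _ wi])
      show "AE u in lborel. (\<lambda>n. indicator {-1..1} u *\<^sub>R ((1 - u\<^sup>2) powr a *\<^sub>R H (x n) u))
          \<longlonglongrightarrow> indicator {-1..1} u *\<^sub>R ((1 - u\<^sup>2) powr a *\<^sub>R H s u)"
      proof (rule AE_I2)
        fix u :: real
        show "(\<lambda>n. indicator {-1..1} u *\<^sub>R ((1 - u\<^sup>2) powr a *\<^sub>R H (x n) u))
          \<longlonglongrightarrow> indicator {-1..1} u *\<^sub>R ((1 - u\<^sup>2) powr a *\<^sub>R H s u)"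
        proof (cases "u \<in> {-1..1}")
          case True
          have "(\<lambda>n. (x n, u)) \<longlonglongrightarrow> (s, u)" using x by (intro tendsto_intros)
          then have "(\<lambda>n. H (x n) u) \<longlonglongrightarrow> H s u"
            using H[unfolded continuous_on_sequentially, rule_format, of "(s, u)" "\<lambda>n. (x n, u)"] s x True
            by (auto simp: o_def)
          then show ?thesis by (intro tendsto_intros)
        qed simp
      qed
      show "AE u in lborel. norm (indicator {-1..1} u *\<^sub>R ((1 - u\<^sup>2) powr a *\<^sub>R H (x n) u))
          \<le> indicator {-1..1} u *\<^sub>R ((1 - u\<^sup>2) powr a * B)" for n
        using B x(1) by (intro AE_I2) (auto split: split_indicator intro!: mult_left_mono)
    qed (use i s x(1) in auto)
    then show "((\<lambda>t. LINT u:{-1..1}|lborel. (1 - u\<^sup>2) powr a *\<^sub>R H t u) \<circ> x)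
        \<longlonglongrightarrow> (LINT u:{-1..1}|lborel. (1 - u\<^sup>2) powr a *\<^sub>R H s u)"
      by (simp only: o_def set_lebesgue_integral_def)
  qed
qed

lemma continuous_on_greaterThanLessThan:
  fixes f :: "real \<Rightarrow> 'b::topological_space"
  assumes "\<And>a b. l < a \<Longrightarrow> a \<le> b \<Longrightarrow> b < u \<Longrightarrow> continuous_on {a..b} f"
  shows "continuous_on {l<..<u} f"
proof (rule continuous_at_imp_continuous_on, safe)
  fix x assume x: "x \<in> {l<..<u}"
  define a b where "a = (l + x) / 2" and "b = (x + u) / 2"
  have ab: "l < a" "a < x" "x < b" "b < u" using x by (auto simp: a_def b_def)
  have "continuous_on {a..b} f" using assms[of a b] ab by simp
  then show "isCont f x" by (rule continuous_on_interior) (use ab in auto)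
qed

lemma borel_measurable_power_int [measurable]:
  fixes f :: "'c \<Rightarrow> real"
  assumes [measurable]: "f \<in> borel_measurable M"
  shows "(\<lambda>x. f x powi k) \<in> borel_measurable M"
proof (cases "0 \<le> k")
  case True
  then have "(\<lambda>x. f x powi k) = (\<lambda>x. f x ^ nat k)" by (simp add: power_int_def)
  then show ?thesis by simp
next
  case False
  then have "(\<lambda>x. f x powi k) = (\<lambda>x. inverse (f x) ^ nat (- k))" by (simp add: power_int_def)
  moreover have "(\<lambda>x. inverse (f x)) \<in> borel_measurable M" by (rule borel_measurable_inverse) (rule assms)
  ultimately show ?thesis by simp
qed

text \<open>The argument of the polynomial is a cosine in the triangle with sides 1, t and r, hence
  lies in [-1, 1]. The kernel of degree 0 is non-negative and serves as the dominating
  function.\<close>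

lemma sphere_kernel_abs_le:
  assumes C: "\<And>u. u \<in> {-1..1} \<Longrightarrow> \<bar>poly (gegen ((real D - 2) / 2) m) u\<bar> \<le> C" and t: "0 < t" "t < 1"
  shows "\<bar>sphere_kernel D m t r\<bar> \<le> C * sphere_kernel D 0 t r"
proof (cases "1 - t \<le> r \<and> r \<le> 1 + t")
  case True
  let ?w = "2 powi (3 - int D) * t powi (2 - int D) * r"
  let ?q = "((1 + t - r) * (1 + t + r) * (r - 1 + t) * (r + 1 - t)) powr ((real D - 3) / 2)"
  let ?u = "(r\<^sup>2 + 1 - t\<^sup>2) / (2 * r)"
  have r: "r > 0" using True t by simp
  have w: "?w \<ge> 0" using t r by simp
  have "(1 - r)\<^sup>2 \<le> t\<^sup>2" using True t by (intro abs_le_square_iff[THEN iffD1]) auto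
  moreover have "t\<^sup>2 \<le> (1 + r)\<^sup>2" using True t r by (intro power_mono) auto
  ultimately have "?u \<in> {-1..1}"
    using r by (simp add: divide_le_eq le_divide_eq power2_eq_square algebra_simps)
  then have P: "\<bar>poly (gegen ((real D - 2) / 2) m) ?u\<bar> \<le> C" by (rule C)
  have e: "sphere_kernel D m t r = ?w * poly (gegen ((real D - 2) / 2) m) ?u * ?q" for m
    unfolding sphere_kernel_def by (rule if_P) (rule True)
  have "\<bar>sphere_kernel D m t r\<bar> = ?w * \<bar>poly (gegen ((real D - 2) / 2) m) ?u\<bar> * ?q"
  proof -
    have "\<bar>w * P * q\<bar> = w * \<bar>P\<bar> * q" if "w \<ge> 0" "q \<ge> 0" for w P q :: real
      using that by (simp add: abs_mult)
    from this[OF w] show ?thesis unfolding e by simp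
  qed
  also have "\<dots> \<le> ?w * C * ?q" using P w by (intro mult_right_mono mult_left_mono) auto
  also have "\<dots> = C * sphere_kernel D 0 t r" unfolding e by simp
  finally show ?thesis .
next
  case False
  then have "sphere_kernel D m t r = 0" for m unfolding sphere_kernel_def by (rule if_not_P)
  then show ?thesis by simp
qed

lemma borel_measurable_sphere_kernel [measurable]:
  "(\<lambda>(t, r). sphere_kernel D m t r) \<in> borel_measurable (borel \<Otimes>\<^sub>M borel)"
  unfolding sphere_kernel_def[abs_def] by measurable

text \<open>Absolute integrability comes from comparison with the kernel of degree 0, whose integral
  over r is the total mass \<open>W\<close> of the weight for every t. The support of \<phi> keeps t
  in [a, b], and then the support of the kernel keeps r in [0, 2].\<close>

lemma sphere_kernel_fubini:
  fixes g :: "real \<Rightarrow> complex" and \<phi> :: "real \<Rightarrow> real"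
  assumes D: "D \<ge> 2" and g: "continuous_on UNIV g" and \<phi>: "continuous_on UNIV \<phi>"
    and supp: "\<And>t. t \<notin> {a..b} \<Longrightarrow> \<phi> t = 0" and ab: "0 < a" "b < 1"
  shows "(LINT r|lborel. (LINT t|lborel. \<phi> t * t ^ (D - 1) * sphere_kernel D m t r) *\<^sub>R g r)
    = (LINT t|lborel. (\<phi> t * t ^ (D - 1)) *\<^sub>R (LINT r|lborel. sphere_kernel D m t r *\<^sub>R g r))"
proof -
  define \<nu> where "\<nu> = (real D - 2) / 2"
  have \<nu>: "\<nu> \<ge> 0" using D by (simp add: \<nu>_def)
  let ?F = "\<lambda>t r. (\<phi> t * t ^ (D - 1)) *\<^sub>R (sphere_kernel D m t r *\<^sub>R g r)"
  have [measurable]: "\<phi> \<in> borel_measurable borel" "g \<in> borel_measurable borel"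
    using \<phi> g by (auto intro: borel_measurable_continuous_onI)
  have "bounded (poly (gegen ((real D - 2) / 2) m) ` {-1..1})"
    by (intro compact_imp_bounded compact_continuous_image continuous_on_poly continuous_on_id) auto
  then obtain C where "\<forall>u\<in>{-1..1}. \<bar>poly (gegen ((real D - 2) / 2) m) u\<bar> \<le> C"
    unfolding bounded_iff by auto
  then have C: "\<bar>poly (gegen ((real D - 2) / 2) m) u\<bar> \<le> C" if "u \<in> {-1..1}" for u
    using that by blast
  have C0: "C \<ge> 0" using C[of 0] by simp
  have "bounded (g ` {0..2})"
    by (intro compact_imp_bounded compact_continuous_image continuous_on_subset[OF g]) auto
  then obtain B where "\<forall>r\<in>{0..2}. norm (g r) \<le> B" unfolding bounded_iff by auto
  then have B: "norm (g r) \<le> B" if "r \<in> {0..2}" for r using that by blast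
  have "bounded (\<phi> ` {a..b})"
    by (intro compact_imp_bounded compact_continuous_image continuous_on_subset[OF \<phi>]) auto
  then obtain E where "\<forall>t\<in>{a..b}. \<bar>\<phi> t\<bar> \<le> E" unfolding bounded_iff by auto
  then have E: "\<bar>\<phi> t\<bar> \<le> E" if "t \<in> {a..b}" for t using that by blast
  have B0: "B \<ge> 0" using order_trans[OF norm_ge_zero B[of 1]] by simp
  define W where "W = gegenbauer_moment (\<nu> - 1 / 2) 0"
  have k0: "integrable lborel (sphere_kernel D 0 t)" "(LINT r|lborel. sphere_kernel D 0 t r) = W" if t: "0 < t" "t < 1" for t
  proof -
    have i: "integrable lborel (\<lambda>r. sphere_kernel D 0 t r *\<^sub>R (1::complex))"
      by (rule sphere_kernel_integrable[OF D t _ \<nu>_def]) auto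
    then have "integrable lborel (\<lambda>r. Re (sphere_kernel D 0 t r *\<^sub>R (1::complex)))" by (rule integrable_Re)
    then show ii: "integrable lborel (sphere_kernel D 0 t)" by simp
    have "complex_of_real (LINT r|lborel. sphere_kernel D 0 t r) = (LINT r|lborel. sphere_kernel D 0 t r *\<^sub>R (1::complex))"
      by (simp add: scaleR_conv_of_real)
    also have "\<dots> = (LINT u:{-1..1}|lborel. (1 - u\<^sup>2) powr (\<nu> - 1 / 2) *\<^sub>R (poly (gegen \<nu> 0) ((1 + t * u) / sqrt (1 + t\<^sup>2 + 2 * t * u)) *\<^sub>R (1::complex)))"
      by (rule sphere_kernel_integral[OF D t _ \<nu>_def]) auto
    also have "\<dots> = (LINT u|lborel. complex_of_real (indicator {-1..1} u * (1 - u\<^sup>2) powr (\<nu> - 1 / 2)))"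
      unfolding set_lebesgue_integral_def
      by (rule Bochner_Integration.integral_cong) (simp_all add: scaleR_conv_of_real)
    also have "\<dots> = complex_of_real W"
      by (simp only: integral_complex_of_real W_def gegenbauer_moment_def set_lebesgue_integral_def) simp
    finally show "(LINT r|lborel. sphere_kernel D 0 t r) = W" by (simp only: of_real_eq_iff)
  qed
  have kg: "integrable lborel (\<lambda>r. sphere_kernel D m t r *\<^sub>R g r)" if t: "0 < t" "t < 1" for t
    by (rule sphere_kernel_integrable[OF D t _ \<nu>_def]) (rule continuous_on_subset[OF g], simp)
  have kgb: "(LINT r|lborel. norm (sphere_kernel D m t r *\<^sub>R g r)) \<le> C * B * W" if t: "0 < t" "t < 1" for t
  proof -
    have "(LINT r|lborel. norm (sphere_kernel D m t r *\<^sub>R g r)) \<le> (LINT r|lborel. (C * B) * sphere_kernel D 0 t r)"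
    proof (rule integral_mono)
      show "integrable lborel (\<lambda>r. norm (sphere_kernel D m t r *\<^sub>R g r))" by (rule integrable_norm[OF kg[OF t]])
      show "integrable lborel (\<lambda>r. (C * B) * sphere_kernel D 0 t r)" using k0(1)[OF t] by simp
      fix r :: real
      show "norm (sphere_kernel D m t r *\<^sub>R g r) \<le> (C * B) * sphere_kernel D 0 t r"
      proof (cases "r \<in> {0..2}")
        case True
        have "norm (sphere_kernel D m t r *\<^sub>R g r) = \<bar>sphere_kernel D m t r\<bar> * norm (g r)" by simp
        also have "\<dots> \<le> (C * sphere_kernel D 0 t r) * B"
          using sphere_kernel_abs_le[OF C t] B[OF True] order_trans[OF abs_ge_zero sphere_kernel_abs_le[OF C t]]
          by (intro mult_mono) auto
        finally show ?thesis by (simp add: mult_ac)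
      next
        case False
        then have "sphere_kernel D m t r = 0" for m unfolding sphere_kernel_def using t by (intro if_not_P) auto
        then show ?thesis by simp
      qed
    qed
    then show ?thesis using k0(2)[OF t] by simp
  qed
  have int: "integrable (lborel \<Otimes>\<^sub>M lborel) (\<lambda>(t, r). ?F t r)"
  proof (rule lborel_pair.Fubini_integrable)
    show m: "(\<lambda>(t, r). ?F t r) \<in> borel_measurable (lborel \<Otimes>\<^sub>M lborel)" by measurable
    show "AE t in lborel. integrable lborel (\<lambda>r. case (t, r) of (t, r) \<Rightarrow> ?F t r)"
    proof (rule AE_I2)
      fix t :: real
      show "integrable lborel (\<lambda>r. case (t, r) of (t, r) \<Rightarrow> ?F t r)"
      proof (cases "t \<in> {a..b}")
        case True
        then have "integrable lborel (\<lambda>r. sphere_kernel D m t r *\<^sub>R g r)" using kg[of t] ab by simp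
        then show ?thesis unfolding prod.case by (rule integrable_scaleR_right)
      qed (simp add: supp)
    qed
    show "integrable lborel (\<lambda>t. LINT r|lborel. norm (case (t, r) of (t, r) \<Rightarrow> ?F t r))"
    proof (rule Bochner_Integration.integrable_bound[where f="\<lambda>t. indicator {a..b} t * (E * (C * B * W))"])
      show "integrable lborel (\<lambda>t. indicator {a..b} t * (E * (C * B * W)))"
        by (intro integrable_mult_left integrable_real_indicator) (auto simp: emeasure_lborel_Icc_eq)
      show "(\<lambda>t. LINT r|lborel. norm (case (t, r) of (t, r) \<Rightarrow> ?F t r)) \<in> borel_measurable lborel" by measurable
      show "AE t in lborel. norm (LINT r|lborel. norm (case (t, r) of (t, r) \<Rightarrow> ?F t r)) \<le> norm (indicator {a..b} t * (E * (C * B * W)))"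
      proof (rule AE_I2)
        fix t :: real
        show "norm (LINT r|lborel. norm (case (t, r) of (t, r) \<Rightarrow> ?F t r)) \<le> norm (indicator {a..b} t * (E * (C * B * W)))"
        proof (cases "t \<in> {a..b}")
          case False
          then show ?thesis using supp by simp
        next
          case True
          then have t: "0 < t" "t < 1" using ab by auto
          have "(LINT r|lborel. norm (?F t r)) = \<bar>\<phi> t * t ^ (D - 1)\<bar> * (LINT r|lborel. norm (sphere_kernel D m t r *\<^sub>R g r))"
            by (simp only: norm_scaleR integral_mult_right_zero)
          also have "\<dots> \<le> E * (C * B * W)"
          proof (rule mult_mono)
            have "\<bar>t ^ (D - 1)\<bar> \<le> 1" using t by (simp add: power_le_one)
            then have "\<bar>\<phi> t\<bar> * \<bar>t ^ (D - 1)\<bar> \<le> E * 1" using E[OF True] by (intro mult_mono) auto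
            then show "\<bar>\<phi> t * t ^ (D - 1)\<bar> \<le> E" by (simp add: abs_mult)
            show "0 \<le> E" using E[OF True] abs_ge_zero order_trans by blast
            show "(LINT r|lborel. norm (sphere_kernel D m t r *\<^sub>R g r)) \<le> C * B * W" by (rule kgb[OF t])
            show "0 \<le> (LINT r|lborel. norm (sphere_kernel D m t r *\<^sub>R g r))" by (rule integral_nonneg_AE) simp
          qed
          finally have "(LINT r|lborel. norm (?F t r)) \<le> E * (C * B * W)" .
          moreover have "0 \<le> (LINT r|lborel. norm (?F t r))" by (rule integral_nonneg_AE) simp
          ultimately show ?thesis using True by simp
        qed
      qed
    qed
  qed
  have "(LINT r|lborel. (LINT t|lborel. \<phi> t * t ^ (D - 1) * sphere_kernel D m t r) *\<^sub>R g r) = (LINT r|lborel. LINT t|lborel. ?F t r)"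
  proof (rule Bochner_Integration.integral_cong[OF refl])
    fix r :: real
    have i: "integrable lborel (\<lambda>t. \<phi> t * t ^ (D - 1) * sphere_kernel D m t r)"
    proof (cases "r > 0")
      case True
      then show ?thesis by (rule sphere_kernel_substitution(1)[OF D _ \<phi> supp ab \<nu>_def])
    next
      case False
      have z: "\<phi> t * t ^ (D - 1) * sphere_kernel D m t r = 0" for t
      proof (cases "t \<in> {a..b}")
        case True
        then have "sphere_kernel D m t r = 0"
          unfolding sphere_kernel_def using False ab by (intro if_not_P) auto
        then show ?thesis by simp
      qed (simp add: supp)
      show ?thesis unfolding z by simp
    qed
    have "(LINT t|lborel. (\<phi> t * t ^ (D - 1) * sphere_kernel D m t r) *\<^sub>R g r) = (LINT t|lborel. \<phi> t * t ^ (D - 1) * sphere_kernel D m t r) *\<^sub>R g r"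
      by (rule integral_scaleR_left) (rule i)
    then show "(LINT t|lborel. \<phi> t * t ^ (D - 1) * sphere_kernel D m t r) *\<^sub>R g r = (LINT t|lborel. ?F t r)"
      by (simp only: scaleR_scaleR)
  qed
  also have "\<dots> = (LINT t|lborel. LINT r|lborel. ?F t r)" by (rule lborel_pair.Fubini_integral[OF int])
  also have "\<dots> = (LINT t|lborel. (\<phi> t * t ^ (D - 1)) *\<^sub>R (LINT r|lborel. sphere_kernel D m t r *\<^sub>R g r))"
    by (simp only: integral_scaleR_right)
  finally show ?thesis .
qed

lemma continuous_on_sphere_average:
  fixes G :: "'a::euclidean_space \<Rightarrow> complex"
  assumes G: "continuous_on UNIV G" and p: "continuous_on UNIV p"
  shows "continuous_on UNIV (\<lambda>r. LINT \<zeta>|sphere_measure. G (r *\<^sub>R \<zeta>) * p \<zeta>)"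
proof (rule continuous_at_imp_continuous_on, safe)
  fix r :: real
  have "continuous_on {r - 1..r + 1} (\<lambda>r. LINT \<zeta>|sphere_measure. G (r *\<^sub>R \<zeta>) * p \<zeta>)"
    by (rule continuous_parametric_sphere_integral)
       (auto simp: case_prod_beta' intro!: continuous_intros continuous_on_compose2[OF G] continuous_on_compose2[OF p])
  then show "isCont (\<lambda>r. LINT \<zeta>|sphere_measure. G (r *\<^sub>R \<zeta>) * p \<zeta>) r"
    by (rule continuous_on_interior) auto
qed

lemma sphere_measure_fubini:
  fixes F :: "'a::euclidean_space \<Rightarrow> 'a \<Rightarrow> complex"
  assumes F: "continuous_on UNIV (\<lambda>(x, y). F x y)"
  shows "(LINT x|sphere_measure. LINT y|sphere_measure. F x y) = (LINT y|sphere_measure. LINT x|sphere_measure. F x y)"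
proof -
  interpret S: finite_measure "sphere_measure :: 'a measure" by (rule finite_measure_sphere)
  interpret P: pair_sigma_finite "sphere_measure :: 'a measure" "sphere_measure :: 'a measure" ..
  interpret Q: finite_measure "(sphere_measure :: 'a measure) \<Otimes>\<^sub>M (sphere_measure :: 'a measure)"
    by (rule finite_measure_pair_measure) (rule finite_measure_sphere)+
  have Fm: "(\<lambda>(x, y). F x y) \<in> borel_measurable (borel \<Otimes>\<^sub>M borel)"
    unfolding borel_prod using F by (rule borel_measurable_continuous_onI)
  have m: "(\<lambda>(x, y). F x y) \<in> borel_measurable (sphere_measure \<Otimes>\<^sub>M sphere_measure)"
  proof -
    have "fst \<in> (sphere_measure :: 'a measure) \<Otimes>\<^sub>M (sphere_measure :: 'a measure) \<rightarrow>\<^sub>M borel"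
      using measurable_compose[OF measurable_fst[of "sphere_measure :: 'a measure" "sphere_measure :: 'a measure"] measurable_ident_sphere] .
    moreover have "snd \<in> (sphere_measure :: 'a measure) \<Otimes>\<^sub>M (sphere_measure :: 'a measure) \<rightarrow>\<^sub>M borel"
      using measurable_compose[OF measurable_snd[of "sphere_measure :: 'a measure" "sphere_measure :: 'a measure"] measurable_ident_sphere] .
    ultimately have "(\<lambda>q. (fst q, snd q)) \<in> (sphere_measure :: 'a measure) \<Otimes>\<^sub>M (sphere_measure :: 'a measure) \<rightarrow>\<^sub>M borel \<Otimes>\<^sub>M borel"
      by (rule measurable_Pair)
    from measurable_compose[OF this Fm] show ?thesis by (simp add: case_prod_beta')
  qed
  have "compact ((\<lambda>(x, y). F x y) ` (sphere 0 1 \<times> sphere 0 1))"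
    by (intro compact_continuous_image continuous_on_subset[OF F] compact_Times) auto
  then have "bounded ((\<lambda>(x, y). F x y) ` (sphere 0 1 \<times> sphere 0 1))" by (rule compact_imp_bounded)
  then obtain B where B: "\<And>x y. norm x = 1 \<Longrightarrow> norm y = 1 \<Longrightarrow> norm (F x y) \<le> B"
    unfolding bounded_iff by fastforce
  have "integrable (sphere_measure \<Otimes>\<^sub>M sphere_measure) (\<lambda>(x, y). F x y)"
    by (rule Q.integrable_const_bound[where B=B]) (use B m in \<open>auto simp: space_pair_measure\<close>)
  from P.Fubini_integral[OF this] show ?thesis by simp
qed

text \<open>Both sides are continuous in \<open>t\<close>, so it suffices to integrate them against test functions
  \<open>\<phi>(t) t\<^sup>D\<^sup>-\<^sup>1\<close>.  On the left this gives an integral over all \<open>z = \<psi> + t \<omega>\<close>, which in polar coordinates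
  for \<open>z\<close> becomes an integral of \<open>\<phi>(|z - \<psi>|) p(\<psi>)\<close> over \<open>\<psi>\<close>, accessible to the Funk-Hecke formula.\<close>

proposition spherical_product_formula:
  fixes G p :: "'a::euclidean_space \<Rightarrow> complex"
  assumes dim: "DIM('a) \<ge> 2" and G: "continuous_on UNIV G" and p: "harmonic_polynomial m p"
    and t: "0 < t" "t < 1"
  shows "(LINT \<psi>|sphere_measure. LINT \<omega>|sphere_measure. p \<psi> * G (\<psi> + t *\<^sub>R \<omega>))
    = sphere_vol (DIM('a) - 2) *\<^sub>R
        (LINT r|lborel. sphere_kernel DIM('a) m t r *\<^sub>R (LINT \<zeta>|sphere_measure. G (r *\<^sub>R \<zeta>) * p \<zeta>))"
proof -
  define D where "D = DIM('a)"
  define \<nu> where "\<nu> = (real D - 2) / 2"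
  define s where "s = sphere_vol (D - 2)"
  define g where "g r = (LINT \<zeta>|sphere_measure. G (r *\<^sub>R \<zeta>) * p \<zeta>)" for r
  define A where "A t = (LINT \<zeta>|sphere_measure. LINT \<psi>|sphere_measure. p \<psi> * G (\<psi> + t *\<^sub>R \<zeta>))" for t
  define B where "B t = s *\<^sub>R (LINT r|lborel. sphere_kernel D m t r *\<^sub>R g r)" for t
  have D: "D \<ge> 2" using dim by (simp add: D_def)
  have \<nu>: "\<nu> - 1 / 2 \<ge> - 1 / 2" using D by (simp add: \<nu>_def)
  have pf: "polynomial_function p" using p by (simp add: harmonic_polynomial_def)
  have pc: "continuous_on UNIV p" by (rule continuous_on_polynomial_function[OF pf])
  have gc: "continuous_on UNIV g" unfolding g_def by (rule continuous_on_sphere_average[OF G pc])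
  have test: "(LINT t|lborel. \<phi> t *\<^sub>R (t ^ (D - 1) *\<^sub>R A t)) = (LINT t|lborel. \<phi> t *\<^sub>R (t ^ (D - 1) *\<^sub>R B t))"
    if \<phi>: "continuous_on UNIV \<phi>" and supp: "\<And>t. t \<notin> {a..b} \<Longrightarrow> \<phi> t = 0" and ab: "0 < a" "b < 1" for \<phi> a b
  proof -
    let ?F1 = "\<lambda>\<psi> w. \<phi> (norm w) *\<^sub>R (p \<psi> * G (\<psi> + w))" and ?F2 = "\<lambda>\<psi> z. \<phi> (norm (z - \<psi>)) *\<^sub>R (p \<psi> * G z)"
    have c1: "continuous_on UNIV (\<lambda>(\<psi>, w). ?F1 \<psi> w)"
      by (auto simp: case_prod_beta' intro!: continuous_intros continuous_on_compose2[OF \<phi>] continuous_on_compose2[OF pc] continuous_on_compose2[OF G])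
    have c2: "continuous_on UNIV (\<lambda>(\<psi>, z). ?F2 \<psi> z)"
      by (auto simp: case_prod_beta' intro!: continuous_intros continuous_on_compose2[OF \<phi>] continuous_on_compose2[OF pc] continuous_on_compose2[OF G])
    have "(LINT t|lborel. \<phi> t *\<^sub>R (t ^ (D - 1) *\<^sub>R A t)) = (LINT r:{0<..}|lborel. r ^ (D - 1) *\<^sub>R (LINT \<zeta>|sphere_measure. LINT \<psi>|sphere_measure. ?F1 \<psi> (r *\<^sub>R \<zeta>)))"
      unfolding set_lebesgue_integral_def
    proof (rule Bochner_Integration.integral_cong[OF refl])
      fix r :: real
      show "\<phi> r *\<^sub>R (r ^ (D - 1) *\<^sub>R A r) = indicator {0<..} r *\<^sub>R (r ^ (D - 1) *\<^sub>R (LINT \<zeta>|sphere_measure. LINT \<psi>|sphere_measure. ?F1 \<psi> (r *\<^sub>R \<zeta>)))"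
      proof (cases "r > 0")
        case True
        have "(LINT \<zeta>|sphere_measure. LINT \<psi>|sphere_measure. ?F1 \<psi> (r *\<^sub>R \<zeta>)) = (LINT \<zeta>|sphere_measure. LINT \<psi>|sphere_measure. \<phi> r *\<^sub>R (p \<psi> * G (\<psi> + r *\<^sub>R \<zeta>)))"
          by (rule Bochner_Integration.integral_cong) (use True in auto)
        also have "\<dots> = \<phi> r *\<^sub>R A r" unfolding A_def by (simp only: integral_scaleR_right)
        finally show ?thesis using True by (simp add: mult.commute)
      next
        case False
        then show ?thesis using supp[of r] ab by auto
      qed
    qed
    also have "\<dots> = (LINT \<psi>|sphere_measure. LINT w|lborel. ?F1 \<psi> w)"
      unfolding D_def by (rule sphere_lborel_polar[OF c1, of b, symmetric]) (use supp in auto)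
    also have "\<dots> = (LINT \<psi>|sphere_measure. LINT z|lborel. ?F2 \<psi> z)"
    proof (rule Bochner_Integration.integral_cong[OF refl])
      fix \<psi> :: 'a
      have "?F2 \<psi> \<in> borel_measurable borel"
        by (intro borel_measurable_continuous_onI continuous_intros continuous_on_compose2[OF \<phi>] G) auto
      then have "(LINT z|distr lborel borel (\<lambda>y. \<psi> + y). ?F2 \<psi> z) = (LINT w|lborel. ?F2 \<psi> (\<psi> + w))"
        by (intro integral_distr) auto
      then show "(LINT w|lborel. ?F1 \<psi> w) = (LINT z|lborel. ?F2 \<psi> z)"
        unfolding lborel_distr_plus by simp
    qed
    also have "\<dots> = (LINT r:{0<..}|lborel. r ^ (D - 1) *\<^sub>R (LINT \<zeta>|sphere_measure. LINT \<psi>|sphere_measure. ?F2 \<psi> (r *\<^sub>R \<zeta>)))"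
      unfolding D_def
    proof (rule sphere_lborel_polar[OF c2, of "1 + b"])
      fix \<psi> z :: 'a assume n: "norm \<psi> = 1" "norm z > 1 + b"
      then have "norm (z - \<psi>) > b" using norm_triangle_ineq2[of z \<psi>] by simp
      then show "?F2 \<psi> z = 0" using supp by simp
    qed
    also have "\<dots> = (LINT r|lborel. s *\<^sub>R ((LINT t|lborel. \<phi> t * t ^ (D - 1) * sphere_kernel D m t r) *\<^sub>R g r))"
      unfolding set_lebesgue_integral_def
    proof (rule Bochner_Integration.integral_cong[OF refl])
      fix r :: real
      show "indicator {0<..} r *\<^sub>R (r ^ (D - 1) *\<^sub>R (LINT \<zeta>|sphere_measure. LINT \<psi>|sphere_measure. ?F2 \<psi> (r *\<^sub>R \<zeta>)))
          = s *\<^sub>R ((LINT t|lborel. \<phi> t * t ^ (D - 1) * sphere_kernel D m t r) *\<^sub>R g r)"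
      proof (cases "r > 0")
        case True
        let ?W = "LINT u:{-1..1}|lborel. \<phi> (sqrt (r\<^sup>2 + 1 - 2 * r * u)) * poly (gegen \<nu> m) u * (1 - u\<^sup>2) powr (\<nu> - 1 / 2)"
        have "(LINT \<zeta>|sphere_measure. LINT \<psi>|sphere_measure. ?F2 \<psi> (r *\<^sub>R \<zeta>)) = (LINT \<zeta>|sphere_measure. (s * ?W) *\<^sub>R (G (r *\<^sub>R \<zeta>) * p \<zeta>))"
        proof (rule Bochner_Integration.integral_cong[OF refl])
          fix \<zeta> :: 'a assume "\<zeta> \<in> space sphere_measure"
          then have z: "norm \<zeta> = 1" by simp
          have nn: "norm (r *\<^sub>R \<zeta> - \<psi>) = sqrt (r\<^sup>2 + 1 - 2 * r * (\<zeta> \<bullet> \<psi>))" if "norm \<psi> = 1" for \<psi>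
          proof -
            have "\<zeta> \<bullet> \<zeta> = 1" "\<psi> \<bullet> \<psi> = 1" using z that by (simp_all add: norm_eq_1)
            then show ?thesis
              unfolding norm_eq_sqrt_inner inner_diff_left inner_diff_right inner_scaleR_left inner_scaleR_right
              by (simp add: inner_commute power2_eq_square algebra_simps)
          qed
          have "(LINT \<psi>|sphere_measure. ?F2 \<psi> (r *\<^sub>R \<zeta>)) = (LINT \<psi>|sphere_measure. (\<phi> (sqrt (r\<^sup>2 + 1 - 2 * r * (\<zeta> \<bullet> \<psi>))) *\<^sub>R p \<psi>) * G (r *\<^sub>R \<zeta>))"
            by (rule Bochner_Integration.integral_cong) (use nn in auto)
          also have "\<dots> = (LINT \<psi>|sphere_measure. \<phi> (sqrt (r\<^sup>2 + 1 - 2 * r * (\<zeta> \<bullet> \<psi>))) *\<^sub>R p \<psi>) * G (r *\<^sub>R \<zeta>)"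
            by (simp only: integral_mult_left_zero)
          also have "(LINT \<psi>|sphere_measure. \<phi> (sqrt (r\<^sup>2 + 1 - 2 * r * (\<zeta> \<bullet> \<psi>))) *\<^sub>R p \<psi>) = (s * ?W) *\<^sub>R p \<zeta>"
            unfolding s_def D_def
            by (rule funk_hecke[OF dim z p, of "\<lambda>u. \<phi> (sqrt (r\<^sup>2 + 1 - 2 * r * u))"])
               (auto simp: \<nu>_def D_def intro!: continuous_intros continuous_on_compose2[OF \<phi>])
          finally show "(LINT \<psi>|sphere_measure. ?F2 \<psi> (r *\<^sub>R \<zeta>)) = (s * ?W) *\<^sub>R (G (r *\<^sub>R \<zeta>) * p \<zeta>)"
            by (simp add: mult.commute)
        qed
        also have "\<dots> = (s * ?W) *\<^sub>R g r" unfolding g_def by (simp only: integral_scaleR_right)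
        finally have "r ^ (D - 1) *\<^sub>R (LINT \<zeta>|sphere_measure. LINT \<psi>|sphere_measure. ?F2 \<psi> (r *\<^sub>R \<zeta>)) = s *\<^sub>R ((r ^ (D - 1) * ?W) *\<^sub>R g r)"
          by (simp add: mult_ac)
        also have "r ^ (D - 1) * ?W = (LINT t|lborel. \<phi> t * t ^ (D - 1) * sphere_kernel D m t r)"
          by (rule sphere_kernel_substitution(2)[OF D True \<phi> supp ab \<nu>_def])
        finally show ?thesis using True by (simp only: indicator_simps greaterThan_iff scaleR_one)
      next
        case False
        have z: "\<phi> t * t ^ (D - 1) * sphere_kernel D m t r = 0" for t
        proof (cases "t \<in> {a..b}")
          case True
          then have "sphere_kernel D m t r = 0"
            unfolding sphere_kernel_def using False ab by (intro if_not_P) auto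
          then show ?thesis by simp
        qed (simp add: supp)
        show ?thesis unfolding z using False by simp
      qed
    qed
    also have "\<dots> = s *\<^sub>R (LINT r|lborel. (LINT t|lborel. \<phi> t * t ^ (D - 1) * sphere_kernel D m t r) *\<^sub>R g r)"
      by (rule integral_scaleR_right)
    also have "\<dots> = s *\<^sub>R (LINT t|lborel. (\<phi> t * t ^ (D - 1)) *\<^sub>R (LINT r|lborel. sphere_kernel D m t r *\<^sub>R g r))"
      by (rule arg_cong[where f="\<lambda>z. s *\<^sub>R z"]) (rule sphere_kernel_fubini[OF D gc \<phi> supp ab])
    also have "\<dots> = (LINT t|lborel. \<phi> t *\<^sub>R (t ^ (D - 1) *\<^sub>R B t))"
      unfolding B_def integral_scaleR_right[symmetric] by (simp add: mult_ac)
    finally show ?thesis .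
  qed
  have Ac: "continuous_on {a..b} A" for a b
  proof -
    have "continuous_on ({a..b} \<times> sphere 0 1) (\<lambda>q. LINT \<psi>|sphere_measure. p \<psi> * G (\<psi> + fst q *\<^sub>R (snd q :: 'a)))"
      by (rule continuous_parametric_sphere_integral)
         (auto simp: case_prod_beta' intro!: compact_Times continuous_intros continuous_on_compose2[OF G] continuous_on_compose2[OF pc])
    then show ?thesis unfolding A_def
      by (intro continuous_parametric_sphere_integral) (auto simp: case_prod_beta')
  qed
  \<comment> \<open>In the variable r the support of the kernel moves with t; on the fixed interval
    in u the integrand is the weight times a jointly continuous function.\<close>
  have Bc: "continuous_on {a..b} B" if ab: "0 < a" "b < 1" for a b
  proof -
    let ?H = "\<lambda>t u. poly (gegen \<nu> m) ((1 + t * u) / sqrt (1 + t\<^sup>2 + 2 * t * u)) *\<^sub>R g (sqrt (1 + t\<^sup>2 + 2 * t * u))"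
    have pos: "1 + t\<^sup>2 + 2 * t * u > 0" if "t \<in> {a..b}" "u \<in> {-1..1}" for t u :: real
    proof -
      have "t * (-1) \<le> t * u" using that ab by (intro mult_left_mono) auto
      then have "(1 - t)\<^sup>2 \<le> 1 + t\<^sup>2 + 2 * t * u" by (simp add: power2_eq_square algebra_simps)
      moreover have "(1 - t)\<^sup>2 > 0" using that ab by simp
      ultimately show ?thesis by linarith
    qed
    have "continuous_on ({a..b} \<times> {-1..1}) (\<lambda>(t, u). ?H t u)"
      unfolding case_prod_beta'
      by (intro continuous_intros continuous_on_compose2[OF gc] continuous_on_poly) (use pos in \<open>fastforce+\<close>)
    then have "continuous_on {a..b} (\<lambda>t. LINT u:{-1..1}|lborel. (1 - u\<^sup>2) powr (\<nu> - 1 / 2) *\<^sub>R ?H t u)"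
      by (intro continuous_parametric_weighted_integral \<nu>) auto
    then have cc: "continuous_on {a..b} (\<lambda>t. s *\<^sub>R (LINT u:{-1..1}|lborel. (1 - u\<^sup>2) powr (\<nu> - 1 / 2) *\<^sub>R ?H t u))"
      by (intro continuous_intros)
    have eqB: "B t = s *\<^sub>R (LINT u:{-1..1}|lborel. (1 - u\<^sup>2) powr (\<nu> - 1 / 2) *\<^sub>R ?H t u)" if "t \<in> {a..b}" for t
      unfolding B_def using that ab
      by (subst sphere_kernel_integral[OF D _ _ continuous_on_subset[OF gc] \<nu>_def]) auto
    show ?thesis by (rule continuous_on_eq[OF cc eqB[symmetric]])
  qed
  have "t ^ (D - 1) *\<^sub>R A t - t ^ (D - 1) *\<^sub>R B t = 0"
  proof (rule continuous_vanishing_test_functions[OF _ _ t])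
    show "continuous_on {0<..<1} (\<lambda>t. t ^ (D - 1) *\<^sub>R A t - t ^ (D - 1) *\<^sub>R B t)"
      by (rule continuous_on_greaterThanLessThan) (intro continuous_intros Ac Bc)
    fix \<phi> :: "real \<Rightarrow> real" and a b :: real
    assume \<phi>: "continuous_on UNIV \<phi>" and supp: "\<And>t. t \<notin> {a..b} \<Longrightarrow> \<phi> t = 0" and ab: "0 < a" "b < 1"
    have i: "integrable lborel (\<lambda>t. \<phi> t *\<^sub>R (t ^ (D - 1) *\<^sub>R f t))" if "continuous_on {a..b} f" for f :: "real \<Rightarrow> complex"
    proof -
      have "set_integrable lborel {a..b} (\<lambda>t. \<phi> t *\<^sub>R (t ^ (D - 1) *\<^sub>R f t))"
        unfolding set_integrable_def
        by (rule borel_integrable_compact) (auto intro!: continuous_intros that continuous_on_subset[OF \<phi>])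
      moreover have "indicator {a..b} t *\<^sub>R (\<phi> t *\<^sub>R (t ^ (D - 1) *\<^sub>R f t)) = \<phi> t *\<^sub>R (t ^ (D - 1) *\<^sub>R f t)" for t
        using supp[of t] by (cases "t \<in> {a..b}") auto
      ultimately show ?thesis unfolding set_integrable_def by (simp only:)
    qed
    have "(LINT t|lborel. \<phi> t *\<^sub>R (t ^ (D - 1) *\<^sub>R A t - t ^ (D - 1) *\<^sub>R B t))
        = (LINT t|lborel. \<phi> t *\<^sub>R (t ^ (D - 1) *\<^sub>R A t)) - (LINT t|lborel. \<phi> t *\<^sub>R (t ^ (D - 1) *\<^sub>R B t))"
      unfolding scaleR_diff_right
      by (rule Bochner_Integration.integral_diff) (intro i Ac Bc ab)+
    then show "(LINT t|lborel. \<phi> t *\<^sub>R (t ^ (D - 1) *\<^sub>R A t - t ^ (D - 1) *\<^sub>R B t)) = 0"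
      using test[OF \<phi> supp ab] by simp
  qed
  then have "t ^ (D - 1) *\<^sub>R (A t - B t) = 0" by (simp only: scaleR_diff_right)
  then have AB: "A t = B t" using t by simp
  have "(LINT \<psi>|sphere_measure. LINT \<omega>|sphere_measure. p \<psi> * G (\<psi> + t *\<^sub>R \<omega>)) = A t"
    unfolding A_def
    by (rule sphere_measure_fubini)
       (auto simp: case_prod_beta' intro!: continuous_intros continuous_on_compose2[OF G] continuous_on_compose2[OF pc])
  then show ?thesis unfolding AB B_def s_def g_def D_def .
qed

section \<open>Fejer summation\<close>

text \<open>An antiderivative of (1 - cos w) / w^2 is Si(w) - (1 - cos w) / w, which tends to
  \<pi>/2 at infinity. Division by zero gives the integrand the value 0 at w = 0; \<open>k\<close>
  carries the limit 1/2 there, so that the fundamental theorem applies on the closed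
  half-line.\<close>

lemma
  shows integrable_fejer_kernel: "integrable lborel (\<lambda>w::real. 2 * (1 - cos w) / w\<^sup>2)"
    and integral_fejer_kernel: "(LINT w|lborel. 2 * (1 - cos w) / w\<^sup>2) = 2 * pi"
proof -
  define k :: "real \<Rightarrow> real" where "k w = (if w = 0 then 1 / 2 else (1 - cos w) / w\<^sup>2)" for w
  define F :: "real \<Rightarrow> real" where "F w = Si w - (1 - cos w) / w" for w
  have km [measurable]: "k \<in> borel_measurable borel" unfolding k_def by measurable
  have k0: "k w \<ge> 0" for w by (simp add: k_def)
  have kneg: "k (0 + (-1) * w) = k w" for w by (simp add: k_def)
  have half: "(\<integral>\<^sup>+w. ennreal (k w) * indicator {0..} w \<partial>lborel) = ennreal (pi / 2 - F 0)"
  proof (rule nn_integral_FTC_atLeast)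
    show "DERIV F x :> k x" if "0 \<le> x" for x
    proof (cases "x = 0")
      case True
      have "((\<lambda>h::real. (1 - cos h) / h / h) \<longlongrightarrow> 1 / 2) (at 0)" by real_asymp
      then have "((\<lambda>w. (1 - cos w) / w) has_real_derivative 1 / 2) (at (0::real))"
        by (simp add: DERIV_def)
      from DERIV_diff[OF DERIV_Si[of 0] this] show ?thesis
        using True by (simp add: F_def[abs_def] k_def)
    next
      case False
      have "((\<lambda>w. (1 - cos w) / w) has_real_derivative (sin x * x - (1 - cos x) * 1) / (x * x)) (at x)"
        by (rule DERIV_divide) (use False in \<open>auto intro!: derivative_eq_intros\<close>)
      from DERIV_diff[OF DERIV_Si[of x] this]
      have "(F has_real_derivative sinc x - (sin x * x - (1 - cos x) * 1) / (x * x)) (at x)"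
        by (simp add: F_def[abs_def])
      also have "sinc x - (sin x * x - (1 - cos x) * 1) / (x * x) = k x"
        using False by (simp add: k_def power2_eq_square field_simps)
      finally show ?thesis .
    qed
    have "((\<lambda>w::real. (1 - cos w) / w) \<longlongrightarrow> 0) at_top"
    proof (rule Lim_null_comparison)
      show "eventually (\<lambda>w::real. norm ((1 - cos w) / w) \<le> 2 / w) at_top"
        using eventually_gt_at_top[of "0::real"]
      proof eventually_elim
        case (elim w)
        have "norm ((1 - cos w) / w) = (1 - cos w) / w" using elim by simp
        also have "\<dots> \<le> 2 / w"
        proof (rule divide_right_mono)
          show "1 - cos w \<le> 2" using cos_ge_minus_one[of w] by linarith
        qed (use elim in simp)
        finally show ?case .
      qed
      show "((\<lambda>w::real. 2 / w) \<longlongrightarrow> 0) at_top" by real_asymp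
    qed
    from tendsto_diff[OF Si_at_top this] show "(F \<longlongrightarrow> pi / 2) at_top"
      by (simp add: F_def[abs_def])
  qed (use k0 in auto)
  have F0: "F 0 = 0" using Si_neg[of 0] by (simp add: F_def)
  have half': "(\<integral>\<^sup>+w. ennreal (k w) * indicator {..0} w \<partial>lborel) = ennreal (pi / 2)"
  proof -
    have "(\<integral>\<^sup>+w. ennreal (k w) * indicator {..0} w \<partial>lborel)
        = ennreal \<bar>-1::real\<bar> * (\<integral>\<^sup>+w. ennreal (k (0 + (-1) * w)) * indicator {..0} (0 + (-1) * w) \<partial>lborel)"
      by (rule nn_integral_real_affine) auto
    also have "\<dots> = (\<integral>\<^sup>+w. ennreal (k w) * indicator {0..} w \<partial>lborel)"
      unfolding kneg by (simp add: indicator_def)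
    finally show ?thesis unfolding half F0 by simp
  qed
  have "(\<integral>\<^sup>+w. ennreal (k w) \<partial>lborel)
      = (\<integral>\<^sup>+w. ennreal (k w) * indicator {0..} w + ennreal (k w) * indicator {..0} w \<partial>lborel)"
  proof (rule nn_integral_cong_AE)
    have "AE w in lborel. w \<noteq> (0::real)" by (rule AE_lborel_singleton)
    then show "AE w in lborel. ennreal (k w) = ennreal (k w) * indicator {0..} w + ennreal (k w) * indicator {..0} w"
      by (rule eventually_mono) (auto split: split_indicator)
  qed
  also have "\<dots> = ennreal (pi / 2) + ennreal (pi / 2)"
    by (subst nn_integral_add) (simp_all add: half half' F0)
  also have "\<dots> = ennreal pi" by (simp flip: ennreal_plus)
  finally have nn: "(\<integral>\<^sup>+w. ennreal (k w) \<partial>lborel) = ennreal pi" .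
  have hb: "has_bochner_integral lborel k pi"
    by (rule has_bochner_integral_nn_integral) (use k0 nn in auto)
  have ae: "AE w in lborel. 2 * (1 - cos w) / w\<^sup>2 = 2 * k w"
    using AE_lborel_singleton[of "0::real"] by (rule eventually_mono) (simp add: k_def)
  have "has_bochner_integral lborel (\<lambda>w. 2 * k w) (2 * pi)"
    by (rule has_bochner_integral_mult_right) (rule hb)
  then have "has_bochner_integral lborel (\<lambda>w. 2 * (1 - cos w) / w\<^sup>2) (2 * pi)"
    by (subst has_bochner_integral_cong_AE[OF _ _ ae]) auto
  then show "integrable lborel (\<lambda>w::real. 2 * (1 - cos w) / w\<^sup>2)"
    "(LINT w|lborel. 2 * (1 - cos w) / w\<^sup>2) = 2 * pi"
    by (auto simp: has_bochner_integral_iff)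
qed

text \<open>Near 0 the scaling v = w / T turns the kernel into a fixed integrable one, and
  continuity of g at 0 gives the limit by dominated convergence. Away from 0 the kernel is at most 4
  / (T \<delta>^2), so integrability of g makes that part O(1/T).\<close>

proposition fejer_limit:
  fixes g :: "real \<Rightarrow> complex"
  assumes g: "integrable lborel g" and c: "isCont g 0"
  shows "((\<lambda>T. LINT v|lborel. (1 / T * (2 * (1 - cos (T * v)) / v\<^sup>2)) *\<^sub>R g v) \<longlongrightarrow> (2 * pi) *\<^sub>R g 0) at_top"
proof -
  let ?k = "\<lambda>w::real. 2 * (1 - cos w) / w\<^sup>2"
  let ?K = "\<lambda>T v. 1 / T * (2 * (1 - cos (T * v)) / v\<^sup>2)"
  have gm [measurable]: "g \<in> borel_measurable borel" using g by auto
  obtain \<delta> where \<delta>: "\<delta> > 0" "\<And>v. \<bar>v\<bar> < \<delta> \<Longrightarrow> dist (g v) (g 0) < 1"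
    using c unfolding continuous_at_eps_delta by (metis dist_real_def diff_zero zero_less_one)
  define M where "M = norm (g 0) + 1"
  have M: "norm (g v) \<le> M" if "\<bar>v\<bar> < \<delta>" for v
    using \<delta>(2)[OF that] norm_triangle_ineq2[of "g v" "g 0"] by (simp add: M_def dist_norm)
  define a where "a v = indicator {-\<delta><..<\<delta>} v *\<^sub>R g v" for v
  define b where "b v = indicator (- {-\<delta><..<\<delta>}) v *\<^sub>R g v" for v
  have ai: "integrable lborel a" and bi: "integrable lborel b"
    unfolding a_def b_def by (rule integrable_mult_indicator[OF _ g], simp)+
  have [measurable]: "a \<in> borel_measurable borel" "b \<in> borel_measurable borel" using ai bi by auto
  have ab: "g v = a v + b v" for v by (auto simp: a_def b_def split: split_indicator)
  have Kk: "?K T ((1 / T) * w) = T * ?k w" if "T > 0" for T w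
    using that by (simp add: power_divide power2_eq_square)
  have aT: "(LINT v|lborel. ?K T v *\<^sub>R a v) = (LINT w|lborel. ?k w *\<^sub>R a (w / T))" if T: "T > 0" for T
  proof -
    have "(LINT v|lborel. ?K T v *\<^sub>R a v) = \<bar>1 / T\<bar> *\<^sub>R (LINT w|lborel. ?K T (0 + (1 / T) * w) *\<^sub>R a (0 + (1 / T) * w))"
      by (rule lborel_integral_real_affine) (use T in simp)
    also have "\<dots> = (LINT w|lborel. \<bar>1 / T\<bar> *\<^sub>R (?K T ((1 / T) * w) *\<^sub>R a (w / T)))"
      by (simp only: integral_scaleR_right add_0) simp
    also have "\<dots> = (LINT w|lborel. ?k w *\<^sub>R a (w / T))"
      unfolding Kk[OF T] scaleR_scaleR using T by simp
    finally show ?thesis .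
  qed
  have "((\<lambda>T. LINT w|lborel. ?k w *\<^sub>R a (w / T)) \<longlongrightarrow> (LINT w|lborel. ?k w *\<^sub>R g 0)) at_top"
  proof (rule integral_dominated_convergence_at_top[where w="\<lambda>w. ?k w * M"])
    show "integrable lborel (\<lambda>w. ?k w * M)" using integrable_fejer_kernel by (rule integrable_mult_left)
    show "AE w in lborel. ((\<lambda>T. ?k w *\<^sub>R a (w / T)) \<longlongrightarrow> ?k w *\<^sub>R g 0) at_top"
    proof (rule AE_I2)
      fix w :: real
      have lim: "((\<lambda>T. w / T) \<longlongrightarrow> 0) at_top" by real_asymp
      have "((\<lambda>T. g (w / T)) \<longlongrightarrow> g 0) at_top" by (rule isCont_tendsto_compose[OF c lim])
      moreover have "eventually (\<lambda>T. g (w / T) = a (w / T)) at_top"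
        using order_tendstoD(1)[OF lim, of "-\<delta>"] order_tendstoD(2)[OF lim, of \<delta>] \<delta>(1)
        by (auto simp: a_def elim: eventually_elim2)
      ultimately have "((\<lambda>T. a (w / T)) \<longlongrightarrow> g 0) at_top" by (rule Lim_transform_eventually)
      then show "((\<lambda>T. ?k w *\<^sub>R a (w / T)) \<longlongrightarrow> ?k w *\<^sub>R g 0) at_top" by (intro tendsto_intros)
    qed
    have am: "norm (a v) \<le> M" for v
      using M[of v] by (auto simp: a_def M_def abs_less_iff split: split_indicator)
    show "eventually (\<lambda>T. AE w in lborel. norm (?k w *\<^sub>R a (w / T)) \<le> ?k w * M) at_top"
      by (intro always_eventually allI AE_I2) (simp add: divide_right_mono mult_left_mono am)
  qed measurable
  also have "(LINT w|lborel. ?k w *\<^sub>R g 0) = (2 * pi) *\<^sub>R g 0"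
    using integral_scaleR_left[OF integrable_fejer_kernel, of "g 0"] unfolding integral_fejer_kernel by simp
  finally have "((\<lambda>T. LINT w|lborel. ?k w *\<^sub>R a (w / T)) \<longlongrightarrow> (2 * pi) *\<^sub>R g 0) at_top" .
  moreover have "eventually (\<lambda>T. (LINT w|lborel. ?k w *\<^sub>R a (w / T)) = (LINT v|lborel. ?K T v *\<^sub>R a v)) at_top"
    using eventually_gt_at_top[of "0::real"] by eventually_elim (simp only: aT)
  ultimately have near: "((\<lambda>T. LINT v|lborel. ?K T v *\<^sub>R a v) \<longlongrightarrow> (2 * pi) *\<^sub>R g 0) at_top"
    by (rule Lim_transform_eventually)
  have Kb: "norm (?K T v *\<^sub>R b v) \<le> 4 / (T * \<delta>\<^sup>2) * norm (g v)" if T: "T > 0" for T v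
  proof (cases "\<bar>v\<bar> < \<delta>")
    case True
    then show ?thesis using T by (simp add: b_def abs_less_iff)
  next
    case False
    have "1 - cos (T * v) \<le> 2" using cos_ge_minus_one[of "T * v"] by linarith
    then have "2 * (1 - cos (T * v)) / v\<^sup>2 \<le> 4 / \<delta>\<^sup>2"
    proof (intro frac_le)
      show "2 * (1 - cos (T * v)) \<le> 4" using mult_left_mono[OF \<open>1 - cos (T * v) \<le> 2\<close>, of 2] by simp
      show "\<delta>\<^sup>2 \<le> v\<^sup>2" using power_mono[of \<delta> "\<bar>v\<bar>" 2] False \<delta>(1) by simp
    qed (use \<delta>(1) in simp_all)
    then have "?K T v \<le> 1 / T * (4 / \<delta>\<^sup>2)" using T by (intro mult_left_mono) auto
    moreover have "?K T v \<ge> 0" using T by simp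
    moreover have "norm (b v) \<le> norm (g v)" by (simp add: b_def indicator_def)
    ultimately have "\<bar>?K T v\<bar> * norm (b v) \<le> (1 / T * (4 / \<delta>\<^sup>2)) * norm (g v)"
      using T by (intro mult_mono) auto
    then show ?thesis by simp
  qed
  have Kbi: "integrable lborel (\<lambda>v. ?K T v *\<^sub>R b v)" if T: "T > 0" for T
  proof (rule Bochner_Integration.integrable_bound[where f="\<lambda>v. (4 / (T * \<delta>\<^sup>2)) * norm (g v)"])
    show "integrable lborel (\<lambda>v. (4 / (T * \<delta>\<^sup>2)) * norm (g v))"
      by (rule integrable_mult_right[OF integrable_norm[OF g]])
    show "AE v in lborel. norm (?K T v *\<^sub>R b v) \<le> norm ((4 / (T * \<delta>\<^sup>2)) * norm (g v))"
      unfolding real_norm_def[of "_ * norm (g _)"] by (rule AE_I2) (rule order_trans[OF Kb[OF T] abs_ge_self])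
  qed measurable
  have Kai: "integrable lborel (\<lambda>v. ?K T v *\<^sub>R a v)" if T: "T > 0" for T
  proof (rule Bochner_Integration.integrable_bound[where f="\<lambda>v. (?K T v) * M"])
    have "integrable lborel (\<lambda>v. ?k (0 + T * v))"
      by (rule lborel_integrable_real_affine[OF integrable_fejer_kernel]) (use T in simp)
    then have "integrable lborel (\<lambda>v. T * ?k (0 + T * v))" by (rule integrable_mult_right)
    moreover have "T * ?k (0 + T * v) = ?K T v" for v using T by (simp add: power_mult_distrib power2_eq_square)
    ultimately show "integrable lborel (\<lambda>v. ?K T v * M)" by (simp only: integrable_mult_left)
    show "AE v in lborel. norm (?K T v *\<^sub>R a v) \<le> norm (?K T v * M)"
    proof (rule AE_I2)
      fix v
      have "norm (a v) \<le> M"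
        using M[of v] by (auto simp: a_def M_def abs_less_iff split: split_indicator)
      then have "\<bar>?K T v\<bar> * norm (a v) \<le> \<bar>?K T v\<bar> * \<bar>M\<bar>" by (intro mult_left_mono) auto
      then show "norm (?K T v *\<^sub>R a v) \<le> norm (?K T v * M)" by (simp only: norm_scaleR real_norm_def abs_mult)
    qed
  qed measurable
  have far: "((\<lambda>T. LINT v|lborel. ?K T v *\<^sub>R b v) \<longlongrightarrow> 0) at_top"
  proof (rule Lim_null_comparison)
    show "eventually (\<lambda>T. norm (LINT v|lborel. ?K T v *\<^sub>R b v) \<le> 4 / (T * \<delta>\<^sup>2) * (LINT v|lborel. norm (g v))) at_top"
      using eventually_gt_at_top[of "0::real"]
    proof eventually_elim
      case (elim T)
      have "norm (LINT v|lborel. ?K T v *\<^sub>R b v) \<le> (LINT v|lborel. norm (?K T v *\<^sub>R b v))" by (rule integral_norm_bound)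
      also have "\<dots> \<le> (LINT v|lborel. 4 / (T * \<delta>\<^sup>2) * norm (g v))"
        by (rule integral_mono[OF integrable_norm[OF Kbi[OF elim]] integrable_mult_right[OF integrable_norm[OF g]] Kb[OF elim]])
      finally show ?case by (simp only: integral_mult_right_zero)
    qed
    have "((\<lambda>T. (4 / \<delta>\<^sup>2 * (LINT v|lborel. norm (g v))) / T) \<longlongrightarrow> 0) at_top"
      by (rule tendsto_divide_0[OF tendsto_const filterlim_at_top_imp_at_infinity[OF filterlim_ident]])
    then show "((\<lambda>T. 4 / (T * \<delta>\<^sup>2) * (LINT v|lborel. norm (g v))) \<longlongrightarrow> 0) at_top"
      by (simp add: field_simps)
  qed
  have "eventually (\<lambda>T. (LINT v|lborel. ?K T v *\<^sub>R a v) + (LINT v|lborel. ?K T v *\<^sub>R b v) = (LINT v|lborel. ?K T v *\<^sub>R g v)) at_top"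
    using eventually_gt_at_top[of "0::real"]
  proof eventually_elim
    case (elim T)
    have "(LINT v|lborel. ?K T v *\<^sub>R g v) = (LINT v|lborel. ?K T v *\<^sub>R a v + ?K T v *\<^sub>R b v)"
      unfolding ab scaleR_add_right ..
    also have "\<dots> = (LINT v|lborel. ?K T v *\<^sub>R a v) + (LINT v|lborel. ?K T v *\<^sub>R b v)"
      by (rule Bochner_Integration.integral_add[OF Kai[OF elim] Kbi[OF elim]])
    finally show ?case by (rule sym)
  qed
  from Lim_transform_eventually[OF tendsto_add[OF near far] this] show ?thesis by (simp only: add_0_right)
qed

text \<open>A bounded kernel on a compact range of s times an integrable g is integrable on the
  product, so Fubini applies.\<close>

lemma
  fixes k :: "real \<Rightarrow> real \<Rightarrow> complex" and g :: "real \<Rightarrow> complex"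
  assumes k: "(\<lambda>(s, v). k s v) \<in> borel_measurable (borel \<Otimes>\<^sub>M borel)"
    and b: "\<And>s v. s \<in> {\<alpha>..\<beta>} \<Longrightarrow> norm (k s v) \<le> B" and g: "integrable lborel g"
  shows set_integrable_parametric: "set_integrable lborel {\<alpha>..\<beta>} (\<lambda>s. LINT v|lborel. k s v * g v)"
    and set_integral_parametric_swap: "(LINT s:{\<alpha>..\<beta>}|lborel. LINT v|lborel. k s v * g v)
      = (LINT v|lborel. (LINT s:{\<alpha>..\<beta>}|lborel. k s v) * g v)"
proof -
  have [measurable]: "g \<in> borel_measurable borel" using g by auto
  note [measurable] = k
  let ?f = "\<lambda>s v. indicator {\<alpha>..\<beta>} s *\<^sub>R (k s v * g v)"
  have km [measurable]: "k s \<in> borel_measurable borel" for s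
    using measurable_compose[OF measurable_Pair1' k, of s] by simp
  have kgi: "integrable lborel (\<lambda>v. k s v * g v)" if "s \<in> {\<alpha>..\<beta>}" for s
  proof (rule Bochner_Integration.integrable_bound[where f="\<lambda>v. B * norm (g v)"])
    show "AE v in lborel. norm (k s v * g v) \<le> norm (B * norm (g v))"
    proof (rule AE_I2)
      fix v
      have "norm (k s v) * norm (g v) \<le> B * norm (g v)" using b[OF that] by (intro mult_right_mono) auto
      then show "norm (k s v * g v) \<le> norm (B * norm (g v))" by (simp add: norm_mult)
    qed
  qed (use g in auto)
  have kgn: "(LINT v|lborel. norm (k s v * g v)) \<le> B * (LINT v|lborel. norm (g v))" if "s \<in> {\<alpha>..\<beta>}" for s
  proof -
    have "(LINT v|lborel. norm (k s v * g v)) \<le> (LINT v|lborel. B * norm (g v))"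
    proof (rule integral_mono)
      show "integrable lborel (\<lambda>v. norm (k s v * g v))" by (rule integrable_norm[OF kgi[OF that]])
      show "norm (k s v * g v) \<le> B * norm (g v)" for v
        unfolding norm_mult using b[OF that] by (intro mult_right_mono) auto
    qed (use g in auto)
    then show ?thesis by simp
  qed
  have int: "integrable (lborel \<Otimes>\<^sub>M lborel) (\<lambda>(s, v). ?f s v)"
  proof (rule lborel_pair.Fubini_integrable)
    show "(\<lambda>(s, v). ?f s v) \<in> borel_measurable (lborel \<Otimes>\<^sub>M lborel)" by measurable
    show "AE s in lborel. integrable lborel (\<lambda>v. case (s, v) of (s, v) \<Rightarrow> ?f s v)"
      unfolding prod.case by (intro AE_I2 integrable_scaleR_right kgi) (auto split: split_indicator_asm)
    show "integrable lborel (\<lambda>s. LINT v|lborel. norm (case (s, v) of (s, v) \<Rightarrow> ?f s v))"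
    proof (rule Bochner_Integration.integrable_bound[where f="\<lambda>s. indicator {\<alpha>..\<beta>} s * (B * (LINT v|lborel. norm (g v)))"])
      show "integrable lborel (\<lambda>s. indicator {\<alpha>..\<beta>} s * (B * (LINT v|lborel. norm (g v))))"
        by (intro integrable_mult_left integrable_real_indicator) (auto simp: emeasure_lborel_Icc_eq)
      show "(\<lambda>s. LINT v|lborel. norm (case (s, v) of (s, v) \<Rightarrow> ?f s v)) \<in> borel_measurable lborel" by measurable
      show "AE s in lborel. norm (LINT v|lborel. norm (case (s, v) of (s, v) \<Rightarrow> ?f s v))
          \<le> norm (indicator {\<alpha>..\<beta>} s * (B * (LINT v|lborel. norm (g v))))"
      proof (rule AE_I2)
        fix s
        show "norm (LINT v|lborel. norm (case (s, v) of (s, v) \<Rightarrow> ?f s v)) \<le> norm (indicator {\<alpha>..\<beta>} s * (B * (LINT v|lborel. norm (g v))))"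
        proof (cases "s \<in> {\<alpha>..\<beta>}")
          case True
          have "0 \<le> (LINT v|lborel. norm (k s v * g v))" by (rule integral_nonneg_AE) simp
          with kgn[OF True] show ?thesis using True by simp
        qed simp
      qed
    qed
  qed
  have "integrable lborel (\<lambda>s. LINT v|lborel. ?f s v)"
    using lborel_pair.integrable_fst'[OF int] by simp
  then show "set_integrable lborel {\<alpha>..\<beta>} (\<lambda>s. LINT v|lborel. k s v * g v)"
    unfolding set_integrable_def by (simp only: integral_scaleR_right)
  have ks: "integrable lborel (\<lambda>s. indicator {\<alpha>..\<beta>} s *\<^sub>R k s v)" for v
  proof (rule Bochner_Integration.integrable_bound[where f="\<lambda>s. indicator {\<alpha>..\<beta>} s * B"])
    show "integrable lborel (\<lambda>s. indicator {\<alpha>..\<beta>} s * B)"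
      by (intro integrable_mult_left integrable_real_indicator) (auto simp: emeasure_lborel_Icc_eq)
    have "(\<lambda>s. k s v) \<in> borel_measurable borel"
      using measurable_compose[OF measurable_Pair2' k, of v] by simp
    then show "(\<lambda>s. indicator {\<alpha>..\<beta>} s *\<^sub>R k s v) \<in> borel_measurable lborel" by measurable
    show "AE s in lborel. norm (indicator {\<alpha>..\<beta>} s *\<^sub>R k s v) \<le> norm (indicator {\<alpha>..\<beta>} s * B)"
      using order_trans[OF b abs_ge_self] by (intro AE_I2) (auto split: split_indicator)
  qed
  have "(LINT s:{\<alpha>..\<beta>}|lborel. LINT v|lborel. k s v * g v) = (LINT s|lborel. LINT v|lborel. ?f s v)"
    unfolding set_lebesgue_integral_def by (simp only: integral_scaleR_right)
  also have "\<dots> = (LINT v|lborel. LINT s|lborel. ?f s v)"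
    by (rule lborel_pair.Fubini_integral[OF int, symmetric])
  also have "\<dots> = (LINT v|lborel. (LINT s:{\<alpha>..\<beta>}|lborel. k s v) * g v)"
  proof (rule Bochner_Integration.integral_cong[OF refl])
    fix v
    have "(LINT s|lborel. ?f s v) = (LINT s|lborel. (indicator {\<alpha>..\<beta>} s *\<^sub>R k s v) * g v)" by simp
    also have "\<dots> = (LINT s:{\<alpha>..\<beta>}|lborel. k s v) * g v"
      unfolding set_lebesgue_integral_def by (rule integral_mult_left_zero)
    finally show "(LINT s|lborel. ?f s v) = (LINT s:{\<alpha>..\<beta>}|lborel. k s v) * g v" .
  qed
  finally show "(LINT s:{\<alpha>..\<beta>}|lborel. LINT v|lborel. k s v * g v) = (LINT v|lborel. (LINT s:{\<alpha>..\<beta>}|lborel. k s v) * g v)" .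
qed

lemma set_integral_continuous_FTC:
  fixes f F :: "real \<Rightarrow> complex"
  assumes "a \<le> b" "\<And>x. (F has_vector_derivative f x) (at x)" "continuous_on {a..b} f"
  shows "(LINT x:{a..b}|lborel. f x) = F b - F a"
proof -
  have i: "set_integrable lborel {a..b} f"
    unfolding set_integrable_def by (rule borel_integrable_compact) (use assms in auto)
  have "(f has_integral F b - F a) {a..b}"
    by (rule fundamental_theorem_of_calculus) (use assms in \<open>auto intro: has_vector_derivative_at_within\<close>)
  then show ?thesis using set_borel_integral_eq_integral(2)[OF i] by (auto dest: integral_unique)
qed

section \<open>Fejer means along a vertical line\<close>

text \<open>The integral of exp(i \<tau> v) over the segment from -u to u, with its limit 2 u at v =
  0. Its own integral over 0 \<le> u \<le> T is, up to the factor 1/T, the kernel of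
  \<open>fejer_limit\<close>.\<close>

definition dirichlet_kernel :: "real \<Rightarrow> real \<Rightarrow> real" where
  "dirichlet_kernel u v = (if v = 0 then 2 * u else 2 * sin (u * v) / v)"

lemma integral_exp_dirichlet:
  assumes "u \<ge> 0"
  shows "(LINT \<tau>:{-u..u}|lborel. exp (\<i> * of_real (\<tau> * v))) = of_real (dirichlet_kernel u v)"
proof (cases "v = 0")
  case True
  have "(LINT \<tau>:{-u..u}|lborel. (1::complex)) = of_real u - of_real (-u)"
    by (rule set_integral_continuous_FTC)
       (use assms in \<open>auto intro!: derivative_eq_intros simp: has_vector_derivative_of_real\<close>)
  then show ?thesis using True by (simp add: dirichlet_kernel_def)
next
  case False
  have "(LINT \<tau>:{-u..u}|lborel. exp (\<i> * of_real (\<tau> * v)))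
      = exp (\<i> * of_real (u * v)) / (\<i> * of_real v) - exp (\<i> * of_real (- u * v)) / (\<i> * of_real v)"
  proof (rule set_integral_continuous_FTC)
    fix x :: real
    have "((\<lambda>z. exp (\<i> * (z * of_real v)) / (\<i> * of_real v)) has_field_derivative exp (\<i> * (of_real x * of_real v))) (at (of_real x))"
    proof -
      have "((\<lambda>z. exp (\<i> * (z * of_real v))) has_field_derivative exp (\<i> * (of_real x * of_real v)) * (\<i> * of_real v)) (at (of_real x))"
        by (auto intro!: derivative_eq_intros)
      from DERIV_cdivide[OF this, of "\<i> * of_real v"] show ?thesis using False by (simp only: nonzero_mult_div_cancel_right mult_eq_0_iff complex_i_not_zero of_real_eq_0_iff simp_thms)
    qed
    from has_vector_derivative_real_field[OF this]
    show "((\<lambda>\<tau>. exp (\<i> * of_real (\<tau> * v)) / (\<i> * of_real v)) has_vector_derivative exp (\<i> * of_real (x * v))) (at x)"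
      by (simp add: o_def)
  qed (use assms in \<open>auto intro!: continuous_intros\<close>)
  also have "\<dots> = of_real (2 * sin (u * v) / v)"
  proof -
    have e: "exp (\<i> * of_real x) = of_real (cos x) + \<i> * of_real (sin x)" for x :: real
      by (simp add: exp_Euler cos_of_real sin_of_real)
    show ?thesis unfolding e using False by (simp add: field_simps)
  qed
  finally show ?thesis using False by (simp add: dirichlet_kernel_def)
qed

lemma abs_dirichlet_le: "\<bar>dirichlet_kernel u v\<bar> \<le> 2 * \<bar>u\<bar>"
proof (cases "v = 0")
  case False
  have "\<bar>sin (u * v)\<bar> \<le> \<bar>u * v\<bar>" by (rule abs_sin_x_le_abs_x)
  then show ?thesis using False by (simp add: dirichlet_kernel_def abs_mult divide_le_eq)
qed (simp add: dirichlet_kernel_def)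

lemma integral_dirichlet_fejer:
  assumes "T \<ge> 0" "v \<noteq> 0"
  shows "(LINT u:{0..T}|lborel. complex_of_real (dirichlet_kernel u v)) = of_real (2 * (1 - cos (T * v)) / v\<^sup>2)"
proof -
  have "(LINT u:{0..T}|lborel. complex_of_real (dirichlet_kernel u v))
      = of_real (- (2 * cos (T * v) / v\<^sup>2)) - of_real (- (2 * cos (0 * v) / v\<^sup>2))"
  proof (rule set_integral_continuous_FTC)
    fix x :: real
    have "((\<lambda>u. - (2 * cos (u * v) / v\<^sup>2)) has_real_derivative dirichlet_kernel x v) (at x)"
      using assms by (auto intro!: derivative_eq_intros simp: dirichlet_kernel_def power2_eq_square)
    then show "((\<lambda>u. complex_of_real (- (2 * cos (u * v) / v\<^sup>2))) has_vector_derivative complex_of_real (dirichlet_kernel x v)) (at x)"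
      by (intro has_vector_derivative_of_real) (simp add: has_real_derivative_iff_has_vector_derivative)
  qed (use assms in \<open>auto simp: dirichlet_kernel_def intro!: continuous_intros\<close>)
  then show ?thesis by (simp add: diff_divide_distrib right_diff_distrib)
qed

text \<open>Along the line \<phi> is almost everywhere the Fourier transform of g. Its integrals
  over symmetric segments are Dirichlet means of g, and the averages of these over 0 < u < T are
  Fejer means, which converge to 2 \<pi> g(0). Exceptional null sets do not affect integrals along
  segments.\<close>

proposition fejer_vline:
  fixes g :: "real \<Rightarrow> complex"
  assumes g: "integrable lborel g" and c: "isCont g 0"
    and \<phi>: "AE \<tau> in lborel. \<phi> (Complex \<rho> \<tau>) = (LINT v|lborel. exp (\<i> * of_real (\<tau> * v)) * g v)"
  shows "vline_has_integral \<rho> \<phi> (2 * of_real pi * \<i> * g 0)"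
proof -
  define G where "G \<tau> = (LINT v|lborel. exp (\<i> * of_real (\<tau> * v)) * g v)" for \<tau>
  have m1: "(\<lambda>(\<tau>, v). exp (\<i> * of_real (\<tau> * v)) :: complex) \<in> borel_measurable (borel \<Otimes>\<^sub>M borel)"
    unfolding borel_prod by (rule borel_measurable_continuous_onI) (auto simp: case_prod_beta' intro!: continuous_intros)
  have b1: "norm (exp (\<i> * of_real (\<tau> * v)) :: complex) \<le> 1" for \<tau> v by simp
  have m2: "(\<lambda>(u, v). complex_of_real (dirichlet_kernel u v)) \<in> borel_measurable (borel \<Otimes>\<^sub>M borel)"
    unfolding dirichlet_kernel_def[abs_def] by measurable
  have Gi: "set_integrable lborel {-u..u} G" for u
    unfolding G_def by (rule set_integrable_parametric[OF m1 b1 g])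
  have GI: "integral {-u..u} G = (LINT v|lborel. of_real (dirichlet_kernel u v) * g v)" if "u \<ge> 0" for u
  proof -
    have "integral {-u..u} G = (LINT \<tau>:{-u..u}|lborel. G \<tau>)"
      by (rule set_borel_integral_eq_integral(2)[OF Gi, symmetric])
    also have "\<dots> = (LINT v|lborel. (LINT \<tau>:{-u..u}|lborel. exp (\<i> * of_real (\<tau> * v))) * g v)"
      unfolding G_def by (rule set_integral_parametric_swap[OF m1 b1 g])
    finally show ?thesis unfolding integral_exp_dirichlet[OF that] .
  qed
  obtain N where N0: "{\<tau> \<in> space lborel. \<not> \<phi> (Complex \<rho> \<tau>) = G \<tau>} \<subseteq> N" "emeasure lborel N = 0" "N \<in> sets lborel"
    using AE_E[OF \<phi>[folded G_def]] .
  have N: "N \<in> null_sets lborel" "{\<tau>. \<phi> (Complex \<rho> \<tau>) \<noteq> G \<tau>} \<subseteq> N"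
    using N0 by (auto intro: null_setsI)
  have neg: "negligible N"
    unfolding negligible_iff_null_sets using N(1) by (rule null_sets_completionI)
  have NG: "\<phi> (Complex \<rho> \<tau>) = G \<tau>" if "\<tau> \<notin> N" for \<tau> using N(2) that by blast
  have \<phi>i: "(\<lambda>\<tau>. \<phi> (Complex \<rho> \<tau>)) integrable_on {-u..u}" for u
    by (rule integrable_spike[OF set_borel_integral_eq_integral(1)[OF Gi] neg]) (simp add: NG)
  have \<phi>I: "integral {-u..u} (\<lambda>\<tau>. \<phi> (Complex \<rho> \<tau>)) = integral {-u..u} G" for u
    by (rule integral_spike[OF neg]) (simp add: NG)
  have P: "vline_partial \<rho> \<phi> u = \<i> * (LINT v|lborel. of_real (dirichlet_kernel u v) * g v)" if "u > 0" for u
    unfolding vline_partial_def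
    using contour_integral_linepath_same_Re[of "Complex \<rho> (- u)" \<rho> "Complex \<rho> u" "- u" u \<phi>] that
    by (simp add: \<phi>I GI)
  have b2: "norm (complex_of_real (dirichlet_kernel u v)) \<le> 2 * T" if "u \<in> {0..T}" for u v T
    using abs_dirichlet_le[of u v] that by simp
  have I: "integral {0..T} (vline_partial \<rho> \<phi>) = \<i> * (LINT v|lborel. of_real (2 * (1 - cos (T * v)) / v\<^sup>2) * g v)" if T: "T > 0" for T
  proof -
    have "integral {0..T} (vline_partial \<rho> \<phi>) = integral {0..T} (\<lambda>u. \<i> * (LINT v|lborel. of_real (dirichlet_kernel u v) * g v))"
      by (rule integral_spike[of "{0}"]) (use P in auto)
    also have "\<dots> = \<i> * integral {0..T} (\<lambda>u. LINT v|lborel. of_real (dirichlet_kernel u v) * g v)"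
      by (rule Henstock_Kurzweil_Integration.integral_mult_right)
    also have "integral {0..T} (\<lambda>u. LINT v|lborel. of_real (dirichlet_kernel u v) * g v)
        = (LINT u:{0..T}|lborel. LINT v|lborel. of_real (dirichlet_kernel u v) * g v)"
      by (rule set_borel_integral_eq_integral(2)[symmetric]) (rule set_integrable_parametric[OF m2 b2 g])
    also have "\<dots> = (LINT v|lborel. (LINT u:{0..T}|lborel. complex_of_real (dirichlet_kernel u v)) * g v)"
      by (rule set_integral_parametric_swap[OF m2 b2 g])
    also have "\<dots> = (LINT v|lborel. of_real (2 * (1 - cos (T * v)) / v\<^sup>2) * g v)"
    proof (rule integral_cong_AE)
      have [measurable]: "g \<in> borel_measurable borel" using g by auto
      show "(\<lambda>v. of_real (2 * (1 - cos (T * v)) / v\<^sup>2) * g v) \<in> borel_measurable lborel" by measurable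
      have "(\<lambda>v. LINT u:{0..T}|lborel. complex_of_real (dirichlet_kernel u v)) \<in> borel_measurable borel"
        unfolding set_lebesgue_integral_def dirichlet_kernel_def by measurable
      then show "(\<lambda>v. (LINT u:{0..T}|lborel. complex_of_real (dirichlet_kernel u v)) * g v) \<in> borel_measurable lborel"
        by measurable
      show "AE v in lborel. (LINT u:{0..T}|lborel. complex_of_real (dirichlet_kernel u v)) * g v = of_real (2 * (1 - cos (T * v)) / v\<^sup>2) * g v"
        using AE_lborel_singleton[of "0::real"]
        by (rule eventually_mono) (use integral_dirichlet_fejer T in auto)
    qed
    finally show ?thesis .
  qed
  have "((\<lambda>T. \<i> * (LINT v|lborel. (1 / T * (2 * (1 - cos (T * v)) / v\<^sup>2)) *\<^sub>R g v)) \<longlongrightarrow> \<i> * ((2 * pi) *\<^sub>R g 0)) at_top"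
    by (intro tendsto_intros fejer_limit g c)
  moreover have "eventually (\<lambda>T. \<i> * (LINT v|lborel. (1 / T * (2 * (1 - cos (T * v)) / v\<^sup>2)) *\<^sub>R g v) = (1 / T) *\<^sub>R integral {0..T} (vline_partial \<rho> \<phi>)) at_top"
    using eventually_gt_at_top[of "0::real"]
  proof eventually_elim
    case (elim T)
    have "(LINT v|lborel. (1 / T * (2 * (1 - cos (T * v)) / v\<^sup>2)) *\<^sub>R g v) = (LINT v|lborel. (1 / T) *\<^sub>R (of_real (2 * (1 - cos (T * v)) / v\<^sup>2) * g v))"
      by (simp add: scaleR_conv_of_real mult.assoc)
    then show ?case unfolding I[OF elim] by (simp only: integral_scaleR_right mult_scaleR_right)
  qed
  ultimately have "((\<lambda>T. (1 / T) *\<^sub>R integral {0..T} (vline_partial \<rho> \<phi>)) \<longlongrightarrow> \<i> * ((2 * pi) *\<^sub>R g 0)) at_top"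
    by (rule Lim_transform_eventually)
  moreover have "\<i> * ((2 * pi) *\<^sub>R g 0) = 2 * of_real pi * \<i> * g 0" by (simp add: scaleR_conv_of_real)
  moreover have "\<phi> contour_integrable_on linepath (Complex \<rho> (- u)) (Complex \<rho> u)" if "u > 0" for u
  proof -
    have "((\<lambda>\<tau>. \<phi> (Complex \<rho> \<tau>)) has_integral (- \<i> * (\<i> * integral {-u..u} (\<lambda>\<tau>. \<phi> (Complex \<rho> \<tau>))))) {-u..u}"
      using \<phi>i[of u] by (simp add: has_integral_integral)
    then have "(\<phi> has_contour_integral (\<i> * integral {-u..u} (\<lambda>\<tau>. \<phi> (Complex \<rho> \<tau>)))) (linepath (Complex \<rho> (- u)) (Complex \<rho> u))"
      by (subst has_contour_integral_linepath_same_Re_iff[of _ \<rho> _ "- u" u]) (use that in simp_all)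
    then show ?thesis unfolding contour_integrable_on_def by blast
  qed
  ultimately show ?thesis unfolding vline_has_integral_def by simp
qed

section \<open>Mellin transforms\<close>

lemma powr_of_real_exp: "y > 0 \<Longrightarrow> complex_of_real y powr s = exp (s * of_real (ln y))"
  by (simp add: powr_def Ln_of_real)

lemma vline_has_integral_zero: "vline_has_integral \<rho> (\<lambda>_. 0) 0"
proof -
  have "vline_partial \<rho> (\<lambda>_. 0) = (\<lambda>_. 0)" by (simp add: vline_partial_def fun_eq_iff)
  then show ?thesis by (auto simp: vline_has_integral_def contour_integrable_on_def intro: has_contour_integral_0)
qed

text \<open>The substitution y = r exp(v) carries the multiplicative integral on the half-line to an
  additive one on the whole line; the power r^s splits off.\<close>

lemma
  assumes F: "mellin_convergent F s" and r: "r > 0"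
  shows mellin_exp_integrable: "integrable lborel (\<lambda>v. exp (s * of_real v) * F (r * exp v))"
    and mellin_exp: "of_real r powr (- s) * mellin F s = (LINT v|lborel. exp (s * of_real v) * F (r * exp v))"
proof -
  let ?f = "\<lambda>y. of_real y powr (s - 1) * F y"
  let ?g = "\<lambda>v. r * exp v"
  have fi: "set_integrable lborel {0<..} ?f" using F by (simp add: mellin_convergent_def)
  have img: "?g ` UNIV = {0<..}"
  proof (intro equalityI subsetI)
    fix y :: real assume "y \<in> {0<..}"
    then show "y \<in> range ?g" using r by (intro image_eqI[of _ _ "ln (y / r)"]) auto
  qed (use r in auto)
  have der: "(?g has_field_derivative r * exp v) (at v within UNIV)" for v
    by (auto intro!: derivative_eq_intros)
  have inj: "inj_on ?g UNIV" using r by (auto simp: inj_on_def)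
  have fm: "(\<lambda>y. indicator {0<..} y *\<^sub>R ?f y) \<in> borel_measurable borel"
    using fi unfolding set_integrable_def by auto
  have meas: "set_borel_measurable borel UNIV (\<lambda>v. \<bar>r * exp v\<bar> *\<^sub>R ?f (?g v))"
  proof -
    have "(\<lambda>v. \<bar>r * exp v\<bar> *\<^sub>R (indicator {0<..} (?g v) *\<^sub>R ?f (?g v))) \<in> borel_measurable borel"
      by (rule borel_measurable_scaleR[OF _ measurable_compose[OF _ fm]]) measurable
    then show ?thesis using r by (simp add: set_borel_measurable_def)
  qed
  have eq: "\<bar>r * exp v\<bar> *\<^sub>R ?f (?g v) = of_real r powr s * (exp (s * of_real v) * F (?g v))" for v
  proof -
    have p: "r * exp v > 0" using r by simp
    have "of_real (r * exp v) * of_real (r * exp v) powr (s - 1) = exp (s * of_real (ln (r * exp v)))"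
    proof -
      have "complex_of_real (r * exp v) = exp (of_real (ln (r * exp v)))" using p by (simp add: exp_of_real)
      then show ?thesis unfolding powr_of_real_exp[OF p] by (simp add: algebra_simps flip: exp_add)
    qed
    also have "\<dots> = of_real r powr s * exp (s * of_real v)"
      unfolding powr_of_real_exp[OF r] using r by (simp add: ln_mult algebra_simps flip: exp_add)
    finally show ?thesis using p unfolding scaleR_conv_of_real abs_of_pos[OF p] mult.assoc[symmetric] by simp
  qed
  have "set_integrable lborel UNIV (\<lambda>v. \<bar>r * exp v\<bar> *\<^sub>R ?f (?g v))"
    by (rule set_integrable_substitution[OF _ img der inj fi meas]) auto
  then have i: "integrable lborel (\<lambda>v. of_real r powr s * (exp (s * of_real v) * F (?g v)))"
    unfolding eq by (simp add: set_integrable_def)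
  have nz: "complex_of_real r powr s \<noteq> 0" using r by simp
  from integrable_mult_right[OF i, of "inverse (of_real r powr s)"] nz
  show "integrable lborel (\<lambda>v. exp (s * of_real v) * F (r * exp v))"
    by (simp add: mult.assoc[symmetric])
  have "mellin F s = (LINT v:UNIV|lborel. \<bar>r * exp v\<bar> *\<^sub>R ?f (?g v))"
    unfolding mellin_def by (rule set_integral_substitution[OF _ img der inj fi meas, symmetric]) auto
  also have "\<dots> = of_real r powr s * (LINT v|lborel. exp (s * of_real v) * F (?g v))"
    unfolding eq set_lebesgue_integral_def by simp
  finally show "of_real r powr (- s) * mellin F s = (LINT v|lborel. exp (s * of_real v) * F (r * exp v))"
    using nz by (simp add: powr_minus)
qed

text \<open>With g(v) = exp(\<rho> v) F(r exp v) the inverse transform along the line is Fourier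
  inversion at v = 0, where g takes the value F(r). The integrand \<phi> is prescribed almost
  everywhere, which will absorb the zeros of the denominator.\<close>

proposition mellin_inversion:
  assumes F: "mellin_convergent F (of_real \<rho>)" and r: "r > 0" and c: "isCont F r"
    and conv: "\<And>\<tau>. mellin_convergent F (Complex \<rho> \<tau>)"
    and \<phi>: "AE \<tau> in lborel. \<phi> (Complex \<rho> \<tau>) = of_real r powr (- Complex \<rho> \<tau>) * mellin F (Complex \<rho> \<tau>)"
  shows "vline_has_integral \<rho> \<phi> (2 * of_real pi * \<i> * F r)"
proof -
  define g where "g v = exp (of_real \<rho> * of_real v) * F (r * exp v)" for v
  have gi: "integrable lborel g" unfolding g_def by (rule mellin_exp_integrable[OF F r])
  have "isCont (\<lambda>v. F (r * exp v)) 0"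
  proof (rule isCont_o2[where f="\<lambda>v. r * exp v"])
    show "isCont (\<lambda>v. r * exp v) 0" by (intro continuous_intros)
    show "isCont F (r * exp 0)" using c by simp
  qed
  then have gc: "isCont g 0" unfolding g_def by (intro continuous_intros)
  have "exp (Complex \<rho> \<tau> * of_real v) * F (r * exp v) = exp (\<i> * of_real (\<tau> * v)) * g v" for \<tau> v
  proof -
    have "Complex \<rho> \<tau> * of_real v = \<i> * of_real (\<tau> * v) + of_real \<rho> * of_real v"
      by (simp add: complex_eq_iff)
    then show ?thesis unfolding g_def by (simp only: exp_add mult.assoc)
  qed
  then have "of_real r powr (- Complex \<rho> \<tau>) * mellin F (Complex \<rho> \<tau>) = (LINT v|lborel. exp (\<i> * of_real (\<tau> * v)) * g v)" for \<tau>
    using mellin_exp[OF conv r, of \<tau>] by simp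
  then have "AE \<tau> in lborel. \<phi> (Complex \<rho> \<tau>) = (LINT v|lborel. exp (\<i> * of_real (\<tau> * v)) * g v)"
    using \<phi> by simp
  from fejer_vline[OF gi gc this] show ?thesis by (simp add: g_def)
qed

text \<open>Where h is non-zero L is bounded, so the exponential series may be integrated term by
  term; the result is a power series that converges everywhere.\<close>

lemma holomorphic_exp_transform:
  fixes h :: "real \<Rightarrow> complex" and L :: "real \<Rightarrow> real"
  assumes h: "integrable lborel h" and L: "L \<in> borel_measurable borel" and B: "\<And>x. h x \<noteq> 0 \<Longrightarrow> \<bar>L x\<bar> \<le> B"
  shows "(\<lambda>z. LINT x|lborel. exp (z * of_real (L x)) * h x) holomorphic_on UNIV"
proof -
  have [measurable]: "h \<in> borel_measurable borel" using h by auto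
  note [measurable] = L
  define a where "a n = (LINT x|lborel. of_real (L x ^ n / fact n) * h x)" for n
  define f where "f z = (LINT x|lborel. exp (z * of_real (L x)) * h x)" for z
  have sums: "(\<lambda>n. a n * z ^ n) sums f z" for z
  proof -
    let ?t = "\<lambda>n x. (z * of_real (L x)) ^ n /\<^sub>R fact n * h x"
    have tb: "norm (?t n x) \<le> (norm z * \<bar>B\<bar>) ^ n /\<^sub>R fact n * norm (h x)" for n x
    proof (cases "h x = 0")
      case False
      have "\<bar>L x\<bar> \<le> \<bar>B\<bar>" using B[OF False] by simp
      then have "(norm z * \<bar>L x\<bar>) ^ n \<le> (norm z * \<bar>B\<bar>) ^ n" by (intro power_mono mult_left_mono) auto
      then show ?thesis by (simp add: norm_mult norm_power divide_right_mono mult_right_mono mult_left_mono)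
    qed simp
    have ti: "integrable lborel (?t n)" for n
      by (rule Bochner_Integration.integrable_bound[where f="\<lambda>x. (norm z * \<bar>B\<bar>) ^ n /\<^sub>R fact n * norm (h x)"])
         (use h tb in \<open>auto intro!: AE_I2 order_trans[OF tb abs_ge_self]\<close>)
    have tn: "(LINT x|lborel. norm (?t n x)) \<le> (norm z * \<bar>B\<bar>) ^ n /\<^sub>R fact n * (LINT x|lborel. norm (h x))" for n
    proof -
      have "(LINT x|lborel. norm (?t n x)) \<le> (LINT x|lborel. (norm z * \<bar>B\<bar>) ^ n /\<^sub>R fact n * norm (h x))"
        by (rule integral_mono) (use h integrable_norm[OF ti] tb in auto)
      then show ?thesis by simp
    qed
    have sm: "summable (\<lambda>n. inverse (fact n) * (norm z * \<bar>B\<bar>) ^ n)" by (rule summable_exp)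
    have "(\<lambda>n. integral\<^sup>L lborel (?t n)) sums (LINT x|lborel. (\<Sum>n. ?t n x))"
    proof (rule sums_integral[OF ti])
      show "AE x in lborel. summable (\<lambda>n. norm (?t n x))"
      proof (rule AE_I2)
        fix x
        show "summable (\<lambda>n. norm (?t n x))"
          by (rule summable_comparison_test'[where N=0 and g="\<lambda>n. (norm z * \<bar>B\<bar>) ^ n /\<^sub>R fact n * norm (h x)"])
             (use tb sm in \<open>auto intro!: summable_mult2\<close>)
      qed
      show "summable (\<lambda>n. LINT x|lborel. norm (?t n x))"
        by (rule summable_comparison_test'[where N=0 and g="\<lambda>n. (norm z * \<bar>B\<bar>) ^ n /\<^sub>R fact n * (LINT x|lborel. norm (h x))"])
           (use tn sm in \<open>auto intro!: summable_mult2 simp: integral_nonneg_AE\<close>)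
    qed
    moreover have "(\<Sum>n. ?t n x) = exp (z * of_real (L x)) * h x" for x
      using sums_unique[OF sums_mult2[OF exp_converges[of "z * of_real (L x)"], of "h x"]] by simp
    moreover have "integral\<^sup>L lborel (?t n) = a n * z ^ n" for n
    proof -
      have "?t n x = (of_real (L x ^ n / fact n) * h x) * z ^ n" for x
        by (simp add: power_mult_distrib scaleR_conv_of_real field_simps)
      then show ?thesis unfolding a_def by simp
    qed
    ultimately show ?thesis by (simp add: f_def)
  qed
  have "f holomorphic_on ball 0 R" for R
    by (rule power_series_holomorphic[where a=a]) (use sums in simp)
  then have "f field_differentiable (at z)" for z
    using holomorphic_on_imp_differentiable_at[of f "ball 0 (norm z + 1)" z] by simp
  then show ?thesis
    unfolding f_def[symmetric] holomorphic_on_def by (auto intro: field_differentiable_at_within)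
qed

section \<open>The Mellin transform of the kernel\<close>

text \<open>The two coefficients of the recurrence differ by 1, as 2 (m + 1 + \<nu>) - (m + 1) = m +
  1 + 2 \<nu>.\<close>

lemma poly_gegen_1:
  assumes "\<nu> \<ge> 0"
  shows "poly (gegen \<nu> m) 1 = 1"
  using assms
proof (induction \<nu> m rule: gegen.induct)
  case (3 \<nu> m)
  have e: "2 * a / d - b / d = 1" if "d > 0" "2 * a - b = d" for a b d :: real
    using that by (simp flip: diff_divide_distrib)
  show ?case using 3 e[of "real m + 1 + 2 * \<nu>" "real m + 1 + \<nu>" "real m + 1"] by simp
qed auto

lemma sphere_kernel_support: "0 < t \<Longrightarrow> t < 1 \<Longrightarrow> sphere_kernel D m t x \<noteq> 0 \<Longrightarrow> x \<in> {1 - t..1 + t}"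
  unfolding sphere_kernel_def by (auto split: if_splits)

lemma integrable_sphere_kernel:
  assumes "D \<ge> 2" "0 < t" "t < 1"
  shows "integrable lborel (\<lambda>x. complex_of_real (sphere_kernel D m t x))"
  using sphere_kernel_integrable[OF assms, of "\<lambda>_. 1" "(real D - 2) / 2" m] by (simp add: scaleR_conv_of_real)

lemma mellin_kernel_eq:
  assumes t: "0 < t" "t < 1"
  shows "indicator {0<..} x *\<^sub>R (of_real x powr (s - 1) * complex_of_real (sphere_kernel D m t x))
    = exp ((s - 1) * of_real (ln x)) * of_real (sphere_kernel D m t x)"
proof (cases "x > 0")
  case True
  then show ?thesis by (simp add: powr_of_real_exp)
next
  case False
  then have "sphere_kernel D m t x = 0" using sphere_kernel_support[OF t, of D m x] t by fastforce
  then show ?thesis by simp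
qed

text \<open>Since t < 1, the support stays away from 0, so the power of x is bounded on it for every
  exponent s.\<close>

lemma mellin_convergent_kernel:
  assumes D: "D \<ge> 2" and t: "0 < t" "t < 1"
  shows "mellin_convergent (\<lambda>x. of_real (sphere_kernel D m t x)) s"
proof -
  let ?b = "exp (\<bar>Re (s - 1)\<bar> * (\<bar>ln (1 - t)\<bar> + \<bar>ln (1 + t)\<bar>))"
  note i = integrable_sphere_kernel[OF D t, of m]
  have "integrable lborel (\<lambda>x. exp ((s - 1) * of_real (ln x)) * complex_of_real (sphere_kernel D m t x))"
  proof (rule Bochner_Integration.integrable_bound[where f="\<lambda>x. complex_of_real ?b * of_real (sphere_kernel D m t x)"])
    show "integrable lborel (\<lambda>x. complex_of_real ?b * of_real (sphere_kernel D m t x))" using i by simp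
    have [measurable]: "(\<lambda>x. complex_of_real (sphere_kernel D m t x)) \<in> borel_measurable borel" using i by auto
    show "(\<lambda>x. exp ((s - 1) * of_real (ln x)) * complex_of_real (sphere_kernel D m t x)) \<in> borel_measurable lborel"
      by measurable
    show "AE x in lborel. norm (exp ((s - 1) * of_real (ln x)) * complex_of_real (sphere_kernel D m t x))
        \<le> norm (complex_of_real ?b * of_real (sphere_kernel D m t x))"
    proof (rule AE_I2)
      fix x :: real
      show "norm (exp ((s - 1) * of_real (ln x)) * complex_of_real (sphere_kernel D m t x))
        \<le> norm (complex_of_real ?b * of_real (sphere_kernel D m t x))"
      proof (cases "sphere_kernel D m t x = 0")
        case False
        then have x: "1 - t \<le> x" "x \<le> 1 + t" using sphere_kernel_support[OF t False] by auto
        have "ln (1 - t) \<le> ln x" "ln x \<le> ln (1 + t)" using x t by auto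
        then have "\<bar>ln x\<bar> \<le> \<bar>ln (1 - t)\<bar> + \<bar>ln (1 + t)\<bar>" by linarith
        then have "\<bar>Re (s - 1) * ln x\<bar> \<le> \<bar>Re (s - 1)\<bar> * (\<bar>ln (1 - t)\<bar> + \<bar>ln (1 + t)\<bar>)"
          unfolding abs_mult by (intro mult_left_mono) auto
        then have "Re (s - 1) * ln x \<le> \<bar>Re (s - 1)\<bar> * (\<bar>ln (1 - t)\<bar> + \<bar>ln (1 + t)\<bar>)" by linarith
        then have "norm (exp ((s - 1) * of_real (ln x))) \<le> ?b" by (simp add: norm_exp_eq_Re)
        then show ?thesis unfolding norm_mult by (intro mult_right_mono) auto
      qed simp
    qed
  qed
  then show ?thesis unfolding mellin_convergent_def set_integrable_def mellin_kernel_eq[OF t] .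
qed

text \<open>Otherwise Mellin inversion along the imaginary axis would make the kernel vanish, whereas its
  polynomial factor takes the value 1 at the end point \<open>1 + t\<close> of the support.\<close>

lemma mellin_kernel_not_all_zero:
  assumes D: "D \<ge> 2" and t: "0 < t" "t < 1"
  shows "\<exists>s. mellin (\<lambda>x. of_real (sphere_kernel D m t x)) s \<noteq> 0"
proof (rule ccontr)
  assume "\<not> ?thesis"
  then have z: "mellin (\<lambda>x. of_real (sphere_kernel D m t x)) s = 0" for s by blast
  define \<nu> where "\<nu> = (real D - 2) / 2"
  have \<nu>: "\<nu> \<ge> 0" using D by (simp add: \<nu>_def)
  let ?q = "\<lambda>r. poly (gegen \<nu> m) ((r\<^sup>2 + 1 - t\<^sup>2) / (2 * r))"
  let ?f = "\<lambda>r. 2 powi (3 - int D) * t powi (2 - int D) * r * ?q r * ((1 + t - r) * (1 + t + r) * (r - 1 + t) * (r + 1 - t)) powr ((real D - 3) / 2)"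
  have pos: "(1 + t - r) * (1 + t + r) * (r - 1 + t) * (r + 1 - t) > 0" if "r \<in> {1 - t<..<1 + t}" for r
    using that t by (intro mult_pos_pos) auto
  \<comment> \<open>Inside the support all factors other than the polynomial are positive, so a
    vanishing kernel forces the polynomial factor to vanish. That factor alone extends continuously
    to the end point, where the remaining power may vanish or blow up.\<close>
  have q0: "?q r = 0" if r: "r \<in> {1 - t<..<1 + t}" for r
  proof -
    have r0: "r > 0" using r t by simp
    have "continuous_on {1 - t<..<1 + t} ?f"
      by (intro continuous_intros continuous_on_poly) (use t pos in \<open>fastforce+\<close>)
    then have "continuous_on {1 - t<..<1 + t} (sphere_kernel D m t)"
      by (rule continuous_on_eq) (auto simp: sphere_kernel_def \<nu>_def)
    then have "continuous_on {1 - t<..<1 + t} (\<lambda>x. complex_of_real (sphere_kernel D m t x))"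
      by (intro continuous_intros)
    then have c: "isCont (\<lambda>x. complex_of_real (sphere_kernel D m t x)) r"
      using r by (simp add: continuous_on_eq_continuous_at)
    have "vline_has_integral 0 (\<lambda>_. 0) (2 * of_real pi * \<i> * of_real (sphere_kernel D m t r))"
      by (rule mellin_inversion[OF mellin_convergent_kernel[OF D t] r0 c mellin_convergent_kernel[OF D t]]) (simp add: z)
    from vline_has_integral_unique[OF this vline_has_integral_zero] have "sphere_kernel D m t r = 0" by simp
    moreover have "sphere_kernel D m t r = ?f r"
      unfolding sphere_kernel_def \<nu>_def by (rule if_P) (use r in auto)
    moreover have "((1 + t - r) * (1 + t + r) * (r - 1 + t) * (r + 1 - t)) powr ((real D - 3) / 2) > 0"
      using less_imp_neq[OF pos[OF r], symmetric] unfolding powr_gt_zero .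
    ultimately show ?thesis using t r0 by (auto simp: power_int_eq_0_iff)
  qed
  have "continuous_on {1 - t..1 + t} ?q"
    by (intro continuous_intros continuous_on_poly) (use t in auto)
  then have c: "continuous_on (closure {1 - t<..<1 + t}) ?q" using t by simp
  have "?q (1 + t) = 0"
    by (rule continuous_constant_on_closure[OF c q0]) (use t in auto)
  moreover have "((1 + t)\<^sup>2 + 1 - t\<^sup>2) / (2 * (1 + t)) = 1"
  proof -
    have e: "(1 + t)\<^sup>2 + 1 - t\<^sup>2 = 2 * (1 + t)" by (simp add: power2_eq_square algebra_simps)
    have "x / x = 1" if "x > 0" for x :: real using that by simp
    from this[of "2 * (1 + t)"] show ?thesis using t unfolding e by simp
  qed
  ultimately show False using poly_gegen_1[OF \<nu>, of m] by (simp only:)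
qed

text \<open>On the support the logarithm is bounded, which makes the transform entire.
  \<open>H\<close> is the transform shifted by one, so its values at 1 - s are those of
  \<open>H\<close> at -s; the line meets the countable zero set in a countable, hence null,
  set.\<close>

lemma mellin_kernel_nonzero_AE:
  assumes D: "D \<ge> 2" and t: "0 < t" "t < 1"
  shows "AE \<tau> in lborel. mellin (\<lambda>x. of_real (sphere_kernel D m t x)) (1 - Complex \<rho> \<tau>) \<noteq> 0"
proof -
  define H where "H z = (LINT x|lborel. exp (z * of_real (ln x)) * (indicator {1 - t..1 + t} x *\<^sub>R complex_of_real (sphere_kernel D m t x)))" for z
  have sup: "indicator {1 - t..1 + t} x *\<^sub>R complex_of_real (sphere_kernel D m t x) = complex_of_real (sphere_kernel D m t x)" for x
    using sphere_kernel_support[OF t, of D m x] by (auto split: split_indicator)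
  have M: "mellin (\<lambda>x. of_real (sphere_kernel D m t x)) s = H (s - 1)" for s
    unfolding mellin_def set_lebesgue_integral_def mellin_kernel_eq[OF t] H_def sup ..
  have "H holomorphic_on UNIV"
    unfolding H_def sup
  proof (rule holomorphic_exp_transform[OF integrable_sphere_kernel[OF D t], where B="\<bar>ln (1 - t)\<bar> + \<bar>ln (1 + t)\<bar>"])
    fix x :: real assume "complex_of_real (sphere_kernel D m t x) \<noteq> 0"
    then have x: "1 - t \<le> x" "x \<le> 1 + t" using sphere_kernel_support[OF t, of D m x] by auto
    have "ln (1 - t) \<le> ln x" "ln x \<le> ln (1 + t)" using x t by auto
    then show "\<bar>ln x\<bar> \<le> \<bar>ln (1 - t)\<bar> + \<bar>ln (1 + t)\<bar>" by linarith
  qed simp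
  obtain s0 where s0: "H s0 \<noteq> 0" using mellin_kernel_not_all_zero[OF D t, of m] unfolding M by auto
  have c: "countable {z. H z = 0}"
  proof (cases "H constant_on UNIV")
    case True
    then have "H z = H s0" for z unfolding constant_on_def by (metis UNIV_I)
    then have "H z \<noteq> 0" for z using s0 by metis
    then show ?thesis by simp
  next
    case False
    from holomorphic_countable_zeros[OF \<open>H holomorphic_on UNIV\<close> open_UNIV connected_UNIV fsigma_UNIV False]
    show ?thesis by simp
  qed
  let ?Z = "{\<tau>. H (- Complex \<rho> \<tau>) = 0}"
  have "inj_on (\<lambda>\<tau>. - Complex \<rho> \<tau>) ?Z" by (auto simp: inj_on_def)
  moreover have "countable ((\<lambda>\<tau>. - Complex \<rho> \<tau>) ` ?Z)"
    by (rule countable_subset[OF _ c]) auto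
  ultimately have "countable ?Z" by (rule countable_image_inj_on[rotated])
  then have "?Z \<in> null_sets lborel" by (rule countable_imp_null_set_lborel)
  then have "AE \<tau> in lborel. \<tau> \<notin> ?Z" by (rule AE_not_in)
  then show ?thesis by (rule eventually_mono) (simp add: M)
qed

section \<open>Multiplicative convolution and the strip of convergence\<close>

text \<open>Replacing F(c) by F(c x) multiplies the Mellin transform by x^(-s), and x^(-s) = x^((1 -
  s) - 1) is the power that belongs to the transform of h at 1 - s. The same scaling with absolute
  values turns the double integral into a product of two convergent integrals, which justifies
  Fubini.\<close>

proposition mellin_convolution:
  fixes h :: "real \<Rightarrow> real" and F K :: "real \<Rightarrow> complex"
  assumes h: "integrable lborel h" and supp: "\<And>x. h x \<noteq> 0 \<Longrightarrow> x \<in> {\<alpha>..\<beta>}" and \<alpha>: "\<alpha> > 0"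
    and Fm: "F \<in> borel_measurable borel" and F: "mellin_convergent F s"
    and hc: "mellin_convergent (\<lambda>x. of_real (h x)) (1 - s)"
    and K: "\<And>c. c > 0 \<Longrightarrow> K c = (LINT x|lborel. h x *\<^sub>R F (c * x))"
  shows "mellin_convergent K s" and "mellin K s = mellin F s * mellin (\<lambda>x. of_real (h x)) (1 - s)"
proof -
  note [measurable] = Fm
  have [measurable]: "h \<in> borel_measurable borel" using h by auto
  let ?p = "\<lambda>c. indicator {0<..} c *\<^sub>R exp ((s - 1) * of_real (ln c))"
  \<comment> \<open>The complex power is rewritten as an exponential of the logarithm, in which form
    joint measurability is immediate.\<close>
  have pp: "indicator {0<..} c *\<^sub>R (of_real c powr (s - 1) * X) = ?p c * X" for c X
    by (auto simp: powr_of_real_exp split: split_indicator)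
  let ?f = "\<lambda>x c. ?p c * (h x *\<^sub>R F (c * x))"
  have scale: "integrable lborel (\<lambda>c. ?p c * F (c * x)) \<and>
      (LINT c|lborel. ?p c * F (c * x)) = of_real x powr (- s) * mellin F s \<and>
      (LINT c|lborel. norm (?p c * F (c * x))) = x powr (- Re s) * (LINT y:{0<..}|lborel. norm (of_real y powr (s - 1) * F y))"
    if x: "x > 0" for x
  proof -
    have i: "integrable lborel (\<lambda>y. ?p y * F y)"
      using F unfolding mellin_convergent_def set_integrable_def pp .
    have e: "?p (0 + x * c) * F (0 + x * c) = of_real x powr (s - 1) * (?p c * F (c * x))" for c
    proof (cases "c > 0")
      case True
      then have l: "ln (x * c) = ln x + ln c" using x by (simp add: ln_mult)
      have E: "exp ((s - 1) * of_real (ln (x * c))) = of_real x powr (s - 1) * exp ((s - 1) * of_real (ln c))"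
        unfolding l of_real_add distrib_left exp_add powr_of_real_exp[OF x] ..
      have I: "indicator {0<..} (x * c) = (1::real)" "indicator {0<..} c = (1::real)" using True x by simp_all
      show ?thesis unfolding add_0 I scaleR_one E mult.commute[of c x] mult.assoc ..
    next
      case False
      then show ?thesis using x by (simp add: zero_less_mult_iff)
    qed
    have nz: "complex_of_real x powr (s - 1) \<noteq> 0" using x by simp
    have "integrable lborel (\<lambda>c. ?p (0 + x * c) * F (0 + x * c))"
      by (rule lborel_integrable_real_affine[OF i]) (use x in simp)
    then have "integrable lborel (\<lambda>c. of_real x powr (s - 1) * (?p c * F (c * x)))" unfolding e .
    from integrable_mult_right[OF this, of "inverse (of_real x powr (s - 1))"] nz
    have i2: "integrable lborel (\<lambda>c. ?p c * F (c * x))" by (simp add: mult.assoc[symmetric])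
    have "mellin F s = (LINT y|lborel. ?p y * F y)"
      unfolding mellin_def set_lebesgue_integral_def pp ..
    also have "\<dots> = \<bar>x\<bar> *\<^sub>R (LINT c|lborel. ?p (0 + x * c) * F (0 + x * c))"
      by (rule lborel_integral_real_affine) (use x in simp)
    also have "\<dots> = (of_real x * of_real x powr (s - 1)) * (LINT c|lborel. ?p c * F (c * x))"
      unfolding e integral_mult_right_zero using x by (simp add: scaleR_conv_of_real)
    also have "of_real x * of_real x powr (s - 1) = complex_of_real x powr s"
      using x by (simp add: powr_diff)
    finally have e2: "(LINT c|lborel. ?p c * F (c * x)) = of_real x powr (- s) * mellin F s"
      using x by (simp add: powr_minus)
    have "(LINT y:{0<..}|lborel. norm (of_real y powr (s - 1) * F y)) = (LINT y|lborel. norm (?p y * F y))"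
      unfolding set_lebesgue_integral_def
      by (rule Bochner_Integration.integral_cong) (auto simp: powr_of_real_exp norm_mult split: split_indicator)
    also have "\<dots> = \<bar>x\<bar> *\<^sub>R (LINT c|lborel. norm (?p (0 + x * c) * F (0 + x * c)))"
      by (rule lborel_integral_real_affine) (use x in simp)
    also have "\<dots> = (x * x powr (Re s - 1)) * (LINT c|lborel. norm (?p c * F (c * x)))"
      unfolding e norm_mult[of "of_real x powr (s - 1)"] integral_mult_right_zero
      using x by (simp add: norm_powr_real_powr)
    also have "x * x powr (Re s - 1) = x powr Re s" using x by (simp add: powr_diff)
    finally have "(LINT c|lborel. norm (?p c * F (c * x))) = x powr (- Re s) * (LINT y:{0<..}|lborel. norm (of_real y powr (s - 1) * F y))"
      using x by (simp add: powr_minus)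
    with i2 e2 show ?thesis by blast
  qed
  define N where "N = (LINT y:{0<..}|lborel. norm (of_real y powr (s - 1) * F y))"
  have h0: "h x = 0" if "x \<le> 0" for x using supp[of x] that \<alpha> by fastforce
  have hn: "integrable lborel (\<lambda>x. norm (indicator {0<..} x *\<^sub>R (of_real x powr ((1 - s) - 1) * complex_of_real (h x))))"
    using hc unfolding mellin_convergent_def set_integrable_def by (rule integrable_norm)
  have int: "integrable (lborel \<Otimes>\<^sub>M lborel) (\<lambda>(x, c). ?f x c)"
  proof (rule lborel_pair.Fubini_integrable)
    show "(\<lambda>(x, c). ?f x c) \<in> borel_measurable (lborel \<Otimes>\<^sub>M lborel)" by measurable
    show "AE x in lborel. integrable lborel (\<lambda>c. case (x, c) of (x, c) \<Rightarrow> ?f x c)"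
    proof (rule AE_I2)
      fix x
      show "integrable lborel (\<lambda>c. case (x, c) of (x, c) \<Rightarrow> ?f x c)"
      proof (cases "x > 0")
        case True
        from integrable_scaleR_right[of "h x", OF scale[OF True, THEN conjunct1]] show ?thesis by simp
      qed (simp add: h0)
    qed
    have "(LINT c|lborel. norm (?f x c)) = N * norm (indicator {0<..} x *\<^sub>R (of_real x powr ((1 - s) - 1) * complex_of_real (h x)))" for x
    proof (cases "x > 0")
      case True
      have "(LINT c|lborel. norm (?f x c)) = (LINT c|lborel. \<bar>h x\<bar> * norm (?p c * F (c * x)))"
        by (simp only: mult_scaleR_right norm_scaleR)
      also have "\<dots> = \<bar>h x\<bar> * (x powr (- Re s) * N)"
        using scale[OF True] by (simp only: integral_mult_right_zero N_def)
      finally show ?thesis using True by (simp add: norm_mult norm_powr_real_powr)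
    qed (simp add: h0)
    then show "integrable lborel (\<lambda>x. LINT c|lborel. norm (case (x, c) of (x, c) \<Rightarrow> ?f x c))"
      using integrable_mult_right[OF hn, of N] by simp
  qed
  have kk: "indicator {0<..} c *\<^sub>R (of_real c powr (s - 1) * K c) = (LINT x|lborel. ?f x c)" for c
  proof (cases "c > 0")
    case True
    then show ?thesis unfolding pp K[OF True] by (simp only: integral_mult_right_zero)
  qed simp
  have "integrable lborel (\<lambda>c. LINT x|lborel. ?f x c)" by (rule lborel_pair.integrable_snd[OF int])
  then show "mellin_convergent K s"
    unfolding mellin_convergent_def set_integrable_def kk .
  have "mellin K s = (LINT c|lborel. LINT x|lborel. ?f x c)"
    unfolding mellin_def set_lebesgue_integral_def kk ..
  also have "\<dots> = (LINT x|lborel. LINT c|lborel. ?f x c)" by (rule lborel_pair.Fubini_integral[OF int])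
  also have "\<dots> = (LINT x|lborel. mellin F s * (indicator {0<..} x *\<^sub>R (of_real x powr ((1 - s) - 1) * complex_of_real (h x))))"
  proof (rule Bochner_Integration.integral_cong[OF refl])
    fix x
    show "(LINT c|lborel. ?f x c) = mellin F s * (indicator {0<..} x *\<^sub>R (of_real x powr ((1 - s) - 1) * complex_of_real (h x)))"
    proof (cases "x > 0")
      case True
      have "(LINT c|lborel. ?f x c) = (LINT c|lborel. h x *\<^sub>R (?p c * F (c * x)))" by simp
      also have "\<dots> = h x *\<^sub>R (of_real x powr (- s) * mellin F s)"
        using scale[OF True] by (simp only: integral_scaleR_right)
      finally show ?thesis using True by (simp add: scaleR_conv_of_real)
    qed (simp add: h0)
  qed
  also have "\<dots> = mellin F s * mellin (\<lambda>x. of_real (h x)) (1 - s)"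
    unfolding mellin_def set_lebesgue_integral_def by (rule integral_mult_right_zero)
  finally show "mellin K s = mellin F s * mellin (\<lambda>x. of_real (h x)) (1 - s)" .
qed

text \<open>Near 0 the function is bounded by M and y^(Re s - 1) is integrable as Re s > 0; beyond 1
  the decay y^(-2) leaves y^(Re s - 3), integrable as Re s < 2.\<close>

lemma mellin_convergent_decay:
  fixes F :: "real \<Rightarrow> complex"
  assumes F: "F \<in> borel_measurable borel" and M: "\<And>y. norm (F y) \<le> M / (1 + y\<^sup>2)" and s: "0 < Re s" "Re s < 2"
  shows "mellin_convergent F s"
proof -
  note [measurable] = F
  let ?a = "\<lambda>y. indicator {0<..1} y *\<^sub>R (y powr (Re s - 1))"
  let ?b = "\<lambda>y. indicator {1..} y *\<^sub>R (y powr (Re s - 3))"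
  have M0: "M \<ge> 0" using order_trans[OF norm_ge_zero M[of 0]] by simp
  have "set_integrable lborel {0<..1} (\<lambda>y. y powr (Re s - 1))"
    by (rule set_integrable_of_nonneg[OF integrable_on_powr_from_0'])
       (use s in \<open>auto simp: set_borel_measurable_def\<close>)
  then have a: "integrable lborel ?a" unfolding set_integrable_def .
  have "set_integrable lborel {1..} (\<lambda>y. y powr (Re s - 3))"
    by (rule set_integrable_of_nonneg[OF has_integral_integrable[OF has_integral_powr_to_inf]])
       (use s in \<open>auto simp: set_borel_measurable_def\<close>)
  then have b: "integrable lborel ?b" unfolding set_integrable_def .
  have bound: "norm (indicator {0<..} y *\<^sub>R (of_real y powr (s - 1) * F y)) \<le> M * (?a y + ?b y)" for y
  proof (cases "y > 0")
    case False
    then show ?thesis by simp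
  next
    case y: True
    have n: "norm (indicator {0<..} y *\<^sub>R (of_real y powr (s - 1) * F y)) = y powr (Re s - 1) * norm (F y)"
      using y by (simp add: norm_mult norm_powr_real_powr)
    show ?thesis
    proof (cases "y \<le> 1")
      case True
      have "M / (1 + y\<^sup>2) \<le> M / 1" by (rule divide_left_mono) (use M0 in \<open>auto simp: add_pos_nonneg\<close>)
      then have "norm (F y) \<le> M" using M[of y] by simp
      then have "y powr (Re s - 1) * norm (F y) \<le> M * ?a y"
        using y True by (simp add: mult.commute[of _ M] mult_right_mono mult.commute[of _ "norm (F y)"])
      also have "\<dots> \<le> M * (?a y + ?b y)" using M0 by (intro mult_left_mono) auto
      finally show ?thesis unfolding n .
    next
      case False
      have "M / (1 + y\<^sup>2) \<le> M / y\<^sup>2" by (rule divide_left_mono) (use M0 y in \<open>auto simp: add_pos_nonneg\<close>)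
      then have "norm (F y) \<le> M / y\<^sup>2" using M[of y] by linarith
      then have "y powr (Re s - 1) * norm (F y) \<le> y powr (Re s - 1) * (M / y\<^sup>2)" by (rule mult_left_mono) simp
      also have "\<dots> = M * y powr (Re s - 3)"
      proof -
        have "y powr (Re s - 3) = y powr ((Re s - 1) - 2)" by simp
        also have "\<dots> = y powr (Re s - 1) / y\<^sup>2" using y by (simp only: powr_diff powr_numeral)
        finally show ?thesis by simp
      qed
      also have "\<dots> = M * ?b y" using False by simp
      also have "\<dots> \<le> M * (?a y + ?b y)" using M0 by (intro mult_left_mono) auto
      finally show ?thesis unfolding n .
    qed
  qed
  have "integrable lborel (\<lambda>y. indicator {0<..} y *\<^sub>R (of_real y powr (s - 1) * F y))"
  proof (rule Bochner_Integration.integrable_bound)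
    show "integrable lborel (\<lambda>y. M * (?a y + ?b y))"
      by (rule integrable_mult_right[OF Bochner_Integration.integrable_add[OF a b]])
    have "(\<lambda>y. indicator {0<..} y *\<^sub>R (of_real y powr (s - 1) * F y))
        = (\<lambda>y. indicator {0<..} y *\<^sub>R (exp ((s - 1) * of_real (ln y)) * F y))"
      by (auto simp: fun_eq_iff powr_of_real_exp split: split_indicator)
    then show "(\<lambda>y. indicator {0<..} y *\<^sub>R (of_real y powr (s - 1) * F y)) \<in> borel_measurable lborel"
      by (simp only:) measurable
    show "AE y in lborel. norm (indicator {0<..} y *\<^sub>R (of_real y powr (s - 1) * F y)) \<le> norm (M * (?a y + ?b y))"
      unfolding real_norm_def[of "M * _"] by (rule AE_I2) (rule order_trans[OF bound abs_ge_self])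
  qed
  then show ?thesis unfolding mellin_convergent_def set_integrable_def .
qed

section \<open>The convolution equation and its inversion\<close>

lemma spherical_harmonic_eq_harmonic_polynomial:
  assumes "spherical_harmonic m u"
  shows "\<exists>p. harmonic_polynomial m p \<and> (\<forall>\<zeta>\<in>sphere 0 1. u \<zeta> = p \<zeta>)"
proof -
  obtain p where p: "polynomial_function p" "\<forall>t x. p (t *\<^sub>R x) = of_real (t ^ m) * p x"
    "\<forall>x. laplacian p x = 0" "\<forall>\<zeta>\<in>sphere 0 1. u \<zeta> = p \<zeta>"
    using assms unfolding spherical_harmonic_def by blast
  have "harmonic_polynomial m p"
    unfolding harmonic_polynomial_def scaleR_conv_of_real laplacian_eq_dir_deriv[OF p(1), symmetric]
    using p(1,2,3) by blast
  then show ?thesis using p(4) by blast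
qed

text \<open>The polynomials coincide by the uniqueness of the Gegenbauer family, and the exponents
  match under D = n - 1.\<close>

lemma h_fun_eq_sphere_kernel:
  assumes n: "n \<ge> 3"
  shows "h_fun n m lam = sphere_kernel (n - 1) m (tanh lam)"
proof
  fix x
  have e: "3 - int (n - 1) = 4 - int n" "2 - int (n - 1) = 3 - int n" "(real (n - 1) - 2) / 2 = (real n - 3) / 2"
    "(real (n - 1) - 3) / 2 = (real n - 4) / 2"
    using n by (simp_all add: of_nat_diff)
  have "(real n - 3) / 2 \<ge> 0" using n by simp
  then show "h_fun n m lam x = sphere_kernel (n - 1) m (tanh lam) x"
    unfolding h_fun_def sphere_kernel_def e using gegenbauer_eq_gegen by simp
qed

context
  fixes f :: "(real^'d) \<times> real \<Rightarrow> complex" and Y p :: "real^'d \<Rightarrow> complex" and n m :: nat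
  assumes f: "continuous_on (sphere 0 1) f" and p: "harmonic_polynomial m p"
    and Y: "\<And>\<zeta>. norm \<zeta> = 1 \<Longrightarrow> Y \<zeta> = p \<zeta>" and n: "n \<ge> 3" and dim: "CARD('d) = n - 1"
begin

text \<open>The weight is the one that \<open>S_transform_subsphere\<close> splits off: up to the
  factor (2 c t)^(n - 2), the transform over a subsphere is a plain spherical mean of this function
  in the parameter \<omega>.\<close>

definition conformal_pullback :: "real^'d \<Rightarrow> complex" where
  "conformal_pullback y = f (inv_stereo y) / of_real ((1 + (norm y)\<^sup>2) ^ (n - 2))"

lemma continuous_inv_stereo_comp: "continuous_on UNIV (\<lambda>y. f (inv_stereo y))"
  by (rule continuous_on_compose2[OF f continuous_on_inv_stereo]) (use inv_stereo_in_sphere in blast)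

lemma continuous_conformal_pullback: "continuous_on UNIV conformal_pullback"
proof -
  have "complex_of_real ((1 + (norm y)\<^sup>2) ^ (n - 2)) \<noteq> 0" for y :: "real^'d"
    unfolding of_real_eq_0_iff using one_plus_square_pos[of y] by simp
  then show ?thesis unfolding conformal_pullback_def
    by (intro continuous_on_divide continuous_inv_stereo_comp continuous_intros) auto
qed

lemma continuous_harmonic_polynomial: "continuous_on A p"
  using p unfolding harmonic_polynomial_def by (intro continuous_on_polynomial_function) auto

lemma harmonic_coeff_average:
  "(LINT \<zeta>|sphere_measure. conformal_pullback (r *\<^sub>R \<zeta>) * cnj (p \<zeta>))
    = harmonic_coeff f Y r / of_real ((1 + r\<^sup>2) ^ (n - 2))"
proof -
  have "(LINT \<zeta>|sphere_measure. conformal_pullback (r *\<^sub>R \<zeta>) * cnj (p \<zeta>))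
      = (LINT \<zeta>|sphere_measure. f (inv_stereo (r *\<^sub>R \<zeta>)) * cnj (Y \<zeta>) / of_real ((1 + r\<^sup>2) ^ (n - 2)))"
  proof (rule Bochner_Integration.integral_cong)
    fix \<zeta> :: "real^'d" assume "\<zeta> \<in> space sphere_measure"
    then have z: "norm \<zeta> = 1" by simp
    have e: "(norm (r *\<^sub>R \<zeta>))\<^sup>2 = r\<^sup>2" unfolding norm_scaleR z by simp
    show "conformal_pullback (r *\<^sub>R \<zeta>) * cnj (p \<zeta>) = f (inv_stereo (r *\<^sub>R \<zeta>)) * cnj (Y \<zeta>) / of_real ((1 + r\<^sup>2) ^ (n - 2))"
      unfolding conformal_pullback_def e Y[OF z] by (simp only: times_divide_eq_left)
  qed simp
  then show ?thesis unfolding harmonic_coeff_def by (simp only: integral_divide_zero)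
qed

lemma continuous_harmonic_average:
  "continuous_on UNIV (\<lambda>r. harmonic_coeff f Y r / of_real ((1 + r\<^sup>2) ^ (n - 2)))"
  unfolding harmonic_coeff_average[symmetric]
  by (rule continuous_on_sphere_average[OF continuous_conformal_pullback])
     (intro continuous_intros continuous_harmonic_polynomial)

text \<open>The coefficients are bounded because f is bounded on the compact sphere, and n - 2 \<ge>
  1 leaves at least one factor 1 + r^2 in the denominator.\<close>

lemma harmonic_average_decay:
  "\<exists>M. \<forall>r. norm (harmonic_coeff f Y r / of_real ((1 + r\<^sup>2) ^ (n - 2))) \<le> M / (1 + r\<^sup>2)"
proof -
  have "bounded (f ` sphere 0 1)"
    by (rule compact_imp_bounded[OF compact_continuous_image[OF f compact_sphere]])
  then obtain B where B: "\<forall>x\<in>sphere 0 1. norm (f x) \<le> B" by (auto simp: bounded_iff)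
  have B0: "B \<ge> 0" using order_trans[OF norm_ge_zero B[rule_format, OF inv_stereo_in_sphere]] .
  define M where "M = (LINT \<zeta>|sphere_measure. B * norm (p \<zeta>))"
  have pi: "integrable sphere_measure (\<lambda>\<zeta>. B * norm (p \<zeta>))"
    by (rule integrable_sphere_continuous) (intro continuous_intros continuous_harmonic_polynomial)
  have "norm (harmonic_coeff f Y r / of_real ((1 + r\<^sup>2) ^ (n - 2))) \<le> M / (1 + r\<^sup>2)" for r
  proof -
    have "norm (harmonic_coeff f Y r) \<le> (LINT \<zeta>|sphere_measure. norm (f (inv_stereo (r *\<^sub>R \<zeta>)) * cnj (Y \<zeta>)))"
      unfolding harmonic_coeff_def by (rule integral_norm_bound)
    also have "\<dots> \<le> M"
      unfolding M_def
    proof (rule integral_mono'[OF pi])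
      fix \<zeta> :: "real^'d" assume "\<zeta> \<in> space sphere_measure"
      then have z: "norm \<zeta> = 1" by simp
      have "norm (f (inv_stereo (r *\<^sub>R \<zeta>))) \<le> B" using B inv_stereo_in_sphere by blast
      then show "norm (f (inv_stereo (r *\<^sub>R \<zeta>)) * cnj (Y \<zeta>)) \<le> B * norm (p \<zeta>)"
        unfolding norm_mult complex_mod_cnj Y[OF z] by (rule mult_right_mono) simp
      show "0 \<le> B * norm (p \<zeta>)" using B0 by simp
    qed
    finally have h: "norm (harmonic_coeff f Y r) \<le> M" .
    have "1 + r\<^sup>2 \<le> (1 + r\<^sup>2) ^ (n - 2)" by (rule self_le_power) (use n in auto)
    moreover have "0 < 1 + r\<^sup>2" by (simp add: add_pos_nonneg)
    moreover have "norm (harmonic_coeff f Y r / of_real ((1 + r\<^sup>2) ^ (n - 2))) = norm (harmonic_coeff f Y r) / (1 + r\<^sup>2) ^ (n - 2)"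
      unfolding norm_divide norm_of_real by simp
    ultimately show ?thesis using h order_trans[OF norm_ge_zero h] by (simp only: frac_le)
  qed
  then show ?thesis by blast
qed

text \<open>After the dilation by c, the spherical product formula evaluates the mean over \<omega>
  paired with the harmonic in \<psi>. The normalization in \<open>K_fun\<close> cancels exactly two
  factors: (2 c t)^(n - 2) from the subsphere and the volume of the sphere of dimension n - 3 from
  Funk-Hecke.\<close>

lemma K_fun_eq_convolution:
  assumes lam: "lam > 0" and c: "c > 0"
  shows "K_fun n lam f Y c
    = (LINT x|lborel. h_fun n m lam x *\<^sub>R (harmonic_coeff f Y (c * x) / of_real ((1 + (c * x)\<^sup>2) ^ (n - 2))))"
proof -
  let ?G = conformal_pullback
  define t where "t = tanh lam"
  have t: "0 < t" "t < 1" using lam tanh_real_lt_1[of lam] by (simp_all add: t_def)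
  define v where "v = sphere_vol (n - 3)"
  have v: "v > 0"
    unfolding v_def sphere_vol_def by (intro divide_pos_pos mult_pos_pos Gamma_real_pos) auto
  have D: "DIM(real^'d) = n - 1" using dim by simp
  have D3: "n - 1 - 2 = n - 3" by simp
  \<comment> \<open>The product formula pairs with p, the coefficients pair with its conjugate. The
    formula is applied to the conjugated pullback and the result is conjugated back; the kernel is
    real.\<close>
  have Gc: "continuous_on UNIV (\<lambda>y. cnj (?G (c *\<^sub>R y)))"
    by (intro continuous_intros continuous_on_compose2[OF continuous_conformal_pullback]) auto
  have "(LINT \<psi>|sphere_measure. LINT \<omega>|sphere_measure. p \<psi> * cnj (?G (c *\<^sub>R (\<psi> + t *\<^sub>R \<omega>))))
    = v *\<^sub>R (LINT r|lborel. h_fun n m lam r *\<^sub>R (LINT \<zeta>|sphere_measure. cnj (?G (c *\<^sub>R (r *\<^sub>R \<zeta>))) * p \<zeta>))"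
    using spherical_product_formula[OF _ Gc p t] n unfolding D D3 h_fun_eq_sphere_kernel[OF n] t_def v_def by simp
  then have "cnj (LINT \<psi>|sphere_measure. LINT \<omega>|sphere_measure. p \<psi> * cnj (?G (c *\<^sub>R (\<psi> + t *\<^sub>R \<omega>))))
    = cnj (v *\<^sub>R (LINT r|lborel. h_fun n m lam r *\<^sub>R (LINT \<zeta>|sphere_measure. cnj (?G (c *\<^sub>R (r *\<^sub>R \<zeta>))) * p \<zeta>)))"
    by (rule arg_cong)
  then have main: "(LINT \<psi>|sphere_measure. LINT \<omega>|sphere_measure. cnj (p \<psi>) * ?G (c *\<^sub>R (\<psi> + t *\<^sub>R \<omega>)))
    = of_real v * (LINT r|lborel. h_fun n m lam r *\<^sub>R (LINT \<zeta>|sphere_measure. ?G ((c * r) *\<^sub>R \<zeta>) * cnj (p \<zeta>)))"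
    by (simp only: Bochner_Integration.integral_cnj[symmetric] scaleR_conv_of_real[where 'a=complex] complex_cnj_mult complex_cnj_cnj complex_cnj_complex_of_real scaleR_scaleR)
  define e where "e = complex_of_real ((2 * c * t) ^ (n - 2))"
  have e0: "e \<noteq> 0" using c t by (simp add: e_def)
  have "(LINT \<psi>|sphere_measure. S_transform f (subsphere lam \<psi> c) * cnj (Y \<psi>))
      = (LINT \<psi>|sphere_measure. e * (LINT \<omega>|sphere_measure. cnj (p \<psi>) * ?G (c *\<^sub>R (\<psi> + t *\<^sub>R \<omega>))))"
  proof (rule Bochner_Integration.integral_cong)
    fix \<psi> :: "real^'d" assume "\<psi> \<in> space sphere_measure"
    then have z: "norm \<psi> = 1" by simp
    have "CARD('d) \<ge> 2" using n dim by simp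
    from S_transform_subsphere[OF this t(1) t_def c z f]
    have "S_transform f (subsphere lam \<psi> c) = of_real ((2 * c * t) ^ (CARD('d) - 1)) *
       (LINT \<omega>|sphere_measure. f (inv_stereo (c *\<^sub>R \<psi> + (c * t) *\<^sub>R \<omega>)) / of_real ((1 + (norm (c *\<^sub>R \<psi> + (c * t) *\<^sub>R \<omega>))\<^sup>2) ^ (CARD('d) - 1)))" .
    also have "CARD('d) - 1 = n - 2" using dim by simp
    also have "(LINT \<omega>|sphere_measure. f (inv_stereo (c *\<^sub>R \<psi> + (c * t) *\<^sub>R \<omega>)) / of_real ((1 + (norm (c *\<^sub>R \<psi> + (c * t) *\<^sub>R \<omega>))\<^sup>2) ^ (n - 2)))
        = (LINT \<omega>|sphere_measure. ?G (c *\<^sub>R (\<psi> + t *\<^sub>R \<omega>)))"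
      unfolding conformal_pullback_def scaleR_add_right scaleR_scaleR ..
    finally have S: "S_transform f (subsphere lam \<psi> c) = e * (LINT \<omega>|sphere_measure. ?G (c *\<^sub>R (\<psi> + t *\<^sub>R \<omega>)))"
      unfolding e_def .
    show "S_transform f (subsphere lam \<psi> c) * cnj (Y \<psi>) = e * (LINT \<omega>|sphere_measure. cnj (p \<psi>) * ?G (c *\<^sub>R (\<psi> + t *\<^sub>R \<omega>)))"
      unfolding S Y[OF z] integral_mult_right_zero by (simp only: mult_ac)
  qed simp
  also have "\<dots> = e * (of_real v * (LINT r|lborel. h_fun n m lam r *\<^sub>R (LINT \<zeta>|sphere_measure. ?G ((c * r) *\<^sub>R \<zeta>) * cnj (p \<zeta>))))"
    unfolding main[symmetric] by (rule integral_mult_right_zero)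
  finally have "K_fun n lam f Y c = 1 / (e * of_real v) * (e * (of_real v * (LINT r|lborel. h_fun n m lam r *\<^sub>R (LINT \<zeta>|sphere_measure. ?G ((c * r) *\<^sub>R \<zeta>) * cnj (p \<zeta>)))))"
    unfolding K_fun_def t_def[symmetric] v_def[symmetric] of_real_mult e_def[symmetric] by (simp only:)
  then show ?thesis
    unfolding harmonic_coeff_average using e0 v by simp
qed

end

text \<open>The conjuncts besides the formula guard against default values: a divergent integral in
  \<open>mellin\<close> would be 0, a quotient with denominator 0 is 0, and
  \<open>vline_integral\<close> is a description that means something only if an integral
  exists.\<close>

theorem theorem2p1:
  fixes n :: nat and lam :: real
    and f :: "(real^'d) \<times> real \<Rightarrow> complex"
    and d :: "nat \<Rightarrow> nat" and Y :: "nat \<Rightarrow> nat \<Rightarrow> real^'d \<Rightarrow> complex"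
  assumes n: "n \<ge> 3" and dim: "CARD('d) = n - 1"
    and lam_pos: "lam > 0"
    and cont: "continuous_on (sphere 0 1) f"
    and L1: "set_integrable lborel (UNIV - {0})
      (\<lambda>x. f (inv_stereo x) / of_real (norm x ^ (n - 2) * (1 + (norm x)\<^sup>2) ^ (n - 2)))"
    and onb: "\<And>m. harmonic_onb m (d m) (Y m)"
  shows "\<forall>m. \<forall>l\<in>{1..d m}. \<forall>\<rho>\<in>{0<..<1}.
    (\<forall>s. Re s = \<rho> \<longrightarrow> mellin_convergent (K_fun n lam f (Y m l)) s
        \<and> mellin_convergent (\<lambda>x. of_real (h_fun n m lam x)) (1 - s)) \<and>
    (AE \<tau> in lborel. mellin (\<lambda>x. of_real (h_fun n m lam x)) (1 - Complex \<rho> \<tau>) \<noteq> 0) \<and>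
    (\<forall>r>0.
      let \<phi> = (\<lambda>s. of_real r powr (- s)
                  * (mellin (K_fun n lam f (Y m l)) s
                     / mellin (\<lambda>x. of_real (h_fun n m lam x)) (1 - s)))
      in (\<exists>I. vline_has_integral \<rho> \<phi> I)
       \<and> harmonic_coeff f (Y m l) r
           = of_real ((1 + r\<^sup>2) ^ (n - 2)) / (2 * of_real pi * \<i>) * vline_integral \<rho> \<phi>)"
proof (intro allI ballI)
  fix m l \<rho> assume l: "l \<in> {1..d m}" and "\<rho> \<in> {0<..<1::real}"
  then have \<rho>: "0 < \<rho>" "\<rho> < 1" by auto
  have "spherical_harmonic m (Y m l)" using onb[of m] l unfolding harmonic_onb_def by blast
  then obtain p where p: "harmonic_polynomial m p" and Yp': "\<forall>\<zeta>\<in>sphere 0 1. Y m l \<zeta> = p \<zeta>"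
    using spherical_harmonic_eq_harmonic_polynomial by blast
  have Yp: "Y m l \<zeta> = p \<zeta>" if "norm \<zeta> = 1" for \<zeta> using Yp' that by simp
  define t where "t = tanh lam"
  have t: "0 < t" "t < 1" using lam_pos tanh_real_lt_1[of lam] by (simp_all add: t_def)
  have D: "n - 1 \<ge> 2" using n by simp
  have h: "h_fun n m lam = sphere_kernel (n - 1) m t" unfolding t_def by (rule h_fun_eq_sphere_kernel[OF n])
  let ?K = "K_fun n lam f (Y m l)" and ?H = "\<lambda>x. complex_of_real (h_fun n m lam x)"
  \<comment> \<open>The function that Mellin inversion recovers; the factor (1 + r^2)^(n - 2) in the
    conclusion restores the coefficient from it.\<close>
  define F where "F r = harmonic_coeff f (Y m l) r / of_real ((1 + r\<^sup>2) ^ (n - 2))" for r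
  have Fc: "continuous_on UNIV F"
    unfolding F_def by (rule continuous_harmonic_average[OF cont p Yp n dim])
  have Fm: "F \<in> borel_measurable borel" by (rule borel_measurable_continuous_onI[OF Fc])
  obtain M where "\<And>r. norm (F r) \<le> M / (1 + r\<^sup>2)"
    using harmonic_average_decay[OF cont p Yp n dim] unfolding F_def by blast
  then have Fconv: "mellin_convergent F s" if "Re s = \<rho>" for s
    using that \<rho> by (intro mellin_convergent_decay[OF Fm]) auto
  have Hconv: "mellin_convergent ?H s" for s unfolding h by (rule mellin_convergent_kernel[OF D t])
  have hi: "integrable lborel (h_fun n m lam)"
    using integrable_Re[OF integrable_sphere_kernel[OF D t, of m]] unfolding h by (simp only: Re_complex_of_real)
  have hs: "x \<in> {1 - t..1 + t}" if "h_fun n m lam x \<noteq> 0" for x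
    using sphere_kernel_support[OF t] that unfolding h by blast
  have t1: "1 - t > 0" using t by simp
  have K: "?K c = (LINT x|lborel. h_fun n m lam x *\<^sub>R F (c * x))" if "c > 0" for c
    unfolding F_def by (rule K_fun_eq_convolution[OF cont p Yp n dim lam_pos that])
  have Kconv: "mellin_convergent ?K s" and Kmul: "mellin ?K s = mellin F s * mellin ?H (1 - s)" if "Re s = \<rho>" for s
    by (rule mellin_convolution[OF hi hs t1 Fm Fconv[OF that] Hconv K]; assumption)+
  have AEnz: "AE \<tau> in lborel. mellin ?H (1 - Complex \<rho> \<tau>) \<noteq> 0"
    unfolding h by (rule mellin_kernel_nonzero_AE[OF D t])
  \<comment> \<open>At zeros of the denominator the quotient is 0 by convention and need not equal
    the transform of F; by \<open>AEnz\<close> these points form a null set on the line.\<close>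
  have inv: "vline_has_integral \<rho> (\<lambda>s. of_real r powr (- s) * (mellin ?K s / mellin ?H (1 - s))) (2 * of_real pi * \<i> * F r)"
    if r: "r > 0" for r
  proof (rule mellin_inversion[OF Fconv r _ Fconv])
    show "isCont F r" using Fc by (simp add: continuous_on_eq_continuous_at)
    show "AE \<tau> in lborel. of_real r powr (- Complex \<rho> \<tau>) * (mellin ?K (Complex \<rho> \<tau>) / mellin ?H (1 - Complex \<rho> \<tau>))
        = of_real r powr (- Complex \<rho> \<tau>) * mellin F (Complex \<rho> \<tau>)"
      using AEnz by (rule eventually_mono) (simp add: Kmul)
  qed simp_all
  have coeff: "harmonic_coeff f (Y m l) r = of_real ((1 + r\<^sup>2) ^ (n - 2)) / (2 * of_real pi * \<i>) * (2 * of_real pi * \<i> * F r)" for r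
  proof -
    have "1 + r\<^sup>2 > 0" by (simp add: add_pos_nonneg)
    then have z: "complex_of_real ((1 + r\<^sup>2) ^ (n - 2)) \<noteq> 0" unfolding of_real_eq_0_iff by simp
    have "a / b * (b * (x / a)) = x" if "a \<noteq> 0" "b \<noteq> 0" for a b x :: complex using that by simp
    from this[OF z, of "2 * of_real pi * \<i>"] show ?thesis unfolding F_def by simp
  qed
  show "(\<forall>s. Re s = \<rho> \<longrightarrow> mellin_convergent ?K s \<and> mellin_convergent ?H (1 - s)) \<and>
    (AE \<tau> in lborel. mellin ?H (1 - Complex \<rho> \<tau>) \<noteq> 0) \<and>
    (\<forall>r>0. let \<phi> = (\<lambda>s. of_real r powr (- s) * (mellin ?K s / mellin ?H (1 - s)))
      in (\<exists>I. vline_has_integral \<rho> \<phi> I)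
       \<and> harmonic_coeff f (Y m l) r = of_real ((1 + r\<^sup>2) ^ (n - 2)) / (2 * of_real pi * \<i>) * vline_integral \<rho> \<phi>)"
    unfolding Let_def using Kconv Hconv AEnz inv vline_integral_eq[OF inv] coeff by auto
qed

end
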